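(* Let $m,n\geq 3$, let $k\leq n$, and let $p,q$ be distinct primes. Let $F$ be the orbit equivalence relation on $\mathrm{Gr}_k(\mathbb{Q}_q^n)$ induced by the natural action of $\mathrm{GL}_n(\mathbb{Q})$. Then the action of $\mathrm{SL}_m(\mathbb{Z})$ on $\mathbb{P}(\mathbb{Q}_p^m)$, equipped with its Haar measure, is $F$-ergodic.
   Context: $\mathbb{Q}_p$ denotes the field of $p$-adic numbers and $\mathbb{Z}_p$ the $p$-adic integers. $\mathrm{Gr}_k(\mathbb{Q}_q^n)$ is the Grassmann space of all $k$-dimensional $\mathbb{Q}_q$-linear subspaces of $\mathbb{Q}_q^n$, and $\mathbb{P}(\mathbb{Q}_p^m)=\mathrm{Gr}_1(\mathbb{Q}_p^m)$. The compact group $\mathrm{SL}_m(\mathbb{Z}_p)$ acts transitively on $\mathbb{P}(\mathbb{Q}_p^m)$, and the Haar measure on $\mathbb{P}(\mathbb{Q}_p^m)$ is the push-forward of the Haar probability measure of $\mathrm{SL}_m(\mathbb{Z}_p)$; it is invariant under $\mathrm{SL}_m(\mathbb{Z})\leq\mathrm{SL}_m(\mathbb{Z}_p)$. For equivalence relations $E$ on $X$ and $F$ on $Y$, a Borel homomorphism from $E$ to $F$ is a Borel map $f\colon X\to Y$ with $x\mathrel{E}x'\Rightarrow f(x)\mathrel{F}f(x')$. A probability measure-preserving action $\Gamma\curvearrowright (X,\mu)$ of a countable group with orbit equivalence relation $E_\Gamma$ is called $F$-ergodic (for an equivalence relation $F$ on a standard Borel space $Y$) iff for every Borel homomorphism $f\colon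 X\to Y$ from $E_\Gamma$ to $F$ there is a $\mu$-conull set $A\subseteq X$ such that $f(A)$ is contained in a single $F$-class. *)

theory Defs
  imports "HOL-Analysis.Analysis" "HOL-Probability.Probability_Measure" "Berlekamp_Zassenhaus.Finite_Field"
begin

section \<open>The field of p-adic numbers\<close>

subsection \<open>The p-adic absolute value on the rationals\<close>

definition padic_abs :: "nat \<Rightarrow> rat \<Rightarrow> real" where
  "padic_abs p x = (if x = 0 then 0 else
     (case quotient_of x of (a, b) \<Rightarrow>
        real p powi (int (multiplicity (int p) b) - int (multiplicity (int p) a))))"

lemma padic_abs_0 [simp]: "padic_abs p 0 = 0"
  by (simp add: padic_abs_def)

lemma padic_abs_frac:
  assumes p: "prime p" and a: "a \<noteq> 0" and b: "b \<noteq> 0"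
  shows "padic_abs p (of_int a / of_int b) =
    real p powi (int (multiplicity (int p) b) - int (multiplicity (int p) a))"
proof -
  obtain c d where cd: "quotient_of (of_int a / of_int b) = (c, d)"
    by (cases "quotient_of (of_int a / of_int b)") auto
  have d: "d > 0" using quotient_of_denom_pos[OF cd] .
  have eq: "of_int a / of_int b = (of_int c / of_int d :: rat)"
    using quotient_of_div[OF cd] .
  then have "of_int (a * d) = (of_int (c * b) :: rat)"
    using b d by (simp add: field_simps)
  then have e: "a * d = c * b" by (simp only: of_int_eq_iff)
  then have c: "c \<noteq> 0" using a d by auto
  have pp: "prime_elem (int p)" using p by simp
  have "multiplicity (int p) a + multiplicity (int p) d =
      multiplicity (int p) c + multiplicity (int p) b"
    using e a b c d pp prime_elem_multiplicity_mult_distrib[OF pp, of a d]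
      prime_elem_multiplicity_mult_distrib[OF pp, of c b] by simp
  then have "int (multiplicity (int p) b) - int (multiplicity (int p) a) =
     int (multiplicity (int p) d) - int (multiplicity (int p) c)" by linarith
  moreover have "(of_int a / of_int b :: rat) \<noteq> 0" using a b by simp
  ultimately show ?thesis using cd by (simp add: padic_abs_def)
qed

lemma rat_frac_cases:
  fixes x :: rat
  obtains a b :: int where "x = of_int a / of_int b" "b \<noteq> 0"
  by (metis quotient_of_div quotient_of_denom_pos less_irrefl surj_pair)

context
  fixes p :: nat
  assumes p: "prime p"
begin

lemma padic_abs_nonneg: "0 \<le> padic_abs p x"
  by (auto simp: padic_abs_def split: prod.split)

lemma padic_abs_eq_0_iff: "padic_abs p x = 0 \<longleftrightarrow> x = 0"
  using p by (auto simp: padic_abs_def power_int_eq_0_iff split: prod.splits)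

lemma padic_abs_1: "padic_abs p 1 = 1"
  using padic_abs_frac[OF p, of 1 1] by simp

lemma padic_abs_mult: "padic_abs p (x * y) = padic_abs p x * padic_abs p y"
proof (cases "x = 0 \<or> y = 0")
  case False
  obtain a b where x: "x = of_int a / of_int b" "b \<noteq> 0" by (rule rat_frac_cases)
  obtain c d where y: "y = of_int c / of_int d" "d \<noteq> 0" by (rule rat_frac_cases)
  have ac: "a \<noteq> 0" "c \<noteq> 0" using False x y by auto
  have xy: "x * y = of_int (a * c) / of_int (b * d)" using x y by simp
  have pp: "prime_elem (int p)" using p by simp
  have p0: "real p \<noteq> 0" using p by auto
  show ?thesis
    unfolding xy unfolding x y
    using ac x y p0
    by (simp add: padic_abs_frac[OF p] prime_elem_multiplicity_mult_distrib[OF pp]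
         flip: power_int_add of_int_mult)
       (simp add: algebra_simps)
qed auto

lemma padic_abs_minus: "padic_abs p (- x) = padic_abs p x"
proof -
  have "padic_abs p (-1) = 1"
    using padic_abs_frac[OF p, of "-1" 1] by (simp add: multiplicity_unit_right)
  then show ?thesis using padic_abs_mult[of "-1" x] by simp
qed

lemma padic_abs_ultrametric: "padic_abs p (x + y) \<le> max (padic_abs p x) (padic_abs p y)"
proof (cases "x = 0 \<or> y = 0 \<or> x + y = 0")
  case True
  then show ?thesis using padic_abs_nonneg[of x] padic_abs_nonneg[of y] by auto
next
  case False
  obtain a b where x: "x = of_int a / of_int b" "b \<noteq> 0" by (rule rat_frac_cases)
  obtain c d where y: "y = of_int c / of_int d" "d \<noteq> 0" by (rule rat_frac_cases)
  define u v w where "u = a * d" and "v = c * b" and "w = b * d"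
  have w: "w \<noteq> 0" using x y by (simp add: w_def)
  have x': "x = of_int u / of_int w" and y': "y = of_int v / of_int w"
    using x y by (simp_all add: u_def v_def w_def)
  have xy': "x + y = of_int (u + v) / of_int w"
    using x' y' by (simp add: add_divide_distrib)
  have nz: "u \<noteq> 0" "v \<noteq> 0" "u + v \<noteq> 0"
    using False x' y' xy' by (auto simp del: of_int_add)
  define k where "k = min (multiplicity (int p) u) (multiplicity (int p) v)"
  have "int p ^ k dvd u" "int p ^ k dvd v"
    by (auto simp: k_def intro!: multiplicity_dvd')
  then have "int p ^ k dvd u + v" by simp
  moreover have "\<not> is_unit (int p)" using prime_gt_1_nat[OF p] by auto
  ultimately have k: "k \<le> multiplicity (int p) (u + v)"
    using nz by (intro multiplicity_geI) auto
  have "padic_abs p (x + y) \<le> real p powi (int (multiplicity (int p) w) - int k)"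
    unfolding xy' padic_abs_frac[OF p nz(3) w]
    by (rule power_int_increasing) (use k p prime_gt_1_nat[OF p] in auto)
  also have "\<dots> \<le> max (padic_abs p x) (padic_abs p y)"
    unfolding x' y' padic_abs_frac[OF p nz(1) w] padic_abs_frac[OF p nz(2) w]
    by (auto simp: k_def min_def max_def)
  finally show ?thesis .
qed

lemma padic_abs_triangle: "padic_abs p (x + y) \<le> padic_abs p x + padic_abs p y"
  using padic_abs_ultrametric[of x y] padic_abs_nonneg[of x] padic_abs_nonneg[of y] by linarith

lemma padic_abs_commute: "padic_abs p (x - y) = padic_abs p (y - x)"
  using padic_abs_minus[of "x - y"] by simp

lemma padic_abs_diff: "\<bar>padic_abs p x - padic_abs p y\<bar> \<le> padic_abs p (x - y)"
  using padic_abs_triangle[of "x - y" y] padic_abs_triangle[of "y - x" x]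
    padic_abs_commute[of x y] by simp

lemma padic_abs_inverse: "padic_abs p (inverse x) = inverse (padic_abs p x)"
proof (cases "x = 0")
  case False
  then have "padic_abs p x * padic_abs p (inverse x) = 1"
    by (simp add: padic_abs_1 flip: padic_abs_mult)
  then show ?thesis by (simp add: inverse_unique)
qed simp

end

subsection \<open>Completion by Cauchy sequences\<close>

definition padic_cauchy :: "nat \<Rightarrow> (nat \<Rightarrow> rat) \<Rightarrow> bool" where
  "padic_cauchy p X \<longleftrightarrow> (\<forall>e>0. \<exists>N. \<forall>m\<ge>N. \<forall>n\<ge>N. padic_abs p (X m - X n) < e)"

definition padic_null :: "nat \<Rightarrow> (nat \<Rightarrow> rat) \<Rightarrow> bool" where
  "padic_null p X \<longleftrightarrow> (\<lambda>n. padic_abs p (X n)) \<longlonglongrightarrow> 0"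

definition padic_rel :: "nat \<Rightarrow> (nat \<Rightarrow> rat) \<Rightarrow> (nat \<Rightarrow> rat) \<Rightarrow> bool" where
  "padic_rel p X Y \<longleftrightarrow> padic_cauchy p X \<and> padic_cauchy p Y \<and> padic_null p (\<lambda>n. X n - Y n)"

context
  fixes p :: nat
  assumes p: "prime p"
begin

lemma padic_null_add:
  assumes "padic_null p X" "padic_null p Y"
  shows "padic_null p (\<lambda>n. X n + Y n)"
proof -
  have l: "(\<lambda>n. padic_abs p (X n) + padic_abs p (Y n)) \<longlonglongrightarrow> 0"
    using tendsto_add[OF assms[unfolded padic_null_def]] by simp
  show ?thesis
    unfolding padic_null_def
    by (rule tendsto_sandwich[where f = "\<lambda>_. 0"
          and h = "\<lambda>n. padic_abs p (X n) + padic_abs p (Y n)"])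
       (simp_all add: padic_abs_nonneg[OF p] padic_abs_triangle[OF p] l)
qed

lemma padic_null_minus: "padic_null p X \<Longrightarrow> padic_null p (\<lambda>n. - X n)"
  by (simp add: padic_null_def padic_abs_minus[OF p])

lemma padic_null_diff:
  "padic_null p X \<Longrightarrow> padic_null p Y \<Longrightarrow> padic_null p (\<lambda>n. X n - Y n)"
  using padic_null_add[of X "\<lambda>n. - Y n"] padic_null_minus[of Y] by simp

lemma padic_cauchy_const: "padic_cauchy p (\<lambda>n. c)"
  by (simp add: padic_cauchy_def)

lemma padic_cauchy_add:
  assumes "padic_cauchy p X" "padic_cauchy p Y"
  shows "padic_cauchy p (\<lambda>n. X n + Y n)"
  unfolding padic_cauchy_def
proof (intro allI impI)
  fix e :: real assume e: "e > 0"
  obtain N where N: "\<And>m n. m \<ge> N \<Longrightarrow> n \<ge> N \<Longrightarrow> padic_abs p (X m - X n) < e"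
    using assms(1) e unfolding padic_cauchy_def by meson
  obtain M where M: "\<And>m n. m \<ge> M \<Longrightarrow> n \<ge> M \<Longrightarrow> padic_abs p (Y m - Y n) < e"
    using assms(2) e unfolding padic_cauchy_def by meson
  show "\<exists>N. \<forall>m\<ge>N. \<forall>n\<ge>N. padic_abs p (X m + Y m - (X n + Y n)) < e"
  proof (intro exI allI impI)
    fix m n assume "max N M \<le> m" "max N M \<le> n"
    then have "padic_abs p (X m - X n) < e" "padic_abs p (Y m - Y n) < e"
      using N M by auto
    moreover have "padic_abs p (X m + Y m - (X n + Y n)) =
       padic_abs p ((X m - X n) + (Y m - Y n))" by (simp add: algebra_simps)
    ultimately show "padic_abs p (X m + Y m - (X n + Y n)) < e"
      using padic_abs_ultrametric[OF p, of "X m - X n" "Y m - Y n"] by linarith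
  qed
qed

lemma padic_cauchy_minus: "padic_cauchy p X \<Longrightarrow> padic_cauchy p (\<lambda>n. - X n)"
proof -
  have "padic_abs p (- X m - - X n) = padic_abs p (X m - X n)" for m n
    using padic_abs_commute[OF p, of "X m" "X n"] by simp
  then show "padic_cauchy p X \<Longrightarrow> padic_cauchy p (\<lambda>n. - X n)"
    unfolding padic_cauchy_def by presburger
qed

lemma padic_cauchy_diff:
  "padic_cauchy p X \<Longrightarrow> padic_cauchy p Y \<Longrightarrow> padic_cauchy p (\<lambda>n. X n - Y n)"
  using padic_cauchy_add[of X "\<lambda>n. - Y n"] padic_cauchy_minus[of Y] by simp

lemma padic_cauchy_convergent_abs:
  assumes "padic_cauchy p X"
  shows "convergent (\<lambda>n. padic_abs p (X n))"
proof -
  have "Cauchy (\<lambda>n. padic_abs p (X n))"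
    unfolding Cauchy_def dist_real_def
  proof (intro allI impI)
    fix e :: real assume "e > 0"
    then obtain N where "\<And>m n. m \<ge> N \<Longrightarrow> n \<ge> N \<Longrightarrow> padic_abs p (X m - X n) < e"
      using assms unfolding padic_cauchy_def by meson
    then show "\<exists>M. \<forall>m\<ge>M. \<forall>n\<ge>M. \<bar>padic_abs p (X m) - padic_abs p (X n)\<bar> < e"
      using order_le_less_trans[OF padic_abs_diff[OF p]] by blast
  qed
  then show ?thesis by (rule Cauchy_convergent)
qed

lemma padic_cauchy_bounded:
  assumes "padic_cauchy p X"
  obtains B where "B > 0" "\<And>n. padic_abs p (X n) \<le> B"
proof -
  have "Bseq (\<lambda>n. padic_abs p (X n))"
    using padic_cauchy_convergent_abs[OF assms] by (rule convergent_imp_Bseq)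
  then show ?thesis
    using that padic_abs_nonneg[OF p] by (auto elim!: BseqE)
qed

lemma padic_null_mult:
  assumes "padic_null p X" "padic_cauchy p Y"
  shows "padic_null p (\<lambda>n. X n * Y n)"
proof -
  obtain B where B: "B > 0" "\<And>n. padic_abs p (Y n) \<le> B"
    using padic_cauchy_bounded[OF assms(2)] by blast
  have l: "(\<lambda>n. padic_abs p (X n) * B) \<longlonglongrightarrow> 0"
    using tendsto_mult_right[OF assms(1)[unfolded padic_null_def], of B] by simp
  show ?thesis
    unfolding padic_null_def
    by (rule tendsto_sandwich[where f = "\<lambda>_. 0" and h = "\<lambda>n. padic_abs p (X n) * B"])
       (auto simp: padic_abs_nonneg[OF p] padic_abs_mult[OF p] mult_left_mono B l)
qed

lemma padic_cauchy_mult: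
  assumes "padic_cauchy p X" "padic_cauchy p Y"
  shows "padic_cauchy p (\<lambda>n. X n * Y n)"
  unfolding padic_cauchy_def
proof (intro allI impI)
  fix e :: real assume e: "e > 0"
  obtain A where A: "A > 0" "\<And>n. padic_abs p (X n) \<le> A"
    using padic_cauchy_bounded[OF assms(1)] by blast
  obtain B where B: "B > 0" "\<And>n. padic_abs p (Y n) \<le> B"
    using padic_cauchy_bounded[OF assms(2)] by blast
  obtain N where N: "\<And>m n. m \<ge> N \<Longrightarrow> n \<ge> N \<Longrightarrow> padic_abs p (X m - X n) < e / B"
    using assms(1) e B unfolding padic_cauchy_def by (meson divide_pos_pos)
  obtain M where M: "\<And>m n. m \<ge> M \<Longrightarrow> n \<ge> M \<Longrightarrow> padic_abs p (Y m - Y n) < e / A"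
    using assms(2) e A unfolding padic_cauchy_def by (meson divide_pos_pos)
  show "\<exists>N. \<forall>m\<ge>N. \<forall>n\<ge>N. padic_abs p (X m * Y m - X n * Y n) < e"
  proof (intro exI allI impI)
    fix m n assume mn: "max N M \<le> m" "max N M \<le> n"
    have "padic_abs p (X m * (Y m - Y n)) \<le> A * padic_abs p (Y m - Y n)"
      using A padic_abs_nonneg[OF p] by (simp add: padic_abs_mult[OF p] mult_right_mono)
    also have "\<dots> < e" using M[of m n] mn A by (simp add: field_simps)
    finally have 1: "padic_abs p (X m * (Y m - Y n)) < e" .
    have "padic_abs p ((X m - X n) * Y n) \<le> padic_abs p (X m - X n) * B"
      using B padic_abs_nonneg[OF p] by (simp add: padic_abs_mult[OF p] mult_left_mono)
    also have "\<dots> < e" using N[of m n] mn B by (simp add: field_simps)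
    finally have 2: "padic_abs p ((X m - X n) * Y n) < e" .
    have "X m * Y m - X n * Y n = X m * (Y m - Y n) + (X m - X n) * Y n"
      by (simp add: algebra_simps)
    then show "padic_abs p (X m * Y m - X n * Y n) < e"
      using 1 2 padic_abs_ultrametric[OF p, of "X m * (Y m - Y n)" "(X m - X n) * Y n"] by simp
  qed
qed

lemma padic_not_null:
  assumes "padic_cauchy p X" "\<not> padic_null p X"
  obtains b N where "b > 0" "\<And>n. n \<ge> N \<Longrightarrow> padic_abs p (X n) > b"
proof -
  obtain L where L: "(\<lambda>n. padic_abs p (X n)) \<longlonglongrightarrow> L"
    using padic_cauchy_convergent_abs[OF assms(1)] by (auto simp: convergent_def)
  have "L \<ge> 0" using L padic_abs_nonneg[OF p] by (intro LIMSEQ_le_const) auto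
  then have "L > 0" using assms(2) L by (cases "L = 0") (auto simp: padic_null_def)
  then have "eventually (\<lambda>n. padic_abs p (X n) > L / 2) sequentially"
    using L by (intro order_tendstoD) auto
  then show ?thesis using that[of "L / 2"] \<open>L > 0\<close> by (auto simp: eventually_sequentially)
qed

lemma padic_cauchy_inverse:
  assumes "padic_cauchy p X" "\<not> padic_null p X"
  shows "padic_cauchy p (\<lambda>n. inverse (X n))"
  unfolding padic_cauchy_def
proof (intro allI impI)
  fix e :: real assume e: "e > 0"
  obtain b N where b: "b > 0" "\<And>n. n \<ge> N \<Longrightarrow> padic_abs p (X n) > b"
    using padic_not_null[OF assms] by blast
  obtain M where M: "\<And>m n. m \<ge> M \<Longrightarrow> n \<ge> M \<Longrightarrow> padic_abs p (X m - X n) < e * (b * b)"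
    using assms(1) e b unfolding padic_cauchy_def by (meson mult_pos_pos)
  show "\<exists>N. \<forall>m\<ge>N. \<forall>n\<ge>N. padic_abs p (inverse (X m) - inverse (X n)) < e"
  proof (intro exI allI impI)
    fix m n assume mn: "max N M \<le> m" "max N M \<le> n"
    have bm: "padic_abs p (X m) > b" and bn: "padic_abs p (X n) > b" using b mn by auto
    then have nz: "X m \<noteq> 0" "X n \<noteq> 0" using b by auto
    have "inverse (X m) - inverse (X n) = (X n - X m) * inverse (X m) * inverse (X n)"
      using nz by (simp add: field_simps)
    then have eq: "padic_abs p (inverse (X m) - inverse (X n)) =
        padic_abs p (X n - X m) / (padic_abs p (X m) * padic_abs p (X n))"
      by (simp add: padic_abs_mult[OF p] padic_abs_inverse[OF p] divide_inverse)
    have "padic_abs p (X n - X m) < e * (b * b)" using M mn by auto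
    also have "\<dots> \<le> e * (padic_abs p (X m) * padic_abs p (X n))"
      using bm bn b e by (intro mult_left_mono mult_mono) auto
    finally show "padic_abs p (inverse (X m) - inverse (X n)) < e"
      unfolding eq using bm bn b by (simp add: pos_divide_less_eq)
  qed
qed

lemma padic_null_inverse_diff:
  assumes X: "padic_cauchy p X" "\<not> padic_null p X"
    and Y: "padic_cauchy p Y" "\<not> padic_null p Y"
    and XY: "padic_null p (\<lambda>n. X n - Y n)"
  shows "padic_null p (\<lambda>n. inverse (X n) - inverse (Y n))"
proof -
  have "padic_null p (\<lambda>n. (X n - Y n) * (inverse (X n) * inverse (Y n)))"
    by (intro padic_null_mult padic_cauchy_mult padic_cauchy_inverse X Y XY)
  then have l: "(\<lambda>n. padic_abs p ((X n - Y n) * (inverse (X n) * inverse (Y n)))) \<longlonglongrightarrow> 0"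
    by (simp add: padic_null_def)
  obtain b N where b: "b > 0" "\<And>n. n \<ge> N \<Longrightarrow> padic_abs p (X n) > b"
    using padic_not_null[OF X] by blast
  obtain c M where c: "c > 0" "\<And>n. n \<ge> M \<Longrightarrow> padic_abs p (Y n) > c"
    using padic_not_null[OF Y] by blast
  have "\<forall>\<^sub>F n in sequentially. padic_abs p ((X n - Y n) * (inverse (X n) * inverse (Y n))) =
      padic_abs p (inverse (X n) - inverse (Y n))"
  proof (rule eventually_sequentiallyI[of "max N M"])
    fix n assume n: "max N M \<le> n"
    have "padic_abs p (X n) > b" "padic_abs p (Y n) > c" using b c n by auto
    then have "X n \<noteq> 0" "Y n \<noteq> 0" using b c by auto
    then have "(X n - Y n) * (inverse (X n) * inverse (Y n)) = - (inverse (X n) - inverse (Y n))"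
      by (simp add: field_simps)
    then show "padic_abs p ((X n - Y n) * (inverse (X n) * inverse (Y n))) =
      padic_abs p (inverse (X n) - inverse (Y n))" by (simp only: padic_abs_minus[OF p])
  qed
  then show ?thesis
    unfolding padic_null_def using l by (rule Lim_transform_eventually[rotated])
qed

lemma padic_rel_null_iff:
  assumes "padic_rel p X Y"
  shows "padic_null p X \<longleftrightarrow> padic_null p Y"
proof -
  have n: "padic_null p (\<lambda>n. X n - Y n)" using assms by (simp add: padic_rel_def)
  show ?thesis
    using padic_null_diff[OF _ n, of X] padic_null_add[OF n, of Y] by auto
qed

lemma padic_rel_abs_lim:
  assumes "padic_rel p X Y"
  shows "lim (\<lambda>n. padic_abs p (X n)) = lim (\<lambda>n. padic_abs p (Y n))"
proof -
  have XY: "padic_cauchy p X" "padic_null p (\<lambda>n. X n - Y n)"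
    using assms by (simp_all add: padic_rel_def)
  have L: "(\<lambda>n. padic_abs p (X n)) \<longlonglongrightarrow> lim (\<lambda>n. padic_abs p (X n))"
    using padic_cauchy_convergent_abs[OF XY(1)] by (simp add: convergent_LIMSEQ_iff)
  have "(\<lambda>n. padic_abs p (Y n) - padic_abs p (X n)) \<longlonglongrightarrow> 0"
  proof (rule tendsto_rabs_zero_cancel,
      rule tendsto_sandwich[where f = "\<lambda>_. 0" and h = "\<lambda>n. padic_abs p (X n - Y n)"])
    show "(\<lambda>n. padic_abs p (X n - Y n)) \<longlonglongrightarrow> 0" using XY(2) by (simp add: padic_null_def)
    show "\<forall>\<^sub>F n in sequentially. \<bar>padic_abs p (Y n) - padic_abs p (X n)\<bar> \<le> padic_abs p (X n - Y n)"
    proof (intro always_eventually allI)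
      fix n show "\<bar>padic_abs p (Y n) - padic_abs p (X n)\<bar> \<le> padic_abs p (X n - Y n)"
        using padic_abs_diff[OF p, of "Y n" "X n"] padic_abs_commute[OF p, of "X n" "Y n"] by simp
    qed
  qed auto
  from tendsto_add[OF this L] have "(\<lambda>n. padic_abs p (Y n)) \<longlonglongrightarrow> lim (\<lambda>n. padic_abs p (X n))"
    by simp
  then show ?thesis by (simp add: limI)
qed

lemma part_equivp_padic_rel: "part_equivp (padic_rel p)"
proof (rule part_equivpI)
  show "\<exists>X. padic_rel p X X"
    by (rule exI[of _ "\<lambda>_. 0"]) (simp add: padic_rel_def padic_cauchy_const padic_null_def)
  show "symp (padic_rel p)"
  proof (rule sympI)
    fix X Y assume "padic_rel p X Y"
    then show "padic_rel p Y X"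
      using padic_null_minus[of "\<lambda>n. X n - Y n"] by (simp add: padic_rel_def)
  qed
  show "transp (padic_rel p)"
  proof (rule transpI)
    fix X Y Z assume "padic_rel p X Y" "padic_rel p Y Z"
    then show "padic_rel p X Z"
      using padic_null_add[of "\<lambda>n. X n - Y n" "\<lambda>n. Y n - Z n"] by (simp add: padic_rel_def)
  qed
qed

end

text \<open>
  The prime is carried by the type argument: \<open>'a padic\<close> is the completion of the
  rationals for the p-adic absolute value with \<open>p = CARD('a)\<close>.
\<close>

typedef (overloaded) ('a :: prime_card) padic =
  "{X. padic_cauchy CARD('a) X} // {(X, Y). padic_rel CARD('a) X Y}"
  using padic_cauchy_const[OF prime_card] by (auto simp: quotient_def)

definition abs_padic :: "(nat \<Rightarrow> rat) \<Rightarrow> 'a :: prime_card padic" where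
  "abs_padic X = Abs_padic ({(X, Y). padic_rel CARD('a) X Y} `` {X})"

definition rep_padic :: "'a :: prime_card padic \<Rightarrow> nat \<Rightarrow> rat" where
  "rep_padic x = (SOME X. X \<in> Rep_padic x)"

definition cr_padic :: "(nat \<Rightarrow> rat) \<Rightarrow> 'a :: prime_card padic \<Rightarrow> bool" where
  "cr_padic X x \<longleftrightarrow> padic_rel CARD('a) X X \<and> abs_padic X = x"

lemma padic_rel_refl_iff: "padic_rel p X X \<longleftrightarrow> padic_cauchy p X"
  by (simp add: padic_rel_def padic_null_def)

lemma Quotient_padic:
  "Quotient (padic_rel CARD('a)) abs_padic rep_padic
     (cr_padic :: (nat \<Rightarrow> rat) \<Rightarrow> 'a :: prime_card padic \<Rightarrow> bool)"
proof -
  let ?R = "padic_rel CARD('a)"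
  have sym: "?R X Y \<Longrightarrow> ?R Y X" and trans: "?R X Y \<Longrightarrow> ?R Y Z \<Longrightarrow> ?R X Z" for X Y Z
    using part_equivp_padic_rel[OF prime_card[where 'a = 'a]]
    by (auto elim!: part_equivpE dest: sympD transpD)
  have Rep: "Rep_padic (abs_padic X :: 'a padic) = {Y. ?R X Y}" if "?R X X" for X
    unfolding abs_padic_def using that
    by (subst Abs_padic_inverse) (auto simp: quotient_def padic_rel_refl_iff)
  have ex: "\<exists>X. ?R X X \<and> x = abs_padic X" for x :: "'a padic"
    using Rep_padic[of x] Rep_padic_inverse[of x]
    by (auto simp: quotient_def abs_padic_def padic_rel_refl_iff)
  have rep: "?R X (rep_padic (abs_padic X :: 'a padic))" if "?R X X" for X
    unfolding rep_padic_def Rep[OF that] using that by (simp add: someI[of "?R X" X])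
  have eq: "(abs_padic X :: 'a padic) = abs_padic Y \<longleftrightarrow> ?R X Y" if "?R X X" "?R Y Y" for X Y
  proof -
    have "(abs_padic X :: 'a padic) = abs_padic Y \<longleftrightarrow> {Z. ?R X Z} = {Z. ?R Y Z}"
      using Rep[OF that(1)] Rep[OF that(2)] Rep_padic_inject by metis
    also have "\<dots> \<longleftrightarrow> ?R X Y" using that sym trans by blast
    finally show ?thesis .
  qed
  show ?thesis
  proof (rule QuotientI)
    fix x :: "'a padic"
    obtain X where X: "?R X X" "x = abs_padic X" using ex by blast
    have r: "?R X (rep_padic x)" using rep X by simp
    show rr: "?R (rep_padic x) (rep_padic x)" using r sym trans by blast
    show "abs_padic (rep_padic x) = x" using eq[OF X(1) rr] r X by simp
  next
    fix X Y
    show "?R X Y = (?R X X \<and> ?R Y Y \<and> (abs_padic X :: 'a padic) = abs_padic Y)"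
      using eq sym trans by blast
  next
    show "(cr_padic :: _ \<Rightarrow> 'a padic \<Rightarrow> bool) = (\<lambda>X x. ?R X X \<and> abs_padic X = x)"
      by (simp add: cr_padic_def fun_eq_iff)
  qed
qed

setup_lifting Quotient_padic

instantiation padic :: (prime_card) comm_ring_1
begin

lift_definition zero_padic :: "'a padic" is "\<lambda>n. 0"
  by (simp add: padic_rel_def padic_cauchy_const[OF prime_card] padic_null_def)

lift_definition one_padic :: "'a padic" is "\<lambda>n. 1"
  by (simp add: padic_rel_def padic_cauchy_const[OF prime_card] padic_null_def)

lift_definition plus_padic :: "'a padic \<Rightarrow> 'a padic \<Rightarrow> 'a padic" is "\<lambda>X Y n. X n + Y n"
proof -
  fix X X' Y Y' :: "nat \<Rightarrow> rat"
  assume *: "padic_rel CARD('a) X X'" "padic_rel CARD('a) Y Y'"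
  then have "padic_null CARD('a) (\<lambda>n. (X n - X' n) + (Y n - Y' n))"
    by (auto simp: padic_rel_def intro: padic_null_add[OF prime_card])
  then show "padic_rel CARD('a) (\<lambda>n. X n + Y n) (\<lambda>n. X' n + Y' n)"
    using * by (auto simp: padic_rel_def algebra_simps intro: padic_cauchy_add[OF prime_card])
qed

lift_definition uminus_padic :: "'a padic \<Rightarrow> 'a padic" is "\<lambda>X n. - X n"
proof -
  fix X X' :: "nat \<Rightarrow> rat"
  assume *: "padic_rel CARD('a) X X'"
  then have "padic_null CARD('a) (\<lambda>n. - (X n - X' n))"
    by (intro padic_null_minus[OF prime_card]) (simp add: padic_rel_def)
  then show "padic_rel CARD('a) (\<lambda>n. - X n) (\<lambda>n. - X' n)"
    using * by (auto simp: padic_rel_def intro: padic_cauchy_minus[OF prime_card])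
qed

definition minus_padic :: "'a padic \<Rightarrow> 'a padic \<Rightarrow> 'a padic" where
  "minus_padic x y = x + - y"

lift_definition times_padic :: "'a padic \<Rightarrow> 'a padic \<Rightarrow> 'a padic" is "\<lambda>X Y n. X n * Y n"
proof -
  fix X X' Y Y' :: "nat \<Rightarrow> rat"
  assume *: "padic_rel CARD('a) X X'" "padic_rel CARD('a) Y Y'"
  then have "padic_null CARD('a) (\<lambda>n. (X n - X' n) * Y n + (Y n - Y' n) * X' n)"
    by (auto simp: padic_rel_def intro: padic_null_add[OF prime_card] padic_null_mult[OF prime_card])
  then show "padic_rel CARD('a) (\<lambda>n. X n * Y n) (\<lambda>n. X' n * Y' n)"
    using * by (auto simp: padic_rel_def algebra_simps intro: padic_cauchy_mult[OF prime_card])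
qed

instance
proof
  fix x y z :: "'a padic"
  note cs = padic_cauchy_add[OF prime_card] padic_cauchy_mult[OF prime_card]
    padic_cauchy_minus[OF prime_card] padic_cauchy_const[OF prime_card]
  show "x + y + z = x + (y + z)"
    by transfer (auto simp: padic_rel_def algebra_simps padic_null_def intro!: cs)
  show "x + y = y + x"
    by transfer (auto simp: padic_rel_def algebra_simps padic_null_def intro!: cs)
  show "0 + x = x"
    by transfer (auto simp: padic_rel_def algebra_simps padic_null_def intro!: cs)
  show "- x + x = 0"
    by transfer (auto simp: padic_rel_def algebra_simps padic_null_def intro!: cs)
  show "x - y = x + - y" by (rule minus_padic_def)
  show "x * y * z = x * (y * z)"
    by transfer (auto simp: padic_rel_def algebra_simps padic_null_def intro!: cs)
  show "x * y = y * x"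
    by transfer (auto simp: padic_rel_def algebra_simps padic_null_def intro!: cs)
  show "1 * x = x"
    by transfer (auto simp: padic_rel_def algebra_simps padic_null_def intro!: cs)
  show "(x + y) * z = x * z + y * z"
    by transfer (auto simp: padic_rel_def distrib_right padic_null_def intro!: cs)
  show "(0 :: 'a padic) \<noteq> 1"
  proof (transfer, rule notI)
    assume "padic_rel CARD('a) (\<lambda>n. 0) (\<lambda>n. 1)"
    then show False
      by (simp add: padic_rel_def padic_null_def padic_abs_minus[OF prime_card]
            padic_abs_1[OF prime_card] LIMSEQ_const_iff)
  qed
qed

end

lift_definition padic_inverse :: "'a :: prime_card padic \<Rightarrow> 'a padic"
  is "\<lambda>X. if padic_null CARD('a) X then (\<lambda>n. 0) else (\<lambda>n. inverse (X n))"
proof -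
  fix X X' :: "nat \<Rightarrow> rat"
  assume *: "padic_rel CARD('a) X X'"
  show "padic_rel CARD('a) (if padic_null CARD('a) X then (\<lambda>n. 0) else (\<lambda>n. inverse (X n)))
         (if padic_null CARD('a) X' then (\<lambda>n. 0) else (\<lambda>n. inverse (X' n)))"
  proof (cases "padic_null CARD('a) X")
    case True
    then show ?thesis using padic_rel_null_iff[OF prime_card *]
      by (simp add: padic_rel_def padic_cauchy_const[OF prime_card] padic_null_def)
  next
    case False
    then show ?thesis using padic_rel_null_iff[OF prime_card *] *
      by (auto simp: padic_rel_def intro!: padic_cauchy_inverse[OF prime_card]
            padic_null_inverse_diff[OF prime_card])
  qed
qed

lemma padic_inverse_0: "padic_inverse 0 = 0"
  by transfer (simp add: padic_rel_def padic_null_def padic_cauchy_const[OF prime_card])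

lemma padic_inverse_mult: "x \<noteq> 0 \<Longrightarrow> padic_inverse x * x = 1"
proof transfer
  note cs = padic_cauchy_add[OF prime_card] padic_cauchy_mult[OF prime_card]
    padic_cauchy_minus[OF prime_card] padic_cauchy_const[OF prime_card]
  fix X :: "nat \<Rightarrow> rat"
  assume X: "padic_rel CARD('a) X X" "\<not> padic_rel CARD('a) X (\<lambda>n. 0)"
  have cX: "padic_cauchy CARD('a) X" using X by (simp add: padic_rel_def)
  have nX: "\<not> padic_null CARD('a) X"
    using X cX padic_cauchy_const[OF prime_card] by (auto simp: padic_rel_def)
  obtain b N where b: "b > 0" "\<And>n. n \<ge> N \<Longrightarrow> padic_abs CARD('a) (X n) > b"
    using padic_not_null[OF prime_card cX nX] by blast
  have "inverse (X n) * X n - 1 = 0" if "n \<ge> N" for n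
    using b(2)[OF that] b(1) by (cases "X n = 0") auto
  then have "\<forall>\<^sub>F n in sequentially. padic_abs CARD('a) (inverse (X n) * X n - 1) = 0"
    by (intro eventually_sequentiallyI[of N]) simp
  then have "padic_null CARD('a) (\<lambda>n. inverse (X n) * X n - 1)"
    unfolding padic_null_def by (rule tendsto_eventually)
  then show "padic_rel CARD('a)
      (\<lambda>n. (if padic_null CARD('a) X then (\<lambda>n. 0) else (\<lambda>n. inverse (X n))) n * X n) (\<lambda>n. 1)"
    using nX cX by (auto simp: padic_rel_def
        intro!: cs padic_cauchy_inverse[OF prime_card])
qed

instantiation padic :: (prime_card) field
begin

definition inverse_padic :: "'a padic \<Rightarrow> 'a padic" where
  "inverse_padic = padic_inverse"

definition divide_padic :: "'a padic \<Rightarrow> 'a padic \<Rightarrow> 'a padic" where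
  "divide_padic x y = x * inverse y"

instance
  by standard (simp_all add: inverse_padic_def divide_padic_def padic_inverse_0 padic_inverse_mult)

end

lemma of_nat_padic: "(of_nat n :: 'a :: prime_card padic) = abs_padic (\<lambda>_. of_nat n)"
proof (induction n)
  case (Suc n)
  have c: "padic_rel CARD('a) (\<lambda>_. c) (\<lambda>_. c)" for c
    by (simp add: padic_rel_refl_iff padic_cauchy_const[OF prime_card])
  show ?case
    using Suc plus_padic.abs_eq[where 'a = 'a, OF c c, of 1 "of_nat n"]
    by (simp add: one_padic.abs_eq)
qed (simp add: zero_padic.abs_eq)

instance padic :: (prime_card) field_char_0
proof
  show "inj (of_nat :: nat \<Rightarrow> 'a padic)"
  proof (rule injI)
    fix m n :: nat
    assume "(of_nat m :: 'a padic) = of_nat n"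
    then have "padic_rel CARD('a) (\<lambda>_. of_nat m) (\<lambda>_. of_nat n)"
      using Quotient_rel[OF Quotient_padic[where 'a = 'a], of "\<lambda>_. of_nat m" "\<lambda>_. of_nat n"]
      by (simp add: of_nat_padic padic_rel_refl_iff padic_cauchy_const[OF prime_card])
    then have "padic_abs CARD('a) (of_nat m - of_nat n) = 0"
      by (simp add: padic_rel_def padic_null_def LIMSEQ_const_iff)
    then show "m = n" by (simp add: padic_abs_eq_0_iff[OF prime_card])
  qed
qed

subsection \<open>Absolute value and metric\<close>

lift_definition padic_norm :: "'a :: prime_card padic \<Rightarrow> real"
  is "\<lambda>X. lim (\<lambda>n. padic_abs CARD('a) (X n))"
  by (rule padic_rel_abs_lim[OF prime_card])

lemma padic_abs_tendsto_lim:
  assumes "padic_rel CARD('a :: prime_card) X X"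
  shows "(\<lambda>n. padic_abs CARD('a) (X n)) \<longlonglongrightarrow> lim (\<lambda>n. padic_abs CARD('a) (X n))"
  using padic_cauchy_convergent_abs[OF prime_card] assms
  by (simp add: padic_rel_refl_iff convergent_LIMSEQ_iff)

lemma padic_norm_nonneg: "0 \<le> padic_norm x"
proof transfer
  fix X assume "padic_rel CARD('a) X X"
  from padic_abs_tendsto_lim[OF this] show "0 \<le> lim (\<lambda>n. padic_abs CARD('a) (X n))"
    by (rule LIMSEQ_le_const) (use padic_abs_nonneg[OF prime_card] in auto)
qed

lemma padic_norm_eq_0_iff: "padic_norm x = 0 \<longleftrightarrow> x = 0"
proof transfer
  fix X assume X: "padic_rel CARD('a) X X"
  have "lim (\<lambda>n. padic_abs CARD('a) (X n)) = 0 \<longleftrightarrow> padic_null CARD('a) X"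
    using padic_abs_tendsto_lim[OF X] unfolding padic_null_def by (auto dest: limI)
  then show "(lim (\<lambda>n. padic_abs CARD('a) (X n)) = 0) = padic_rel CARD('a) X (\<lambda>n. 0)"
    using X by (simp add: padic_rel_refl_iff) (simp add: padic_rel_def padic_cauchy_const[OF prime_card])
qed

lemma padic_norm_mult: "padic_norm (x * y) = padic_norm x * padic_norm y"
proof transfer
  fix X Y assume "padic_rel CARD('a) X X" "padic_rel CARD('a) Y Y"
  from tendsto_mult[OF this[THEN padic_abs_tendsto_lim]]
  show "lim (\<lambda>n. padic_abs CARD('a) (X n * Y n)) =
      lim (\<lambda>n. padic_abs CARD('a) (X n)) * lim (\<lambda>n. padic_abs CARD('a) (Y n))"
    by (intro limI) (simp add: padic_abs_mult[OF prime_card])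
qed

lemma padic_norm_minus: "padic_norm (- x) = padic_norm x"
  by transfer (simp add: padic_abs_minus[OF prime_card])

lemma padic_norm_ultrametric: "padic_norm (x + y) \<le> max (padic_norm x) (padic_norm y)"
proof transfer
  fix X Y assume X: "padic_rel CARD('a) X X" and Y: "padic_rel CARD('a) Y Y"
  have "padic_rel CARD('a) (\<lambda>n. X n + Y n) (\<lambda>n. X n + Y n)"
    using X Y by (simp add: padic_rel_refl_iff padic_cauchy_add[OF prime_card])
  from padic_abs_tendsto_lim[OF this]
    tendsto_max[OF padic_abs_tendsto_lim[OF X] padic_abs_tendsto_lim[OF Y]]
  show "lim (\<lambda>n. padic_abs CARD('a) (X n + Y n)) \<le>
      max (lim (\<lambda>n. padic_abs CARD('a) (X n))) (lim (\<lambda>n. padic_abs CARD('a) (Y n)))"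
    by (rule LIMSEQ_le) (use padic_abs_ultrametric[OF prime_card] in auto)
qed

instantiation padic :: (prime_card) metric_space
begin

definition dist_padic :: "'a padic \<Rightarrow> 'a padic \<Rightarrow> real" where
  "dist_padic x y = padic_norm (x - y)"

definition uniformity_padic :: "('a padic \<times> 'a padic) filter" where
  "uniformity_padic = (INF e\<in>{0<..}. principal {(x, y). dist x y < e})"

definition open_padic :: "'a padic set \<Rightarrow> bool" where
  "open_padic U \<longleftrightarrow> (\<forall>x\<in>U. eventually (\<lambda>(x', y). x' = x \<longrightarrow> y \<in> U) uniformity)"

instance
proof
  fix x y z :: "'a padic"
  show "dist x y = 0 \<longleftrightarrow> x = y"
    by (simp add: dist_padic_def padic_norm_eq_0_iff)
  have "padic_norm (x - y) \<le> max (padic_norm (x - z)) (padic_norm (z - y))"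
    using padic_norm_ultrametric[of "x - z" "z - y"] by simp
  moreover have "padic_norm (z - y) = padic_norm (y - z)"
    using padic_norm_minus[of "y - z"] by simp
  ultimately show "dist x y \<le> dist x z + dist y z"
    using padic_norm_nonneg[of "x - z"] padic_norm_nonneg[of "y - z"]
    by (simp add: dist_padic_def)
qed (simp_all add: uniformity_padic_def open_padic_def)

end

lemma of_rat_padic: "(of_rat r :: 'a :: prime_card padic) = abs_padic (\<lambda>_. r)"
proof -
  have c: "padic_rel CARD('a) (\<lambda>_. c) (\<lambda>_. c)" for c
    by (simp add: padic_rel_refl_iff padic_cauchy_const[OF prime_card])
  have int: "(of_int a :: 'a padic) = abs_padic (\<lambda>_. of_int a)" for a
    using uminus_padic.abs_eq[where 'a = 'a, OF c]
    by (cases a rule: int_cases2) (simp_all add: of_nat_padic)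
  obtain a b where ab: "r = of_int a / of_int b" "b \<noteq> 0" by (rule rat_frac_cases)
  have "of_rat r * of_int b = (of_int a :: 'a padic)"
    using ab by (simp add: of_rat_divide)
  moreover have "abs_padic (\<lambda>_. r) * of_int b = (of_int a :: 'a padic)"
    unfolding int using times_padic.abs_eq[where 'a = 'a, OF c c, of r "of_int b"] ab by simp
  ultimately show ?thesis using ab
    by (metis mult_right_cancel of_int_eq_0_iff)
qed

lemma padic_norm_of_rat: "padic_norm (of_rat r :: 'a :: prime_card padic) = padic_abs CARD('a) r"
  unfolding of_rat_padic
  by (subst padic_norm.abs_eq) (simp_all add: padic_rel_refl_iff padic_cauchy_const[OF prime_card] limI)

lemma of_rat_tendsto_abs_padic:
  assumes X: "padic_cauchy CARD('a) X"
  shows "(\<lambda>n. of_rat (X n)) \<longlonglongrightarrow> (abs_padic X :: 'a :: prime_card padic)"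
proof (rule metric_LIMSEQ_I)
  fix e :: real assume e: "e > 0"
  then obtain N where N: "\<And>m n. m \<ge> N \<Longrightarrow> n \<ge> N \<Longrightarrow> padic_abs CARD('a) (X m - X n) < e / 2"
    using X unfolding padic_cauchy_def by (meson half_gt_zero)
  show "\<exists>N. \<forall>n\<ge>N. dist (of_rat (X n)) (abs_padic X :: 'a padic) < e"
  proof (intro exI allI impI)
    fix n assume n: "n \<ge> N"
    have r: "padic_rel CARD('a) (\<lambda>_. X n) (\<lambda>_. X n)" "padic_rel CARD('a) X X"
      "padic_rel CARD('a) (\<lambda>k. - X k) (\<lambda>k. - X k)"
      "padic_rel CARD('a) (\<lambda>k. X n - X k) (\<lambda>k. X n - X k)"
      using X by (simp_all add: padic_rel_refl_iff padic_cauchy_const[OF prime_card]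
          padic_cauchy_minus[OF prime_card] padic_cauchy_diff[OF prime_card])
    have "of_rat (X n) - abs_padic X = (abs_padic (\<lambda>k. X n - X k) :: 'a padic)"
      by (simp add: minus_padic_def of_rat_padic uminus_padic.abs_eq[OF r(2)]
          plus_padic.abs_eq[OF r(1) r(3)])
    then have "dist (of_rat (X n)) (abs_padic X :: 'a padic) =
        lim (\<lambda>k. padic_abs CARD('a) (X n - X k))"
      by (simp add: dist_padic_def padic_norm.abs_eq[OF r(4)])
    also have "\<dots> \<le> e / 2"
      by (rule LIMSEQ_le_const2[OF padic_abs_tendsto_lim[OF r(4)]])
         (use N n in \<open>auto intro!: exI[of _ N] less_imp_le\<close>)
    finally show "dist (of_rat (X n)) (abs_padic X :: 'a padic) < e" using e by simp
  qed
qed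

lemma padic_rat_dense:
  assumes "e > 0"
  shows "\<exists>r. dist (of_rat r) (x :: 'a :: prime_card padic) < e"
proof -
  have "padic_cauchy CARD('a) (rep_padic x)" "abs_padic (rep_padic x) = x"
    using Quotient_rep_reflp[OF Quotient_padic] Quotient_abs_rep[OF Quotient_padic]
    by (auto simp: padic_rel_refl_iff)
  then have "(\<lambda>n. of_rat (rep_padic x n)) \<longlonglongrightarrow> x"
    using of_rat_tendsto_abs_padic by metis
  then show ?thesis using metric_LIMSEQ_D[OF _ assms] by blast
qed

instance padic :: (prime_card) complete_space
proof
  fix x :: "nat \<Rightarrow> 'a padic"
  assume x: "Cauchy x"
  have "\<forall>n. \<exists>r. dist (of_rat r) (x n) < 1 / real (Suc n)"
    by (intro allI padic_rat_dense) simp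
  then obtain R where R: "\<And>n. dist (of_rat (R n)) (x n) < 1 / real (Suc n)"
    by metis
  have lim0: "(\<lambda>n. 1 / real (Suc n)) \<longlonglongrightarrow> 0" by (rule LIMSEQ_inverse_real_of_nat[unfolded inverse_eq_divide])
  have R0: "(\<lambda>n. dist (of_rat (R n)) (x n)) \<longlonglongrightarrow> 0"
    by (rule tendsto_sandwich[OF _ _ tendsto_const lim0]) (auto intro!: always_eventually less_imp_le R simp del: of_nat_Suc)
  have "padic_cauchy CARD('a) R"
    unfolding padic_cauchy_def
  proof (intro allI impI)
    fix e :: real assume e: "e > 0"
    obtain N where N: "\<And>m n. m \<ge> N \<Longrightarrow> n \<ge> N \<Longrightarrow> dist (x m) (x n) < e / 3"
      using x e unfolding Cauchy_def by (meson zero_less_divide_iff zero_less_numeral)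
    have "\<forall>\<^sub>F n in sequentially. dist (of_rat (R n)) (x n) < e / 3"
      using order_tendstoD(2)[OF R0, of "e / 3"] e by simp
    then obtain M where M: "\<And>n. n \<ge> M \<Longrightarrow> dist (of_rat (R n)) (x n) < e / 3"
      by (auto simp: eventually_sequentially)
    show "\<exists>N. \<forall>m\<ge>N. \<forall>n\<ge>N. padic_abs CARD('a) (R m - R n) < e"
    proof (intro exI allI impI)
      fix m n assume mn: "max N M \<le> m" "max N M \<le> n"
      have "padic_abs CARD('a) (R m - R n) = dist (of_rat (R m)) (of_rat (R n) :: 'a padic)"
        by (simp add: dist_padic_def padic_norm_of_rat flip: of_rat_diff)
      also have "\<dots> \<le> dist (of_rat (R m)) (x m) + dist (x m) (x n) + dist (of_rat (R n)) (x n)"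
        using dist_triangle[of "of_rat (R m)" "of_rat (R n)" "x m"]
          dist_triangle[of "x m" "of_rat (R n)" "x n"] by (simp add: dist_commute)
      also have "\<dots> < e" using M[of m] M[of n] N[of m n] mn by simp
      finally show "padic_abs CARD('a) (R m - R n) < e" .
    qed
  qed
  then have l: "(\<lambda>n. of_rat (R n)) \<longlonglongrightarrow> (abs_padic R :: 'a padic)"
    by (rule of_rat_tendsto_abs_padic)
  have "x \<longlonglongrightarrow> abs_padic R"
  proof (rule iffD2[OF tendsto_dist_iff], rule tendsto_sandwich[where f = "\<lambda>_. 0"])
    show "(\<lambda>n. dist (of_rat (R n)) (x n) + dist (of_rat (R n)) (abs_padic R :: 'a padic)) \<longlonglongrightarrow> 0"
      using tendsto_add[OF R0 iffD1[OF tendsto_dist_iff l]] by simp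
    show "\<forall>\<^sub>F n in sequentially. dist (x n) (abs_padic R) \<le>
        dist (of_rat (R n)) (x n) + dist (of_rat (R n)) (abs_padic R :: 'a padic)"
      by (intro always_eventually allI) (metis dist_commute dist_triangle)
    show "\<forall>\<^sub>F n in sequentially. 0 \<le> dist (x n) (abs_padic R)" by simp
  qed simp
  then show "convergent x" by (auto simp: convergent_def)
qed

instance padic :: (prime_card) topological_comm_monoid_add
proof
  fix a b :: "'a padic"
  show "((\<lambda>x. fst x + snd x) \<longlongrightarrow> a + b) (nhds a \<times>\<^sub>F nhds b)"
  proof (rule tendstoI)
    fix e :: real assume e: "e > 0"
    have "\<forall>\<^sub>F x in nhds a. dist x a < e" "\<forall>\<^sub>F x in nhds b. dist x b < e"
      using e by (auto simp: eventually_nhds_metric)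
    then have "\<forall>\<^sub>F x in nhds a \<times>\<^sub>F nhds b. dist (fst x) a < e \<and> dist (snd x) b < e"
      by (rule eventually_prodI)
    then show "\<forall>\<^sub>F x in nhds a \<times>\<^sub>F nhds b. dist (fst x + snd x) (a + b) < e"
    proof (rule eventually_mono)
      fix x :: "'a padic \<times> 'a padic" assume "dist (fst x) a < e \<and> dist (snd x) b < e"
      then show "dist (fst x + snd x) (a + b) < e"
        using padic_norm_ultrametric[of "fst x - a" "snd x - b"]
        by (auto simp: dist_padic_def algebra_simps)
    qed
  qed
qed

instance padic :: (prime_card) topological_semigroup_mult
proof
  fix a b :: "'a padic"
  show "((\<lambda>x. fst x * snd x) \<longlongrightarrow> a * b) (nhds a \<times>\<^sub>F nhds b)"
  proof (rule tendstoI)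
    fix e :: real assume e: "e > 0"
    define A where "A = padic_norm a + 1"
    define B where "B = padic_norm b + 1"
    have AB: "A \<ge> 1" "B \<ge> 1" "A \<ge> padic_norm a" "B \<ge> padic_norm b"
      using padic_norm_nonneg[of a] padic_norm_nonneg[of b] by (simp_all add: A_def B_def)
    have "\<forall>\<^sub>F x in nhds a. dist x a < e / B" "\<forall>\<^sub>F x in nhds b. dist x b < min 1 (e / A)"
      unfolding eventually_nhds_metric
      by (rule exI[of _ "e / B"], use e AB in simp)
         (rule exI[of _ "min 1 (e / A)"], use e AB in simp)
    then have "\<forall>\<^sub>F x in nhds a \<times>\<^sub>F nhds b. dist (fst x) a < e / B \<and> dist (snd x) b < min 1 (e / A)"
      by (rule eventually_prodI)
    then show "\<forall>\<^sub>F x in nhds a \<times>\<^sub>F nhds b. dist (fst x * snd x) (a * b) < e"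
    proof (rule eventually_mono)
      fix x :: "'a padic \<times> 'a padic"
      assume "dist (fst x) a < e / B \<and> dist (snd x) b < min 1 (e / A)"
      then have x: "padic_norm (fst x - a) < e / B" "padic_norm (snd x - b) < 1"
        "padic_norm (snd x - b) < e / A" by (auto simp: dist_padic_def)
      have "padic_norm (snd x) \<le> B"
        using padic_norm_ultrametric[of "snd x - b" b] x AB by simp
      then have "padic_norm ((fst x - a) * snd x) \<le> padic_norm (fst x - a) * B"
        by (simp add: padic_norm_mult padic_norm_nonneg mult_left_mono)
      also have "\<dots> < e" using x AB by (simp add: field_simps)
      finally have 1: "padic_norm ((fst x - a) * snd x) < e" .
      have "padic_norm (a * (snd x - b)) \<le> A * padic_norm (snd x - b)"
        using AB by (simp add: padic_norm_mult padic_norm_nonneg mult_right_mono)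
      also have "\<dots> < e" using x AB by (simp add: field_simps)
      finally have 2: "padic_norm (a * (snd x - b)) < e" .
      have "fst x * snd x - a * b = (fst x - a) * snd x + a * (snd x - b)"
        by (simp add: algebra_simps)
      then show "dist (fst x * snd x) (a * b) < e"
        using 1 2 padic_norm_ultrametric[of "(fst x - a) * snd x" "a * (snd x - b)"]
        by (simp add: dist_padic_def)
    qed
  qed
qed

definition padic_integers :: "'a :: prime_card padic set" where
  "padic_integers = {x. padic_norm x \<le> 1}"

section \<open>Grassmann spaces\<close>

definition grassmannian :: "nat \<Rightarrow> ('a :: field ^ 'n) set set" where
  "grassmannian k = {V. vec.subspace V \<and> vec.dim V = k}"

definition frames :: "nat \<Rightarrow> (nat \<Rightarrow> 'a :: field ^ 'n) set" where
  "frames k = {v \<in> {..<k} \<rightarrow>\<^sub>E UNIV. inj_on v {..<k} \<and> vec.independent (v ` {..<k})}"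

definition frame_topology :: "nat \<Rightarrow> (nat \<Rightarrow> ('a :: {field, topological_space}) ^ 'n) topology" where
  "frame_topology k = subtopology (product_topology (\<lambda>_. euclidean) {..<k}) (frames k)"

text \<open>The quotient topology under the map sending a k-frame to its span.\<close>

definition grassmannian_topology ::
    "nat \<Rightarrow> (('a :: {field, topological_space}) ^ 'n) set topology" where
  "grassmannian_topology k = topology (\<lambda>U. U \<subseteq> grassmannian k \<and>
     openin (frame_topology k) {v \<in> frames k. vec.span (v ` {..<k}) \<in> U})"

lemma topspace_frame_topology [simp]: "topspace (frame_topology k) = frames k"
  by (auto simp: frame_topology_def frames_def)

lemma frame_span_grassmannian: "v \<in> frames k \<Longrightarrow> vec.span (v ` {..<k}) \<in> grassmannian k"
  by (auto simp: frames_def grassmannian_def vec.dim_span vec.dim_eq_card_independent card_image)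

lemma openin_grassmannian_topology:
  "openin (grassmannian_topology k) U \<longleftrightarrow> U \<subseteq> grassmannian k \<and>
     openin (frame_topology k) {v \<in> frames k. vec.span (v ` {..<k}) \<in> U}"
proof -
  let ?f = "\<lambda>v :: nat \<Rightarrow> 'a ^ 'b. vec.span (v ` {..<k})"
  have "istopology (\<lambda>U. U \<subseteq> grassmannian k \<and>
     openin (frame_topology k) {v \<in> frames k. ?f v \<in> U})"
    unfolding istopology_def
  proof (intro conjI allI impI)
    fix S T :: "('a ^ 'b) set set"
    assume a: "S \<subseteq> grassmannian k \<and> openin (frame_topology k) {v \<in> frames k. ?f v \<in> S}"
      "T \<subseteq> grassmannian k \<and> openin (frame_topology k) {v \<in> frames k. ?f v \<in> T}"
    show "S \<inter> T \<subseteq> grassmannian k" using a by blast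
    have "{v \<in> frames k. ?f v \<in> S \<inter> T} = {v \<in> frames k. ?f v \<in> S} \<inter> {v \<in> frames k. ?f v \<in> T}"
      by auto
    then show "openin (frame_topology k) {v \<in> frames k. ?f v \<in> S \<inter> T}" using a by auto
  next
    fix K :: "('a ^ 'b) set set set"
    assume a: "\<forall>S\<in>K. S \<subseteq> grassmannian k \<and> openin (frame_topology k) {v \<in> frames k. ?f v \<in> S}"
    then show "\<Union> K \<subseteq> grassmannian k" by blast
    have "{v \<in> frames k. ?f v \<in> \<Union> K} = (\<Union>S\<in>K. {v \<in> frames k. ?f v \<in> S})" by auto
    then show "openin (frame_topology k) {v \<in> frames k. ?f v \<in> \<Union> K}" using a by auto
  qed
  then show ?thesis unfolding grassmannian_topology_def by (subst topology_inverse') auto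
qed

lemma topspace_grassmannian_topology [simp]:
  "topspace (grassmannian_topology k :: ('a :: {field, topological_space} ^ 'n) set topology) =
     grassmannian k"
proof
  show "topspace (grassmannian_topology k :: ('a ^ 'n) set topology) \<subseteq> grassmannian k"
    by (metis openin_grassmannian_topology openin_topspace)
  have "{v \<in> frames k. vec.span (v ` {..<k}) \<in> grassmannian k} = (frames k :: (nat \<Rightarrow> 'a ^ 'n) set)"
    using frame_span_grassmannian by auto
  then have "openin (grassmannian_topology k) (grassmannian k :: ('a ^ 'n) set set)"
    using openin_topspace[of "frame_topology k :: (nat \<Rightarrow> 'a ^ 'n) topology"]
    by (simp add: openin_grassmannian_topology)
  then show "(grassmannian k :: ('a ^ 'n) set set) \<subseteq> topspace (grassmannian_topology k)"
    by (rule openin_subset)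
qed

lemma grassmannian_frame:
  assumes "V \<in> grassmannian k"
  shows "\<exists>v\<in>frames k. V = vec.span (v ` {..<k})"
proof -
  obtain B where B: "B \<subseteq> V" "vec.independent B" "V \<subseteq> vec.span B" "card B = vec.dim V"
    using vec.basis_exists by blast
  have V: "vec.subspace V" "vec.dim V = k" using assms by (auto simp: grassmannian_def)
  have fin: "finite B" using B(2) by (rule vec.finiteI_independent)
  obtain h where h: "bij_betw h {0..<k} B"
    using ex_bij_betw_nat_finite[OF fin] B(4) V(2) by auto
  define v where "v = restrict h {..<k}"
  have h': "bij_betw h {..<k} B" using h by (simp add: lessThan_atLeast0)
  have im: "v ` {..<k} = B" using h' by (simp add: v_def bij_betw_def)
  have "inj_on v {..<k}" using h' by (simp add: v_def bij_betw_def inj_on_restrict_eq)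
  then have "v \<in> frames k" using im B(2) by (auto simp: frames_def v_def)
  moreover have "V = vec.span B"
    using B V vec.span_minimal[of B V] by auto
  ultimately show ?thesis using im by auto
qed

lemma quotient_map_frame_span:
  "quotient_map (frame_topology k) (grassmannian_topology k) (\<lambda>v. vec.span (v ` {..<k}))"
  unfolding quotient_map_def
  using frame_span_grassmannian grassmannian_frame
  by (auto simp: openin_grassmannian_topology image_iff)

section \<open>Measures and ergodicity\<close>

definition borel_of :: "'a topology \<Rightarrow> 'a measure" where
  "borel_of T = sigma (topspace T) {U. openin T U}"

definition matrix_image :: "'a :: comm_semiring_1 ^ 'n ^ 'n \<Rightarrow> ('a ^ 'n) set \<Rightarrow> ('a ^ 'n) set" where
  "matrix_image A V = (\<lambda>v. A *v v) ` V"

definition SL_padic_integers :: "('p :: prime_card padic ^ 'm ^ 'm) set" where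
  "SL_padic_integers = {A. (\<forall>i j. A $ i $ j \<in> padic_integers) \<and> det A = 1}"

definition is_haar_prob ::
    "('a :: {comm_ring_1, topological_space} ^ 'm ^ 'm) set \<Rightarrow> ('a ^ 'm ^ 'm) measure \<Rightarrow> bool" where
  "is_haar_prob G \<nu> \<longleftrightarrow> prob_space \<nu> \<and> sets \<nu> = sets (restrict_space borel G) \<and>
     (\<forall>g\<in>G. \<forall>B\<in>sets \<nu>. emeasure \<nu> ((\<lambda>h. g ** h) ` B) = emeasure \<nu> B)"

text \<open>
  The action of the special linear group over the p-adic integers on lines is transitive,
  so the push-forward does not depend on the base point \<open>L\<close>.
\<close>

definition is_haar_projective :: "('p :: prime_card padic ^ 'm) set measure \<Rightarrow> bool" where
  "is_haar_projective \<mu> \<longleftrightarrow> (\<exists>\<nu> L. is_haar_prob SL_padic_integers \<nu> \<and> L \<in> grassmannian 1 \<and>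
     \<mu> = distr \<nu> (borel_of (grassmannian_topology 1)) (\<lambda>g. matrix_image g L))"

lemma matrix_image_span:
  fixes A :: "'a :: field ^ 'n ^ 'n"
  shows "matrix_image A (vec.span S) = vec.span (((*v) A) ` S)"
  unfolding matrix_image_def by (rule vec.linear_span_image[OF matrix_vector_mul_linear_gen, symmetric])

lemma matrix_image_frame:
  fixes A :: "'a :: field ^ 'n ^ 'n"
  assumes v: "v \<in> frames k" and A: "invertible A"
  shows "(\<lambda>i\<in>{..<k}. A *v v i) \<in> frames k"
proof -
  have inj: "inj ((*v) A)" using A by (rule inj_matrix_vector_mult)
  have im: "(\<lambda>i\<in>{..<k}. A *v v i) ` {..<k} = ((*v) A) ` v ` {..<k}" by auto
  have "vec.independent (((*v) A) ` v ` {..<k})"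
  proof (rule vec.linear_independent_injective_image[OF matrix_vector_mul_linear_gen])
    show "vec.independent (v ` {..<k})" using v by (simp add: frames_def)
    show "inj_on ((*v) A) (vec.span (v ` {..<k}))" using inj by (rule inj_on_subset) simp
  qed
  moreover have "inj_on (\<lambda>i\<in>{..<k}. A *v v i) {..<k}"
    using v inj by (auto simp: frames_def inj_on_def inj_def)
  ultimately show ?thesis by (simp add: frames_def image_image)
qed

lemma continuous_map_orbit:
  fixes G :: "('a :: {field, topological_comm_monoid_add, topological_semigroup_mult} ^ 'n ^ 'n) set"
  assumes V: "V \<in> grassmannian k" and G: "\<And>A. A \<in> G \<Longrightarrow> invertible A"
  shows "continuous_map (top_of_set G) (grassmannian_topology k) (\<lambda>A. matrix_image A V)"
proof -
  obtain v where v: "v \<in> frames k" "V = vec.span (v ` {..<k})"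
    using grassmannian_frame[OF V] by blast
  let ?f = "\<lambda>A. \<lambda>i\<in>{..<k}. A *v v i"
  have "continuous_map (top_of_set G) euclidean (\<lambda>A. A *v w)" for w :: "'a ^ 'n"
    unfolding continuous_map_iff_continuous matrix_vector_mult_def
    by (intro continuous_on_vec_lambda continuous_intros)
  then have "continuous_map (top_of_set G) (product_topology (\<lambda>_. euclidean) {..<k}) ?f"
    by (auto simp: continuous_map_componentwise)
  moreover have "?f ` topspace (top_of_set G) \<subseteq> frames k"
    using matrix_image_frame[OF v(1) G] by auto
  ultimately have "continuous_map (top_of_set G) (frame_topology k) ?f"
    unfolding frame_topology_def by (auto simp: continuous_map_in_subtopology)
  from continuous_map_compose[OF this quotient_imp_continuous_map[OF quotient_map_frame_span]]
  have "continuous_map (top_of_set G) (grassmannian_topology k) (\<lambda>A. vec.span (?f A ` {..<k}))"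
    by (simp add: o_def)
  moreover have "vec.span (?f A ` {..<k}) = matrix_image A V" for A
    by (simp add: v(2) matrix_image_span image_image)
  ultimately show ?thesis by simp
qed

lemma SL_padic_integers_invertible: "A \<in> SL_padic_integers \<Longrightarrow> invertible A"
  by (simp add: SL_padic_integers_def invertible_det_nz)

lemma prob_space_haar_projective:
  fixes \<mu> :: "('p :: prime_card padic ^ 'm) set measure"
  assumes "is_haar_projective \<mu>"
  shows "prob_space \<mu>"
proof -
  let ?T = "grassmannian_topology 1 :: ('p padic ^ 'm) set topology"
  obtain \<nu> L where \<nu>: "is_haar_prob SL_padic_integers \<nu>" and L: "L \<in> grassmannian 1"
    and \<mu>: "\<mu> = distr \<nu> (borel_of ?T) (\<lambda>g. matrix_image g L)"
    using assms by (auto simp: is_haar_projective_def)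
  have sets: "sets \<nu> = sets (restrict_space borel SL_padic_integers)" and p: "prob_space \<nu>"
    using \<nu> by (auto simp: is_haar_prob_def)
  have sp: "space \<nu> = SL_padic_integers"
    using sets_eq_imp_space_eq[OF sets] by (simp add: space_restrict_space)
  have c: "continuous_map (top_of_set SL_padic_integers) ?T (\<lambda>g. matrix_image g L)"
    using L SL_padic_integers_invertible by (rule continuous_map_orbit)
  have "(\<lambda>g. matrix_image g L) \<in> measurable \<nu> (borel_of ?T)"
    unfolding borel_of_def
  proof (rule measurable_measure_of)
    show "{U. openin ?T U} \<subseteq> Pow (topspace ?T)"
      by (auto dest: openin_subset simp del: topspace_grassmannian_topology)
    show "(\<lambda>g. matrix_image g L) \<in> space \<nu> \<rightarrow> topspace ?T"
      using continuous_map_funspace[OF c] by (simp add: sp)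
    fix U assume "U \<in> {U. openin ?T U}"
    then have "openin (top_of_set SL_padic_integers) {g \<in> SL_padic_integers. matrix_image g L \<in> U}"
      using openin_continuous_map_preimage[OF c] by simp
    moreover have "(\<lambda>g. matrix_image g L) -` U \<inter> space \<nu> = {g \<in> SL_padic_integers. matrix_image g L \<in> U}"
      by (auto simp: sp)
    ultimately show "(\<lambda>g. matrix_image g L) -` U \<inter> space \<nu> \<in> sets \<nu>"
      by (auto simp: sets sets_restrict_space openin_open)
  qed
  then show ?thesis unfolding \<mu> by (rule prob_space.prob_space_distr[OF p])
qed

definition orbit_rel :: "'g set \<Rightarrow> ('g \<Rightarrow> 'x \<Rightarrow> 'x) \<Rightarrow> 'x set \<Rightarrow> ('x \<times> 'x) set" where
  "orbit_rel G act X = {(x, y). x \<in> X \<and> y \<in> X \<and> (\<exists>g\<in>G. y = act g x)}"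

definition borel_homomorphism ::
    "'x measure \<Rightarrow> ('x \<times> 'x) set \<Rightarrow> 'y measure \<Rightarrow> ('y \<times> 'y) set \<Rightarrow> ('x \<Rightarrow> 'y) \<Rightarrow> bool" where
  "borel_homomorphism M E N F f \<longleftrightarrow> f \<in> measurable M N \<and> (\<forall>(x, x')\<in>E. (f x, f x') \<in> F)"

definition F_ergodic ::
    "'g set \<Rightarrow> ('g \<Rightarrow> 'x \<Rightarrow> 'x) \<Rightarrow> 'x measure \<Rightarrow> 'y measure \<Rightarrow> ('y \<times> 'y) set \<Rightarrow> bool" where
  "F_ergodic G act M N F \<longleftrightarrow>
     (\<forall>f. borel_homomorphism M (orbit_rel G act (space M)) N F f \<longrightarrow>
        (\<exists>A\<in>sets M. space M - A \<in> null_sets M \<and> (\<exists>y\<in>space N. f ` A \<subseteq> F `` {y})))"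

definition SL_int :: "(int ^ 'm ^ 'm) set" where
  "SL_int = {A. det A = 1}"

definition GL_rat :: "(rat ^ 'n ^ 'n) set" where
  "GL_rat = {A. invertible A}"

end

theory Submission
  imports Defs "HOL-Number_Theory.Cong"
begin

text \<open>
  In the affine chart where a fixed coordinate equals 1 and all coordinates are integral, the Haar
  measure becomes a probability measure on which the translations by integer vectors act as a
  \<open>p\<close>-adic odometer, and the elementary matrices not touching the fixed coordinate normalise this
  action.

  Let \<open>f\<close> be a homomorphism into the orbit relation of a countable group \<open>\<Lambda>\<close>. The probability that
  \<open>(f (g x), f (g y))\<close> and \<open>(f (h x), f (h y))\<close> lie in the same diagonal orbit of \<open>\<Lambda>\<close>, for
  independent random points \<open>x\<close>, \<open>y\<close> of a small ball, is a positive semidefinite kernel in \<open>g\<close> and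
  \<open>h\<close>, almost invariant for the finitely many generators once the balls are small. By relative
  property (T) of the plane in its semidirect product with the shears, a single element of \<open>\<Lambda>\<close>
  works simultaneously for most points of the ball, uniformly over all translations. Since only
  countably many stabilisers occur, \<open>f (x + j p\<^sup>k e) = u\<^sup>j (f x)\<close> follows on most of some ball,
  for a fixed \<open>u\<close> in \<open>\<Lambda>\<close> and all \<open>j\<close>.

  Choose exponents tending to 0 in the \<open>p\<close>-adic and to 1 in the \<open>q\<close>-adic integers. Along them the
  left side returns to \<open>f x\<close> because translations by small vectors do. On Pluecker coordinates,
  \<open>u\<close> is a linear map over the \<open>q\<close>-adic numbers, and a line that is recurrent along powers tending
  \<open>q\<close>-adically to the first power is fixed by one of them. So some power of \<open>u\<close> fixes \<open>f x\<close>, the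
  map \<open>f\<close> is almost invariant under a finite index group of translations of the ball, and hence
  has a fibre of positive measure. Ergodicity of the translations turns this fibre into a conull
  class.
\<close>

section \<open>Positive definite functions on the plane lattice\<close>

definition psd_kernel :: "('i \<Rightarrow> 'i \<Rightarrow> real) \<Rightarrow> bool" where
  "psd_kernel K \<longleftrightarrow> (\<forall>i j. K i j = K j i) \<and>
     (\<forall>(n::nat) s a. 0 \<le> (\<Sum>i<n. \<Sum>j<n. a i * a j * K (s i) (s j)))"

lemma psd_kernel_sym: "psd_kernel K \<Longrightarrow> K i j = K j i"
  by (auto simp: psd_kernel_def)

lemma psd_kernel_comp: "psd_kernel K \<Longrightarrow> psd_kernel (\<lambda>i j. K (f i) (f j))"
  unfolding psd_kernel_def
proof (elim conjE, intro conjI allI)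
  fix n :: nat and s :: "nat \<Rightarrow> 'b" and a :: "nat \<Rightarrow> real"
  assume "\<forall>(n::nat) s a. 0 \<le> (\<Sum>i<n. \<Sum>j<n. a i * a j * K (s i) (s j))"
  then show "0 \<le> (\<Sum>i<n. \<Sum>j<n. a i * a j * K (f (s i)) (f (s j)))"
    by (elim allE[where x = n] allE[where x = "\<lambda>i. f (s i)"] allE[where x = a])
qed auto

lemma psd_kernel_sum_nonneg:
  assumes "psd_kernel K" "finite A"
  shows "0 \<le> (\<Sum>i\<in>A. \<Sum>j\<in>A. a i * a j * K (s i) (s j))"
proof -
  obtain h where h: "bij_betw h {..<card A} A"
    using ex_bij_betw_nat_finite[OF assms(2)] by (auto simp: lessThan_atLeast0)
  have "(\<Sum>i\<in>A. \<Sum>j\<in>A. a i * a j * K (s i) (s j)) =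
    (\<Sum>i<card A. \<Sum>j<card A. a (h i) * a (h j) * K (s (h i)) (s (h j)))"
    by (simp add: sum.reindex_bij_betw[OF h, symmetric])
  also have "\<dots> \<ge> 0"
    using conjunct2[OF assms(1)[unfolded psd_kernel_def]]
    by (elim allE[where x = "card A"] allE[where x = "\<lambda>i. s (h i)"]
        allE[where x = "\<lambda>i. a (h i)"])
  finally show ?thesis .
qed

lemma power2_le_mult_of_quadratic_nonneg:
  fixes x y z :: real
  assumes quadratic: "\<And>t. 0 \<le> x + 2 * t * y + t\<^sup>2 * z" and "0 \<le> z"
  shows "y\<^sup>2 \<le> x * z"
proof (cases "z = 0")
  case True
  have "y = 0"
  proof (rule ccontr)
    assume "y \<noteq> 0"
    then show False
      using quadratic[of "- (x + 1) / (2 * y)"] True by (simp add: field_simps)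
  qed
  then show ?thesis using True by simp
next
  case False
  then show ?thesis using quadratic[of "- y / z"] assms(2)
    by (simp add: field_simps power2_eq_square)
qed

lemma psd_kernel_Cauchy_Schwarz:
  assumes K: "psd_kernel K" and fin: "finite A" "finite B"
  shows "(\<Sum>i\<in>A. \<Sum>j\<in>B. a i * b j * K (x i) (y j))\<^sup>2 \<le>
    (\<Sum>i\<in>A. \<Sum>j\<in>A. a i * a j * K (x i) (x j)) * (\<Sum>i\<in>B. \<Sum>j\<in>B. b i * b j * K (y i) (y j))"
proof (rule power2_le_mult_of_quadratic_nonneg)
  fix t :: real
  let ?xx = "\<Sum>i\<in>A. \<Sum>j\<in>A. a i * a j * K (x i) (x j)"
  let ?xy = "\<Sum>i\<in>A. \<Sum>j\<in>B. a i * b j * K (x i) (y j)"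
  let ?yy = "\<Sum>i\<in>B. \<Sum>j\<in>B. b i * b j * K (y i) (y j)"
  let ?c = "case_sum a (\<lambda>j. t * b j)" and ?p = "case_sum x y"
  have swap: "(\<Sum>j\<in>B. \<Sum>i\<in>A. b j * a i * K (y j) (x i)) = ?xy"
    by (subst sum.swap) (simp add: psd_kernel_sym[OF K, of "y _"] mult.commute)
  have "0 \<le> (\<Sum>i\<in>Sum_Type.Plus A B. \<Sum>j\<in>Sum_Type.Plus A B. ?c i * ?c j * K (?p i) (?p j))"
    by (rule psd_kernel_sum_nonneg[OF K]) (simp add: fin)
  also have "\<dots> = ?xx + t * ?xy + t * (\<Sum>j\<in>B. \<Sum>i\<in>A. b j * a i * K (y j) (x i)) + t\<^sup>2 * ?yy"
    by (simp add: sum.Plus fin sum.distrib sum_distrib_left power2_eq_square algebra_simps)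
  finally show "0 \<le> ?xx + 2 * t * ?xy + t\<^sup>2 * ?yy" by (simp add: swap)
qed (rule psd_kernel_sum_nonneg[OF K fin(2)])

lemma psd_kernel_sum_diff_le:
  assumes K: "psd_kernel K" and A: "finite A"
  shows "(\<Sum>i\<in>A. a i * (K (x i) y - K (x i) z))\<^sup>2 \<le>
    (\<Sum>i\<in>A. \<Sum>j\<in>A. a i * a j * K (x i) (x j)) * (K y y + K z z - 2 * K y z)"
  using psd_kernel_Cauchy_Schwarz[OF K A, of "{True, False}" a "\<lambda>u. if u then 1 else -1" x
      "\<lambda>u. if u then y else z"]
  by (simp add: psd_kernel_sym[OF K, of z y] right_diff_distrib algebra_simps)

definition positive_definite :: "('a :: ab_group_add \<Rightarrow> real) \<Rightarrow> bool" where
  "positive_definite \<psi> \<longleftrightarrow> psd_kernel (\<lambda>v w. \<psi> (v - w))"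

lemma positive_definite_minus: "positive_definite \<psi> \<Longrightarrow> \<psi> (- u) = \<psi> u"
  using psd_kernel_sym[of "\<lambda>v w. \<psi> (v - w)" 0 u] by (simp add: positive_definite_def)

definition phase :: "int \<times> int \<Rightarrow> real \<times> real \<Rightarrow> real" where
  "phase u \<theta> = 2 * pi * (of_int (fst u) * fst \<theta> + of_int (snd u) * snd \<theta>)"

lemma phase_add: "phase (u + v) \<theta> = phase u \<theta> + phase v \<theta>"
  and phase_diff: "phase (u - v) \<theta> = phase u \<theta> - phase v \<theta>"
  and phase_minus: "phase (- u) \<theta> = - phase u \<theta>"
  and phase_0 [simp]: "phase 0 \<theta> = 0"
  by (simp_all add: phase_def algebra_simps)

lemma sum_cis_roots_of_unity:
  fixes k :: int and R :: nat
  assumes "R > 0" "\<bar>k\<bar> < int R"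
  shows "(\<Sum>j<R. cis (2 * pi * (of_int k * (real j / real R)))) = (if k = 0 then of_nat R else 0)"
proof (cases "k = 0")
  case False
  define z where "z = cis (2 * pi * of_int k / real R)"
  have powers: "cis (2 * pi * (of_int k * (real j / real R))) = z ^ j" for j
    unfolding z_def Complex.DeMoivre by (simp add: mult_ac)
  have "z ^ R = cis (2 * pi * of_int k)"
    unfolding z_def Complex.DeMoivre using assms by simp
  then have root: "z ^ R = 1" by (simp add: cis_multiple_2pi)
  have "z \<noteq> 1"
  proof
    assume "z = 1"
    then have "cos (2 * pi * of_int k / real R) = 1" by (simp add: z_def complex_eq_iff)
    then obtain n :: int where "2 * pi * of_int k / real R = of_int n * 2 * pi"
      by (auto simp: cos_one_2pi_int)
    then have "real_of_int k = of_int (n * int R)" using assms by (simp add: field_simps)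
    then have k: "k = n * int R" by linarith
    then have "int R * \<bar>n\<bar> < int R" using assms by (simp add: abs_mult mult.commute)
    then have "n = 0" using assms by (simp add: mult_less_cancel_left1)
    then show False using k False by simp
  qed
  moreover have "(\<Sum>j<R. z ^ j) * (z - 1) = 0"
    using geometric_sum[of z R] root \<open>z \<noteq> 1\<close> by simp
  ultimately show ?thesis using False by (simp only: powers) simp
qed simp

definition torus_grid :: "nat \<Rightarrow> (real \<times> real) set" where
  "torus_grid R = (\<lambda>(i, j). (real i / real R, real j / real R)) ` ({..<R} \<times> {..<R})"

lemma sum_cos_phase_torus_grid:
  assumes "R > 0" "\<bar>fst u\<bar> < int R" "\<bar>snd u\<bar> < int R"
  shows "(\<Sum>\<theta>\<in>torus_grid R. cos (phase u \<theta>)) = (if u = 0 then (real R)\<^sup>2 else 0)"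
proof -
  let ?e = "\<lambda>k i. cis (2 * pi * (of_int k * (real i / real R)))"
  have "inj_on (\<lambda>(i, j). (real i / real R, real j / real R)) ({..<R} \<times> {..<R})"
    using assms by (auto simp: inj_on_def)
  then have "(\<Sum>\<theta>\<in>torus_grid R. cos (phase u \<theta>)) =
      Re (\<Sum>i<R. \<Sum>j<R. ?e (fst u) i * ?e (snd u) j)"
    unfolding torus_grid_def
    by (simp add: sum.reindex sum.cartesian_product phase_def case_prod_unfold cis_mult
        algebra_simps)
  also have "\<dots> = Re ((\<Sum>i<R. ?e (fst u) i) * (\<Sum>j<R. ?e (snd u) j))"
    by (simp only: sum_product)
  also have "\<dots> = (if u = 0 then (real R)\<^sup>2 else 0)"
    unfolding sum_cis_roots_of_unity[OF assms(1,2)] sum_cis_roots_of_unity[OF assms(1,3)]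
    by (auto simp: prod_eq_iff power2_eq_square)
  finally show ?thesis .
qed

lemma sum_cos_mult_cos_torus_grid:
  assumes "R > 0" "\<bar>fst u\<bar> + \<bar>fst v\<bar> < int R" "\<bar>snd u\<bar> + \<bar>snd v\<bar> < int R"
  shows "(\<Sum>\<theta>\<in>torus_grid R. cos (phase u \<theta>) * cos (phase v \<theta>)) =
    (real R)\<^sup>2 / 2 * (of_bool (v = u) + of_bool (v = - u))"
proof -
  have "(\<Sum>\<theta>\<in>torus_grid R. cos (phase u \<theta>) * cos (phase v \<theta>)) =
      (\<Sum>\<theta>\<in>torus_grid R. cos (phase (u - v) \<theta>)) / 2 +
      (\<Sum>\<theta>\<in>torus_grid R. cos (phase (u + v) \<theta>)) / 2"
    by (simp add: phase_add phase_diff cos_times_cos add_divide_distrib sum.distrib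
        sum_divide_distrib)
  also have "\<dots> = (if u - v = 0 then (real R)\<^sup>2 else 0) / 2 + (if u + v = 0 then (real R)\<^sup>2 else 0) / 2"
    using assms by (subst (1 2) sum_cos_phase_torus_grid) auto
  also have "\<dots> = (real R)\<^sup>2 / 2 * (of_bool (v = u) + of_bool (v = - u))"
    using add_eq_0_iff[of u v] by auto
  finally show ?thesis .
qed

definition int_box :: "nat \<Rightarrow> (int \<times> int) set" where
  "int_box N = {0..<int N} \<times> {0..<int N}"

lemma finite_int_box [simp]: "finite (int_box N)" by (simp add: int_box_def)

definition fejer_weight :: "nat \<Rightarrow> int \<times> int \<Rightarrow> real" where
  "fejer_weight N u = real (card {(v, w) \<in> int_box N \<times> int_box N. v - w = u})"

lemma sum_int_box_diff_eq:
  "(\<Sum>v\<in>int_box N. \<Sum>w\<in>int_box N. x * of_bool (v - w = u)) = x * fejer_weight N u"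
proof -
  have "(\<Sum>v\<in>int_box N. \<Sum>w\<in>int_box N. x * of_bool (v - w = u)) =
      (\<Sum>z\<in>int_box N \<times> int_box N. x * of_bool (fst z - snd z = u))"
    by (simp only: sum.cartesian_product case_prod_unfold)
  also have "\<dots> = x * card (int_box N \<times> int_box N \<inter> {z. fst z - snd z = u})"
    by (simp flip: sum_distrib_left)
  also have "int_box N \<times> int_box N \<inter> {z. fst z - snd z = u} =
      {(v, w) \<in> int_box N \<times> int_box N. v - w = u}" by auto
  finally show ?thesis by (simp add: fejer_weight_def)
qed

lemma fejer_weight_minus: "fejer_weight N (- u) = fejer_weight N u"
proof -
  have "bij_betw prod.swap {(v, w) \<in> int_box N \<times> int_box N. v - w = u}
      {(v, w) \<in> int_box N \<times> int_box N. v - w = - u}"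
    by (rule bij_betw_byWitness[where f' = prod.swap]) (auto simp: int_box_def prod_eq_iff)
  then show ?thesis by (simp add: fejer_weight_def bij_betw_same_card)
qed

lemma fejer_weight_eq:
  assumes "\<bar>fst u\<bar> \<le> int N" "\<bar>snd u\<bar> \<le> int N"
  shows "fejer_weight N u = (real N - of_int \<bar>fst u\<bar>) * (real N - of_int \<bar>snd u\<bar>)"
proof -
  let ?I = "\<lambda>k::int. {max 0 (-k)..<min (int N) (int N - k)}"
  have "bij_betw (\<lambda>w. (w + u, w)) (?I (fst u) \<times> ?I (snd u))
      {(v, w) \<in> int_box N \<times> int_box N. v - w = u}"
    by (rule bij_betw_byWitness[where f' = snd]) (auto simp: int_box_def plus_prod_def)
  then have "fejer_weight N u = card (?I (fst u) \<times> ?I (snd u))"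
    by (simp add: fejer_weight_def bij_betw_same_card)
  moreover have "real (card (?I k)) = real N - of_int \<bar>k\<bar>" if "\<bar>k\<bar> \<le> int N" for k
    using that by (simp add: of_nat_nat)
  ultimately show ?thesis using assms by (simp add: card_cartesian_product)
qed

lemma fejer_weight_LIMSEQ: "(\<lambda>N. fejer_weight N u / (real N)\<^sup>2) \<longlonglongrightarrow> 1"
proof -
  let ?x = "of_int \<bar>fst u\<bar> :: real" and ?y = "of_int \<bar>snd u\<bar> :: real"
  let ?w = "\<lambda>N. (1 - ?x * inverse (real N)) * (1 - ?y * inverse (real N))"
  have "?w \<longlonglongrightarrow> (1 - ?x * 0) * (1 - ?y * 0)"
    by (intro tendsto_intros lim_inverse_n)
  moreover have "\<forall>\<^sub>F N in sequentially. ?w N = fejer_weight N u / (real N)\<^sup>2"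
  proof (rule eventually_sequentiallyI[of "nat (\<bar>fst u\<bar> + \<bar>snd u\<bar>) + 1"])
    fix N assume N: "nat (\<bar>fst u\<bar> + \<bar>snd u\<bar>) + 1 \<le> N"
    then show "?w N = fejer_weight N u / (real N)\<^sup>2"
      by (subst fejer_weight_eq) (auto simp: field_simps power2_eq_square)
  qed
  ultimately show ?thesis by (simp add: Lim_transform_eventually)
qed

definition trig_poly ::
    "(int \<times> int) set \<Rightarrow> (int \<times> int \<Rightarrow> real) \<Rightarrow> real \<times> real \<Rightarrow> real" where
  "trig_poly A \<alpha> \<theta> = (\<Sum>u\<in>A. \<alpha> u * cos (phase u \<theta>))"

lemma positive_definite_cos_int_box_nonneg:
  assumes "positive_definite \<psi>"
  shows "0 \<le> (\<Sum>v\<in>int_box N. \<Sum>w\<in>int_box N. cos (phase (v - w) \<theta>) * \<psi> (v - w))"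
proof -
  have psd: "psd_kernel (\<lambda>v w. \<psi> (v - w))"
    using assms by (simp add: positive_definite_def)
  have "0 \<le> (\<Sum>v\<in>int_box N. \<Sum>w\<in>int_box N. cos (phase v \<theta>) * cos (phase w \<theta>) * \<psi> (v - w)) +
      (\<Sum>v\<in>int_box N. \<Sum>w\<in>int_box N. sin (phase v \<theta>) * sin (phase w \<theta>) * \<psi> (v - w))"
    using psd_kernel_sum_nonneg[OF psd finite_int_box, where a = "\<lambda>v. cos (phase v \<theta>)" and s = "\<lambda>v. v"]
      psd_kernel_sum_nonneg[OF psd finite_int_box, where a = "\<lambda>v. sin (phase v \<theta>)" and s = "\<lambda>v. v"]
        by simp
  then show ?thesis by (simp add: phase_diff cos_diff algebra_simps sum.distrib)
qed

lemma ex_torus_grid_orthogonal: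
  fixes s :: "'i \<Rightarrow> int \<times> int"
  assumes I: "finite I"
  obtains R where "R > 0" "\<And>i v w. i \<in> I \<Longrightarrow> v \<in> int_box N \<Longrightarrow> w \<in> int_box N \<Longrightarrow>
    (\<Sum>\<theta>\<in>torus_grid R. cos (phase (s i) \<theta>) * cos (phase (v - w) \<theta>)) =
      (real R)\<^sup>2 / 2 * (of_bool (v - w = s i) + of_bool (v - w = - s i))"
proof
  define R where "R = 2 * N + 1 + nat (\<Sum>i\<in>I. \<bar>fst (s i)\<bar> + \<bar>snd (s i)\<bar>)"
  show R: "R > 0" by (simp add: R_def)
  fix i v w assume i: "i \<in> I" and vw: "v \<in> int_box N" "w \<in> int_box N"
  have "\<bar>fst (s i)\<bar> + \<bar>snd (s i)\<bar> \<le> (\<Sum>i\<in>I. \<bar>fst (s i)\<bar> + \<bar>snd (s i)\<bar>)"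
    using i I by (intro member_le_sum[of _ _ "\<lambda>i. \<bar>fst (s i)\<bar> + \<bar>snd (s i)\<bar>"]) auto
  then have "\<bar>fst (s i)\<bar> + \<bar>snd (s i)\<bar> + int N < int R" unfolding R_def by linarith
  moreover have "\<bar>fst (v - w)\<bar> \<le> int N" "\<bar>snd (v - w)\<bar> \<le> int N"
    using vw by (auto simp: int_box_def)
  ultimately show "(\<Sum>\<theta>\<in>torus_grid R. cos (phase (s i) \<theta>) * cos (phase (v - w) \<theta>)) =
      (real R)\<^sup>2 / 2 * (of_bool (v - w = s i) + of_bool (v - w = - s i))"
    by (intro sum_cos_mult_cos_torus_grid[OF R]) linarith+
qed

lemma positive_definite_fejer_sum_nonneg:
  fixes \<psi> :: "int \<times> int \<Rightarrow> real"
  assumes \<psi>: "positive_definite \<psi>" and I: "finite I"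
    and nonneg: "\<And>\<theta>. 0 \<le> (\<Sum>i\<in>I. \<alpha> i * cos (phase (s i) \<theta>))"
  shows "0 \<le> (\<Sum>i\<in>I. \<alpha> i * \<psi> (s i) * fejer_weight N (s i))"
proof -
  let ?B = "int_box N"
  obtain R where R: "R > 0" and orthogonal: "\<And>i v w. i \<in> I \<Longrightarrow> v \<in> ?B \<Longrightarrow> w \<in> ?B \<Longrightarrow>
    (\<Sum>\<theta>\<in>torus_grid R. cos (phase (s i) \<theta>) * cos (phase (v - w) \<theta>)) =
      (real R)\<^sup>2 / 2 * (of_bool (v - w = s i) + of_bool (v - w = - s i))"
    using ex_torus_grid_orthogonal[OF I] by blast
  have "0 \<le> (\<Sum>\<theta>\<in>torus_grid R. (\<Sum>i\<in>I. \<alpha> i * cos (phase (s i) \<theta>)) *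
      (\<Sum>v\<in>?B. \<Sum>w\<in>?B. cos (phase (v - w) \<theta>) * \<psi> (v - w)))"
    by (rule sum_nonneg)
      (intro mult_nonneg_nonneg nonneg positive_definite_cos_int_box_nonneg \<psi>)
  also have "\<dots> = (\<Sum>\<theta>\<in>torus_grid R. \<Sum>i\<in>I. \<Sum>v\<in>?B. \<Sum>w\<in>?B. \<alpha> i * \<psi> (v - w) *
      (cos (phase (s i) \<theta>) * cos (phase (v - w) \<theta>)))"
    unfolding sum_distrib_right unfolding sum_distrib_left
    by (intro sum.cong refl) (simp add: mult_ac)
  also have "\<dots> = (\<Sum>i\<in>I. \<Sum>v\<in>?B. \<Sum>w\<in>?B. \<alpha> i * \<psi> (v - w) *
      (\<Sum>\<theta>\<in>torus_grid R. cos (phase (s i) \<theta>) * cos (phase (v - w) \<theta>)))"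
    unfolding sum_distrib_left by (simp only: sum.swap[where A = "torus_grid R"])
  also have "\<dots> = (\<Sum>i\<in>I. \<Sum>v\<in>?B. \<Sum>w\<in>?B. (real R)\<^sup>2 / 2 * (\<alpha> i * \<psi> (s i)) *
      of_bool (v - w = s i) + (real R)\<^sup>2 / 2 * (\<alpha> i * \<psi> (s i)) * of_bool (v - w = - s i))"
  proof (intro sum.cong refl)
    fix i v w assume ivw: "i \<in> I" "v \<in> ?B" "w \<in> ?B"
    show "\<alpha> i * \<psi> (v - w) *
        (\<Sum>\<theta>\<in>torus_grid R. cos (phase (s i) \<theta>) * cos (phase (v - w) \<theta>)) =
      (real R)\<^sup>2 / 2 * (\<alpha> i * \<psi> (s i)) * of_bool (v - w = s i) +
      (real R)\<^sup>2 / 2 * (\<alpha> i * \<psi> (s i)) * of_bool (v - w = - s i)"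
      unfolding orthogonal[OF ivw] using positive_definite_minus[OF \<psi>, of "s i"]
      by (cases "v - w = s i"; cases "v - w = - s i") simp_all
  qed
  also have "\<dots> = (real R)\<^sup>2 * (\<Sum>i\<in>I. \<alpha> i * \<psi> (s i) * fejer_weight N (s i))"
    by (simp only: sum.distrib sum_int_box_diff_eq fejer_weight_minus)
      (simp add: mult.assoc flip: sum_distrib_left sum_divide_distrib)
  finally have "0 \<le> (real R)\<^sup>2 * (\<Sum>i\<in>I. \<alpha> i * \<psi> (s i) * fejer_weight N (s i))" .
  moreover have "(real R)\<^sup>2 > 0" using R by simp
  ultimately show ?thesis by (simp add: zero_le_mult_iff del: zero_less_power2)
qed

lemma positive_definite_cos_sum_nonneg:
  fixes \<psi> :: "int \<times> int \<Rightarrow> real"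
  assumes \<psi>: "positive_definite \<psi>" and I: "finite I"
    and nonneg: "\<And>\<theta>. 0 \<le> (\<Sum>i\<in>I. \<alpha> i * cos (phase (s i) \<theta>))"
  shows "0 \<le> (\<Sum>i\<in>I. \<alpha> i * \<psi> (s i))"
proof (rule LIMSEQ_le_const)
  have "(\<lambda>N. \<Sum>i\<in>I. \<alpha> i * \<psi> (s i) * (fejer_weight N (s i) / (real N)\<^sup>2))
      \<longlonglongrightarrow> (\<Sum>i\<in>I. \<alpha> i * \<psi> (s i) * 1)"
    by (intro tendsto_intros fejer_weight_LIMSEQ)
  then show "(\<lambda>N. (\<Sum>i\<in>I. \<alpha> i * \<psi> (s i) * fejer_weight N (s i)) / (real N)\<^sup>2)
      \<longlonglongrightarrow> (\<Sum>i\<in>I. \<alpha> i * \<psi> (s i))"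
    by (simp add: sum_divide_distrib)
  show "\<exists>N. \<forall>n\<ge>N. 0 \<le> (\<Sum>i\<in>I. \<alpha> i * \<psi> (s i) * fejer_weight n (s i)) / (real n)\<^sup>2"
    using positive_definite_fejer_sum_nonneg[OF \<psi> I nonneg] by simp
qed

text \<open>
  By Bochner's theorem \<open>\<psi>\<close> is the Fourier transform of a measure on the torus; the relation below
  integrates trigonometric polynomials against this measure without constructing it.
\<close>

definition has_spectral_integral ::
    "(int \<times> int \<Rightarrow> real) \<Rightarrow> (real \<times> real \<Rightarrow> real) \<Rightarrow> real \<Rightarrow> bool" where
  "has_spectral_integral \<psi> \<phi> c \<longleftrightarrow>
     (\<exists>A \<alpha>. finite A \<and> \<phi> = trig_poly A \<alpha> \<and> c = (\<Sum>u\<in>A. \<alpha> u * \<psi> u))"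

lemma has_spectral_integralE:
  assumes "has_spectral_integral \<psi> \<phi> c"
  obtains A \<alpha> where "finite A" "\<phi> = trig_poly A \<alpha>" "c = (\<Sum>u\<in>A. \<alpha> u * \<psi> u)"
  using assms by (auto simp: has_spectral_integral_def)

lemma has_spectral_integral_trig_poly:
  "finite A \<Longrightarrow> has_spectral_integral \<psi> (trig_poly A \<alpha>) (\<Sum>u\<in>A. \<alpha> u * \<psi> u)"
  by (auto simp: has_spectral_integral_def)

lemma has_spectral_integral_cos:
  "has_spectral_integral \<psi> (\<lambda>\<theta>. k * cos (phase u \<theta>)) (k * \<psi> u)"
  unfolding has_spectral_integral_def trig_poly_def
  by (intro exI[of _ "{u}"] exI[of _ "\<lambda>_. k"]) auto

lemma has_spectral_integral_const: "has_spectral_integral \<psi> (\<lambda>\<theta>. k) (k * \<psi> 0)"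
  using has_spectral_integral_cos[of \<psi> k 0] by simp

lemma has_spectral_integral_add:
  assumes "has_spectral_integral \<psi> \<phi> c" "has_spectral_integral \<psi> \<phi>' c'"
  shows "has_spectral_integral \<psi> (\<lambda>\<theta>. \<phi> \<theta> + \<phi>' \<theta>) (c + c')"
proof -
  obtain A \<alpha> where A: "finite A" "\<phi> = trig_poly A \<alpha>" "c = (\<Sum>u\<in>A. \<alpha> u * \<psi> u)"
    using assms(1) by (rule has_spectral_integralE)
  obtain B \<beta> where B: "finite B" "\<phi>' = trig_poly B \<beta>" "c' = (\<Sum>u\<in>B. \<beta> u * \<psi> u)"
    using assms(2) by (rule has_spectral_integralE)
  define \<gamma> where "\<gamma> u = (if u \<in> A then \<alpha> u else 0) + (if u \<in> B then \<beta> u else 0)" for u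
  have "(\<Sum>u\<in>A \<union> B. \<gamma> u * h u) = (\<Sum>u\<in>A. \<alpha> u * h u) + (\<Sum>u\<in>B. \<beta> u * h u)" for h
  proof -
    have "(\<Sum>u\<in>A \<union> B. \<gamma> u * h u) =
        (\<Sum>u\<in>A \<union> B. if u \<in> A then \<alpha> u * h u else 0) + (\<Sum>u\<in>A \<union> B. if u \<in> B then \<beta> u * h u else 0)"
      unfolding sum.distrib[symmetric] by (intro sum.cong refl) (auto simp: \<gamma>_def algebra_simps)
    also have "\<dots> = (\<Sum>u\<in>A. \<alpha> u * h u) + (\<Sum>u\<in>B. \<beta> u * h u)"
      using A(1) B(1) by (simp add: sum.inter_restrict[symmetric] Int_absorb1)
    finally show ?thesis .
  qed
  then show ?thesis unfolding has_spectral_integral_def trig_poly_def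
    by (intro exI[of _ "A \<union> B"] exI[of _ \<gamma>]) (use A B in \<open>simp add: trig_poly_def fun_eq_iff\<close>)
qed

lemma has_spectral_integral_cmult:
  assumes "has_spectral_integral \<psi> \<phi> c"
  shows "has_spectral_integral \<psi> (\<lambda>\<theta>. k * \<phi> \<theta>) (k * c)"
proof -
  obtain A \<alpha> where A: "finite A" "\<phi> = trig_poly A \<alpha>" "c = (\<Sum>u\<in>A. \<alpha> u * \<psi> u)"
    using assms by (rule has_spectral_integralE)
  show ?thesis unfolding has_spectral_integral_def
    by (intro exI[of _ A] exI[of _ "\<lambda>u. k * \<alpha> u"])
      (use A in \<open>simp add: trig_poly_def sum_distrib_left mult_ac fun_eq_iff\<close>)
qed

lemma has_spectral_integral_mono:
  assumes \<psi>: "positive_definite \<psi>"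
    and \<phi>: "has_spectral_integral \<psi> \<phi> c" "has_spectral_integral \<psi> \<phi>' c'"
    and le: "\<And>\<theta>. \<phi> \<theta> \<le> \<phi>' \<theta>"
  shows "c \<le> c'"
proof -
  have "has_spectral_integral \<psi> (\<lambda>\<theta>. \<phi>' \<theta> + (-1) * \<phi> \<theta>) (c' + (-1) * c)"
    by (intro has_spectral_integral_add has_spectral_integral_cmult \<phi>)
  then obtain A \<alpha> where A: "finite A" "(\<lambda>\<theta>. \<phi>' \<theta> + (-1) * \<phi> \<theta>) = trig_poly A \<alpha>"
    "c' + (-1) * c = (\<Sum>u\<in>A. \<alpha> u * \<psi> u)" by (rule has_spectral_integralE)
  have "0 \<le> (\<Sum>u\<in>A. \<alpha> u * cos (phase u \<theta>))" for \<theta>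
    using le[of \<theta>] fun_cong[OF A(2), of \<theta>] by (simp add: trig_poly_def)
  then have "0 \<le> c' + (-1) * c"
    unfolding A(3) by (rule positive_definite_cos_sum_nonneg[OF \<psi> A(1)])
  then show ?thesis by simp
qed

lemma has_spectral_integral_sum_ex:
  assumes "finite I" "\<And>i. i \<in> I \<Longrightarrow> \<exists>c. has_spectral_integral \<psi> (\<phi> i) c"
  shows "\<exists>c. has_spectral_integral \<psi> (\<lambda>\<theta>. \<Sum>i\<in>I. \<phi> i \<theta>) c"
  using assms
proof (induction I rule: finite_induct)
  case empty
  show ?case using has_spectral_integral_const[of \<psi> 0] by auto
next
  case (insert i I)
  then show ?case
    using has_spectral_integral_add[of \<psi> "\<phi> i" _ "\<lambda>\<theta>. \<Sum>i\<in>I. \<phi> i \<theta>"] by fastforce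
qed

lemma has_spectral_integral_mult_ex:
  assumes "\<exists>c. has_spectral_integral \<psi> \<phi> c" "\<exists>c. has_spectral_integral \<psi> \<phi>' c"
  shows "\<exists>c. has_spectral_integral \<psi> (\<lambda>\<theta>. \<phi> \<theta> * \<phi>' \<theta>) c"
proof -
  obtain A \<alpha> where A: "finite A" "\<phi> = trig_poly A \<alpha>"
    using assms(1) by (elim exE has_spectral_integralE)
  obtain B \<beta> where B: "finite B" "\<phi>' = trig_poly B \<beta>"
    using assms(2) by (elim exE has_spectral_integralE)
  let ?\<phi> = "\<lambda>u v \<theta>. \<alpha> u * \<beta> v / 2 * cos (phase (u - v) \<theta>) +
      \<alpha> u * \<beta> v / 2 * cos (phase (u + v) \<theta>)"
  have "\<exists>c. has_spectral_integral \<psi> (\<lambda>\<theta>. \<Sum>u\<in>A. \<Sum>v\<in>B. ?\<phi> u v \<theta>) c"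
    by (intro has_spectral_integral_sum_ex A(1) B(1))
      (use has_spectral_integral_add[OF has_spectral_integral_cos has_spectral_integral_cos]
        in blast)
  moreover have "\<phi> \<theta> * \<phi>' \<theta> = (\<Sum>u\<in>A. \<Sum>v\<in>B. ?\<phi> u v \<theta>)" for \<theta>
    unfolding A(2) B(2) trig_poly_def sum_product
    by (intro sum.cong refl) (simp add: phase_add phase_diff cos_add cos_diff algebra_simps)
  ultimately show ?thesis by simp
qed

lemma has_spectral_integral_polynomial_ex:
  assumes "real_polynomial_function p"
  shows "\<exists>c. has_spectral_integral \<psi> (\<lambda>\<theta>. p (cos (2 * pi * fst \<theta>), cos (2 * pi * snd \<theta>))) c"
  using assms
proof (induction rule: real_polynomial_function.induct)
  case (linear f)
  interpret bounded_linear f by (rule linear)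
  have linear_form: "f (x, y) = f (1, 0) * x + f (0, 1) * y" for x y
  proof -
    have "f (x, y) = f (x *\<^sub>R (1, 0) + y *\<^sub>R (0, 1))" by simp
    also have "\<dots> = f (1, 0) * x + f (0, 1) * y"
      by (simp only: add scaleR) (simp only: real_scaleR_def mult.commute)
    finally show ?thesis .
  qed
  have "f (cos (2 * pi * fst \<theta>), cos (2 * pi * snd \<theta>)) =
      f (1, 0) * cos (phase (1, 0) \<theta>) + f (0, 1) * cos (phase (0, 1) \<theta>)" for \<theta>
    by (subst linear_form) (simp add: phase_def)
  then show ?case
    by (simp only:)
      (rule exI, rule has_spectral_integral_add[OF has_spectral_integral_cos
          has_spectral_integral_cos])
next
  case (const c)
  show ?case using has_spectral_integral_const by blast
next
  case (add f g)
  then show ?case using has_spectral_integral_add by blast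
next
  case (mult f g)
  then show ?case using has_spectral_integral_mult_ex by blast
qed

section \<open>Relative property (T)\<close>

text \<open>
  The kernel \<open>\<kappa>\<close> is the Gram matrix of two copies of the orbit of a unit vector, the second one
  moved by an operator implementing \<open>g\<close>; the last condition says that this operator almost fixes
  the vector.
\<close>

definition almost_invariant ::
    "real \<Rightarrow> (int \<times> int \<Rightarrow> real) \<Rightarrow> (int \<times> int \<Rightarrow> int \<times> int) \<Rightarrow> bool" where
  "almost_invariant \<delta> \<psi> g \<longleftrightarrow>
     (\<exists>\<kappa> :: bool \<times> int \<times> int \<Rightarrow> bool \<times> int \<times> int \<Rightarrow> real. psd_kernel \<kappa> \<and>
     (\<forall>v w. \<kappa> (False, v) (False, w) = \<psi> (v - w)) \<and>
     (\<forall>v w. \<kappa> (True, v) (True, w) = \<psi> (g (v - w))) \<and>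
     (\<forall>v w. \<kappa> (True, v) (False, w) = \<kappa> (True, 0) (False, w - v)) \<and>
     1 - \<delta> \<le> \<kappa> (True, 0) (False, 0))"

lemma almost_invariant_positive_definite:
  assumes "almost_invariant \<delta> \<psi> g"
  shows "positive_definite \<psi>" "positive_definite (\<lambda>u. \<psi> (g u))"
proof -
  obtain \<kappa> where \<kappa>: "psd_kernel \<kappa>" "\<And>v w. \<kappa> (False, v) (False, w) = \<psi> (v - w)"
    "\<And>v w. \<kappa> (True, v) (True, w) = \<psi> (g (v - w))"
    using assms unfolding almost_invariant_def by metis
  show "positive_definite \<psi>" "positive_definite (\<lambda>u. \<psi> (g u))"
    using psd_kernel_comp[OF \<kappa>(1), of "Pair False"] psd_kernel_comp[OF \<kappa>(1), of "Pair True"]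
    by (simp_all add: positive_definite_def \<kappa>(2,3))
qed

lemma positive_definite_norm_le:
  fixes \<psi> :: "int \<times> int \<Rightarrow> real"
  assumes \<psi>: "positive_definite \<psi>" and I: "finite I" and "\<psi> 0 = 1"
    and cos_le: "\<And>\<theta>. \<bar>\<Sum>i\<in>I. \<alpha> i * cos (phase (s i) \<theta>)\<bar> \<le> B"
    and sin_0: "\<And>\<theta>. (\<Sum>i\<in>I. \<alpha> i * sin (phase (s i) \<theta>)) = 0"
  shows "(\<Sum>i\<in>I. \<Sum>j\<in>I. \<alpha> i * \<alpha> j * \<psi> (s i - s j)) \<le> B\<^sup>2"
proof -
  let ?J = "insert None (Some ` (I \<times> I))"
  let ?\<beta> = "case_option (B\<^sup>2) (\<lambda>(i, j). - (\<alpha> i * \<alpha> j))"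
  let ?r = "case_option 0 (\<lambda>(i, j). s i - s j)"
  have expand: "(\<Sum>z\<in>?J. ?\<beta> z * h (?r z)) =
      B\<^sup>2 * h 0 - (\<Sum>i\<in>I. \<Sum>j\<in>I. \<alpha> i * \<alpha> j * h (s i - s j))" for h :: "int \<times> int \<Rightarrow> real"
    using I
    by (subst sum.insert)
      (auto simp: sum.reindex sum.cartesian_product case_prod_unfold sum_negf)
  have "0 \<le> (\<Sum>z\<in>?J. ?\<beta> z * \<psi> (?r z))"
  proof (rule positive_definite_cos_sum_nonneg[OF \<psi>])
    fix \<theta>
    have "(\<Sum>i\<in>I. \<Sum>j\<in>I. \<alpha> i * \<alpha> j * cos (phase (s i - s j) \<theta>)) =
        (\<Sum>i\<in>I. \<alpha> i * cos (phase (s i) \<theta>))\<^sup>2 + (\<Sum>i\<in>I. \<alpha> i * sin (phase (s i) \<theta>))\<^sup>2"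
      unfolding power2_eq_square sum_product sum.distrib[symmetric]
      by (intro sum.cong refl) (simp add: phase_diff cos_diff algebra_simps)
    also have "\<dots> \<le> B\<^sup>2" using power_mono[OF cos_le, of \<theta> 2] by (simp add: sin_0)
    finally show "0 \<le> (\<Sum>z\<in>?J. ?\<beta> z * cos (phase (?r z) \<theta>))"
      by (subst expand[of "\<lambda>u. cos (phase u \<theta>)"]) simp
  qed (use I in simp)
  then show ?thesis using expand[of \<psi>] \<open>\<psi> 0 = 1\<close> by simp
qed

lemma almost_invariant_kernel_diff_le:
  assumes \<kappa>: "psd_kernel \<kappa>" "\<kappa> y y = 1" "\<kappa> z z = 1" "1 - \<delta> \<le> \<kappa> y z" and "finite I"
    and norm_le: "(\<Sum>i\<in>I. \<Sum>j\<in>I. a i * a j * \<kappa> (x i) (x j)) \<le> B\<^sup>2" and "0 \<le> B"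
  shows "\<bar>\<Sum>i\<in>I. a i * (\<kappa> (x i) y - \<kappa> (x i) z)\<bar> \<le> B * sqrt (2 * \<delta>)"
proof -
  have dist_nonneg: "0 \<le> \<kappa> y y + \<kappa> z z - 2 * \<kappa> y z"
    using psd_kernel_sum_nonneg[OF \<kappa>(1), of "{True, False}" "\<lambda>u. if u then 1 else -1"
        "\<lambda>u. if u then y else z"]
    by (simp add: psd_kernel_sym[OF \<kappa>(1), of z y])
  have "(\<Sum>i\<in>I. a i * (\<kappa> (x i) y - \<kappa> (x i) z))\<^sup>2 \<le> B\<^sup>2 * (\<kappa> y y + \<kappa> z z - 2 * \<kappa> y z)"
    using psd_kernel_sum_diff_le[OF \<kappa>(1) \<open>finite I\<close>, of a x y z]
      mult_right_mono[OF norm_le dist_nonneg] by linarith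
  also have "\<dots> \<le> B\<^sup>2 * (2 * \<delta>)" using \<kappa> by (intro mult_left_mono) auto
  also have "\<dots> = (B * sqrt (2 * \<delta>))\<^sup>2" using \<kappa> dist_nonneg by (simp add: power_mult_distrib)
  finally have "\<bar>\<Sum>i\<in>I. a i * (\<kappa> (x i) y - \<kappa> (x i) z)\<bar>\<^sup>2 \<le> (B * sqrt (2 * \<delta>))\<^sup>2"
    by (simp only: power2_abs)
  then show ?thesis
    by (rule power2_le_imp_le) (use \<open>0 \<le> B\<close> \<kappa> dist_nonneg in simp)
qed

lemma almost_invariant_spectral_integral:
  fixes \<psi> :: "int \<times> int \<Rightarrow> real"
  assumes inv: "almost_invariant \<delta> \<psi> g" and g_diff: "\<And>v w. g (v - w) = g v - g w"
    and \<psi>0: "\<psi> 0 = 1" and A: "finite A" and bound: "\<And>\<theta>. \<bar>trig_poly A \<alpha> \<theta>\<bar> \<le> B"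
  shows "\<bar>(\<Sum>u\<in>A. \<alpha> u * \<psi> (g u)) - (\<Sum>u\<in>A. \<alpha> u * \<psi> u)\<bar> \<le> 2 * B * sqrt (2 * \<delta>)"
proof -
  obtain \<kappa> where \<kappa>: "psd_kernel \<kappa>"
    and FF: "\<And>v w. \<kappa> (False, v) (False, w) = \<psi> (v - w)"
    and TT: "\<And>v w. \<kappa> (True, v) (True, w) = \<psi> (g (v - w))"
    and TF: "\<And>v w. \<kappa> (True, v) (False, w) = \<kappa> (True, 0) (False, w - v)"
    and close: "1 - \<delta> \<le> \<kappa> (True, 0) (False, 0)"
    using inv unfolding almost_invariant_def by metis
  note pd = almost_invariant_positive_definite[OF inv]
  have B: "B \<ge> 0" using bound[of 0] by linarith
  have \<psi>g0: "\<psi> (g 0) = 1" using g_diff[of 0 0] \<psi>0 by simp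
  \<comment> \<open>Symmetrising the frequencies makes the trigonometric sum real, so its square is the kernel norm.\<close>
  define I where "I = A \<times> {True, False}"
  define s where "s i = (if snd i then fst i else - fst i)" for i :: "(int \<times> int) \<times> bool"
  define a where "a i = \<alpha> (fst i) / 2" for i :: "(int \<times> int) \<times> bool"
  have I: "finite I" using A by (simp add: I_def)
  have sum_I: "(\<Sum>i\<in>I. h i) = (\<Sum>u\<in>A. h (u, True) + h (u, False))" for h :: "_ \<Rightarrow> real"
    by (simp add: I_def sum.cartesian_product')
  have "(\<Sum>i\<in>I. a i * cos (phase (s i) \<theta>)) = trig_poly A \<alpha> \<theta>" for \<theta>
    by (simp add: sum_I a_def s_def phase_minus trig_poly_def field_simps)
  moreover have "(\<Sum>i\<in>I. a i * sin (phase (s i) \<theta>)) = 0" for \<theta>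
    by (simp add: sum_I a_def s_def phase_minus)
  ultimately have "(\<Sum>i\<in>I. \<Sum>j\<in>I. a i * a j * \<psi> (s i - s j)) \<le> B\<^sup>2"
    "(\<Sum>i\<in>I. \<Sum>j\<in>I. a i * a j * \<psi> (g (s i - s j))) \<le> B\<^sup>2"
    using positive_definite_norm_le[OF pd(1) I \<psi>0] positive_definite_norm_le[OF pd(2) I \<psi>g0]
      bound by simp_all
  then have "(\<Sum>i\<in>I. \<Sum>j\<in>I. a i * a j * \<kappa> (b, s i) (b, s j)) \<le> B\<^sup>2" for b
    by (cases b) (simp_all add: FF TT)
  then have diff_le: "\<bar>\<Sum>i\<in>I. a i * (\<kappa> (b, s i) (True, 0) - \<kappa> (b, s i) (False, 0))\<bar>
      \<le> B * sqrt (2 * \<delta>)" for b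
    by (intro almost_invariant_kernel_diff_le[OF \<kappa>] close I B) (simp_all add: FF TT \<psi>0 \<psi>g0)
  have "(\<Sum>i\<in>I. a i * \<kappa> (True, s i) (True, 0)) = (\<Sum>u\<in>A. \<alpha> u * \<psi> (g u))"
    using positive_definite_minus[OF pd(2)] by (simp add: sum_I a_def s_def TT field_simps)
  moreover have "(\<Sum>i\<in>I. a i * \<kappa> (False, s i) (False, 0)) = (\<Sum>u\<in>A. \<alpha> u * \<psi> u)"
    using positive_definite_minus[OF pd(1)] by (simp add: sum_I a_def s_def FF field_simps)
  moreover have "(\<Sum>i\<in>I. a i * \<kappa> (True, s i) (False, 0)) = (\<Sum>i\<in>I. a i * \<kappa> (False, s i) (True, 0))"
  proof -
    have flip: "\<kappa> (True, u) (False, 0) = \<kappa> (False, - u) (True, 0)" for u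
      using TF[of u 0] psd_kernel_sym[OF \<kappa>, of "(True, 0)" "(False, - u)"] by simp
    then show ?thesis by (simp add: sum_I a_def s_def algebra_simps)
  qed
  ultimately show ?thesis using diff_le[of True] diff_le[of False]
    by (simp add: right_diff_distrib sum_subtractf)
qed

definition lower_shear :: "int \<Rightarrow> int \<times> int \<Rightarrow> int \<times> int" where
  "lower_shear c u = (fst u, snd u + c * fst u)"

definition upper_shear :: "int \<Rightarrow> int \<times> int \<Rightarrow> int \<times> int" where
  "upper_shear c u = (fst u + c * snd u, snd u)"

lemma phase_lower_shear: "phase (lower_shear c u) \<theta> = phase u (fst \<theta> + of_int c * snd \<theta>, snd \<theta>)"
  and phase_upper_shear: "phase (upper_shear c u) \<theta> = phase u (fst \<theta>, snd \<theta> + of_int c * fst \<theta>)"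
  by (simp_all add: phase_def lower_shear_def upper_shear_def algebra_simps)

lemma lower_shear_diff: "lower_shear c (v - w) = lower_shear c v - lower_shear c w"
  and upper_shear_diff: "upper_shear c (v - w) = upper_shear c v - upper_shear c w"
  by (auto simp: lower_shear_def upper_shear_def prod_eq_iff algebra_simps)

lemma inj_lower_shear: "inj (lower_shear c)" and inj_upper_shear: "inj (upper_shear c)"
  by (auto simp: inj_def lower_shear_def upper_shear_def prod_eq_iff)

lemma almost_invariant_spectral_integral_ge:
  assumes "almost_invariant \<delta> \<psi> g" "inj g" "\<And>v w. g (v - w) = g v - g w" "\<psi> 0 = 1"
    and A: "finite A" "\<And>\<theta>. \<bar>trig_poly A \<alpha> \<theta>\<bar> \<le> B"
    and dual: "\<And>u \<theta>. phase (g u) \<theta> = phase u (g' \<theta>)"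
  obtains c where "has_spectral_integral \<psi> (\<lambda>\<theta>. trig_poly A \<alpha> (g' \<theta>)) c"
    "(\<Sum>u\<in>A. \<alpha> u * \<psi> u) - 2 * B * sqrt (2 * \<delta>) \<le> c"
proof
  show "has_spectral_integral \<psi> (\<lambda>\<theta>. trig_poly A \<alpha> (g' \<theta>)) (\<Sum>u\<in>A. \<alpha> u * \<psi> (g u))"
    unfolding has_spectral_integral_def using \<open>inj g\<close> A(1)
    by (intro exI[of _ "g ` A"] exI[of _ "\<lambda>u. \<alpha> (inv_into UNIV g u)"])
      (auto simp: trig_poly_def dual[symmetric] fun_eq_iff sum.reindex
        inj_on_subset[OF _ subset_UNIV])
  show "(\<Sum>u\<in>A. \<alpha> u * \<psi> u) - 2 * B * sqrt (2 * \<delta>) \<le> (\<Sum>u\<in>A. \<alpha> u * \<psi> (g u))"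
    using almost_invariant_spectral_integral[OF assms(1,3,4) A] by linarith
qed

definition circle_norm :: "real \<Rightarrow> real" where
  "circle_norm x = arccos (cos (2 * pi * x)) / (2 * pi)"

lemma circle_norm_eq_abs:
  assumes "\<bar>x\<bar> \<le> 1 / 2"
  shows "circle_norm x = \<bar>x\<bar>"
proof -
  have "cos (2 * pi * x) = cos (2 * pi * \<bar>x\<bar>)" by (cases "x \<ge> 0") auto
  moreover have "2 * pi * \<bar>x\<bar> \<le> pi" using assms by (simp add: mult_left_le)
  ultimately show ?thesis by (simp add: circle_norm_def arccos_cos)
qed

lemma cos_2pi_diff_int: "cos (2 * pi * (x - of_int n)) = cos (2 * pi * x)"
  by (simp only: right_diff_distrib cos_diff cos_int_2pin sin_int_2pin mult_1_right
      mult_zero_right add_0_right)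

lemma circle_norm_diff_int: "circle_norm (x - of_int n) = circle_norm x"
  by (simp add: circle_norm_def cos_2pi_diff_int)

lemma circle_representative:
  obtains n :: int where "\<bar>x - of_int n\<bar> \<le> 1 / 2" "circle_norm x = \<bar>x - of_int n\<bar>"
    "cos (2 * pi * x) = cos (2 * pi * (x - of_int n))"
proof
  show "\<bar>x - of_int (round x)\<bar> \<le> 1 / 2"
    using of_int_round_abs_le[of x] by (simp add: abs_minus_commute)
  then show "circle_norm x = \<bar>x - of_int (round x)\<bar>"
    using circle_norm_eq_abs[of "x - of_int (round x)"] by (simp add: circle_norm_diff_int)
qed (simp add: cos_2pi_diff_int)

definition cone_cutoff :: "real \<Rightarrow> real \<Rightarrow> real \<Rightarrow> real" where
  "cone_cutoff r a b = max 0 (min 1 ((2 * b - a) / r))"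

lemma cone_cutoff_nonneg: "0 \<le> cone_cutoff r a b"
  and cone_cutoff_le_1: "cone_cutoff r a b \<le> 1"
  by (auto simp: cone_cutoff_def)

lemma cone_cutoff_approx_bound: "\<bar>cone_cutoff r a b - x\<bar> < e \<Longrightarrow> e \<le> 1 \<Longrightarrow> \<bar>x\<bar> \<le> 2"
  using cone_cutoff_nonneg[of r a b] cone_cutoff_le_1[of r a b] by linarith

lemma cone_cutoff_add_ge_1:
  assumes "r > 0" "r \<le> a \<or> r \<le> b"
  shows "1 \<le> cone_cutoff r a b + cone_cutoff r b a"
proof -
  have one: "1 \<le> cone_cutoff r a b" if "a \<le> b" "r \<le> b" for a b
    using that assms(1) by (simp add: cone_cutoff_def field_simps)
  show ?thesis
    using assms(2) one[of a b] one[of b a] cone_cutoff_nonneg[of r a b] cone_cutoff_nonneg[of r b a]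
    by linarith
qed

lemma cone_cutoff_shears_le:
  fixes x y r :: real
  assumes "r > 0"
  shows "cone_cutoff r \<bar>x + 4 * y\<bar> \<bar>y\<bar> + cone_cutoff r \<bar>x - 4 * y\<bar> \<bar>y\<bar> \<le> cone_cutoff r \<bar>y\<bar> \<bar>x\<bar>"
proof -
  have mono: "cone_cutoff r a b \<le> cone_cutoff r a' b'" if "2 * b - a \<le> 2 * b' - a'" for a b a' b'
    unfolding cone_cutoff_def
    by (intro max.mono min.mono order_refl divide_right_mono that) (use assms in simp)
  have zero: "cone_cutoff r a b = 0" if "2 * b - a \<le> 0" for a b
    using divide_nonpos_pos[OF that assms] by (simp add: cone_cutoff_def)
  consider "2 * \<bar>y\<bar> - \<bar>x + 4 * y\<bar> \<le> 0" "2 * \<bar>y\<bar> - \<bar>x - 4 * y\<bar> \<le> 0"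
    | "2 * \<bar>y\<bar> - \<bar>x + 4 * y\<bar> \<le> 0" "2 * \<bar>y\<bar> - \<bar>x - 4 * y\<bar> \<le> 2 * \<bar>x\<bar> - \<bar>y\<bar>"
    | "2 * \<bar>y\<bar> - \<bar>x - 4 * y\<bar> \<le> 0" "2 * \<bar>y\<bar> - \<bar>x + 4 * y\<bar> \<le> 2 * \<bar>x\<bar> - \<bar>y\<bar>"
    by linarith
  then show ?thesis
    using cone_cutoff_nonneg[of r "\<bar>y\<bar>" "\<bar>x\<bar>"] by cases (use zero mono in fastforce)+
qed

definition far_weight :: real where
  "far_weight = 2 / (1 - cos (pi / 5))"

lemma far_weight_pos: "far_weight > 0"
  using cos_monotone_0_pi[of 0 "pi / 5"] by (simp add: far_weight_def)

lemma far_weight_ge_2: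
  assumes "\<bar>x\<bar> \<le> 1 / 2" "\<bar>y\<bar> \<le> 1 / 2" "1 / 10 < \<bar>x\<bar> \<or> 1 / 10 < \<bar>y\<bar>"
  shows "2 \<le> far_weight * (2 - cos (2 * pi * x) - cos (2 * pi * y))"
proof -
  have far: "cos (2 * pi * t) \<le> cos (pi / 5)" if "\<bar>t\<bar> \<le> 1 / 2" "1 / 10 < \<bar>t\<bar>" for t
  proof -
    have "cos (2 * pi * t) = cos (2 * pi * \<bar>t\<bar>)" by (cases "t \<ge> 0") auto
    also have "\<dots> \<le> cos (pi / 5)"
      using that by (intro cos_monotone_0_pi_le) (auto simp: field_simps)
    finally show ?thesis .
  qed
  have "cos (2 * pi * x) \<le> cos (pi / 5) \<or> cos (2 * pi * y) \<le> cos (pi / 5)"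
    using assms far by blast
  then have "1 - cos (pi / 5) \<le> 2 - cos (2 * pi * x) - cos (2 * pi * y)"
    using cos_le_one[of "2 * pi * x"] cos_le_one[of "2 * pi * y"] by linarith
  then show ?thesis
    using cos_monotone_0_pi[of 0 "pi / 5"] by (simp add: far_weight_def field_simps)
qed

text \<open>
  Near 0 the shears by 4 move two essentially disjoint cones into one; away from 0 the error term
  dominates.
\<close>

lemma cone_cutoff_circle_shears_le:
  fixes x y r :: real
  assumes r: "r > 0"
  shows "cone_cutoff r (circle_norm (x + 4 * y)) (circle_norm y) +
      cone_cutoff r (circle_norm (x - 4 * y)) (circle_norm y) \<le>
    cone_cutoff r (circle_norm y) (circle_norm x) +
      far_weight * (2 - cos (2 * pi * x) - cos (2 * pi * y))"
proof -
  obtain m where m: "\<bar>x - of_int m\<bar> \<le> 1 / 2" "circle_norm x = \<bar>x - of_int m\<bar>"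
    "cos (2 * pi * x) = cos (2 * pi * (x - of_int m))" by (rule circle_representative)
  obtain n where n: "\<bar>y - of_int n\<bar> \<le> 1 / 2" "circle_norm y = \<bar>y - of_int n\<bar>"
    "cos (2 * pi * y) = cos (2 * pi * (y - of_int n))" by (rule circle_representative)
  define x' y' where "x' = x - of_int m" and "y' = y - of_int n"
  have shift: "circle_norm (x + 4 * y) = circle_norm (x' + 4 * y')"
    "circle_norm (x - 4 * y) = circle_norm (x' - 4 * y')"
    using circle_norm_diff_int[of "x + 4 * y" "m + 4 * n"]
      circle_norm_diff_int[of "x - 4 * y" "m - 4 * n"]
    by (simp_all add: x'_def y'_def algebra_simps)
  note reduce = shift m(2,3)[folded x'_def] n(2,3)[folded y'_def]
  show ?thesis
  proof (cases "\<bar>x'\<bar> \<le> 1 / 10 \<and> \<bar>y'\<bar> \<le> 1 / 10")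
    case True
    then have "circle_norm (x' + 4 * y') = \<bar>x' + 4 * y'\<bar>"
      "circle_norm (x' - 4 * y') = \<bar>x' - 4 * y'\<bar>"
      by (intro circle_norm_eq_abs; linarith)+
    moreover have "0 \<le> far_weight * (2 - cos (2 * pi * x') - cos (2 * pi * y'))"
      using far_weight_pos cos_le_one[of "2 * pi * x'"] cos_le_one[of "2 * pi * y'"]
      by (intro mult_nonneg_nonneg) linarith+
    ultimately show ?thesis
      using cone_cutoff_shears_le[OF r, of x' y'] unfolding reduce by simp
  next
    case False
    then have "2 \<le> far_weight * (2 - cos (2 * pi * x') - cos (2 * pi * y'))"
      using m(1) n(1) by (intro far_weight_ge_2) (auto simp: x'_def y'_def)
    then show ?thesis unfolding reduce
      using cone_cutoff_le_1[of r "circle_norm (x' + 4 * y')" "\<bar>y'\<bar>"]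
        cone_cutoff_le_1[of r "circle_norm (x' - 4 * y')" "\<bar>y'\<bar>"]
        cone_cutoff_nonneg[of r "\<bar>y'\<bar>" "\<bar>x'\<bar>"] by linarith
  qed
qed

lemma cone_cutoff_trig_approx:
  assumes "r > 0" "e > 0"
  obtains A \<alpha> where "finite A"
    "\<And>\<theta>. \<bar>cone_cutoff r (circle_norm (fst \<theta>)) (circle_norm (snd \<theta>)) - trig_poly A \<alpha> \<theta>\<bar> < e"
proof -
  let ?S = "{-1..1} \<times> {-1..1} :: (real \<times> real) set"
  let ?f = "\<lambda>z. cone_cutoff r (arccos (fst z) / (2 * pi)) (arccos (snd z) / (2 * pi))"
  have "continuous_on ?S (\<lambda>z. arccos (fst z))" "continuous_on ?S (\<lambda>z. arccos (snd z))"
    by (rule continuous_on_compose2[OF continuous_on_arccos'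
          continuous_on_fst[OF continuous_on_id]]; auto)
      (rule continuous_on_compose2[OF continuous_on_arccos'
          continuous_on_snd[OF continuous_on_id]]; auto)
  then have "continuous_on ?S ?f"
    unfolding cone_cutoff_def divide_inverse
    by (intro continuous_on_max continuous_on_min continuous_on_const continuous_on_mult
        continuous_on_diff)
  with compact_Times[OF compact_Icc compact_Icc] show ?thesis
  proof (rule Stone_Weierstrass_real_polynomial_function[OF _ _ assms(2)])
    fix p assume p: "real_polynomial_function p" "\<And>z. z \<in> ?S \<Longrightarrow> \<bar>?f z - p z\<bar> < e"
    let ?z = "\<lambda>\<theta>. (cos (2 * pi * fst \<theta>), cos (2 * pi * snd \<theta>))"
    obtain A \<alpha> where A: "finite A" "(\<lambda>\<theta>. p (?z \<theta>)) = trig_poly A \<alpha>"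
      using has_spectral_integral_polynomial_ex[OF p(1), of "\<lambda>_. 0"]
      by (elim exE has_spectral_integralE)
    have "\<bar>?f (?z \<theta>) - p (?z \<theta>)\<bar> < e" for \<theta> by (rule p(2)) simp
    then show ?thesis
      by (intro that[OF A(1), of \<alpha>]) (simp add: circle_norm_def flip: A(2))
  qed
qed

lemma one_minus_cos_le_abs: "1 - cos w \<le> \<bar>w :: real\<bar>"
proof -
  have "1 - cos w = 2 * (sin (w / 2))\<^sup>2" using cos_double_sin[of "w / 2"] by simp
  also have "\<dots> \<le> 2 * \<bar>sin (w / 2)\<bar>"
    using mult_left_le[OF abs_sin_le_one[of "w / 2"] abs_ge_zero[of "sin (w / 2)"]]
    by (simp add: power2_eq_square)
  also have "\<dots> \<le> \<bar>w\<bar>" using abs_sin_x_le_abs_x[of "w / 2"] by simp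
  finally show ?thesis .
qed

lemma one_minus_cos_phase_le:
  assumes m: "\<bar>fst \<theta> - of_int m\<bar> \<le> r" and n: "\<bar>snd \<theta> - of_int n\<bar> \<le> r"
  shows "1 - cos (phase v \<theta>) \<le> 2 * pi * (\<bar>of_int (fst v)\<bar> + \<bar>of_int (snd v)\<bar>) * r"
proof -
  define z where "z = of_int (fst v) * (fst \<theta> - of_int m) + of_int (snd v) * (snd \<theta> - of_int n)"
  have "phase v \<theta> = 2 * pi * z + 2 * pi * of_int (fst v * m + snd v * n)"
    by (simp add: phase_def z_def algebra_simps)
  then have "cos (phase v \<theta>) = cos (2 * pi * z)"
    by (simp add: cos_add cos_int_2pin sin_int_2pin del: of_int_add of_int_mult)
  then have "1 - cos (phase v \<theta>) \<le> \<bar>2 * pi * z\<bar>" using one_minus_cos_le_abs by simp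
  also have "\<bar>z\<bar> \<le> \<bar>of_int (fst v)\<bar> * r + \<bar>of_int (snd v)\<bar> * r"
    unfolding z_def using m n
    by (intro order_trans[OF abs_triangle_ineq] add_mono)
      (auto simp: abs_mult intro: mult_left_mono)
  then have "\<bar>2 * pi * z\<bar> \<le> 2 * pi * (\<bar>of_int (fst v)\<bar> * r + \<bar>of_int (snd v)\<bar> * r)"
    by (simp add: abs_mult)
  finally show ?thesis by (simp add: algebra_simps)
qed

lemma one_minus_cos_phase_le_cones:
  assumes r: "r > 0" and small: "2 * pi * (\<bar>of_int (fst v)\<bar> + \<bar>of_int (snd v)\<bar>) * r \<le> \<epsilon>"
  shows "1 - cos (phase v \<theta>) \<le> \<epsilon> +
    2 * cone_cutoff r (circle_norm (fst \<theta>)) (circle_norm (snd \<theta>)) +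
    2 * cone_cutoff r (circle_norm (snd \<theta>)) (circle_norm (fst \<theta>))"
proof -
  obtain m where m: "circle_norm (fst \<theta>) = \<bar>fst \<theta> - of_int m\<bar>" by (rule circle_representative)
  obtain n where n: "circle_norm (snd \<theta>) = \<bar>snd \<theta> - of_int n\<bar>" by (rule circle_representative)
  have "0 \<le> 2 * pi * (\<bar>of_int (fst v)\<bar> + \<bar>of_int (snd v)\<bar>) * r"
    using r by (intro mult_nonneg_nonneg) auto
  then have \<epsilon>: "0 \<le> \<epsilon>" using small by linarith
  show ?thesis
  proof (cases "r \<le> circle_norm (fst \<theta>) \<or> r \<le> circle_norm (snd \<theta>)")
    case True
    then show ?thesis
      using cone_cutoff_add_ge_1[OF r True] cos_ge_minus_one[of "phase v \<theta>"] \<epsilon> by linarith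
  next
    case False
    then have "1 - cos (phase v \<theta>) \<le> \<epsilon>"
      using one_minus_cos_phase_le[of \<theta> m r n v] small by (simp add: m n)
    then show ?thesis
      using cone_cutoff_nonneg[of r "circle_norm (fst \<theta>)" "circle_norm (snd \<theta>)"]
        cone_cutoff_nonneg[of r "circle_norm (snd \<theta>)" "circle_norm (fst \<theta>)"] by linarith
  qed
qed

lemma spectral_integral_doubling:
  assumes \<psi>: "positive_definite \<psi>" "\<psi> 0 = 1"
    and \<phi>: "\<exists>c. has_spectral_integral \<psi> \<phi>\<^sub>1 c \<and> m \<le> c" "\<exists>c. has_spectral_integral \<psi> \<phi>\<^sub>2 c \<and> m \<le> c"
      "has_spectral_integral \<psi> \<phi> c"
    and le: "\<And>\<theta>. \<phi>\<^sub>1 \<theta> + \<phi>\<^sub>2 \<theta> \<le> \<phi> \<theta> + a + b * (2 - cos (2 * pi * fst \<theta>) - cos (2 * pi * snd \<theta>))"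
  shows "2 * m \<le> c + a + b * (2 - \<psi> (1, 0) - \<psi> (0, 1))"
proof -
  obtain c\<^sub>1 c\<^sub>2
    where c: "has_spectral_integral \<psi> \<phi>\<^sub>1 c\<^sub>1" "m \<le> c\<^sub>1" "has_spectral_integral \<psi> \<phi>\<^sub>2 c\<^sub>2" "m \<le> c\<^sub>2"
    using \<phi>(1,2) by blast
  have "has_spectral_integral \<psi>
      (\<lambda>\<theta>. \<phi> \<theta> + ((a + 2 * b) + ((- b) * cos (phase (1, 0) \<theta>) + (- b) * cos (phase (0, 1) \<theta>))))
      (c + ((a + 2 * b) * \<psi> 0 + ((- b) * \<psi> (1, 0) + (- b) * \<psi> (0, 1))))"
    by (intro has_spectral_integral_add has_spectral_integral_const has_spectral_integral_cos \<phi>)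
  then have "has_spectral_integral \<psi>
      (\<lambda>\<theta>. \<phi> \<theta> + a + b * (2 - cos (2 * pi * fst \<theta>) - cos (2 * pi * snd \<theta>)))
      (c + a + b * (2 - \<psi> (1, 0) - \<psi> (0, 1)))"
    by (simp add: phase_def \<psi>(2) algebra_simps)
  then have "c\<^sub>1 + c\<^sub>2 \<le> c + a + b * (2 - \<psi> (1, 0) - \<psi> (0, 1))"
    by (rule has_spectral_integral_mono[OF \<psi>(1) has_spectral_integral_add[OF c(1,3)] _ le])
  then show ?thesis using c(2,4) by linarith
qed

definition almost_shear_invariant :: "real \<Rightarrow> (int \<times> int \<Rightarrow> real) \<Rightarrow> bool" where
  "almost_shear_invariant \<delta> \<psi> \<longleftrightarrow> \<psi> 0 = 1 \<and> 1 - \<delta> \<le> \<psi> (1, 0) \<and> 1 - \<delta> \<le> \<psi> (0, 1) \<and>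
     (\<forall>n\<in>{4, -4}. almost_invariant \<delta> \<psi> (lower_shear n) \<and> almost_invariant \<delta> \<psi> (upper_shear n))"

text \<open>
  Burger's argument: the spectral measure of \<open>\<psi>\<close> on the torus is concentrated near 0, while the
  shears by 4 push each of two cones covering a punctured neighbourhood of 0 into two essentially
  disjoint parts of the other cone. Almost invariance then forces nearly all the mass to sit at 0.
\<close>

lemma almost_shear_invariant_doubling:
  assumes inv: "almost_shear_invariant \<delta> \<psi>"
    and shear: "\<And>n. n \<in> {4, -4} \<Longrightarrow> almost_invariant \<delta> \<psi> (g n)" "\<And>n. inj (g n)"
      "\<And>n v w. g n (v - w) = g n v - g n w" "\<And>n u \<theta>. phase (g n u) \<theta> = phase u (g' n \<theta>)"
    and A: "finite A" "\<And>\<theta>. \<bar>trig_poly A \<alpha> \<theta>\<bar> \<le> 2" and B: "finite B"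
    and le: "\<And>\<theta>. trig_poly A \<alpha> (g' 4 \<theta>) + trig_poly A \<alpha> (g' (- 4) \<theta>) \<le>
      trig_poly B \<beta> \<theta> + d + far_weight * (2 - cos (2 * pi * fst \<theta>) - cos (2 * pi * snd \<theta>))"
  shows "2 * ((\<Sum>u\<in>A. \<alpha> u * \<psi> u) - 4 * sqrt (2 * \<delta>)) \<le>
    (\<Sum>u\<in>B. \<beta> u * \<psi> u) + d + 2 * (far_weight * \<delta>)"
proof -
  have \<psi>0: "\<psi> 0 = 1" and near_1: "1 - \<delta> \<le> \<psi> (1, 0)" "1 - \<delta> \<le> \<psi> (0, 1)"
    using inv by (auto simp: almost_shear_invariant_def)
  have \<psi>: "positive_definite \<psi>"
    by (rule almost_invariant_positive_definite(1)[OF shear(1)[of 4]]) simp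
  have "\<exists>c. has_spectral_integral \<psi> (\<lambda>\<theta>. trig_poly A \<alpha> (g' n \<theta>)) c \<and>
      (\<Sum>u\<in>A. \<alpha> u * \<psi> u) - 4 * sqrt (2 * \<delta>) \<le> c" if "n \<in> {4, -4}" for n
    by (rule almost_invariant_spectral_integral_ge[OF shear(1)[OF that] shear(2,3) \<psi>0 A shear(4)]) auto
  then have "2 * ((\<Sum>u\<in>A. \<alpha> u * \<psi> u) - 4 * sqrt (2 * \<delta>)) \<le>
      (\<Sum>u\<in>B. \<beta> u * \<psi> u) + d + far_weight * (2 - \<psi> (1, 0) - \<psi> (0, 1))"
    by (intro spectral_integral_doubling[OF \<psi> \<psi>0 _ _ has_spectral_integral_trig_poly[OF B] le]) auto
  moreover have "far_weight * (2 - \<psi> (1, 0) - \<psi> (0, 1)) \<le> 2 * (far_weight * \<delta>)"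
    using mult_left_mono[of "2 - \<psi> (1, 0) - \<psi> (0, 1)" "2 * \<delta>" far_weight] near_1 far_weight_pos
    by simp
  ultimately show ?thesis by linarith
qed

lemma almost_shear_invariant_cone_mass_le:
  assumes inv: "almost_shear_invariant \<delta> \<psi>" and "r > 0" "e \<le> 1"
    and A: "finite A" "\<And>\<theta>. \<bar>cone_cutoff r (circle_norm (fst \<theta>)) (circle_norm (snd \<theta>)) -
      trig_poly A \<alpha> \<theta>\<bar> < e"
    and B: "finite B" "\<And>\<theta>. \<bar>cone_cutoff r (circle_norm (snd \<theta>)) (circle_norm (fst \<theta>)) -
      trig_poly B \<beta> \<theta>\<bar> < e"
  shows "(\<Sum>u\<in>A. \<alpha> u * \<psi> u) + (\<Sum>u\<in>B. \<beta> u * \<psi> u) \<le>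
    16 * sqrt (2 * \<delta>) + 6 * e + 4 * (far_weight * \<delta>)"
proof -
  have shear_inv: "n \<in> {4, -4} \<Longrightarrow> almost_invariant \<delta> \<psi> (lower_shear n)"
    "n \<in> {4, -4} \<Longrightarrow> almost_invariant \<delta> \<psi> (upper_shear n)" for n
    using inv by (auto simp: almost_shear_invariant_def)
  note bound = cone_cutoff_approx_bound[OF A(2) \<open>e \<le> 1\<close>] cone_cutoff_approx_bound[OF B(2) \<open>e \<le> 1\<close>]
  have "2 * ((\<Sum>u\<in>A. \<alpha> u * \<psi> u) - 4 * sqrt (2 * \<delta>)) \<le>
      (\<Sum>u\<in>B. \<beta> u * \<psi> u) + 3 * e + 2 * (far_weight * \<delta>)"
  proof (rule almost_shear_invariant_doubling[OF inv shear_inv(1) inj_lower_shear lower_shear_diff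
        phase_lower_shear A(1) bound(1) B(1)])
    fix \<theta> :: "real \<times> real"
    show "trig_poly A \<alpha> (fst \<theta> + of_int 4 * snd \<theta>, snd \<theta>) +
        trig_poly A \<alpha> (fst \<theta> + of_int (- 4) * snd \<theta>, snd \<theta>) \<le> trig_poly B \<beta> \<theta> + 3 * e +
        far_weight * (2 - cos (2 * pi * fst \<theta>) - cos (2 * pi * snd \<theta>))"
      using cone_cutoff_circle_shears_le[OF \<open>r > 0\<close>, of "fst \<theta>" "snd \<theta>"] B(2)[of \<theta>]
        A(2)[of "(fst \<theta> + 4 * snd \<theta>, snd \<theta>)"] A(2)[of "(fst \<theta> - 4 * snd \<theta>, snd \<theta>)"] by simp
  qed
  moreover have "2 * ((\<Sum>u\<in>B. \<beta> u * \<psi> u) - 4 * sqrt (2 * \<delta>)) \<le>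
      (\<Sum>u\<in>A. \<alpha> u * \<psi> u) + 3 * e + 2 * (far_weight * \<delta>)"
  proof (rule almost_shear_invariant_doubling[OF inv shear_inv(2) inj_upper_shear upper_shear_diff
        phase_upper_shear B(1) bound(2) A(1)])
    fix \<theta> :: "real \<times> real"
    show "trig_poly B \<beta> (fst \<theta>, snd \<theta> + of_int 4 * fst \<theta>) +
        trig_poly B \<beta> (fst \<theta>, snd \<theta> + of_int (- 4) * fst \<theta>) \<le> trig_poly A \<alpha> \<theta> + 3 * e +
        far_weight * (2 - cos (2 * pi * fst \<theta>) - cos (2 * pi * snd \<theta>))"
      using cone_cutoff_circle_shears_le[OF \<open>r > 0\<close>, of "snd \<theta>" "fst \<theta>"] A(2)[of \<theta>]
        B(2)[of "(fst \<theta>, snd \<theta> + 4 * fst \<theta>)"] B(2)[of "(fst \<theta>, snd \<theta> - 4 * fst \<theta>)"]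
      by (simp add: algebra_simps)
  qed
  ultimately show ?thesis by argo
qed

lemma almost_shear_invariant_ge:
  assumes inv: "almost_shear_invariant \<delta> \<psi>" and "0 < \<epsilon>"
  shows "1 - \<epsilon> - 32 * sqrt (2 * \<delta>) - 8 * (far_weight * \<delta>) \<le> \<psi> v"
proof -
  define e where "e = min 1 (\<epsilon> / 32)"
  have e: "0 < e" "e \<le> 1" "16 * e \<le> \<epsilon> / 2" using \<open>0 < \<epsilon>\<close> by (auto simp: e_def)
  define N :: real where "N = 1 + 2 * pi * (\<bar>of_int (fst v)\<bar> + \<bar>of_int (snd v)\<bar>)"
  have N: "1 \<le> N" by (simp add: N_def)
  define r where "r = \<epsilon> / (2 * N)"
  have "2 * pi * (\<bar>of_int (fst v)\<bar> + \<bar>of_int (snd v)\<bar>) * r \<le> N * r"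
    using \<open>0 < \<epsilon>\<close> N by (intro mult_right_mono) (auto simp: N_def r_def)
  then have r: "0 < r" "2 * pi * (\<bar>of_int (fst v)\<bar> + \<bar>of_int (snd v)\<bar>) * r \<le> \<epsilon> / 2"
    using \<open>0 < \<epsilon>\<close> N by (auto simp: r_def)
  obtain A \<alpha> where A: "finite A" "\<And>\<theta>. \<bar>cone_cutoff r (circle_norm (fst \<theta>)) (circle_norm (snd \<theta>)) -
      trig_poly A \<alpha> \<theta>\<bar> < e"
    using cone_cutoff_trig_approx[OF r(1) e(1)] by blast
  define B \<beta> where "B = prod.swap ` A" and "\<beta> u = \<alpha> (prod.swap u)" for u
  have "trig_poly B \<beta> \<theta> = trig_poly A \<alpha> (prod.swap \<theta>)" for \<theta>
    by (simp add: trig_poly_def B_def \<beta>_def sum.reindex phase_def add.commute)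
  then have B: "finite B" "\<And>\<theta>. \<bar>cone_cutoff r (circle_norm (snd \<theta>)) (circle_norm (fst \<theta>)) -
      trig_poly B \<beta> \<theta>\<bar> < e"
    using A(1) A(2)[of "prod.swap _"] by (auto simp: B_def)
  let ?a = "\<Sum>u\<in>A. \<alpha> u * \<psi> u" and ?b = "\<Sum>u\<in>B. \<beta> u * \<psi> u"
  have \<psi>: "positive_definite \<psi>" "\<psi> 0 = 1"
    using inv almost_invariant_positive_definite(1) by (auto simp: almost_shear_invariant_def)
  have "1 * \<psi> 0 \<le> 1 * \<psi> v + ((\<epsilon> / 2 + 4 * e) * \<psi> 0 + (2 * ?a + 2 * ?b))"
  proof (rule has_spectral_integral_mono[OF \<psi>(1) has_spectral_integral_const])
    show "has_spectral_integral \<psi>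
      (\<lambda>\<theta>. 1 * cos (phase v \<theta>) + ((\<epsilon> / 2 + 4 * e) + (2 * trig_poly A \<alpha> \<theta> + 2 * trig_poly B \<beta> \<theta>)))
      (1 * \<psi> v + ((\<epsilon> / 2 + 4 * e) * \<psi> 0 + (2 * ?a + 2 * ?b)))"
      by (intro has_spectral_integral_add has_spectral_integral_cos has_spectral_integral_const
          has_spectral_integral_cmult has_spectral_integral_trig_poly A(1) B(1))
    show "1 \<le> 1 * cos (phase v \<theta>) + ((\<epsilon> / 2 + 4 * e) + (2 * trig_poly A \<alpha> \<theta> + 2 * trig_poly B \<beta> \<theta>))"
      for \<theta>
      using one_minus_cos_phase_le_cones[OF r, of \<theta>] A(2)[of \<theta>] B(2)[of \<theta>] by linarith
  qed
  then show ?thesis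
    using almost_shear_invariant_cone_mass_le[OF inv r(1) e(2) A B] e(3) by (simp add: \<psi>(2))
qed

theorem relative_property_T:
  assumes "\<epsilon> > 0"
  obtains \<delta> where "\<delta> > 0" "\<And>\<psi> v. almost_shear_invariant \<delta> \<psi> \<Longrightarrow> 1 - \<epsilon> \<le> \<psi> v"
proof -
  have "((\<lambda>\<delta>. 32 * sqrt (2 * \<delta>) + 8 * (far_weight * \<delta>)) \<longlongrightarrow> 32 * sqrt (2 * 0) + 8 * (far_weight * 0))
      (at_right 0)"
    by (intro tendsto_intros)
  then have "\<forall>\<^sub>F \<delta> in at_right 0. 32 * sqrt (2 * \<delta>) + 8 * (far_weight * \<delta>) < \<epsilon> / 2"
    using assms by (intro order_tendstoD) auto
  then obtain \<delta> where \<delta>: "\<delta> > 0" "32 * sqrt (2 * \<delta>) + 8 * (far_weight * \<delta>) < \<epsilon> / 2"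
    by (auto simp: eventually_at_right_field dest: dense)
  show ?thesis
  proof (rule that[OF \<delta>(1)])
    fix \<psi> v assume "almost_shear_invariant \<delta> \<psi>"
    then show "1 - \<epsilon> \<le> \<psi> v"
      using almost_shear_invariant_ge[of \<delta> \<psi> "\<epsilon> / 2" v] \<delta>(2) assms by simp
  qed
qed

section \<open>Odometers\<close>

lemma (in finite_measure) measure_UN_lessThan_LIMSEQ:
  assumes "\<And>i. A i \<in> sets M"
  shows "(\<lambda>n. measure M (\<Union>i<n. A i)) \<longlonglongrightarrow> measure M (\<Union>i::nat. A i)"
proof -
  have "(\<lambda>n. measure M (\<Union>i<n. A i)) \<longlonglongrightarrow> measure M (\<Union>n. \<Union>i<n. A i)"
    using assms by (intro finite_Lim_measure_incseq monoI UN_mono) auto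
  then show ?thesis using UN_UN_finite_eq[of A] by (simp add: lessThan_atLeast0)
qed

lemma (in finite_measure) ex_measure_UN_lessThan_gt:
  assumes "\<And>i. A i \<in> sets M" "\<epsilon> > 0"
  obtains N where "measure M (\<Union>i::nat. A i) - \<epsilon> < measure M (\<Union>i<N. A i)"
proof -
  have "\<forall>\<^sub>F n in sequentially. measure M (\<Union>i. A i) - \<epsilon> < measure M (\<Union>i<n. A i)"
    using assms(2) by (intro order_tendstoD(1)[OF measure_UN_lessThan_LIMSEQ] assms) simp
  then show ?thesis using that by (auto simp: eventually_sequentially)
qed

lemma (in finite_measure) measure_add_le_measure_Int:
  assumes "A \<in> sets M" "B \<in> sets M" "C \<in> sets M" "A \<subseteq> C" "B \<subseteq> C"
  shows "measure M A + measure M B \<le> measure M C + measure M (A \<inter> B)"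
proof -
  have "measure M (A \<union> B) \<le> measure M C" using assms by (intro finite_measure_mono) auto
  then show ?thesis using measure_Un3[of A M B] assms by (simp add: fmeasurable_eq_sets)
qed

lemma (in sigma_finite_measure) measure_pair_Times:
  assumes "A \<in> sets N" "B \<in> sets M"
  shows "measure (N \<Otimes>\<^sub>M M) (A \<times> B) = measure N A * measure M B"
  unfolding measure_def by (simp add: emeasure_pair_measure_Times assms enn2real_mult)

text \<open>
  A model of the additive group of \<open>p\<close>-adic integer vectors indexed by \<open>I\<close>: \<open>code k x\<close> names the
  ball of radius \<open>p\<close> to the power \<open>-k\<close> around \<open>x\<close>, and \<open>T t\<close> is the translation by the integer
  vector \<open>t\<close>.
\<close>

locale odometer = prob_space M for M :: "'x measure" +
  fixes code :: "nat \<Rightarrow> 'x \<Rightarrow> 'b" and p :: nat and I :: "'d set" and T :: "('d \<Rightarrow> int) \<Rightarrow> 'x \<Rightarrow> 'x"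
  assumes p_gt_1: "p > 1" and finite_I: "finite I"
    and finite_code: "finite (code k ` space M)"
    and card_code: "card (code k ` space M) \<le> p ^ (k * card I)"
    and code_sets: "{x \<in> space M. code k x = b} \<in> sets M"
    and code_Suc: "x \<in> space M \<Longrightarrow> y \<in> space M \<Longrightarrow> code (Suc k) x = code (Suc k) y \<Longrightarrow>
      code k x = code k y"
    and sets_generated: "sets M = sigma_sets (space M) {{x \<in> space M. code k x = b} |k b. True}"
    and T_measurable: "T t \<in> measurable M M"
    and T_distr: "distr M M (T t) = M"
    and T_add: "x \<in> space M \<Longrightarrow> T s (T t x) = T (\<lambda>i. s i + t i) x"
    and T_zero: "x \<in> space M \<Longrightarrow> T (\<lambda>i. 0) x = x"
    and code_T_eq_iff: "x \<in> space M \<Longrightarrow> y \<in> space M \<Longrightarrow>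
      code k (T t x) = code k (T t y) \<longleftrightarrow> code k x = code k y"
    and code_T_fixed_iff: "x \<in> space M \<Longrightarrow> code k (T t x) = code k x \<longleftrightarrow> (\<forall>i\<in>I. int p ^ k dvd t i)"
    and T_transitive: "x \<in> space M \<Longrightarrow> y \<in> space M \<Longrightarrow> \<exists>t. code k (T t x) = code k y"
begin

lemma T_space: "x \<in> space M \<Longrightarrow> T t x \<in> space M"
  using T_measurable[of t] by (rule measurable_space)

lemma T_vimage_sets: "A \<in> sets M \<Longrightarrow> T t -` A \<inter> space M \<in> sets M"
  by (rule measurable_sets[OF T_measurable])

lemma measure_T_vimage: "A \<in> sets M \<Longrightarrow> measure M (T t -` A \<inter> space M) = measure M A"
  using measure_distr[OF T_measurable, of A t] by (simp add: T_distr)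

lemma code_mono: "k \<le> k' \<Longrightarrow> x \<in> space M \<Longrightarrow> y \<in> space M \<Longrightarrow> code k' x = code k' y \<Longrightarrow> code k x = code k y"
  by (induction k' rule: dec_induct) (auto dest: code_Suc)

definition cell :: "nat \<Rightarrow> 'b \<Rightarrow> 'x set" where
  "cell k b = {x \<in> space M. code k x = b}"

lemma cell_sets [measurable]: "cell k b \<in> sets M"
  using code_sets by (simp add: cell_def)

lemma cell_subset_space: "cell k b \<subseteq> space M"
  by (auto simp: cell_def)

lemma disjoint_family_on_cell: "disjoint_family_on (cell k) B"
  by (auto simp: disjoint_family_on_def cell_def)

definition num_cells :: "nat \<Rightarrow> nat" where
  "num_cells k = card (code k ` space M)"

lemma num_cells_pos: "num_cells k > 0"
  using finite_code[of k] not_empty by (auto simp: num_cells_def card_gt_0_iff)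

lemma sum_measure_Int_cell:
  assumes "A \<in> sets M"
  shows "(\<Sum>b\<in>code k ` space M. measure M (A \<inter> cell k b)) = measure M A"
proof -
  have "measure M (\<Union>b\<in>code k ` space M. A \<inter> cell k b) =
      (\<Sum>b\<in>code k ` space M. measure M (A \<inter> cell k b))"
    using disjoint_family_on_cell[of k "code k ` space M"] assms
    by (intro finite_measure_finite_Union finite_code) (auto simp: disjoint_family_on_def)
  moreover have "(\<Union>b\<in>code k ` space M. A \<inter> cell k b) = A"
    using sets.sets_into_space[OF assms] by (auto simp: cell_def)
  ultimately show ?thesis by simp
qed

lemma measure_cell:
  assumes b: "b \<in> code k ` space M"
  shows "measure M (cell k b) = 1 / num_cells k"
proof -
  have same: "measure M (cell k (code k x)) = measure M (cell k (code k y))"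
    if x: "x \<in> space M" and y: "y \<in> space M" for x y
  proof -
    obtain t where t: "code k (T t x) = code k y" using T_transitive x y by blast
    have "T t -` cell k (code k y) \<inter> space M = cell k (code k x)"
      using x t by (auto simp: cell_def T_space simp flip: code_T_eq_iff[of _ x k t])
    then show ?thesis using measure_T_vimage[of "cell k (code k y)" t] by simp
  qed
  have "1 = (\<Sum>c\<in>code k ` space M. measure M (space M \<inter> cell k c))"
    by (simp only: sum_measure_Int_cell[OF sets.top] prob_space)
  also have "\<dots> = (\<Sum>c\<in>code k ` space M. measure M (cell k b))"
    using b same by (intro sum.cong refl) (auto simp: Int_absorb1 cell_subset_space)
  also have "\<dots> = num_cells k * measure M (cell k b)" by (simp add: num_cells_def)
  finally show ?thesis using num_cells_pos[of k] by (simp add: field_simps)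
qed

definition saturated :: "nat \<Rightarrow> 'x set \<Rightarrow> bool" where
  "saturated k W \<longleftrightarrow> W \<subseteq> space M \<and>
     (\<forall>x\<in>space M. \<forall>y\<in>space M. code k x = code k y \<longrightarrow> x \<in> W \<longrightarrow> y \<in> W)"

lemma saturated_mono: "k \<le> k' \<Longrightarrow> saturated k W \<Longrightarrow> saturated k' W"
  unfolding saturated_def using code_mono by blast

lemma saturated_cell: "saturated k (cell k b)"
  by (auto simp: saturated_def cell_def)

lemma saturated_Un: "saturated k W \<Longrightarrow> saturated k W' \<Longrightarrow> saturated k (W \<union> W')"
  unfolding saturated_def by blast

lemma saturated_Compl: "saturated k W \<Longrightarrow> saturated k (space M - W)"
  unfolding saturated_def by (metis Diff_iff Diff_subset)

lemma saturated_eq_UN_cell: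
  assumes "saturated k W"
  shows "W = (\<Union>b\<in>code k ` W. cell k b)"
proof (intro equalityI subsetI)
  fix x assume "x \<in> W"
  then show "x \<in> (\<Union>b\<in>code k ` W. cell k b)" using assms by (auto simp: saturated_def cell_def)
next
  fix x assume "x \<in> (\<Union>b\<in>code k ` W. cell k b)"
  then obtain w where "w \<in> W" "x \<in> space M" "code k w = code k x" by (auto simp: cell_def)
  then show "x \<in> W" using assms unfolding saturated_def by blast
qed

lemma saturated_code_image:
  assumes "saturated k W"
  shows "finite (code k ` W)" "code k ` W \<subseteq> code k ` space M"
  using assms finite_subset[OF image_mono finite_code] by (auto simp: saturated_def)

lemma saturated_sets:
  assumes "saturated k W"
  shows "W \<in> sets M"
proof -
  have "(\<Union>b\<in>code k ` W. cell k b) \<in> sets M"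
    using saturated_code_image[OF assms] by (intro sets.finite_UN cell_sets)
  then show ?thesis using saturated_eq_UN_cell[OF assms] by simp
qed

lemma measure_saturated:
  assumes "saturated k W"
  shows "measure M W = card (code k ` W) / num_cells k"
proof -
  have "measure M W = measure M (\<Union>b\<in>code k ` W. cell k b)"
    using saturated_eq_UN_cell[OF assms] by simp
  also have "\<dots> = (\<Sum>b\<in>code k ` W. measure M (cell k b))"
    by (rule finite_measure_finite_Union)
      (auto simp: saturated_code_image[OF assms] disjoint_family_on_cell)
  also have "\<dots> = (\<Sum>b\<in>code k ` W. 1 / num_cells k)"
    using saturated_code_image[OF assms] by (intro sum.cong refl measure_cell) auto
  finally show ?thesis by simp
qed

lemma saturated_approx_finite_UN:
  assumes "finite J"
    and "\<And>i. i \<in> J \<Longrightarrow> A i \<in> sets M"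
    and "\<And>i \<epsilon>. i \<in> J \<Longrightarrow> \<epsilon> > 0 \<Longrightarrow> \<exists>k W. saturated k W \<and> measure M (sym_diff (A i) W) < \<epsilon>"
    and "\<epsilon> > 0"
  shows "\<exists>k W. saturated k W \<and> measure M (sym_diff (\<Union>i\<in>J. A i) W) < \<epsilon>"
  using assms
proof (induction J arbitrary: \<epsilon> rule: finite_induct)
  case empty
  then show ?case by (intro exI[of _ 0] exI[of _ "{}"]) (auto simp: saturated_def)
next
  case (insert i J)
  obtain k W where W: "saturated k W" "measure M (sym_diff (A i) W) < \<epsilon> / 2"
    using insert.prems(2)[of i "\<epsilon> / 2"] \<open>\<epsilon> > 0\<close> by auto
  obtain k' W' where W': "saturated k' W'" "measure M (sym_diff (\<Union>i\<in>J. A i) W') < \<epsilon> / 2"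
    using insert.IH[of "\<epsilon> / 2"] insert.prems by auto
  have W_sets: "W \<in> sets M" "W' \<in> sets M" using W(1) W'(1) by (auto intro: saturated_sets)
  have A: "A i \<in> sets M" "(\<Union>i\<in>J. A i) \<in> sets M" using insert by auto
  have "measure M (sym_diff (\<Union>i\<in>insert i J. A i) (W \<union> W')) \<le>
      measure M (sym_diff (A i) W \<union> sym_diff (\<Union>i\<in>J. A i) W')"
    by (rule finite_measure_mono) (use A W_sets in auto)
  also have "\<dots> \<le> measure M (sym_diff (A i) W) + measure M (sym_diff (\<Union>i\<in>J. A i) W')"
    by (rule measure_Un_le) (use A W_sets in auto)
  finally have "measure M (sym_diff (\<Union>i\<in>insert i J. A i) (W \<union> W')) < \<epsilon>"
    using W(2) W'(2) by simp
  moreover have "saturated (max k k') (W \<union> W')"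
    using saturated_mono[OF _ W(1), of "max k k'"] saturated_mono[OF _ W'(1), of "max k k'"]
    by (simp add: saturated_Un)
  ultimately show ?case by blast
qed

lemma saturated_approx:
  assumes "A \<in> sets M" "\<epsilon> > 0"
  shows "\<exists>k W. saturated k W \<and> measure M (sym_diff A W) < \<epsilon>"
  using assms(1)[unfolded sets_generated] assms(2)
proof (induction arbitrary: \<epsilon> rule: sigma_sets.induct)
  case (Basic A)
  then obtain k b where "A = cell k b" by (auto simp: cell_def)
  then show ?case
    using saturated_cell[of k b] Basic by (intro exI[of _ k] exI[of _ A]) auto
next
  case Empty
  then show ?case by (intro exI[of _ 0] exI[of _ "{}"]) (auto simp: saturated_def)
next
  case (Compl A)
  then obtain k W where W: "saturated k W" "measure M (sym_diff A W) < \<epsilon>" by blast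
  have "A \<subseteq> space M"
    using Compl(1) sets.sets_into_space[of A M] by (simp add: sets_generated)
  then have "sym_diff (space M - A) (space M - W) = sym_diff A W"
    using W(1) by (auto simp: saturated_def)
  then show ?case using W saturated_Compl by (intro exI[of _ k] exI[of _ "space M - W"]) auto
next
  case (Union A)
  have A: "A i \<in> sets M" for i using Union(1) by (simp add: sets_generated)
  obtain N where N: "measure M (\<Union>i. A i) - \<epsilon> / 2 < measure M (\<Union>i<N. A i)"
    using ex_measure_UN_lessThan_gt[of A "\<epsilon> / 2"] A \<open>\<epsilon> > 0\<close> by auto
  obtain k W where W: "saturated k W" "measure M (sym_diff (\<Union>i<N. A i) W) < \<epsilon> / 2"
    using saturated_approx_finite_UN[of "{..<N}" A "\<epsilon> / 2"] A Union(2) \<open>\<epsilon> > 0\<close> by auto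
  have W_sets: "W \<in> sets M" using W(1) by (rule saturated_sets)
  have "measure M (sym_diff (\<Union>i. A i) W) \<le>
      measure M (((\<Union>i. A i) - (\<Union>i<N. A i)) \<union> sym_diff (\<Union>i<N. A i) W)"
    by (rule finite_measure_mono) (use A W_sets in auto)
  also have "\<dots> \<le> measure M ((\<Union>i. A i) - (\<Union>i<N. A i)) + measure M (sym_diff (\<Union>i<N. A i) W)"
    by (rule measure_Un_le) (use A W_sets in auto)
  also have "measure M ((\<Union>i. A i) - (\<Union>i<N. A i)) = measure M (\<Union>i. A i) - measure M (\<Union>i<N. A i)"
    by (rule finite_measure_Diff) (use A in auto)
  finally have "measure M (sym_diff (\<Union>i. A i) W) < \<epsilon>" using N W(2) by linarith
  then show ?case using W(1) by blast
qed

lemma cells_decide_finite_family: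
  assumes "finite J" "\<And>i. i \<in> J \<Longrightarrow> A i \<in> sets M" "\<epsilon> > 0"
  obtains E k where "E \<in> sets M" "measure M E < \<epsilon>"
    "\<And>i x y l. \<lbrakk>i \<in> J; k \<le> l; x \<in> space M - E; y \<in> space M - E; code l x = code l y\<rbrakk> \<Longrightarrow>
       x \<in> A i \<longleftrightarrow> y \<in> A i"
  using assms
proof (induction J arbitrary: \<epsilon> thesis rule: finite_induct)
  case empty
  show ?case by (rule empty.prems(1)[of "{}" 0]) (use empty in auto)
next
  case (insert i J)
  obtain k W where W: "saturated k W" "measure M (sym_diff (A i) W) < \<epsilon> / 2"
    using saturated_approx[of "A i" "\<epsilon> / 2"] insert.prems by auto
  obtain E k' where E: "E \<in> sets M" "measure M E < \<epsilon> / 2"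
    and decide: "\<And>i x y l. \<lbrakk>i \<in> J; k' \<le> l; x \<in> space M - E; y \<in> space M - E; code l x = code l y\<rbrakk>
      \<Longrightarrow> x \<in> A i \<longleftrightarrow> y \<in> A i"
    using insert.IH[of "\<epsilon> / 2"] insert.prems by auto
  have AW: "A i \<in> sets M" "W \<in> sets M" using insert.prems saturated_sets[OF W(1)] by auto
  show ?case
  proof (rule insert.prems(1)[of "sym_diff (A i) W \<union> E" "max k k'"])
    show "sym_diff (A i) W \<union> E \<in> sets M" using AW E(1) by auto
    have "measure M (sym_diff (A i) W \<union> E) \<le> measure M (sym_diff (A i) W) + measure M E"
      by (rule measure_Un_le) (use AW E(1) in auto)
    then show "measure M (sym_diff (A i) W \<union> E) < \<epsilon>" using W(2) E(2) by linarith
    fix j x y l assume "j \<in> insert i J" and l: "max k k' \<le> l" and eq: "code l x = code l y"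
      and xy: "x \<in> space M - (sym_diff (A i) W \<union> E)" "y \<in> space M - (sym_diff (A i) W \<union> E)"
    then consider "j = i" | "j \<in> J" by blast
    then show "x \<in> A j \<longleftrightarrow> y \<in> A j"
    proof cases
      case 1
      have "saturated l W" using l by (intro saturated_mono[OF _ W(1)]) simp
      then have "x \<in> W \<longleftrightarrow> y \<in> W" using xy eq unfolding saturated_def by (metis DiffD1)
      then show ?thesis using 1 xy by blast
    next
      case 2
      then show ?thesis using decide[of j l x y] l xy eq by auto
    qed
  qed
qed

lemma cells_decide_set:
  assumes "A \<in> sets M" "\<epsilon> > 0"
  obtains E k where "E \<in> sets M" "measure M E < \<epsilon>"
    "\<And>x y l. \<lbrakk>k \<le> l; x \<in> space M - E; y \<in> space M - E; code l x = code l y\<rbrakk> \<Longrightarrow> x \<in> A \<longleftrightarrow> y \<in> A"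
  by (rule cells_decide_finite_family[of "{()}" "\<lambda>_. A" \<epsilon>]) (use assms that in auto)

lemma cells_refine_countable_cover:
  fixes A :: "nat \<Rightarrow> 'x set"
  assumes A: "\<And>n. A n \<in> sets M" and cover: "space M \<subseteq> (\<Union>n. A n)" and "\<epsilon> > 0"
  obtains E k where "E \<in> sets M" "measure M E < \<epsilon>"
    "\<And>x y l. \<lbrakk>k \<le> l; x \<in> space M - E; y \<in> space M - E; code l x = code l y\<rbrakk> \<Longrightarrow>
       \<exists>n. x \<in> A n \<and> y \<in> A n"
proof -
  have "(\<Union>n. A n) = space M" using cover A[THEN sets.sets_into_space] by blast
  then obtain N where N: "1 - \<epsilon> / 2 < measure M (\<Union>n<N. A n)"
    using ex_measure_UN_lessThan_gt[of A "\<epsilon> / 2"] A \<open>\<epsilon> > 0\<close> by (auto simp: prob_space)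
  obtain E k where E: "E \<in> sets M" "measure M E < \<epsilon> / 2"
    and decide: "\<And>n x y l. \<lbrakk>n \<in> {..<N}; k \<le> l; x \<in> space M - E; y \<in> space M - E;
      code l x = code l y\<rbrakk>
      \<Longrightarrow> x \<in> A n \<longleftrightarrow> y \<in> A n"
    by (rule cells_decide_finite_family[of "{..<N}" A "\<epsilon> / 2"]) (use A \<open>\<epsilon> > 0\<close> in auto)
  let ?E = "(space M - (\<Union>n<N. A n)) \<union> E"
  show ?thesis
  proof (rule that[of ?E k])
    show "?E \<in> sets M" using A E(1) by auto
    have "measure M ?E \<le> measure M (space M - (\<Union>n<N. A n)) + measure M E"
      by (rule measure_Un_le) (use A E(1) in auto)
    also have "measure M (space M - (\<Union>n<N. A n)) = 1 - measure M (\<Union>n<N. A n)"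
      by (rule prob_compl) (use A in auto)
    finally show "measure M ?E < \<epsilon>" using N E(2) by linarith
    fix x y l assume "k \<le> l" "x \<in> space M - ?E" "y \<in> space M - ?E" "code l x = code l y"
    moreover from this obtain n where "n < N" "x \<in> A n" by blast
    ultimately show "\<exists>n. x \<in> A n \<and> y \<in> A n" using decide[of n l x y] by auto
  qed
qed

definition box :: "nat \<Rightarrow> ('d \<Rightarrow> nat) set" where
  "box n = I \<rightarrow>\<^sub>E {..<p ^ n}"

definition shift :: "nat \<Rightarrow> nat \<Rightarrow> ('d \<Rightarrow> nat) \<Rightarrow> 'x \<Rightarrow> 'x" where
  "shift k m t = T (\<lambda>i. if i \<in> I then int (t i * m) * int p ^ k else 0)"

lemma finite_box: "finite (box n)"
  unfolding box_def using finite_I by (intro finite_PiE) auto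

lemma card_box: "card (box n) = p ^ (n * card I)"
  unfolding box_def using finite_I by (simp add: card_PiE power_mult)

lemma num_cells_le_box: "num_cells (k + n) \<le> card (box n) * p ^ (k * card I)"
  using card_code[of "k + n"]
  by (simp add: num_cells_def card_box add.commute flip: power_add add_mult_distrib)

lemma shift_space: "x \<in> space M \<Longrightarrow> shift k m t x \<in> space M"
  unfolding shift_def by (rule T_space)

lemma shift_measurable [measurable]: "shift k m t \<in> measurable M M"
  unfolding shift_def by (rule T_measurable)

lemma shift_vimage_sets [measurable]: "A \<in> sets M \<Longrightarrow> shift k m t -` A \<inter> space M \<in> sets M"
  unfolding shift_def by (rule T_vimage_sets)

lemma measure_shift_vimage: "A \<in> sets M \<Longrightarrow> measure M (shift k m t -` A \<inter> space M) = measure M A"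
  unfolding shift_def by (rule measure_T_vimage)

lemma shift_code_inj:
  assumes x: "x \<in> space M" and m: "0 < m" "m \<le> p ^ a" and t: "t \<in> box n" "t' \<in> box n"
    and eq: "code (k + a + n) (shift k m t x) = code (k + a + n) (shift k m t' x)"
  shows "t = t'"
proof (rule PiE_ext[OF t[unfolded box_def]])
  fix i assume i: "i \<in> I"
  let ?s = "\<lambda>t i. if i \<in> I then int (t i * m) * int p ^ k else 0"
  have "shift k m t x = T (\<lambda>i. ?s t i - ?s t' i) (shift k m t' x)"
    unfolding shift_def using T_add[OF x, of "\<lambda>i. ?s t i - ?s t' i" "?s t'"] by simp
  then have "code (k + a + n) (T (\<lambda>i. ?s t i - ?s t' i) (shift k m t' x)) =
      code (k + a + n) (shift k m t' x)" using eq by simp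
  then have "\<forall>i\<in>I. int p ^ (k + a + n) dvd ?s t i - ?s t' i"
    unfolding code_T_fixed_iff[OF shift_space[OF x]] .
  then have "int p ^ k * int p ^ (a + n) dvd int p ^ k * ((int (t i) - int (t' i)) * int m)"
    using i by (simp add: algebra_simps power_add)
  then have dvd: "int p ^ (a + n) dvd (int (t i) - int (t' i)) * int m"
    using p_gt_1 by simp
  have "t i < p ^ n" "t' i < p ^ n" using t i by (auto simp: box_def)
  then have "int (t i) < int p ^ n" "int (t' i) < int p ^ n" by (simp_all flip: of_nat_power)
  then have "\<bar>int (t i) - int (t' i)\<bar> < int p ^ n" by linarith
  then have "\<bar>(int (t i) - int (t' i)) * int m\<bar> < int p ^ n * int m"
    using m by (simp add: abs_mult)
  also have "\<dots> \<le> int p ^ n * int p ^ a"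
    using m by (intro mult_left_mono) (simp_all flip: of_nat_power)
  finally have "\<bar>(int (t i) - int (t' i)) * int m\<bar> < int p ^ (a + n)"
    by (simp add: power_add mult.commute)
  then have "(int (t i) - int (t' i)) * int m = 0"
    using dvd_imp_le_int[OF _ dvd] p_gt_1 by (auto simp: abs_mult)
  then show "t i = t' i" using m by simp
qed

lemma sum_measure_shift_cell_le:
  assumes A: "A \<in> sets M" and m: "0 < m" "m \<le> p ^ a"
  shows "(\<Sum>t\<in>box n. measure M (A \<inter> (shift k m t -` cell (k + a + n) b \<inter> space M))) \<le> measure M A"
proof -
  let ?S = "\<lambda>t. A \<inter> (shift k m t -` cell (k + a + n) b \<inter> space M)"
  have "disjoint_family_on ?S (box n)"
    unfolding disjoint_family_on_def
  proof (intro ballI impI, rule ccontr)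
    fix t t' assume t: "t \<in> box n" "t' \<in> box n" "t \<noteq> t'" and "?S t \<inter> ?S t' \<noteq> {}"
    then obtain x where "x \<in> space M" "code (k + a + n) (shift k m t x) = b"
      "code (k + a + n) (shift k m t' x) = b" by (auto simp: cell_def)
    then show False using shift_code_inj[of x m a t n t' k] m t by auto
  qed
  then have "(\<Sum>t\<in>box n. measure M (?S t)) = measure M (\<Union>t\<in>box n. ?S t)"
    using A by (intro finite_measure_finite_Union[symmetric] finite_box) auto
  also have "\<dots> \<le> measure M A" using A by (intro finite_measure_mono) auto
  finally show ?thesis .
qed

lemma sum_measure_shift_saturated_le:
  assumes A: "A \<in> sets M" and W: "saturated (k + a + n) W" and m: "0 < m" "m \<le> p ^ a"
  shows "(\<Sum>t\<in>box n. measure M (A \<inter> (shift k m t -` W \<inter> space M))) \<le>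
    card (box n) * (real p ^ ((k + a) * card I) * (measure M A * measure M W))"
proof -
  let ?K = "k + a + n" and ?B = "code (k + a + n) ` W"
  let ?S = "\<lambda>t b. A \<inter> (shift k m t -` cell (k + a + n) b \<inter> space M)"
  have split: "measure M (A \<inter> (shift k m t -` W \<inter> space M)) \<le> (\<Sum>b\<in>?B. measure M (?S t b))" for t
  proof -
    have "A \<inter> (shift k m t -` W \<inter> space M) = (\<Union>b\<in>?B. ?S t b)"
      by (subst saturated_eq_UN_cell[OF W]) auto
    then show ?thesis using A
      by (simp only:)
        (intro finite_measure_subadditive_finite saturated_code_image[OF W], auto)
  qed
  have "(\<Sum>t\<in>box n. measure M (A \<inter> (shift k m t -` W \<inter> space M))) \<le>
      (\<Sum>b\<in>?B. \<Sum>t\<in>box n. measure M (?S t b))"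
    by (subst sum.swap) (intro sum_mono split)
  also have "\<dots> \<le> (\<Sum>b\<in>?B. measure M A)"
    by (intro sum_mono sum_measure_shift_cell_le A m)
  also have "\<dots> = num_cells ?K * (measure M A * measure M W)"
    using num_cells_pos[of ?K] by (simp add: measure_saturated[OF W])
  also have "\<dots> \<le> (card (box n) * real p ^ ((k + a) * card I)) * (measure M A * measure M W)"
    using of_nat_mono[OF num_cells_le_box[of "k + a" n]] by (intro mult_right_mono) simp_all
  finally show ?thesis by (simp only: mult.assoc)
qed

lemma measure_Int_shift_vimage_le:
  assumes A: "A \<in> sets M" and B: "B \<in> sets M" and W: "W \<in> sets M"
  shows "measure M (A \<inter> (shift k m t -` B \<inter> space M)) \<le>
    measure M (A \<inter> (shift k m t -` W \<inter> space M)) + measure M (sym_diff B W)"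
proof -
  have "measure M (A \<inter> (shift k m t -` B \<inter> space M)) \<le> measure M
      (A \<inter> (shift k m t -` W \<inter> space M) \<union> (shift k m t -` sym_diff B W \<inter> space M))"
    using A B W by (intro finite_measure_mono sets.Un sets.Int shift_vimage_sets) auto
  also have "\<dots> \<le> measure M (A \<inter> (shift k m t -` W \<inter> space M)) +
      measure M (shift k m t -` sym_diff B W \<inter> space M)"
    using A B W by (intro measure_Un_le sets.Int shift_vimage_sets) auto
  also have "measure M (shift k m t -` sym_diff B W \<inter> space M) = measure M (sym_diff B W)"
    using B W by (intro measure_shift_vimage) auto
  finally show ?thesis .
qed

lemma sum_measure_shift_eventually_le:
  assumes A: "A \<in> sets M" and B: "B \<in> sets M" and m: "0 < m" "m \<le> p ^ a" and "\<epsilon> > 0"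
  shows "\<forall>\<^sub>F n in sequentially. (\<Sum>t\<in>box n. measure M (A \<inter> (shift k m t -` B \<inter> space M))) \<le>
    card (box n) * (real p ^ ((k + a) * card I) * (measure M A * measure M B) + \<epsilon>)"
proof -
  define c where "c = real p ^ ((k + a) * card I)"
  have c: "c \<ge> 0" by (simp add: c_def)
  define \<epsilon>' where "\<epsilon>' = \<epsilon> / (c + 1)"
  have "\<epsilon>' > 0" "(c + 1) * \<epsilon>' = \<epsilon>" using c \<open>\<epsilon> > 0\<close> by (simp_all add: \<epsilon>'_def)
  then have \<epsilon>': "\<epsilon>' > 0" "c * \<epsilon>' + \<epsilon>' = \<epsilon>" by (simp_all add: algebra_simps)
  obtain l W where W: "saturated l W" "measure M (sym_diff B W) < \<epsilon>'"
    using saturated_approx[OF B \<epsilon>'(1)] by blast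
  have W_sets: "W \<in> sets M" by (rule saturated_sets[OF W(1)])
  have "measure M W \<le> measure M (B \<union> sym_diff B W)"
    by (rule finite_measure_mono) (use B W_sets in auto)
  also have "\<dots> \<le> measure M B + measure M (sym_diff B W)"
    by (rule measure_Un_le) (use B W_sets in auto)
  finally have W_le: "measure M W \<le> measure M B + \<epsilon>'" using W(2) by linarith
  have close: "measure M (A \<inter> (shift k m t -` B \<inter> space M)) \<le>
      measure M (A \<inter> (shift k m t -` W \<inter> space M)) + \<epsilon>'" for t
    using measure_Int_shift_vimage_le[OF A B W_sets, of k m t] W(2) by linarith
  show ?thesis
  proof (rule eventually_sequentiallyI[of l])
    fix n assume "l \<le> n"
    then have W_sat: "saturated (k + a + n) W" by (intro saturated_mono[OF _ W(1)]) simp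
    have "(\<Sum>t\<in>box n. measure M (A \<inter> (shift k m t -` B \<inter> space M))) \<le>
        (\<Sum>t\<in>box n. measure M (A \<inter> (shift k m t -` W \<inter> space M)) + \<epsilon>')"
      by (intro sum_mono close)
    also have "\<dots> \<le> card (box n) * (c * (measure M A * measure M W)) + card (box n) * \<epsilon>'"
      using sum_measure_shift_saturated_le[OF A W_sat m] by (simp add: sum.distrib c_def)
    also have "\<dots> \<le> card (box n) * (c * (measure M A * measure M B) + \<epsilon>)"
    proof -
      have "measure M A * measure M W \<le> measure M A * (measure M B + \<epsilon>')"
        using W_le by (intro mult_left_mono) auto
      also have "\<dots> \<le> measure M A * measure M B + \<epsilon>'"
        using mult_right_mono[OF prob_le_1[of A], of \<epsilon>'] \<epsilon>'(1) by (simp add: distrib_left)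
      finally have "c * (measure M A * measure M W) \<le> c * (measure M A * measure M B + \<epsilon>')"
        using c by (rule mult_left_mono)
      then have "c * (measure M A * measure M W) + \<epsilon>' \<le> c * (measure M A * measure M B) + \<epsilon>"
        using \<epsilon>'(2) by (simp add: distrib_left)
      then show ?thesis by (simp add: mult_left_mono flip: distrib_left)
    qed
    finally show "(\<Sum>t\<in>box n. measure M (A \<inter> (shift k m t -` B \<inter> space M))) \<le>
        card (box n) * (real p ^ ((k + a) * card I) * (measure M A * measure M B) + \<epsilon>)"
      by (simp add: c_def)
  qed
qed

text \<open>
  Averaging over ever larger boxes: the pair \<open>(x, shift k m t x)\<close> is asymptotically distributed
  with density at most \<open>c\<close> with respect to the product measure.
\<close>

lemma shift_return_le:
  assumes J: "finite J" "\<And>j. j \<in> J \<Longrightarrow> A j \<in> sets M" "\<And>j. j \<in> J \<Longrightarrow> B j \<in> sets M"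
    and m: "0 < m" "m \<le> p ^ a"
    and return: "\<And>t. \<gamma> \<le> (\<Sum>j\<in>J. measure M (A j \<inter> (shift k m t -` B j \<inter> space M)))"
  shows "\<gamma> \<le> real p ^ ((k + a) * card I) * (\<Sum>j\<in>J. measure M (A j) * measure M (B j))"
proof (rule field_le_epsilon)
  define c where "c = real p ^ ((k + a) * card I)"
  fix \<epsilon> :: real assume "\<epsilon> > 0"
  define \<epsilon>' where "\<epsilon>' = \<epsilon> / (card J + 1)"
  have \<epsilon>': "\<epsilon>' > 0" "card J * \<epsilon>' \<le> \<epsilon>" using \<open>\<epsilon> > 0\<close> by (simp_all add: \<epsilon>'_def field_simps)
  have "\<forall>\<^sub>F n in sequentially. \<forall>j\<in>J. (\<Sum>t\<in>box n. measure M (A j \<inter> (shift k m t -` B j \<inter> space M)))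
      \<le> card (box n) * (c * (measure M (A j) * measure M (B j)) + \<epsilon>')"
    unfolding c_def
    using sum_measure_shift_eventually_le J m \<epsilon>'(1) by (intro eventually_ball_finite) auto
  then obtain n where n: "\<And>j. j \<in> J \<Longrightarrow>
      (\<Sum>t\<in>box n. measure M (A j \<inter> (shift k m t -` B j \<inter> space M)))
      \<le> card (box n) * (c * (measure M (A j) * measure M (B j)) + \<epsilon>')"
    by (auto simp: eventually_sequentially)
  have "card (box n) * \<gamma> = (\<Sum>t\<in>box n. \<gamma>)" by simp
  also have "\<dots> \<le> (\<Sum>t\<in>box n. \<Sum>j\<in>J. measure M (A j \<inter> (shift k m t -` B j \<inter> space M)))"
    by (intro sum_mono return)
  also have "\<dots> = (\<Sum>j\<in>J. \<Sum>t\<in>box n. measure M (A j \<inter> (shift k m t -` B j \<inter> space M)))"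
    by (rule sum.swap)
  also have "\<dots> \<le> (\<Sum>j\<in>J. card (box n) * (c * (measure M (A j) * measure M (B j)) + \<epsilon>'))"
    by (intro sum_mono n)
  also have "\<dots> = card (box n) * (c * (\<Sum>j\<in>J. measure M (A j) * measure M (B j)) + card J * \<epsilon>')"
    by (simp add: sum.distrib sum_distrib_left[symmetric])
  finally have "\<gamma> \<le> c * (\<Sum>j\<in>J. measure M (A j) * measure M (B j)) + card J * \<epsilon>'"
    using p_gt_1 by (simp add: card_box)
  then show "\<gamma> \<le> real p ^ ((k + a) * card I) * (\<Sum>j\<in>J. measure M (A j) * measure M (B j)) + \<epsilon>"
    using \<epsilon>'(2) by (simp add: c_def)
qed

theorem ergodic:
  assumes D: "D \<in> sets M" "\<And>t x. x \<in> space M \<Longrightarrow> T t x \<in> D \<longleftrightarrow> x \<in> D" and pos: "measure M D > 0"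
  shows "measure M D = 1"
proof -
  have "D \<inter> (shift 0 1 t -` D \<inter> space M) = D" for t
    using D(2) sets.sets_into_space[OF D(1)] by (auto simp: shift_def)
  then have "measure M D \<le> measure M D * measure M D"
    using shift_return_le[of "{()}" "\<lambda>_. D" "\<lambda>_. D" 1 0 "measure M D" 0] D(1) by simp
  then have "1 \<le> measure M D" using pos by simp
  then show ?thesis using prob_le_1[of D] by simp
qed

end

lemma (in prob_space) measure_pair_same_value:
  assumes fin: "finite (h ` space M)" and fibres: "\<And>v. {x \<in> space M. h x = v} \<in> sets M"
  shows "{z \<in> space M \<times> space M. h (fst z) = h (snd z)} \<in> sets (M \<Otimes>\<^sub>M M)"
    "measure (M \<Otimes>\<^sub>M M) {z \<in> space M \<times> space M. h (fst z) = h (snd z)} =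
      (\<Sum>v\<in>h ` space M. (measure M {x \<in> space M. h x = v})\<^sup>2)"
proof -
  interpret pair: pair_prob_space M M ..
  let ?V = "\<lambda>v. {x \<in> space M. h x = v}"
  have eq: "{z \<in> space M \<times> space M. h (fst z) = h (snd z)} = (\<Union>v\<in>h ` space M. ?V v \<times> ?V v)"
    by auto
  show "{z \<in> space M \<times> space M. h (fst z) = h (snd z)} \<in> sets (M \<Otimes>\<^sub>M M)"
    unfolding eq by (intro sets.finite_UN fin pair_measureI fibres)
  have "measure (M \<Otimes>\<^sub>M M) (\<Union>v\<in>h ` space M. ?V v \<times> ?V v) =
      (\<Sum>v\<in>h ` space M. measure (M \<Otimes>\<^sub>M M) (?V v \<times> ?V v))"
    using fin fibres
    by (intro pair.P.finite_measure_finite_Union) (auto simp: disjoint_family_on_def)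
  then show "measure (M \<Otimes>\<^sub>M M) {z \<in> space M \<times> space M. h (fst z) = h (snd z)} =
      (\<Sum>v\<in>h ` space M. (measure M {x \<in> space M. h x = v})\<^sup>2)"
    by (simp only: eq measure_pair_Times[OF fibres fibres] power2_eq_square)
qed

lemma (in prob_space) ex_positive_fibre_of_pair_measure:
  assumes S: "{z \<in> space M \<times> space M. f (fst z) = f (snd z)} \<in> sets (M \<Otimes>\<^sub>M M)"
    and pos: "0 < measure (M \<Otimes>\<^sub>M M) {z \<in> space M \<times> space M. f (fst z) = f (snd z)}"
  shows "\<exists>x0\<in>space M. measure M {x \<in> space M. f x = f x0} > 0"
proof (rule ccontr)
  let ?S = "{z \<in> space M \<times> space M. f (fst z) = f (snd z)}"
  assume neg: "\<not> ?thesis"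
  have "emeasure (M \<Otimes>\<^sub>M M) ?S = (\<integral>\<^sup>+x. emeasure M (Pair x -` ?S) \<partial>M)"
    by (rule emeasure_pair_measure_alt[OF S])
  also have "\<dots> = (\<integral>\<^sup>+x. 0 \<partial>M)"
  proof (rule nn_integral_cong)
    fix x assume x: "x \<in> space M"
    then have "Pair x -` ?S = {y \<in> space M. f y = f x}" by auto
    moreover have "measure M {y \<in> space M. f y = f x} = 0"
      using neg x by (auto simp: zero_less_measure_iff)
    ultimately show "emeasure M (Pair x -` ?S) = 0" by (simp add: emeasure_eq_measure)
  qed
  finally show False using pos by (simp add: measure_def)
qed

lemma (in odometer) shift_return_same_value_le:
  assumes fin: "finite (h ` space M)" and fibres: "\<And>v. {x \<in> space M. h x = v} \<in> sets M"
    and m: "0 < m" "m \<le> p ^ a"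
    and return: "\<And>t. \<gamma> \<le> measure M {x \<in> space M. h (shift k m t x) = h x}"
  shows "\<gamma> \<le> real p ^ ((k + a) * card I) *
    measure (M \<Otimes>\<^sub>M M) {z \<in> space M \<times> space M. h (fst z) = h (snd z)}"
proof -
  let ?V = "\<lambda>v. {x \<in> space M. h x = v}"
  have "\<gamma> \<le> real p ^ ((k + a) * card I) * (\<Sum>v\<in>h ` space M. measure M (?V v) * measure M (?V v))"
  proof (rule shift_return_le[OF fin fibres fibres m])
    fix t
    have "{x \<in> space M. h (shift k m t x) = h x} =
        (\<Union>v\<in>h ` space M. ?V v \<inter> (shift k m t -` ?V v \<inter> space M))"
      by (auto simp: shift_space)
    moreover have "measure M (\<Union>v\<in>h ` space M. ?V v \<inter> (shift k m t -` ?V v \<inter> space M)) \<le>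
        (\<Sum>v\<in>h ` space M. measure M (?V v \<inter> (shift k m t -` ?V v \<inter> space M)))"
      using sets.Int[OF fibres shift_vimage_sets[OF fibres]]
      by (intro finite_measure_subadditive_finite[OF fin]) blast
    ultimately show "\<gamma> \<le> (\<Sum>v\<in>h ` space M. measure M (?V v \<inter> (shift k m t -` ?V v \<inter> space M)))"
      using return[of t] by simp
  qed
  then show ?thesis
    by (simp only: measure_pair_same_value(2)[OF fin fibres] power2_eq_square)
qed

lemma ex_countable_open_separation:
  "\<exists>U :: nat \<Rightarrow> 'z :: {second_countable_topology, t1_space} set.
     (\<forall>i. open (U i)) \<and> inj (\<lambda>x. {i. x \<in> U i})"
proof -
  obtain B :: "'z set set" where B: "countable B" "topological_basis B"
    using ex_countable_basis by blast
  let ?U = "from_nat_into (insert {} B)"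
  have "x = y" if same: "{i. x \<in> ?U i} = {i. y \<in> ?U i}" for x y
  proof (rule ccontr)
    assume "x \<noteq> y"
    then obtain V where "open V" "x \<in> V" "y \<notin> V" using t1_space by blast
    then obtain W where "W \<in> B" "x \<in> W" "y \<notin> W" using topological_basisE[OF B(2)] by blast
    then show False
      using same from_nat_into_surj[of "insert {} B" W] B(1) by auto
  qed
  moreover have "open (?U i)" for i
    using from_nat_into[of "insert {} B" i] topological_basis_open[OF B(2)] by auto
  ultimately show ?thesis by (intro exI[of _ ?U]) (auto simp: inj_def)
qed

definition readings :: "(nat \<Rightarrow> 'z set) \<Rightarrow> nat \<Rightarrow> 'z \<Rightarrow> nat set" where
  "readings U n y = {i \<in> {..<n}. y \<in> U i}"

lemma finite_image_readings: "finite ((\<lambda>x. readings U n (f x)) ` A)"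
  by (rule finite_subset[of _ "Pow {..<n}"]) (auto simp: readings_def)

lemma readings_eq_sets:
  fixes f g :: "'x \<Rightarrow> 'z :: topological_space"
  assumes [measurable]: "f \<in> borel_measurable M" "g \<in> borel_measurable M" and U: "\<forall>i. open (U i)"
  shows "{x \<in> space M. readings U n (f x) = readings U n (g x)} \<in> sets M"
proof -
  have [measurable]: "U i \<in> sets borel" for i using U by simp
  have "{x \<in> space M. readings U n (f x) = readings U n (g x)} =
      {x \<in> space M. \<forall>i\<in>{..<n}. f x \<in> U i \<longleftrightarrow> g x \<in> U i}"
    by (auto simp: readings_def)
  also have "\<dots> \<in> sets M" by measurable
  finally show ?thesis .
qed

lemma readings_fibre_sets:
  assumes f: "f \<in> borel_measurable M" and U: "\<forall>i. open (U i)"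
  shows "{x \<in> space M. readings U n (f x) = v} \<in> sets M"
proof (cases "\<exists>y\<in>space M. readings U n (f y) = v")
  case True
  then obtain y where "readings U n (f y) = v" by blast
  then show ?thesis using readings_eq_sets[OF f borel_measurable_const U, of n "f y"] by simp
next
  case False
  then have "{x \<in> space M. readings U n (f x) = v} = {}" by blast
  then show ?thesis by (simp only: sets.empty_sets)
qed

lemma all_readings_eq_iff:
  assumes "inj (\<lambda>y. {i. y \<in> U i})"
  shows "(\<forall>n. readings U n y = readings U n z) \<longleftrightarrow> y = z"
proof
  assume same: "\<forall>n. readings U n y = readings U n z"
  have "i \<in> readings U (Suc i) y \<longleftrightarrow> y \<in> U i" for i y by (simp add: readings_def)
  then show "y = z" using same by (intro injD[OF assms]) blast
qed simp

theorem (in odometer) ex_positive_fibre_of_return: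
  fixes f :: "'x \<Rightarrow> 'z :: {second_countable_topology, t1_space}"
  assumes f [measurable]: "f \<in> borel_measurable M" and m: "0 < m" and "\<gamma> > 0"
    and return: "\<And>t. \<gamma> \<le> measure M {x \<in> space M. f (shift k m t x) = f x}"
  shows "\<exists>x0\<in>space M. measure M {x \<in> space M. f x = f x0} > 0"
proof -
  interpret pair: pair_prob_space M M ..
  obtain U :: "nat \<Rightarrow> 'z set" where U_open: "\<forall>i. open (U i)" and separate: "inj (\<lambda>x. {i. x \<in> U i})"
    using ex_countable_open_separation by blast
  let ?h = "\<lambda>n x. readings U n (f x)"
  define S where "S n = {z \<in> space M \<times> space M. ?h n (fst z) = ?h n (snd z)}" for n
  note fibres = readings_fibre_sets[OF f U_open]
  note S_sets = measure_pair_same_value(1)[OF finite_image_readings fibres, folded S_def]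
  have h_return: "\<gamma> \<le> measure M {x \<in> space M. ?h n (shift k m t x) = ?h n x}" for n t
  proof -
    have "measure M {x \<in> space M. f (shift k m t x) = f x} \<le>
        measure M {x \<in> space M. ?h n (shift k m t x) = ?h n x}"
      using U_open by (intro finite_measure_mono readings_eq_sets) auto
    then show ?thesis using return[of t] by linarith
  qed
  have "m \<le> p ^ m" using p_gt_1 less_exp[of m] power_mono[of 2 p m] by linarith
  then have "\<gamma> \<le> real p ^ ((k + m) * card I) * measure (M \<Otimes>\<^sub>M M) (S n)" for n
    unfolding S_def
    by (rule shift_return_same_value_le[OF finite_image_readings fibres m _ h_return])
  then have S_ge: "\<gamma> / real p ^ ((k + m) * card I) \<le> measure (M \<Otimes>\<^sub>M M) (S n)" for n
    using p_gt_1 by (simp add: field_simps)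
  have "decseq S"
    by (intro decseq_SucI subsetI) (auto simp: S_def readings_def less_Suc_eq)
  then have "(\<lambda>n. measure (M \<Otimes>\<^sub>M M) (S n)) \<longlonglongrightarrow> measure (M \<Otimes>\<^sub>M M) (\<Inter>n. S n)"
    using S_sets by (intro pair.P.finite_Lim_measure_decseq) auto
  then have "\<gamma> / real p ^ ((k + m) * card I) \<le> measure (M \<Otimes>\<^sub>M M) (\<Inter>n. S n)"
    using S_ge by (intro LIMSEQ_le_const) auto
  moreover have "(\<Inter>n. S n) = {z \<in> space M \<times> space M. f (fst z) = f (snd z)}"
    using all_readings_eq_iff[OF separate] by (auto simp: S_def)
  moreover have "(\<Inter>n. S n) \<in> sets (M \<Otimes>\<^sub>M M)" using S_sets by auto
  moreover have "0 < \<gamma> / real p ^ ((k + m) * card I)" using p_gt_1 \<open>\<gamma> > 0\<close> by simp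
  ultimately show ?thesis by (intro ex_positive_fibre_of_pair_measure) auto
qed

context odometer begin

definition same_cell :: "nat \<Rightarrow> ('x \<times> 'x) set" where
  "same_cell k = {z \<in> space M \<times> space M. code k (fst z) = code k (snd z)}"

definition cell_pair_measure :: "nat \<Rightarrow> ('x \<times> 'x) measure" where
  "cell_pair_measure k = uniform_measure (M \<Otimes>\<^sub>M M) (same_cell k)"

definition cell_density :: "nat \<Rightarrow> 'b \<Rightarrow> ('x \<times> 'x) set \<Rightarrow> real" where
  "cell_density k b S = (num_cells k)\<^sup>2 * measure (M \<Otimes>\<^sub>M M) (S \<inter> cell k b \<times> cell k b)"

lemma prob_space_pair: "prob_space (M \<Otimes>\<^sub>M M)"
proof -
  interpret pair: pair_prob_space M M ..
  show ?thesis by (rule pair.P.prob_space_axioms)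
qed

lemma finite_measure_pair: "finite_measure (M \<Otimes>\<^sub>M M)"
  using prob_space_pair by (simp add: prob_space_def)

lemma same_cell_sets [measurable]: "same_cell k \<in> sets (M \<Otimes>\<^sub>M M)"
  unfolding same_cell_def by (rule measure_pair_same_value(1)[OF finite_code code_sets])

lemma measure_same_cell: "measure (M \<Otimes>\<^sub>M M) (same_cell k) = 1 / num_cells k"
proof -
  have "measure (M \<Otimes>\<^sub>M M) (same_cell k) = (\<Sum>b\<in>code k ` space M. (measure M (cell k b))\<^sup>2)"
    unfolding same_cell_def cell_def by (rule measure_pair_same_value(2)[OF finite_code code_sets])
  also have "\<dots> = num_cells k * (1 / num_cells k)\<^sup>2"
    by (simp add: measure_cell num_cells_def)
  finally show ?thesis using num_cells_pos[of k] by (simp add: power2_eq_square)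
qed

lemma sets_cell_pair_measure [simp]: "sets (cell_pair_measure k) = sets (M \<Otimes>\<^sub>M M)"
  by (simp add: cell_pair_measure_def)

lemma space_cell_pair_measure: "space (cell_pair_measure k) = space M \<times> space M"
  by (simp add: cell_pair_measure_def space_pair_measure)

lemma emeasure_same_cell_pos: "emeasure (M \<Otimes>\<^sub>M M) (same_cell k) \<noteq> 0"
  using measure_same_cell[of k] num_cells_pos[of k] by (auto simp: measure_def)

lemma prob_space_cell_pair_measure: "prob_space (cell_pair_measure k)"
  unfolding cell_pair_measure_def
  using emeasure_same_cell_pos finite_measure.emeasure_finite[OF finite_measure_pair]
  by (intro prob_space_uniform_measure) auto

lemma measure_cell_pair_measure:
  assumes "S \<in> sets (M \<Otimes>\<^sub>M M)"
  shows "measure (cell_pair_measure k) S = num_cells k * measure (M \<Otimes>\<^sub>M M) (S \<inter> same_cell k)"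
  using measure_uniform_measure[OF emeasure_same_cell_pos _ assms, of k] measure_same_cell[of k]
    finite_measure.emeasure_finite[OF finite_measure_pair]
  by (simp add: cell_pair_measure_def Int_commute)

lemma measure_cell_pair_measure_mono:
  assumes "A \<in> sets (M \<Otimes>\<^sub>M M)" "B \<in> sets (M \<Otimes>\<^sub>M M)" "A \<inter> same_cell k \<subseteq> B"
  shows "measure (cell_pair_measure k) A \<le> measure (cell_pair_measure k) B"
  unfolding measure_cell_pair_measure[OF assms(1)] measure_cell_pair_measure[OF assms(2)]
  using assms
  by (intro mult_left_mono finite_measure.finite_measure_mono[OF finite_measure_pair]) auto

lemma sum_cell_density:
  assumes "S \<in> sets (M \<Otimes>\<^sub>M M)"
  shows "(\<Sum>b\<in>code k ` space M. cell_density k b S) = num_cells k * measure (cell_pair_measure k) S"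
proof -
  have "S \<inter> same_cell k = (\<Union>b\<in>code k ` space M. S \<inter> cell k b \<times> cell k b)"
    by (auto simp: same_cell_def cell_def)
  moreover have "measure (M \<Otimes>\<^sub>M M) (\<Union>b\<in>code k ` space M. S \<inter> cell k b \<times> cell k b) =
      (\<Sum>b\<in>code k ` space M. measure (M \<Otimes>\<^sub>M M) (S \<inter> cell k b \<times> cell k b))"
    using assms disjoint_family_on_cell[of k "code k ` space M"]
    by (intro finite_measure.finite_measure_finite_Union[OF finite_measure_pair] finite_code)
      (auto simp: disjoint_family_on_def)
  ultimately show ?thesis
    by (simp add: measure_cell_pair_measure[OF assms] cell_density_def power2_eq_square
        sum_distrib_left mult.assoc)
qed

lemma measure_cell_pair_measure_le_marginal:
  assumes E: "E \<in> sets M"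
  shows "measure (cell_pair_measure k) (E \<times> space M \<union> space M \<times> E) \<le> 2 * measure M E"
proof -
  interpret P: prob_space "cell_pair_measure k" by (rule prob_space_cell_pair_measure)
  have Int_eq: "(A \<times> B) \<inter> C \<times> C = (A \<inter> C) \<times> (B \<inter> C)" for A B C :: "'x set" by auto
  have marginal: "measure (cell_pair_measure k) (A \<times> B) = measure M E"
    if AB: "A \<in> sets M" "B \<in> sets M" and E_or: "A = E \<and> B = space M \<or> A = space M \<and> B = E" for A B
  proof -
    have "num_cells k * measure (cell_pair_measure k) (A \<times> B) =
        (\<Sum>b\<in>code k ` space M. (num_cells k)\<^sup>2 * (measure M (A \<inter> cell k b) * measure M (B \<inter> cell k b)))"
      using AB by (subst sum_cell_density[symmetric])
        (auto simp: cell_density_def Int_eq measure_pair_Times)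
    also have "\<dots> = (\<Sum>b\<in>code k ` space M. num_cells k * measure M (E \<inter> cell k b))"
      using E_or num_cells_pos[of k]
      by (intro sum.cong refl)
        (auto simp: measure_cell cell_subset_space Int_absorb1 power2_eq_square)
    also have "\<dots> = num_cells k * measure M E"
      using sum_measure_Int_cell[OF E, of k] by (simp flip: sum_distrib_left)
    finally show ?thesis using num_cells_pos[of k] by simp
  qed
  have "measure (cell_pair_measure k) (E \<times> space M \<union> space M \<times> E) \<le>
      measure (cell_pair_measure k) (E \<times> space M) + measure (cell_pair_measure k) (space M \<times> E)"
    by (rule measure_Un_le) (use E in auto)
  then show ?thesis using marginal[of E "space M"] marginal[of "space M" E] E by simp
qed

lemma cell_density_nonneg: "0 \<le> cell_density k b S"
  by (simp add: cell_density_def)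

lemma measure_Int_cell_square:
  "measure (M \<Otimes>\<^sub>M M) (S \<inter> cell k b \<times> cell k b) = cell_density k b S * (1 / num_cells k)\<^sup>2"
  using num_cells_pos[of k] by (simp add: cell_density_def power_divide)

lemma cell_density_le_1:
  assumes "b \<in> code k ` space M"
  shows "cell_density k b S \<le> 1"
proof -
  have "measure (M \<Otimes>\<^sub>M M) (S \<inter> cell k b \<times> cell k b) \<le> measure (M \<Otimes>\<^sub>M M) (cell k b \<times> cell k b)"
    by (intro finite_measure.finite_measure_mono[OF finite_measure_pair]) auto
  also have "\<dots> = (1 / num_cells k)\<^sup>2"
    by (simp add: measure_pair_Times measure_cell[OF assms] power2_eq_square)
  finally show ?thesis
    using num_cells_pos[of k] by (simp add: measure_Int_cell_square)
qed

lemma measure_Int_not_nearly_full_cell_le: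
  assumes sets: "B \<in> sets M" "E \<in> sets M" and e: "e \<le> 1"
    and decide: "\<And>x y. x \<in> space M - E \<Longrightarrow> y \<in> space M - E \<Longrightarrow> code k x = code k y \<Longrightarrow> x \<in> B \<longleftrightarrow> y \<in> B"
    and not_full: "e * measure M (cell k b) < measure M (cell k b - B)" and "0 \<le> e"
  shows "e * measure M (B \<inter> cell k b) \<le> measure M (E \<inter> cell k b)"
proof (cases "B \<inter> cell k b \<subseteq> E")
  case True
  have "e * measure M (B \<inter> cell k b) \<le> measure M (B \<inter> cell k b)"
    using e \<open>0 \<le> e\<close> by (intro mult_left_le_one_le) auto
  also have "\<dots> \<le> measure M (E \<inter> cell k b)"
    using True sets by (intro finite_measure_mono) auto
  finally show ?thesis .
next
  case False
  then obtain y where "y \<in> space M - E" "y \<in> B" "code k y = b" by (auto simp: cell_def)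
  then have "x \<in> E" if "x \<in> cell k b - B" for x
    using that decide[of x y] by (auto simp: cell_def)
  then have "measure M (cell k b - B) \<le> measure M (E \<inter> cell k b)"
    using sets by (intro finite_measure_mono) auto
  moreover have "e * measure M (B \<inter> cell k b) \<le> e * measure M (cell k b)"
    using \<open>0 \<le> e\<close> by (intro mult_left_mono finite_measure_mono) auto
  ultimately show ?thesis using not_full by linarith
qed

lemma eventually_many_nearly_full_cells:
  assumes B: "B \<in> sets M" "measure M B > 0" and e: "0 < e" "e \<le> 1"
  shows "\<forall>\<^sub>F k in sequentially. measure M B / 2 * num_cells k \<le>
    card {b \<in> code k ` space M. measure M (cell k b - B) \<le> e * measure M (cell k b)}"
proof -
  obtain E l where E: "E \<in> sets M" "measure M E < e * measure M B / 2"
    and decide: "\<And>x y k. \<lbrakk>l \<le> k; x \<in> space M - E; y \<in> space M - E; code k x = code k y\<rbrakk> \<Longrightarrow>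
      x \<in> B \<longleftrightarrow> y \<in> B"
    using cells_decide_set[OF B(1), of "e * measure M B / 2"] B(2) e by auto
  show ?thesis
  proof (rule eventually_sequentiallyI[of l])
    fix k assume k: "l \<le> k"
    define F where "F = {b \<in> code k ` space M. measure M (cell k b - B) \<le> e * measure M (cell k b)}"
    have F: "F \<subseteq> code k ` space M" by (auto simp: F_def)
    have in_cell: "measure M (B \<inter> cell k b) \<le>
        of_bool (b \<in> F) / num_cells k + measure M (E \<inter> cell k b) / e"
      if b: "b \<in> code k ` space M" for b
    proof (cases "b \<in> F")
      case True
      have "measure M (B \<inter> cell k b) \<le> measure M (cell k b)" by (rule finite_measure_mono) auto
      also have "\<dots> = of_bool (b \<in> F) / num_cells k" using True b by (simp add: measure_cell)
      also have "\<dots> \<le> of_bool (b \<in> F) / num_cells k + measure M (E \<inter> cell k b) / e" using e by simp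
      finally show ?thesis .
    next
      case False
      then have not_full: "e * measure M (cell k b) < measure M (cell k b - B)"
        using b by (simp add: F_def not_le)
      have "e * measure M (B \<inter> cell k b) \<le> measure M (E \<inter> cell k b)"
        by (rule measure_Int_not_nearly_full_cell_le[OF B(1) E(1) e(2) decide[OF k] not_full])
          (use e(1) in simp_all)
      then show ?thesis using False e by (simp add: field_simps)
    qed
    have "measure M B \<le>
        (\<Sum>b\<in>code k ` space M. of_bool (b \<in> F) / num_cells k + measure M (E \<inter> cell k b) / e)"
      unfolding sum_measure_Int_cell[OF B(1), of k, symmetric] by (intro sum_mono in_cell)
    also have "\<dots> = card F / num_cells k + measure M E / e"
      using F by (simp add: sum.distrib sum_measure_Int_cell[OF E(1)] finite_code Int_absorb1
          flip: sum_divide_distrib)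
    also have "measure M E / e < measure M B / 2" using E(2) e by (simp add: field_simps)
    finally have "measure M B / 2 < card F / num_cells k" by linarith
    then show "measure M B / 2 * num_cells k \<le> card F"
      using num_cells_pos[of k] by (metis less_imp_le of_nat_0_less_iff pos_less_divide_eq)
  qed
qed

end

lemma sum_lower_bound_of_triangle:
  fixes d :: "nat \<Rightarrow> real"
  assumes bounds: "\<And>v. 0 \<le> d v" "\<And>v. d v \<le> 1" and triangle: "\<And>v. d s \<le> d v + d (s + v)"
  shows "N * d s \<le> 2 * (\<Sum>v<N. d v) + s"
proof -
  have "N * d s = (\<Sum>v<N. d s)" by simp
  also have "\<dots> \<le> (\<Sum>v<N. d v + d (s + v))" by (intro sum_mono triangle)
  also have "\<dots> = (\<Sum>v<N. d v) + (\<Sum>v=s..<N + s. d v)"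
    using sum.shift_bounds_nat_ivl[of d 0 s N]
    by (simp add: sum.distrib lessThan_atLeast0 add.commute)
  also have "(\<Sum>v=s..<N + s. d v) \<le> (\<Sum>v<N + s. d v)" using bounds by (intro sum_mono2) auto
  also have "\<dots> = (\<Sum>v<N. d v) + (\<Sum>v=N..<N + s. d v)"
    by (simp add: lessThan_atLeast0 sum.atLeastLessThan_concat)
  also have "(\<Sum>v=N..<N + s. d v) \<le> (\<Sum>v=N..<N + s. 1)" using bounds by (intro sum_mono) auto
  finally show ?thesis by simp
qed

text \<open>
  A bound on the sums for each single \<open>v\<close> limits the set of \<open>b\<close> for which \<open>d b v\<close> is ever large:
  by the triangle inequality one large value makes the average of \<open>d b\<close> large.
\<close>

lemma card_ever_large_le:
  fixes d :: "'b \<Rightarrow> nat \<Rightarrow> real" and A c :: real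
  assumes Q: "finite Q" and bounds: "\<And>b v. b \<in> Q \<Longrightarrow> 0 \<le> d b v" "\<And>b v. b \<in> Q \<Longrightarrow> d b v \<le> 1"
    and triangle: "\<And>b s v. b \<in> Q \<Longrightarrow> d b s \<le> d b v + d b (s + v)"
    and sum_le: "\<And>v. (\<Sum>b\<in>Q. d b v) \<le> A" and "c \<ge> 0"
  shows "card {b \<in> Q. \<exists>s. c < d b s} * c \<le> 2 * A"
proof -
  define X where "X = {b \<in> Q. \<exists>s. c < d b s}"
  have X: "finite X" "X \<subseteq> Q" using Q by (auto simp: X_def)
  have "\<forall>b\<in>X. \<exists>s. c < d b s" by (simp add: X_def)
  then obtain s where s: "\<And>b. b \<in> X \<Longrightarrow> c < d b (s b)" by metis
  have average: "card X * c \<le> 2 * A + real (\<Sum>b\<in>X. s b) * inverse (real (Suc n))" for n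
  proof -
    have "Suc n * (card X * c) = (\<Sum>b\<in>X. Suc n * c)" by simp
    also have "\<dots> \<le> (\<Sum>b\<in>X. 2 * (\<Sum>v<Suc n. d b v) + s b)"
    proof (rule sum_mono)
      fix b assume b: "b \<in> X"
      have "Suc n * c \<le> Suc n * d b (s b)" using s[OF b] by (intro mult_left_mono) auto
      also have "\<dots> \<le> 2 * (\<Sum>v<Suc n. d b v) + s b"
        using X b bounds triangle by (intro sum_lower_bound_of_triangle) auto
      finally show "Suc n * c \<le> 2 * (\<Sum>v<Suc n. d b v) + s b" .
    qed
    also have "\<dots> = 2 * (\<Sum>v<Suc n. \<Sum>b\<in>X. d b v) + (\<Sum>b\<in>X. s b)"
      by (simp add: sum.distrib sum.swap[of _ X] del: sum.lessThan_Suc flip: sum_distrib_left)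
    also have "(\<Sum>v<Suc n. \<Sum>b\<in>X. d b v) \<le> (\<Sum>v<Suc n. A)"
      using Q X bounds by (intro sum_mono order.trans[OF sum_mono2 sum_le]) auto
    finally show ?thesis by (simp add: field_simps)
  qed
  have "(\<lambda>n. 2 * A + real (\<Sum>b\<in>X. s b) * inverse (real (Suc n))) \<longlonglongrightarrow> 2 * A + real (\<Sum>b\<in>X. s b) * 0"
    by (intro tendsto_intros LIMSEQ_inverse_real_of_nat)
  then have "card X * c \<le> 2 * A" using average by (intro LIMSEQ_le_const) auto
  then show ?thesis by (simp add: X_def)
qed

section \<open>Homomorphisms into orbit relations\<close>

locale countable_transformation_group =
  fixes L :: "('y \<Rightarrow> 'y) set"
  assumes countable: "countable L"
    and bij: "l \<in> L \<Longrightarrow> bij l"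
    and id: "id \<in> L"
    and comp: "l \<in> L \<Longrightarrow> m \<in> L \<Longrightarrow> l \<circ> m \<in> L"
    and inv: "l \<in> L \<Longrightarrow> the_inv l \<in> L"
begin

lemma inv_apply [simp]: "l \<in> L \<Longrightarrow> the_inv l (l y) = y"
  and apply_inv [simp]: "l \<in> L \<Longrightarrow> l (the_inv l y) = y"
  using bij by (auto simp: bij_def the_inv_f_f f_the_inv_into_f)

lemma funpow: "u \<in> L \<Longrightarrow> u ^^ j \<in> L"
  by (induction j) (simp_all add: id comp flip: id_def)

definition stabiliser :: "'y \<Rightarrow> ('y \<Rightarrow> 'y) set" where
  "stabiliser y = {l \<in> L. l y = y}"

definition diagonal_orbit :: "'y \<times> 'y \<Rightarrow> ('y \<times> 'y) set" where
  "diagonal_orbit w = (\<lambda>l. map_prod l l w) ` L"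

lemma eq_apply_if_stabiliser_eq:
  assumes "stabiliser y = stabiliser z" "l \<in> L" "m \<in> L" "l y = m y"
  shows "l z = m z"
proof -
  have "the_inv m \<circ> l \<in> stabiliser y"
    using assms(2-4) inv_apply[of m y] by (simp add: stabiliser_def comp inv)
  then have "the_inv m \<circ> l \<in> stabiliser z" using assms(1) by simp
  then have "the_inv m (l z) = z" by (simp add: stabiliser_def)
  then show ?thesis using apply_inv[OF \<open>m \<in> L\<close>, of "l z"] by simp
qed

lemma diagonal_orbit_subset:
  assumes "l \<in> L"
  shows "diagonal_orbit (map_prod l l w) \<subseteq> diagonal_orbit w"
  unfolding diagonal_orbit_def
proof (intro image_subsetI)
  fix m assume "m \<in> L"
  then show "map_prod m m (map_prod l l w) \<in> (\<lambda>l. map_prod l l w) ` L"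
    using comp[OF _ assms]
    by (intro image_eqI[of _ _ "m \<circ> l"]) (auto simp: map_prod.compositionality)
qed

lemma diagonal_orbit_eq_iff: "diagonal_orbit w = diagonal_orbit w' \<longleftrightarrow> (\<exists>l\<in>L. map_prod l l w = w')"
proof
  have "map_prod id id w' \<in> diagonal_orbit w'"
    unfolding diagonal_orbit_def using id by (rule imageI)
  moreover assume "diagonal_orbit w = diagonal_orbit w'"
  ultimately have "w' \<in> diagonal_orbit w" by (simp add: prod.map_id)
  then show "\<exists>l\<in>L. map_prod l l w = w'" by (auto simp: diagonal_orbit_def)
next
  assume "\<exists>l\<in>L. map_prod l l w = w'"
  then obtain l where l: "l \<in> L" "map_prod l l w = w'" by blast
  then have "map_prod (the_inv l) (the_inv l) w' = w" by (cases w) auto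
  then show "diagonal_orbit w = diagonal_orbit w'"
    using diagonal_orbit_subset[OF l(1), of w] diagonal_orbit_subset[OF inv[OF l(1)], of w'] l(2)
    by simp
qed

end

lemma psd_kernel_same_class: "psd_kernel (\<lambda>i j. of_bool (c i = c j))"
  unfolding psd_kernel_def
proof (intro conjI allI)
  fix n :: nat and s and a :: "nat \<Rightarrow> real"
  let ?V = "(\<lambda>i. c (s i)) ` {..<n}"
  have in_classes: "of_bool (c (s i) = c (s j)) =
      (\<Sum>v\<in>?V. of_bool (c (s i) = v) * of_bool (c (s j) = v) :: real)" if "i < n" for i j
  proof -
    have "(\<Sum>v\<in>?V. of_bool (c (s i) = v) * of_bool (c (s j) = v) :: real) =
        (\<Sum>v\<in>?V. if c (s i) = v then of_bool (c (s j) = v) else 0)"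
      by (intro sum.cong) auto
    then show ?thesis using that by (simp add: eq_commute)
  qed
  have "(\<Sum>i<n. \<Sum>j<n. a i * a j * of_bool (c (s i) = c (s j))) =
      (\<Sum>i<n. \<Sum>j<n. \<Sum>v\<in>?V. (a i * of_bool (c (s i) = v)) * (a j * of_bool (c (s j) = v)))"
    by (intro sum.cong refl) (simp only: in_classes lessThan_iff sum_distrib_left mult_ac)
  also have "\<dots> = (\<Sum>v\<in>?V. (\<Sum>i<n. a i * of_bool (c (s i) = v))\<^sup>2)"
    by (simp only: power2_eq_square sum_product sum.swap[where B = ?V])
  also have "\<dots> \<ge> 0" by (intro sum_nonneg) simp
  finally show "0 \<le> (\<Sum>i<n. \<Sum>j<n. a i * a j * of_bool (c (s i) = c (s j)))" .
qed auto

lemma psd_kernel_integral: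
  assumes int: "\<And>i j. integrable N (K i j)" and psd: "\<And>z. z \<in> space N \<Longrightarrow> psd_kernel (\<lambda>i j. K i j z)"
  shows "psd_kernel (\<lambda>i j. LINT z|N. K i j z)"
  unfolding psd_kernel_def
proof (intro conjI allI)
  fix i j show "(LINT z|N. K i j z) = (LINT z|N. K j i z)"
    using psd_kernel_sym[OF psd] by (intro Bochner_Integration.integral_cong refl)
next
  fix n :: nat and s a
  have "0 \<le> (LINT z|N. (\<Sum>i<n. \<Sum>j<n. a i * a j * K (s i) (s j) z))"
    using psd by (intro integral_nonneg_AE AE_I2) (auto simp: psd_kernel_def)
  also have "\<dots> = (\<Sum>i<n. \<Sum>j<n. a i * a j * (LINT z|N. K (s i) (s j) z))"
    using int by simp
  finally show "0 \<le> (\<Sum>i<n. \<Sum>j<n. a i * a j * (LINT z|N. K (s i) (s j) z))" .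
qed

locale odometer_hom = odometer M code p I T + countable_transformation_group L
  for M :: "'x measure" and code :: "nat \<Rightarrow> 'x \<Rightarrow> 'b" and p
    and I :: "'d set" and T :: "('d \<Rightarrow> int) \<Rightarrow> 'x \<Rightarrow> 'x" and L :: "('y \<Rightarrow> 'y) set" +
  fixes G :: "('x \<Rightarrow> 'x) set" and Sh :: "'d \<Rightarrow> 'd \<Rightarrow> int \<Rightarrow> 'x \<Rightarrow> 'x" and f :: "'x \<Rightarrow> 'y"
  assumes two_le_card_I: "2 \<le> card I"
    and G_measurable: "g \<in> G \<Longrightarrow> g \<in> measurable M M"
    and G_distr: "g \<in> G \<Longrightarrow> distr M M g = M"
    and code_G_eq_iff: "g \<in> G \<Longrightarrow> x \<in> space M \<Longrightarrow> y \<in> space M \<Longrightarrow>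
      code k (g x) = code k (g y) \<longleftrightarrow> code k x = code k y"
    and G_comp: "g \<in> G \<Longrightarrow> h \<in> G \<Longrightarrow> g \<circ> h \<in> G"
    and T_G: "T t \<in> G"
    and Sh_G: "i \<in> I \<Longrightarrow> j \<in> I \<Longrightarrow> i \<noteq> j \<Longrightarrow> Sh i j c \<in> G"
    and Sh_T: "i \<in> I \<Longrightarrow> j \<in> I \<Longrightarrow> i \<noteq> j \<Longrightarrow> x \<in> space M \<Longrightarrow>
      Sh i j c (T t x) = T (t(i := t i + c * t j)) (Sh i j c x)"
    and hom: "g \<in> G \<Longrightarrow> x \<in> space M \<Longrightarrow> \<exists>l\<in>L. l (f x) = f (g x)"
    and hom_sets: "g \<in> G \<Longrightarrow> l \<in> L \<Longrightarrow> {x \<in> space M. l (f x) = f (g x)} \<in> sets M"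
begin

lemma G_space: "g \<in> G \<Longrightarrow> x \<in> space M \<Longrightarrow> g x \<in> space M"
  using G_measurable by (rule measurable_space)

lemma G_vimage_sets: "g \<in> G \<Longrightarrow> A \<in> sets M \<Longrightarrow> g -` A \<inter> space M \<in> sets M"
  by (rule measurable_sets[OF G_measurable])

lemma measure_G_vimage: "g \<in> G \<Longrightarrow> A \<in> sets M \<Longrightarrow> measure M (g -` A \<inter> space M) = measure M A"
  using measure_distr[OF G_measurable, of g A] by (simp add: G_distr)

lemma ex_other_index: "\<exists>j\<in>I. j \<noteq> i"
proof (rule ccontr)
  assume "\<not> ?thesis"
  then have "card I \<le> card {i}" by (intro card_mono) auto
  then show False using two_le_card_I by simp
qed

lemma fixed_sets: "l \<in> L \<Longrightarrow> {x \<in> space M. l (f x) = f x} \<in> sets M"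
  using hom_sets[OF T_G, of l "\<lambda>_. 0"] by (simp add: T_zero cong: conj_cong)

lemma transporter_sets:
  assumes "g \<in> G" "h \<in> G" "l \<in> L"
  shows "{x \<in> space M. l (f (g x)) = f (h x)} \<in> sets M"
proof -
  have "{x \<in> space M. l (f (g x)) = f (h x)} =
      (\<Union>m\<in>L. {x \<in> space M. m (f x) = f (g x)} \<inter> {x \<in> space M. (l \<circ> m) (f x) = f (h x)})"
    using hom[OF assms(1)] by fastforce
  also have "\<dots> \<in> sets M"
    using assms by (intro sets.countable_UN'' countable sets.Int hom_sets comp) auto
  finally show ?thesis .
qed

text \<open>
  For most pairs in a small cell, a single element of \<open>L\<close> moves \<open>f \<circ> g\<close> to \<open>f \<circ> h\<close> at both points.
  The relation between \<open>g\<close> and \<open>h\<close> is an equivalence for each pair, so its probability is a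
  positive semidefinite kernel.
\<close>

definition aligned :: "('x \<Rightarrow> 'x) \<Rightarrow> ('x \<Rightarrow> 'x) \<Rightarrow> ('x \<times> 'x) set" where
  "aligned g h = {z \<in> space M \<times> space M.
     diagonal_orbit (map_prod (f \<circ> g) (f \<circ> g) z) = diagonal_orbit (map_prod (f \<circ> h) (f \<circ> h) z)}"

definition alignment :: "nat \<Rightarrow> ('x \<Rightarrow> 'x) \<Rightarrow> ('x \<Rightarrow> 'x) \<Rightarrow> real" where
  "alignment k g h = measure (cell_pair_measure k) (aligned g h)"

definition misaligned :: "('x \<Rightarrow> 'x) \<Rightarrow> ('x \<times> 'x) set" where
  "misaligned g = space M \<times> space M - aligned id g"

lemma aligned_iff:
  "(x, y) \<in> aligned g h \<longleftrightarrow>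
     x \<in> space M \<and> y \<in> space M \<and> (\<exists>l\<in>L. l (f (g x)) = f (h x) \<and> l (f (g y)) = f (h y))"
  by (auto simp: aligned_def diagonal_orbit_eq_iff)

lemma aligned_cong:
  "(\<And>x. x \<in> space M \<Longrightarrow> g x = g' x) \<Longrightarrow> (\<And>x. x \<in> space M \<Longrightarrow> h x = h' x) \<Longrightarrow> aligned g h = aligned g' h'"
  by (auto simp: aligned_def)

lemma aligned_sets:
  assumes "g \<in> G" "h \<in> G"
  shows "aligned g h \<in> sets (M \<Otimes>\<^sub>M M)"
proof -
  have "aligned g h =
      (\<Union>l\<in>L. {x \<in> space M. l (f (g x)) = f (h x)} \<times> {x \<in> space M. l (f (g x)) = f (h x)})"
    by (auto simp: aligned_iff)
  also have "\<dots> \<in> sets (M \<Otimes>\<^sub>M M)"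
    by (intro sets.countable_UN'' countable pair_measureI transporter_sets assms)
  finally show ?thesis .
qed

lemma aligned_id_eq: "aligned id g = aligned (T (\<lambda>_. 0)) g"
  by (rule aligned_cong) (simp_all add: T_zero)

lemma misaligned_sets: "g \<in> G \<Longrightarrow> misaligned g \<in> sets (M \<Otimes>\<^sub>M M)"
  using sets.compl_sets[OF aligned_sets[OF T_G]]
  by (simp add: misaligned_def aligned_id_eq space_pair_measure)

lemma alignment_id:
  assumes "g \<in> G"
  shows "alignment k id g = 1 - measure (cell_pair_measure k) (misaligned g)"
proof -
  interpret P: prob_space "cell_pair_measure k" by (rule prob_space_cell_pair_measure)
  show ?thesis
    using P.prob_compl[of "aligned id g"] aligned_sets[OF T_G assms]
    by (simp add: alignment_def misaligned_def aligned_id_eq space_cell_pair_measure)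
qed

lemma measure_pair_vimage:
  assumes a: "a \<in> G" and S: "S \<in> sets (M \<Otimes>\<^sub>M M)"
  shows "measure (M \<Otimes>\<^sub>M M) (map_prod a a -` S \<inter> space (M \<Otimes>\<^sub>M M)) = measure (M \<Otimes>\<^sub>M M) S"
proof -
  have [measurable]: "a \<in> measurable M M" by (rule G_measurable[OF a])
  have "distr M M a \<Otimes>\<^sub>M distr M M a = distr (M \<Otimes>\<^sub>M M) (M \<Otimes>\<^sub>M M) (\<lambda>(x, y). (a x, a y))"
    by (rule pair_measure_distr) (simp_all add: G_distr[OF a] sigma_finite_measure_axioms)
  then have "distr (M \<Otimes>\<^sub>M M) (M \<Otimes>\<^sub>M M) (map_prod a a) = M \<Otimes>\<^sub>M M"
    by (simp add: G_distr[OF a] map_prod_def)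
  moreover have "map_prod a a \<in> measurable (M \<Otimes>\<^sub>M M) (M \<Otimes>\<^sub>M M)"
    unfolding map_prod_def by measurable
  ultimately show ?thesis using measure_distr[of "map_prod a a" "M \<Otimes>\<^sub>M M" "M \<Otimes>\<^sub>M M" S] S by simp
qed

lemma measure_cell_pair_vimage:
  assumes a: "a \<in> G" and S: "S \<in> sets (M \<Otimes>\<^sub>M M)"
  shows "measure (cell_pair_measure k) (map_prod a a -` S \<inter> space (M \<Otimes>\<^sub>M M)) =
    measure (cell_pair_measure k) S"
proof -
  have "map_prod a a -` S \<inter> space (M \<Otimes>\<^sub>M M) \<inter> same_cell k =
      map_prod a a -` (S \<inter> same_cell k) \<inter> space (M \<Otimes>\<^sub>M M)"
    by (auto simp: same_cell_def space_pair_measure code_G_eq_iff[OF a] G_space[OF a])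
  moreover have "map_prod a a -` S \<inter> space (M \<Otimes>\<^sub>M M) \<in> sets (M \<Otimes>\<^sub>M M)"
    using G_measurable[OF a] S
    by (intro measurable_sets[of "map_prod a a"]) (auto simp: map_prod_def)
  ultimately show ?thesis
    using measure_pair_vimage[OF a, of "S \<inter> same_cell k"] S by (simp add: measure_cell_pair_measure)
qed

lemma alignment_cong:
  "(\<And>x. x \<in> space M \<Longrightarrow> g x = g' x) \<Longrightarrow> (\<And>x. x \<in> space M \<Longrightarrow> h x = h' x) \<Longrightarrow>
    alignment k g h = alignment k g' h'"
  unfolding alignment_def by (metis aligned_cong)

lemma alignment_comp:
  assumes "a \<in> G" "g \<in> G" "h \<in> G"
  shows "alignment k (g \<circ> a) (h \<circ> a) = alignment k g h"
proof -
  have "aligned (g \<circ> a) (h \<circ> a) = map_prod a a -` aligned g h \<inter> space (M \<Otimes>\<^sub>M M)"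
    by (auto simp: aligned_def space_pair_measure G_space[OF assms(1)] map_prod_def)
  then show ?thesis
    using measure_cell_pair_vimage[OF assms(1) aligned_sets[OF assms(2,3)]]
    by (simp add: alignment_def)
qed

lemma psd_kernel_alignment:
  assumes "\<And>i. s i \<in> G"
  shows "psd_kernel (\<lambda>i j. alignment k (s i) (s j))"
proof -
  interpret P: prob_space "cell_pair_measure k" by (rule prob_space_cell_pair_measure)
  let ?A = "\<lambda>i j. aligned (s i) (s j)"
  have "psd_kernel (\<lambda>i j. LINT z|cell_pair_measure k. indicator (?A i j) z)"
  proof (rule psd_kernel_integral)
    show "integrable (cell_pair_measure k) (indicator (?A i j) :: _ \<Rightarrow> real)" for i j
      using aligned_sets[OF assms assms, of i j]
      by (intro P.integrable_const_bound[of _ 1] borel_measurable_indicator) auto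
    fix z assume "z \<in> space (cell_pair_measure k)"
    then have "(indicator (?A i j) z :: real) =
        of_bool (diagonal_orbit (map_prod (f \<circ> s i) (f \<circ> s i) z) =
          diagonal_orbit (map_prod (f \<circ> s j) (f \<circ> s j) z))" for i j
      by (simp add: aligned_def indicator_def space_cell_pair_measure)
    then show "psd_kernel (\<lambda>i j. indicator (?A i j) z)"
      by (simp add: psd_kernel_same_class)
  qed
  moreover have "?A i j \<inter> space (cell_pair_measure k) = ?A i j" for i j
    by (auto simp: aligned_def space_cell_pair_measure)
  ultimately show ?thesis by (simp add: alignment_def)
qed

lemma alignment_commute: "alignment k g h = alignment k h g"
  by (simp add: alignment_def aligned_def eq_commute)

lemma eventually_misaligned_le:
  assumes g: "g \<in> G" and "\<epsilon> > 0"
  shows "\<forall>\<^sub>F k in sequentially. measure (cell_pair_measure k) (misaligned g) \<le> \<epsilon>"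
proof -
  let ?A = "\<lambda>n. {x \<in> space M. from_nat_into L n (f x) = f (g x)}"
  have in_L: "from_nat_into L n \<in> L" for n using id by (intro from_nat_into) auto
  have cover: "space M \<subseteq> (\<Union>n. ?A n)"
    using hom[OF g] from_nat_into_surj[OF countable] by fastforce
  obtain E l where E: "E \<in> sets M" "measure M E < \<epsilon> / 2"
    and refine: "\<And>x y k. \<lbrakk>l \<le> k; x \<in> space M - E; y \<in> space M - E; code k x = code k y\<rbrakk> \<Longrightarrow>
      \<exists>n. x \<in> ?A n \<and> y \<in> ?A n"
    using cells_refine_countable_cover[OF hom_sets[OF g in_L] cover, of "\<epsilon> / 2"] \<open>\<epsilon> > 0\<close> by auto
  show ?thesis
  proof (rule eventually_sequentiallyI[of l])
    fix k assume k: "l \<le> k"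
    have "misaligned g \<inter> same_cell k \<subseteq> E \<times> space M \<union> space M \<times> E"
    proof (rule subsetI, rule ccontr)
      fix z assume z: "z \<in> misaligned g \<inter> same_cell k" "z \<notin> E \<times> space M \<union> space M \<times> E"
      obtain x y where z_eq: "z = (x, y)" by (cases z)
      have "x \<in> space M - E" "y \<in> space M - E" "code k x = code k y"
        using z by (auto simp: z_eq same_cell_def)
      then obtain n where "x \<in> ?A n" "y \<in> ?A n" using refine[OF k] by blast
      then have "z \<in> aligned id g" using in_L[of n] by (auto simp: z_eq aligned_iff)
      then show False using z by (simp add: misaligned_def)
    qed
    then have "measure (cell_pair_measure k) (misaligned g) \<le>
        measure (cell_pair_measure k) (E \<times> space M \<union> space M \<times> E)"
      using E(1) misaligned_sets[OF g] by (intro measure_cell_pair_measure_mono) auto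
    also have "\<dots> \<le> \<epsilon>" using measure_cell_pair_measure_le_marginal[OF E(1), of k] E(2) by linarith
    finally show "measure (cell_pair_measure k) (misaligned g) \<le> \<epsilon>" .
  qed
qed

definition plane_action :: "(int \<times> int \<Rightarrow> 'x \<Rightarrow> 'x) \<Rightarrow> bool" where
  "plane_action \<tau> \<longleftrightarrow> (\<forall>v. \<tau> v \<in> G) \<and> (\<forall>v w. \<forall>x\<in>space M. \<tau> v (\<tau> w x) = \<tau> (v + w) x) \<and>
     (\<forall>x\<in>space M. \<tau> 0 x = x)"

definition intertwines ::
    "(int \<times> int \<Rightarrow> 'x \<Rightarrow> 'x) \<Rightarrow> ('x \<Rightarrow> 'x) \<Rightarrow> (int \<times> int \<Rightarrow> int \<times> int) \<Rightarrow> bool" where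
  "intertwines \<tau> S g \<longleftrightarrow> S \<in> G \<and> (\<forall>v. \<forall>x\<in>space M. S (\<tau> v x) = \<tau> (g v) (S x))"

lemma plane_actionD:
  assumes "plane_action \<tau>"
  shows "\<tau> v \<in> G" "x \<in> space M \<Longrightarrow> \<tau> v (\<tau> w x) = \<tau> (v + w) x" "x \<in> space M \<Longrightarrow> \<tau> 0 x = x"
  using assms unfolding plane_action_def by blast+

lemma intertwinesD:
  assumes "intertwines \<tau> S g"
  shows "S \<in> G" "x \<in> space M \<Longrightarrow> S (\<tau> v x) = \<tau> (g v) (S x)"
  using assms unfolding intertwines_def by blast+

lemma alignment_plane_action:
  assumes \<tau>: "plane_action \<tau>"
  shows "alignment k (\<tau> v) (\<tau> w) = alignment k id (\<tau> (v - w))"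
proof -
  have "alignment k (\<tau> v) (\<tau> w) = alignment k (\<tau> (v - w) \<circ> \<tau> w) (\<tau> 0 \<circ> \<tau> w)"
    by (intro alignment_cong) (simp_all add: plane_actionD[OF \<tau>])
  also have "\<dots> = alignment k (\<tau> (v - w)) (\<tau> 0)"
    by (intro alignment_comp plane_actionD[OF \<tau>])
  also have "\<dots> = alignment k (\<tau> (v - w)) id"
    by (intro alignment_cong) (simp_all add: plane_actionD[OF \<tau>])
  finally show ?thesis by (simp add: alignment_commute)
qed

lemma almost_invariant_alignment:
  assumes \<tau>: "plane_action \<tau>" and S: "intertwines \<tau> S g" and g: "\<And>v w. g (v - w) = g v - g w"
    and small: "measure (cell_pair_measure k) (misaligned S) \<le> \<delta>"
  shows "almost_invariant \<delta> (\<lambda>v. alignment k id (\<tau> v)) g"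
proof -
  note \<tau>_G = plane_actionD(1)[OF \<tau>] and S_G = intertwinesD(1)[OF S]
  define \<sigma> where "\<sigma> = (\<lambda>(b, v). if b then S \<circ> \<tau> v else \<tau> v)"
  show ?thesis unfolding almost_invariant_def
  proof (intro exI[of _ "\<lambda>z w. alignment k (\<sigma> z) (\<sigma> w)"] conjI allI)
    have \<sigma>_G: "\<sigma> z \<in> G" for z using S_G \<tau>_G by (auto simp: \<sigma>_def G_comp split: prod.split)
    then show "psd_kernel (\<lambda>z w. alignment k (\<sigma> z) (\<sigma> w))" by (rule psd_kernel_alignment)
    show "alignment k (\<sigma> (False, v)) (\<sigma> (False, w)) = alignment k id (\<tau> (v - w))" for v w
      using alignment_plane_action[OF \<tau>] by (simp add: \<sigma>_def)
    show "alignment k (\<sigma> (True, v)) (\<sigma> (True, w)) = alignment k id (\<tau> (g (v - w)))" for v w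
    proof -
      have "alignment k (\<sigma> (True, v)) (\<sigma> (True, w)) = alignment k (\<tau> (g v) \<circ> S) (\<tau> (g w) \<circ> S)"
        by (intro alignment_cong) (simp_all add: \<sigma>_def intertwinesD(2)[OF S])
      also have "\<dots> = alignment k (\<tau> (g v)) (\<tau> (g w))"
        by (intro alignment_comp S_G \<tau>_G)
      finally show ?thesis by (simp add: alignment_plane_action[OF \<tau>] g)
    qed
    show "alignment k (\<sigma> (True, v)) (\<sigma> (False, w)) = alignment k (\<sigma> (True, 0)) (\<sigma> (False, w - v))"
      for v w
    proof -
      have "alignment k (\<sigma> (True, v)) (\<sigma> (False, w)) =
          alignment k (\<sigma> (True, 0) \<circ> \<tau> v) (\<sigma> (False, w - v) \<circ> \<tau> v)"
        by (intro alignment_cong) (simp_all add: \<sigma>_def plane_actionD[OF \<tau>])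
      also have "\<dots> = alignment k (\<sigma> (True, 0)) (\<sigma> (False, w - v))"
        by (intro alignment_comp \<sigma>_G \<tau>_G)
      finally show ?thesis .
    qed
    have "alignment k (\<sigma> (True, 0)) (\<sigma> (False, 0)) = alignment k S id"
      by (intro alignment_cong) (simp_all add: \<sigma>_def plane_actionD[OF \<tau>])
    then show "1 - \<delta> \<le> alignment k (\<sigma> (True, 0)) (\<sigma> (False, 0))"
      using small by (simp add: alignment_commute[of k S] alignment_id[OF S_G])
  qed
qed

lemma eventually_misaligned_plane_action_le:
  assumes \<tau>: "plane_action \<tau>"
    and lower: "\<And>c. intertwines \<tau> (S c) (lower_shear c)"
    and upper: "\<And>c. intertwines \<tau> (S' c) (upper_shear c)" and "\<epsilon> > 0"
  shows "\<forall>\<^sub>F k in sequentially. \<forall>v. measure (cell_pair_measure k) (misaligned (\<tau> v)) \<le> \<epsilon>"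
proof -
  obtain \<delta> where "\<delta> > 0" and rigid: "\<And>\<psi> v. almost_shear_invariant \<delta> \<psi> \<Longrightarrow> 1 - \<epsilon> \<le> \<psi> v"
    using relative_property_T[OF \<open>\<epsilon> > 0\<close>] by metis
  define H where "H = {\<tau> (1, 0), \<tau> (0, 1)} \<union> (\<Union>c\<in>{4, -4}. {S c, S' c})"
  note \<tau>_G = plane_actionD(1)[OF \<tau>]
  have "finite H" "H \<subseteq> G"
    using \<tau>_G intertwinesD(1)[OF lower] intertwinesD(1)[OF upper] by (auto simp: H_def)
  then have "\<forall>\<^sub>F k in sequentially. \<forall>h\<in>H. measure (cell_pair_measure k) (misaligned h) \<le> \<delta>"
    using eventually_misaligned_le \<open>\<delta> > 0\<close> by (intro eventually_ball_finite) auto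
  then show ?thesis
  proof eventually_elim
    case (elim k)
    have "alignment k id (\<tau> 0) = alignment k id id"
      by (intro alignment_cong) (simp_all add: plane_actionD[OF \<tau>])
    moreover have "aligned id id = space (cell_pair_measure k)"
      by (auto simp: aligned_def space_cell_pair_measure)
    ultimately have "alignment k id (\<tau> 0) = 1"
      using prob_space.prob_space[OF prob_space_cell_pair_measure] by (simp add: alignment_def)
    moreover have "almost_invariant \<delta> (\<lambda>v. alignment k id (\<tau> v)) (lower_shear c)"
      "almost_invariant \<delta> (\<lambda>v. alignment k id (\<tau> v)) (upper_shear c)" if "c \<in> {4, -4}" for c
      using elim that almost_invariant_alignment[OF \<tau> lower lower_shear_diff]
        almost_invariant_alignment[OF \<tau> upper upper_shear_diff] by (auto simp: H_def)
    moreover have "1 - \<delta> \<le> alignment k id (\<tau> (1, 0))" "1 - \<delta> \<le> alignment k id (\<tau> (0, 1))"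
      using elim by (simp_all add: H_def alignment_id[OF \<tau>_G])
    ultimately have "almost_shear_invariant \<delta> (\<lambda>v. alignment k id (\<tau> v))"
      unfolding almost_shear_invariant_def by blast
    then show ?case using rigid by (fastforce simp: alignment_id[OF \<tau>_G])
  qed
qed

definition axis_shift :: "nat \<Rightarrow> 'd \<Rightarrow> int \<Rightarrow> 'x \<Rightarrow> 'x" where
  "axis_shift k i s = T ((\<lambda>_. 0)(i := s * int p ^ k))"

lemma axis_shift_G: "axis_shift k i s \<in> G"
  by (simp add: axis_shift_def T_G)

lemma axis_shift_add:
  assumes "x \<in> space M"
  shows "axis_shift k i s (axis_shift k i t x) = axis_shift k i (s + t) x"
proof -
  have "(\<lambda>j. ((\<lambda>_. 0)(i := s * int p ^ k)) j + ((\<lambda>_. 0)(i := t * int p ^ k)) j) =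
      (\<lambda>_. 0)(i := (s + t) * int p ^ k)"
    by (auto simp: distrib_right)
  then show ?thesis by (simp add: axis_shift_def T_add[OF assms])
qed

lemma axis_shift_0: "x \<in> space M \<Longrightarrow> axis_shift k i 0 x = x"
  by (simp add: axis_shift_def T_zero fun_upd_idem)

lemma code_axis_shift: "x \<in> space M \<Longrightarrow> code k (axis_shift k i s x) = code k x"
  by (simp add: axis_shift_def code_T_fixed_iff)

lemma axis_shift_cell_iff: "x \<in> space M \<Longrightarrow> axis_shift k i s x \<in> cell k b \<longleftrightarrow> x \<in> cell k b"
  by (simp add: cell_def code_axis_shift G_space[OF axis_shift_G])

lemma eventually_misaligned_axis_shift_le:
  assumes i: "i \<in> I" and "\<epsilon> > 0"
  shows "\<forall>\<^sub>F k in sequentially. \<forall>s. measure (cell_pair_measure k) (misaligned (axis_shift k i s)) \<le> \<epsilon>"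
proof -
  obtain j where j: "j \<in> I" "j \<noteq> i" using ex_other_index by blast
  define v where "v a = (\<lambda>_. 0)(i := fst a, j := snd a)" for a :: "int \<times> int"
  define \<tau> where "\<tau> a = T (v a)" for a
  have "(\<lambda>i. v a i + v b i) = v (a + b)" for a b using j by (auto simp: v_def)
  moreover have "v 0 = (\<lambda>_. 0)" by (auto simp: v_def)
  ultimately have \<tau>: "plane_action \<tau>"
    unfolding plane_action_def by (simp add: \<tau>_def T_G T_add T_zero del: split_paired_All)
  have "(v a)(j := v a j + c * v a i) = v (lower_shear c a)"
    "(v a)(i := v a i + c * v a j) = v (upper_shear c a)" for a c
    using j by (auto simp: v_def lower_shear_def upper_shear_def)
  then have "intertwines \<tau> (Sh j i c) (lower_shear c)" "intertwines \<tau> (Sh i j c) (upper_shear c)"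
    for c
    unfolding intertwines_def using i j by (simp_all add: \<tau>_def Sh_G Sh_T del: split_paired_All)
  then have "\<forall>\<^sub>F k in sequentially. \<forall>a. measure (cell_pair_measure k) (misaligned (\<tau> a)) \<le> \<epsilon>"
    by (rule eventually_misaligned_plane_action_le[OF \<tau> _ _ \<open>\<epsilon> > 0\<close>])
  moreover have "axis_shift k i s = \<tau> (s * int p ^ k, 0)" for k s
    using j by (auto simp: axis_shift_def \<tau>_def v_def fun_upd_idem intro!: arg_cong[of _ _ T])
  ultimately show ?thesis by (auto elim: eventually_mono)
qed

definition axis_defect :: "nat \<Rightarrow> 'b \<Rightarrow> 'd \<Rightarrow> nat \<Rightarrow> real" where
  "axis_defect k b i s = cell_density k b (misaligned (axis_shift k i (int s)))"

lemma axis_defect_triangle: "axis_defect k b i s \<le> axis_defect k b i v + axis_defect k b i (s + v)"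
proof -
  let ?N = "M \<Otimes>\<^sub>M M" and ?\<rho> = "\<lambda>s. axis_shift k i (int s)"
  define D where "D s = misaligned (?\<rho> s) \<inter> cell k b \<times> cell k b" for s
  have D_sets: "D s \<in> sets ?N" for s
    unfolding D_def using misaligned_sets[OF axis_shift_G] by auto
  have "map_prod (?\<rho> v) (?\<rho> v) -` D s \<inter> space ?N \<subseteq> D v \<union> D (s + v)"
  proof (rule subsetI, rule ccontr)
    fix z assume z: "z \<in> map_prod (?\<rho> v) (?\<rho> v) -` D s \<inter> space ?N" "z \<notin> D v \<union> D (s + v)"
    obtain x y where z_eq: "z = (x, y)" by (cases z)
    have xy: "x \<in> space M" "y \<in> space M" "x \<in> cell k b" "y \<in> cell k b"
      using z(1) by (auto simp: z_eq D_def space_pair_measure axis_shift_cell_iff)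
    then have "(x, y) \<in> aligned id (?\<rho> v)" "(x, y) \<in> aligned id (?\<rho> (s + v))"
      using z(2) by (auto simp: z_eq D_def misaligned_def)
    then obtain l m where l: "l \<in> L" "l (f x) = f (?\<rho> v x)" "l (f y) = f (?\<rho> v y)"
      and m: "m \<in> L" "m (f x) = f (?\<rho> (s + v) x)" "m (f y) = f (?\<rho> (s + v) y)"
      by (auto simp: aligned_iff)
    have "(m \<circ> the_inv l) (f (?\<rho> v x)) = f (?\<rho> s (?\<rho> v x))"
      "(m \<circ> the_inv l) (f (?\<rho> v y)) = f (?\<rho> s (?\<rho> v y))"
      using l(1) m(2,3) xy(1,2) by (simp_all add: l(2,3)[symmetric] axis_shift_add)
    moreover have "m \<circ> the_inv l \<in> L" using l(1) m(1) by (intro comp inv)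
    ultimately have "(?\<rho> v x, ?\<rho> v y) \<in> aligned id (?\<rho> s)"
      using xy G_space[OF axis_shift_G] unfolding aligned_iff id_apply by blast
    then show False using z(1) by (simp add: z_eq D_def misaligned_def)
  qed
  then have "measure ?N (map_prod (?\<rho> v) (?\<rho> v) -` D s \<inter> space ?N) \<le> measure ?N (D v \<union> D (s + v))"
    using D_sets by (intro finite_measure.finite_measure_mono[OF finite_measure_pair]) auto
  also have "\<dots> \<le> measure ?N (D v) + measure ?N (D (s + v))"
    by (rule measure_Un_le[OF D_sets D_sets])
  finally have "measure ?N (D s) \<le> measure ?N (D v) + measure ?N (D (s + v))"
    by (simp only: measure_pair_vimage[OF axis_shift_G D_sets])
  from mult_left_mono[OF this, of "(num_cells k)\<^sup>2"] show ?thesis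
    by (simp add: axis_defect_def cell_density_def D_def distrib_left)
qed

lemma card_defective_cells_le:
  fixes c \<epsilon> :: real
  assumes "\<And>s. measure (cell_pair_measure k) (misaligned (axis_shift k i s)) \<le> \<epsilon>" "c \<ge> 0"
  shows "card {b \<in> code k ` space M. \<exists>s. c < axis_defect k b i s} * c \<le> 2 * (num_cells k * \<epsilon>)"
proof (rule card_ever_large_le)
  show "(\<Sum>b\<in>code k ` space M. axis_defect k b i s) \<le> num_cells k * \<epsilon>" for s
    unfolding axis_defect_def sum_cell_density[OF misaligned_sets[OF axis_shift_G]]
    using assms(1) by (intro mult_left_mono) auto
qed (use assms(2) finite_code cell_density_nonneg cell_density_le_1 axis_defect_triangle
  in \<open>auto simp: axis_defect_def\<close>)

lemma ex_large_section:
  assumes Q: "Q \<in> sets (M \<Otimes>\<^sub>M M)" "Q \<subseteq> A \<times> space M" and A: "A \<in> sets M"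
    and c: "0 \<le> c" "c * measure M A < measure (M \<Otimes>\<^sub>M M) Q"
  shows "\<exists>x\<in>A. c < measure M (Pair x -` Q)"
proof (rule ccontr)
  assume neg: "\<not> ?thesis"
  have "emeasure (M \<Otimes>\<^sub>M M) Q = (\<integral>\<^sup>+x. emeasure M (Pair x -` Q) \<partial>M)"
    by (rule emeasure_pair_measure_alt[OF Q(1)])
  also have "\<dots> \<le> (\<integral>\<^sup>+x. ennreal c * indicator A x \<partial>M)"
  proof (rule nn_integral_mono)
    fix x
    show "emeasure M (Pair x -` Q) \<le> ennreal c * indicator A x"
    proof (cases "x \<in> A")
      case True
      then show ?thesis using neg by (auto simp: emeasure_eq_measure not_less intro!: ennreal_leI)
    next
      case False
      then have "Pair x -` Q = {}" using Q(2) by auto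
      then show ?thesis by simp
    qed
  qed
  also have "\<dots> = ennreal (c * measure M A)"
    using A c(1) by (simp add: nn_integral_cmult_indicator emeasure_eq_measure ennreal_mult')
  finally show False
    using c
    by (simp add: finite_measure.emeasure_eq_measure[OF finite_measure_pair] not_le[symmetric])
qed

lemma measure_full_square_diff_ge:
  assumes S: "S \<in> sets (M \<Otimes>\<^sub>M M)" and B: "B \<in> sets M" and b: "b \<in> code k ` space M"
    and density: "cell_density k b S \<le> e"
    and full: "measure M (cell k b - B) \<le> e * measure M (cell k b)"
  shows "(1 - 3 * e) * (measure M (cell k b))\<^sup>2 \<le>
    measure (M \<Otimes>\<^sub>M M) ((cell k b \<inter> B) \<times> (cell k b \<inter> B) - S)"
proof -
  define C m where "C = cell k b" and "m = measure M C"
  let ?N = "M \<Otimes>\<^sub>M M" and ?Q = "(C \<inter> B) \<times> (C \<inter> B) - S"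
  have C: "C \<in> sets M" by (simp add: C_def)
  have sets: "?Q \<in> sets ?N" "S \<inter> C \<times> C \<in> sets ?N" "(C - B) \<times> C \<in> sets ?N" "C \<times> (C - B) \<in> sets ?N"
    using S B C by auto
  have "m * m = measure ?N (C \<times> C)" using C by (simp add: measure_pair_Times m_def)
  also have "\<dots> \<le> measure ?N ((?Q \<union> (S \<inter> C \<times> C)) \<union> ((C - B) \<times> C \<union> C \<times> (C - B)))"
    using sets by (intro finite_measure.finite_measure_mono[OF finite_measure_pair]) auto
  also have "\<dots> \<le> (measure ?N ?Q + measure ?N (S \<inter> C \<times> C)) +
      (measure ?N ((C - B) \<times> C) + measure ?N (C \<times> (C - B)))"
    using sets by (intro order.trans[OF measure_Un_le] add_mono measure_Un_le) auto
  also have "measure ?N (S \<inter> C \<times> C) \<le> e * (m * m)"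
    using density measure_cell[OF b] unfolding C_def measure_Int_cell_square
    by (simp add: m_def C_def power2_eq_square divide_right_mono)
  also have "measure ?N ((C - B) \<times> C) \<le> e * (m * m)"
    using full B C mult_right_mono[of "measure M (C - B)" "e * m" m]
    by (simp add: measure_pair_Times m_def C_def mult.assoc)
  also have "measure ?N (C \<times> (C - B)) \<le> e * (m * m)"
    using full B C mult_left_mono[of "measure M (C - B)" "e * m" m]
    by (simp add: measure_pair_Times m_def C_def mult.left_commute)
  finally show ?thesis by (simp add: m_def C_def power2_eq_square algebra_simps)
qed

lemma ex_common_transporter:
  assumes g: "g \<in> G" and b: "b \<in> code k ` space M" and e: "0 < e" "e \<le> 1 / 4"
    and density: "cell_density k b (misaligned g) \<le> e"
    and B: "B \<in> sets M" "\<And>x y. x \<in> B \<Longrightarrow> y \<in> B \<Longrightarrow> stabiliser (f x) = stabiliser (f y)"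
    and full: "measure M (cell k b - B) \<le> e * measure M (cell k b)"
  shows "\<exists>l\<in>L. (1 - 4 * e) * measure M (cell k b) < measure M {x \<in> cell k b \<inter> B. l (f x) = f (g x)}"
proof -
  define C m where "C = cell k b" and "m = measure M C"
  have m: "m > 0" using num_cells_pos[of k] measure_cell[OF b] by (simp add: m_def C_def)
  have C: "C \<in> sets M" "C \<subseteq> space M" by (auto simp: C_def cell_subset_space)
  define Q where "Q = (C \<inter> B) \<times> (C \<inter> B) - misaligned g"
  have Q: "Q \<in> sets (M \<Otimes>\<^sub>M M)" using C(1) B(1) misaligned_sets[OF g] by (auto simp: Q_def)
  have "(1 - 4 * e) * m\<^sup>2 < (1 - 3 * e) * m\<^sup>2" using e m by (intro mult_strict_right_mono) auto
  also have "\<dots> \<le> measure (M \<Otimes>\<^sub>M M) Q"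
    using measure_full_square_diff_ge[OF misaligned_sets[OF g] B(1) b density full]
    by (simp add: Q_def m_def C_def)
  finally have "(1 - 4 * e) * m * measure M C < measure (M \<Otimes>\<^sub>M M) Q"
    by (simp add: m_def power2_eq_square mult.assoc)
  then obtain x where x: "x \<in> C" "(1 - 4 * e) * m < measure M (Pair x -` Q)"
    using ex_large_section[OF Q _ C(1), of "(1 - 4 * e) * m"] C e m by (auto simp: Q_def)
  obtain l where l: "l \<in> L" "l (f x) = f (g x)" using hom[OF g] x(1) C by blast
  have "Pair x -` Q \<subseteq> {y \<in> C \<inter> B. l (f y) = f (g y)}"
  proof
    fix y assume y: "y \<in> Pair x -` Q"
    then have xy: "x \<in> B" "y \<in> C" "y \<in> B" "(x, y) \<in> aligned id g"
      using C by (auto simp: Q_def misaligned_def)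
    from xy(4) obtain l' where l': "l' \<in> L" "l' (f x) = f (g x)" "l' (f y) = f (g y)"
      by (auto simp: aligned_iff)
    have "l (f y) = l' (f y)"
      by (rule eq_apply_if_stabiliser_eq[OF B(2)[OF xy(1,3)] l(1) l'(1)]) (simp add: l(2) l'(2))
    then show "y \<in> {y \<in> C \<inter> B. l (f y) = f (g y)}" using xy(2,3) l'(3) by simp
  qed
  moreover have "{y \<in> C \<inter> B. l (f y) = f (g y)} = C \<inter> B \<inter> {y \<in> space M. l (f y) = f (g y)}"
    using C by auto
  ultimately have "measure M (Pair x -` Q) \<le> measure M {y \<in> C \<inter> B. l (f y) = f (g y)}"
    using C(1) B(1) hom_sets[OF g l(1)] by (intro finite_measure_mono) auto
  then show ?thesis using x(2) l(1) unfolding C_def m_def by (intro bexI[of _ l]) linarith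
qed

definition transported :: "nat \<Rightarrow> 'd \<Rightarrow> 'x set \<Rightarrow> ('y \<Rightarrow> 'y) \<Rightarrow> nat \<Rightarrow> 'x set" where
  "transported k i A l s = {x \<in> A. l (f x) = f (axis_shift k i (int s) x)}"

lemma transported_sets:
  assumes "A \<in> sets M" "l \<in> L"
  shows "transported k i A l s \<in> sets M"
proof -
  have "transported k i A l s = A \<inter> {x \<in> space M. l (f x) = f (axis_shift k i (int s) x)}"
    using sets.sets_into_space[OF assms(1)] by (auto simp: transported_def)
  then show ?thesis using assms(1) hom_sets[OF axis_shift_G assms(2)] by auto
qed

lemma ex_transported_successively:
  assumes B: "B \<in> sets M" and maps: "l \<in> L" "l' \<in> L" "u \<in> L" and e: "e \<le> 1 / 12"
    and large: "(1 - 4 * e) * measure M (cell k b) < measure M (transported k i (cell k b \<inter> B) l s)"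
      "(1 - 4 * e) * measure M (cell k b) < measure M (transported k i (cell k b \<inter> B) l' (Suc s))"
      "(1 - 4 * e) * measure M (cell k b) < measure M (transported k i (cell k b \<inter> B) u 1)"
  obtains x where "x \<in> space M" "x \<in> transported k i (cell k b \<inter> B) l s"
    "x \<in> transported k i (cell k b \<inter> B) l' (Suc s)"
    "axis_shift k i (int s) x \<in> transported k i (cell k b \<inter> B) u 1"
proof -
  let ?m = "measure M (cell k b)" and ?H = "transported k i (cell k b \<inter> B)"
  let ?V = "axis_shift k i (int s) -` ?H u 1 \<inter> space M"
  have H_sets: "?H l s \<in> sets M" "?H l' (Suc s) \<in> sets M" "?H u 1 \<in> sets M"
    using B maps by (auto intro: transported_sets)
  have H_subset: "?H v n \<subseteq> cell k b" for v n by (auto simp: transported_def)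
  have V: "?V \<in> sets M" "measure M ?V = measure M (?H u 1)"
    by (rule G_vimage_sets measure_G_vimage, rule axis_shift_G, rule H_sets(3))+
  have V_subset: "?V \<subseteq> cell k b" using axis_shift_cell_iff by (auto simp: transported_def)
  have "measure M (?H l s \<inter> ?H l' (Suc s)) + measure M ?V \<le>
      ?m + measure M (?H l s \<inter> ?H l' (Suc s) \<inter> ?V)"
    using H_sets H_subset[of l s] by (intro measure_add_le_measure_Int V(1) V_subset cell_sets) auto
  moreover have "measure M (?H l s) + measure M (?H l' (Suc s)) \<le>
      ?m + measure M (?H l s \<inter> ?H l' (Suc s))"
    by (intro measure_add_le_measure_Int H_sets H_subset cell_sets)
  moreover have "0 \<le> (1 - 12 * e) * ?m" using e by simp
  ultimately have "0 < measure M (?H l s \<inter> ?H l' (Suc s) \<inter> ?V)"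
    using large V(2) by (simp add: algebra_simps)
  then have "?H l s \<inter> ?H l' (Suc s) \<inter> ?V \<noteq> {}" by (metis less_irrefl measure_empty)
  then show ?thesis using that by blast
qed

lemma transported_subset_funpow:
  assumes e: "e \<le> 1 / 12" and B: "B \<in> sets M"
    "\<And>x y. x \<in> B \<Longrightarrow> y \<in> B \<Longrightarrow> stabiliser (f x) = stabiliser (f y)"
    and l: "\<And>s. l s \<in> L"
      "\<And>s. (1 - 4 * e) * measure M (cell k b) < measure M (transported k i (cell k b \<inter> B) (l s) s)"
  shows "transported k i (cell k b \<inter> B) (l s) s \<subseteq> transported k i (cell k b) (l 1 ^^ s) s"
proof (induction s)
  case 0
  then show ?case using subsetD[OF cell_subset_space] by (auto simp: transported_def axis_shift_0)
next
  case (Suc s)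
  let ?H = "transported k i (cell k b \<inter> B)"
  obtain x where x: "x \<in> space M" "x \<in> ?H (l s) s" "x \<in> ?H (l (Suc s)) (Suc s)"
    "axis_shift k i (int s) x \<in> ?H (l 1) 1"
    by (rule ex_transported_successively[OF B(1) l(1) l(1) l(1) e l(2) l(2) l(2)])
  have "f (axis_shift k i (int (Suc s)) x) = f (axis_shift k i (int 1) (axis_shift k i (int s) x))"
    using x(1) by (simp add: axis_shift_add)
  also have "\<dots> = l 1 ((l 1 ^^ s) (f x))" using x(2,4) Suc by (auto simp: transported_def)
  finally have at_x: "l (Suc s) (f x) = (l 1 ^^ Suc s) (f x)"
    using x(3) by (simp add: transported_def)
  show ?case
  proof
    fix y assume y: "y \<in> ?H (l (Suc s)) (Suc s)"
    then have "x \<in> B" "y \<in> B" using x(3) by (simp_all add: transported_def)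
    then have "l (Suc s) (f y) = (l 1 ^^ Suc s) (f y)"
      by (rule eq_apply_if_stabiliser_eq[OF B(2) l(1) funpow[OF l(1)] at_x])
    then show "y \<in> transported k i (cell k b) (l 1 ^^ Suc s) (Suc s)"
      using y by (simp add: transported_def)
  qed
qed

definition axis_cocycle :: "real \<Rightarrow> nat \<Rightarrow> 'b \<Rightarrow> 'd \<Rightarrow> ('y \<Rightarrow> 'y) \<Rightarrow> bool" where
  "axis_cocycle c k b i u \<longleftrightarrow> u \<in> L \<and>
     (\<forall>j. c \<le> measure M {x \<in> cell k b. (u ^^ j) (f x) = f (axis_shift k i (int j) x)})"

lemma axis_cocycleD:
  assumes "axis_cocycle c k b i u"
  shows "u \<in> L" "c \<le> measure M {x \<in> cell k b. (u ^^ j) (f x) = f (axis_shift k i (int j) x)}"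
  using assms by (simp_all add: axis_cocycle_def)

lemma ex_axis_cocycle:
  assumes b: "b \<in> code k ` space M" and e: "0 < e" "e \<le> 1 / 12"
    and defect: "\<And>s. axis_defect k b i s \<le> e"
    and B: "B \<in> sets M" "\<And>x y. x \<in> B \<Longrightarrow> y \<in> B \<Longrightarrow> stabiliser (f x) = stabiliser (f y)"
    and full: "measure M (cell k b - B) \<le> e * measure M (cell k b)"
  shows "\<exists>u. axis_cocycle ((1 - 4 * e) * measure M (cell k b)) k b i u"
proof -
  have "\<exists>l\<in>L. (1 - 4 * e) * measure M (cell k b) < measure M (transported k i (cell k b \<inter> B) l s)"
    for s
    using ex_common_transporter[OF axis_shift_G b _ _ defect[unfolded axis_defect_def] B full] e
    by (auto simp: transported_def)
  then obtain l where l: "\<And>s. l s \<in> L"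
    "\<And>s. (1 - 4 * e) * measure M (cell k b) < measure M (transported k i (cell k b \<inter> B) (l s) s)"
      by metis
  have "(1 - 4 * e) * measure M (cell k b) \<le> measure M (transported k i (cell k b) (l 1 ^^ j) j)"
    for j
    using finite_measure_mono[OF transported_subset_funpow[OF e(2) B l, of j]
        transported_sets[OF cell_sets funpow[OF l(1)]]]
      l(2)[of j] by linarith
  then show ?thesis unfolding transported_def axis_cocycle_def using l(1) by blast
qed

lemma ex_cell_with_axis_cocycles:
  assumes e: "0 < e" "e \<le> 1 / 12" and B: "B \<in> sets M" "measure M B > 0"
    and stabilisers: "\<And>x y. x \<in> B \<Longrightarrow> y \<in> B \<Longrightarrow> stabiliser (f x) = stabiliser (f y)"
  shows "\<exists>k. \<exists>b\<in>code k ` space M. \<forall>i\<in>I. \<exists>u.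
    axis_cocycle ((1 - 4 * e) * measure M (cell k b)) k b i u"
proof -
  define \<epsilon> where "\<epsilon> = e * measure M B / (8 * card I)"
  have \<epsilon>: "\<epsilon> > 0" using e B two_le_card_I by (simp add: \<epsilon>_def)
  have "\<forall>\<^sub>F k in sequentially.
      (\<forall>i\<in>I. \<forall>s. measure (cell_pair_measure k) (misaligned (axis_shift k i s)) \<le> \<epsilon>) \<and>
      measure M B / 2 * num_cells k \<le>
        card {b \<in> code k ` space M. measure M (cell k b - B) \<le> e * measure M (cell k b)}"
    using eventually_misaligned_axis_shift_le[OF _ \<epsilon>]
      eventually_many_nearly_full_cells[OF B, of e] e finite_I
    by (intro eventually_conj eventually_ball_finite) auto
  then obtain k where small: "\<And>i s. i \<in> I \<Longrightarrow>
      measure (cell_pair_measure k) (misaligned (axis_shift k i s)) \<le> \<epsilon>"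
    and many_full: "measure M B / 2 * num_cells k \<le>
        card {b \<in> code k ` space M. measure M (cell k b - B) \<le> e * measure M (cell k b)}"
    by (auto simp: eventually_sequentially)
  define F where "F = {b \<in> code k ` space M. measure M (cell k b - B) \<le> e * measure M (cell k b)}"
  define Y where "Y i = {b \<in> code k ` space M. \<exists>s. e < axis_defect k b i s}" for i
  have Y: "card (Y i) \<le> num_cells k * measure M B / (4 * card I)" if "i \<in> I" for i
  proof -
    have "card (Y i) * e \<le> (num_cells k * measure M B / (4 * card I)) * e"
      using card_defective_cells_le[OF small[OF that], of e] e
      by (simp add: Y_def \<epsilon>_def field_simps)
    then show ?thesis using e(1) by (rule mult_right_le_imp_le)
  qed
  have "real (card (\<Union>i\<in>I. Y i)) \<le> (\<Sum>i\<in>I. real (card (Y i)))"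
    using card_UN_le[OF finite_I, of Y] by (simp flip: of_nat_sum)
  also have "\<dots> \<le> (\<Sum>i\<in>I. num_cells k * measure M B / (4 * card I))" by (intro sum_mono Y)
  also have "\<dots> = measure M B / 4 * num_cells k" using two_le_card_I by simp
  also have "\<dots> < measure M B / 2 * num_cells k" using B num_cells_pos[of k] by simp
  finally have "card (\<Union>i\<in>I. Y i) < card F" using many_full by (simp add: F_def)
  moreover have "finite (\<Union>i\<in>I. Y i)" using finite_I finite_code by (simp add: Y_def)
  ultimately have "\<not> F \<subseteq> (\<Union>i\<in>I. Y i)" using card_mono by (metis not_le)
  then obtain b where "b \<in> F" "b \<notin> (\<Union>i\<in>I. Y i)" by blast
  then have b: "b \<in> code k ` space M" "measure M (cell k b - B) \<le> e * measure M (cell k b)"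
    and defect: "\<And>i s. i \<in> I \<Longrightarrow> axis_defect k b i s \<le> e"
    unfolding F_def Y_def by (auto simp del: image_iff) (meson not_less)
  have "\<forall>i\<in>I. \<exists>u. axis_cocycle ((1 - 4 * e) * measure M (cell k b)) k b i u"
    using ex_axis_cocycle[OF b(1) e defect B(1) stabilisers b(2)] by blast
  then show ?thesis using b(1) by blast
qed

end

lemma (in finite_measure) measure_frequently_ge:
  assumes A: "\<And>n. A n \<in> sets M" and c: "\<forall>\<^sub>F n in sequentially. c \<le> measure M (A n)"
  shows "{x. \<exists>\<^sub>F n in sequentially. x \<in> A n} \<in> sets M"
    and "c \<le> measure M {x. \<exists>\<^sub>F n in sequentially. x \<in> A n}"
proof -
  have limsup_eq: "{x. \<exists>\<^sub>F n in sequentially. x \<in> A n} = (\<Inter>n. \<Union>m\<in>{n..}. A m)"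
    by (auto simp: frequently_sequentially)
  have tail_sets: "(\<Union>m\<in>{n..}. A m) \<in> sets M" for n using A by auto
  show "{x. \<exists>\<^sub>F n in sequentially. x \<in> A n} \<in> sets M"
    unfolding limsup_eq using tail_sets by (intro sets.countable_INT) auto
  obtain N where N: "\<And>n. n \<ge> N \<Longrightarrow> c \<le> measure M (A n)"
    using c by (auto simp: eventually_sequentially)
  have "c \<le> measure M (\<Union>m\<in>{n..}. A m)" for n
  proof -
    have "measure M (A (max n N)) \<le> measure M (\<Union>m\<in>{n..}. A m)"
      using tail_sets by (intro finite_measure_mono UN_upper) auto
    then show ?thesis using N[of "max n N"] by simp
  qed
  moreover have "(\<lambda>n. measure M (\<Union>m\<in>{n..}. A m)) \<longlonglongrightarrow> measure M (\<Inter>n. \<Union>m\<in>{n..}. A m)"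
    using tail_sets by (intro finite_Lim_measure_decseq antimonoI UN_mono) auto
  ultimately show "c \<le> measure M {x. \<exists>\<^sub>F n in sequentially. x \<in> A n}"
    unfolding limsup_eq by (intro LIMSEQ_le_const) auto
qed

lemma (in prob_space) ex_positive_fibre_of_countable_range:
  assumes "countable (h ` space M)" "\<And>v. {x \<in> space M. h x = v} \<in> sets M"
  shows "\<exists>x0\<in>space M. measure M {x \<in> space M. h x = h x0} > 0"
proof (rule ccontr)
  assume neg: "\<not> ?thesis"
  have "{x \<in> space M. h x = v} \<in> null_sets M" if "v \<in> h ` space M" for v
    using that neg assms(2) by (auto simp: null_sets_def emeasure_eq_measure zero_less_measure_iff)
  then have "(\<Union>v\<in>h ` space M. {x \<in> space M. h x = v}) \<in> null_sets M"
    by (intro null_sets_UN' assms(1))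
  moreover have "(\<Union>v\<in>h ` space M. {x \<in> space M. h x = v}) = space M" by auto
  ultimately show False using emeasure_space_1 by (auto dest: null_setsD1)
qed

lemma (in odometer) ex_level_translations_close:
  fixes z :: "'x \<Rightarrow> 'z :: {metric_space, second_countable_topology}"
  assumes z: "z \<in> borel_measurable M" and "\<epsilon> > 0" "\<eta> > 0"
  shows "\<exists>l. \<forall>t. (\<forall>i\<in>I. int p ^ l dvd t i) \<longrightarrow>
    measure M {x \<in> space M. \<epsilon> \<le> dist (z (T t x)) (z x)} \<le> \<eta>"
proof -
  obtain D :: "'z set" where D: "countable D" "\<forall>U. open U \<longrightarrow> U \<noteq> {} \<longrightarrow> (\<exists>d\<in>D. d \<in> U)"
    using countable_dense_exists by blast
  let ?A = "\<lambda>n. z -` ball (from_nat_into D n) (\<epsilon> / 2) \<inter> space M"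
  have A: "?A n \<in> sets M" for n using z by (rule measurable_sets) simp
  have "space M \<subseteq> (\<Union>n. ?A n)"
  proof
    fix x assume x: "x \<in> space M"
    obtain d where "d \<in> D" "d \<in> ball (z x) (\<epsilon> / 2)"
      using D(2)[rule_format, of "ball (z x) (\<epsilon> / 2)"] \<open>\<epsilon> > 0\<close> by auto
    then show "x \<in> (\<Union>n. ?A n)"
      using x from_nat_into_surj[OF D(1), of d] by (auto simp: dist_commute)
  qed
  then obtain E l where E: "E \<in> sets M" "measure M E < \<eta> / 2"
    and refine: "\<And>x y k. \<lbrakk>l \<le> k; x \<in> space M - E; y \<in> space M - E; code k x = code k y\<rbrakk> \<Longrightarrow>
      \<exists>n. x \<in> ?A n \<and> y \<in> ?A n"
    by (rule cells_refine_countable_cover[OF A _ half_gt_zero[OF \<open>\<eta> > 0\<close>]]) blast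
  show ?thesis
  proof (intro exI[of _ l] allI impI)
    fix t assume t: "\<forall>i\<in>I. int p ^ l dvd t i"
    have "{x \<in> space M. \<epsilon> \<le> dist (z (T t x)) (z x)} \<subseteq> E \<union> (T t -` E \<inter> space M)"
    proof (rule subsetI, rule ccontr)
      fix x assume x: "x \<in> {x \<in> space M. \<epsilon> \<le> dist (z (T t x)) (z x)}" "x \<notin> E \<union> (T t -` E \<inter> space M)"
      then obtain n where "T t x \<in> ?A n" "x \<in> ?A n"
        using refine[of l "T t x" x] t T_space[of x t] code_T_fixed_iff[of x l t] by auto
      then have "dist (z (T t x)) (z x) < \<epsilon>"
        using dist_triangle_half_r[of "from_nat_into D n" "z (T t x)" \<epsilon> "z x"] by simp
      then show False using x(1) by simp
    qed
    then have "measure M {x \<in> space M. \<epsilon> \<le> dist (z (T t x)) (z x)} \<le>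
        measure M (E \<union> (T t -` E \<inter> space M))"
      using E(1) T_vimage_sets by (intro finite_measure_mono) auto
    also have "\<dots> \<le> measure M E + measure M (T t -` E \<inter> space M)"
      using E(1) T_vimage_sets by (intro measure_Un_le) auto
    finally show "measure M {x \<in> space M. \<epsilon> \<le> dist (z (T t x)) (z x)} \<le> \<eta>"
      using E measure_T_vimage[of E t] by simp
  qed
qed

lemma funpow_fixed_dvd: "(u ^^ a) y = y \<Longrightarrow> a dvd b \<Longrightarrow> (u ^^ b) y = y"
proof (elim dvdE)
  fix c assume fixed: "(u ^^ a) y = y" and b: "b = a * c"
  have "((u ^^ a) ^^ c) y = y" by (induction c) (simp_all add: fixed)
  then show "(u ^^ b) y = y" by (simp add: b funpow_mult)
qed

locale recurrent_odometer_hom = odometer_hom M code p I T L G Sh f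
  for M :: "'x measure" and code :: "nat \<Rightarrow> 'x \<Rightarrow> 'b" and p
    and I :: "'d set" and T and L :: "('y \<Rightarrow> 'y) set" and G Sh f +
  fixes y :: "'y \<Rightarrow> 'z :: {metric_space, second_countable_topology}" and \<sigma> :: "nat \<Rightarrow> nat"
  assumes y_f_measurable: "(\<lambda>x. y (f x)) \<in> borel_measurable M"
    and y_inj: "inj_on y (f ` space M)"
    and countable_stabilisers: "countable ((\<lambda>x. stabiliser (f x)) ` space M)"
    and \<sigma>_pos: "\<sigma> l > 0" and \<sigma>_dvd: "p ^ l dvd \<sigma> l"
    and fixed_if_recurrent: "u \<in> L \<Longrightarrow> x \<in> space M \<Longrightarrow>
      (\<And>\<epsilon>. \<epsilon> > 0 \<Longrightarrow> \<exists>\<^sub>F j in sequentially. dist (y ((u ^^ \<sigma> j) (f x))) (y (f x)) < \<epsilon>) \<Longrightarrow>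
      \<exists>j. (u ^^ \<sigma> j) (f x) = f x"
begin

lemma axis_shift_measurable [measurable]: "axis_shift k i s \<in> measurable M M"
  by (rule G_measurable[OF axis_shift_G])

lemma cell_fixed_sets: "u \<in> L \<Longrightarrow> {x \<in> cell k b. u (f x) = f x} \<in> sets M"
  using sets.Int[OF cell_sets fixed_sets] by (simp add: cell_def Int_def conj_ac)

lemma cell_hom_sets: "u \<in> L \<Longrightarrow> g \<in> G \<Longrightarrow> {x \<in> cell k b. u (f x) = f (g x)} \<in> sets M"
  using sets.Int[OF cell_sets hom_sets] by (simp add: cell_def Int_def conj_ac)

lemma eventually_measure_close_ge:
  assumes i: "i \<in> I" and cocycle: "axis_cocycle c k b i u"
    and "c' < c" "\<epsilon> > 0"
  shows "\<forall>\<^sub>F j in sequentially. c' \<le> measure M {x \<in> cell k b.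
    (u ^^ \<sigma> j) (f x) = f (axis_shift k i (int (\<sigma> j)) x) \<and>
    dist (y (f (axis_shift k i (int (\<sigma> j)) x))) (y (f x)) < \<epsilon>}"
proof -
  note u = axis_cocycleD(1)[OF cocycle]
  obtain l where l: "\<And>t. \<forall>i\<in>I. int p ^ l dvd t i \<Longrightarrow>
      measure M {x \<in> space M. \<epsilon> \<le> dist (y (f (T t x))) (y (f x))} \<le> c - c'"
    using ex_level_translations_close[OF y_f_measurable \<open>\<epsilon> > 0\<close>, of "c - c'"] \<open>c' < c\<close> by auto
  show ?thesis
  proof (rule eventually_sequentiallyI[of l])
    fix j assume j: "l \<le> j"
    let ?\<rho> = "axis_shift k i (int (\<sigma> j))"
    let ?H = "{x \<in> cell k b. (u ^^ \<sigma> j) (f x) = f (?\<rho> x)}"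
    let ?far = "{x \<in> space M. \<epsilon> \<le> dist (y (f (?\<rho> x))) (y (f x))}"
    note [measurable] = y_f_measurable measurable_compose[OF axis_shift_measurable y_f_measurable]
    have far_sets: "?far \<in> sets M" by measurable
    have "int p ^ l dvd int (\<sigma> j)"
      using \<sigma>_dvd[of j] le_imp_power_dvd[OF j, of p] dvd_trans
      by (metis int_dvd_int_iff of_nat_power)
    then have "measure M ?far \<le> c - c'" unfolding axis_shift_def by (intro l) auto
    moreover have "measure M ?H \<le> measure M (?H - ?far) + measure M ?far"
      using finite_measure_mono[of ?H "(?H - ?far) \<union> ?far"] measure_Un_le[of "?H - ?far" M ?far]
        far_sets cell_hom_sets[OF funpow[OF u] axis_shift_G] by fastforce
    ultimately have "c' \<le> measure M (?H - ?far)"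
      using axis_cocycleD(2)[OF cocycle, of "\<sigma> j"] by linarith
    moreover have "?H - ?far = {x \<in> cell k b. (u ^^ \<sigma> j) (f x) = f (?\<rho> x) \<and>
        dist (y (f (?\<rho> x))) (y (f x)) < \<epsilon>}"
      by (auto simp: cell_def not_le)
    ultimately show "c' \<le> measure M {x \<in> cell k b. (u ^^ \<sigma> j) (f x) = f (?\<rho> x) \<and>
        dist (y (f (?\<rho> x))) (y (f x)) < \<epsilon>}" by simp
  qed
qed

text \<open>
  Translations by multiples of \<open>\<sigma> j * p ^ k\<close> tend to the identity, so along \<open>\<sigma>\<close> the powers of \<open>u\<close>
  return to \<open>f x\<close> infinitely often, for most points of the cell.
\<close>

lemma measure_recurrent_ge:
  assumes i: "i \<in> I" and cocycle: "axis_cocycle c k b i u"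
    and "c' < c"
  obtains R where "R \<in> sets M" "R \<subseteq> cell k b" "c' \<le> measure M R"
    "\<And>x \<epsilon>. x \<in> R \<Longrightarrow> \<epsilon> > 0 \<Longrightarrow> \<exists>\<^sub>F j in sequentially. dist (y ((u ^^ \<sigma> j) (f x))) (y (f x)) < \<epsilon>"
proof -
  note u = axis_cocycleD(1)[OF cocycle]
  define A where "A n j = {x \<in> cell k b. (u ^^ \<sigma> j) (f x) = f (axis_shift k i (int (\<sigma> j)) x) \<and>
    dist (y (f (axis_shift k i (int (\<sigma> j)) x))) (y (f x)) < 1 / real (Suc n)}" for n j
  define R where "R n = {x. \<exists>\<^sub>F j in sequentially. x \<in> A n j}" for n
  have A_sets: "A n j \<in> sets M" for n j
  proof -
    note [measurable] = y_f_measurable measurable_compose[OF axis_shift_measurable y_f_measurable]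
    have "A n j = {x \<in> cell k b. (u ^^ \<sigma> j) (f x) = f (axis_shift k i (int (\<sigma> j)) x)} \<inter>
        {x \<in> space M. dist (y (f (axis_shift k i (int (\<sigma> j)) x))) (y (f x)) < 1 / real (Suc n)}"
      by (auto simp: A_def cell_def)
    also have "\<dots> \<in> sets M" by (intro sets.Int cell_hom_sets funpow u axis_shift_G) measurable
    finally show ?thesis .
  qed
  have "\<forall>\<^sub>F j in sequentially. c' \<le> measure M (A n j)" for n
    unfolding A_def by (rule eventually_measure_close_ge[OF i cocycle \<open>c' < c\<close>]) simp
  note R = measure_frequently_ge[OF A_sets this, folded R_def]
  have A_mono: "A n j \<subseteq> A m j" if "m \<le> n" for m n j
    using that frac_le[of 1 1 "real (Suc m)" "real (Suc n)"] by (auto simp: A_def)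
  have "R n \<subseteq> R m" if "m \<le> n" for m n
    using A_mono[OF that] by (auto simp: R_def elim!: frequently_elim1)
  then have "decseq R" by (auto intro: antimonoI)
  then have "(\<lambda>n. measure M (R n)) \<longlonglongrightarrow> measure M (\<Inter>n. R n)"
    using R(1) by (intro finite_Lim_measure_decseq) auto
  then have large: "c' \<le> measure M (\<Inter>n. R n)" using R(2) by (intro LIMSEQ_le_const) auto
  have in_cell: "(\<Inter>n. R n) \<subseteq> cell k b"
    by (auto simp: R_def A_def dest: frequently_ex)
  have recurrent: "\<exists>\<^sub>F j in sequentially. dist (y ((u ^^ \<sigma> j) (f x))) (y (f x)) < \<epsilon>"
    if x: "x \<in> (\<Inter>n. R n)" and "\<epsilon> > 0" for x \<epsilon>
  proof -
    obtain n where "1 / real (Suc n) < \<epsilon>" using \<open>\<epsilon> > 0\<close> nat_approx_posE by blast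
    moreover have "\<exists>\<^sub>F j in sequentially. x \<in> A n j" using x by (auto simp: R_def)
    ultimately show ?thesis by (auto simp: A_def elim!: frequently_elim1)
  qed
  show ?thesis by (rule that[OF _ in_cell large recurrent]) (use R(1) in auto)
qed

lemma ex_fixed_power:
  assumes i: "i \<in> I" and cocycle: "axis_cocycle c k b i u"
    and "c' < c"
  shows "\<exists>N>0. c' \<le> measure M {x \<in> cell k b. (u ^^ N) (f x) = f x}"
proof -
  note u = axis_cocycleD(1)[OF cocycle]
  obtain R where R: "R \<in> sets M" "R \<subseteq> cell k b" "(c + c') / 2 \<le> measure M R"
    and recurrent: "\<And>x \<epsilon>. x \<in> R \<Longrightarrow> \<epsilon> > 0 \<Longrightarrow>
      \<exists>\<^sub>F j in sequentially. dist (y ((u ^^ \<sigma> j) (f x))) (y (f x)) < \<epsilon>"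
    using measure_recurrent_ge[OF i cocycle, of "(c + c') / 2"] \<open>c' < c\<close> by auto
  define F where "F j = {x \<in> cell k b. (u ^^ \<sigma> j) (f x) = f x}" for j
  have F: "F j \<in> sets M" for j unfolding F_def by (intro cell_fixed_sets funpow u)
  have "R \<subseteq> (\<Union>j. F j)"
  proof
    fix x assume "x \<in> R"
    moreover from this have "x \<in> cell k b" "x \<in> space M" using R(2) cell_subset_space by blast+
    ultimately have "x \<in> cell k b" "\<exists>j. (u ^^ \<sigma> j) (f x) = f x"
      using recurrent by (auto intro!: fixed_if_recurrent[OF u])
    then show "x \<in> (\<Union>j. F j)" by (auto simp: F_def)
  qed
  then have "measure M R \<le> measure M (\<Union>j. F j)" using F by (intro finite_measure_mono) auto
  moreover obtain N where "measure M (\<Union>j. F j) - (c - c') / 2 < measure M (\<Union>j<N. F j)"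
    using ex_measure_UN_lessThan_gt[of F "(c - c') / 2"] F \<open>c' < c\<close> by auto
  moreover define P where "P = (\<Prod>j<N. \<sigma> j)"
  have "(\<Union>j<N. F j) \<subseteq> {x \<in> cell k b. (u ^^ P) (f x) = f x}"
    by (auto simp: F_def P_def intro: funpow_fixed_dvd)
  then have "measure M (\<Union>j<N. F j) \<le> measure M {x \<in> cell k b. (u ^^ P) (f x) = f x}"
    by (rule finite_measure_mono) (rule cell_fixed_sets[OF funpow[OF u]])
  ultimately have "c' \<le> measure M {x \<in> cell k b. (u ^^ P) (f x) = f x}"
    using R(3) by (simp add: field_simps)
  moreover have "P > 0" unfolding P_def using \<sigma>_pos by (intro prod_pos) auto
  ultimately show ?thesis by blast
qed

lemma measure_axis_return_ge:
  fixes c c' :: real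
  assumes cocycle: "axis_cocycle c k b i u" and "N dvd P"
    and fixed: "c' \<le> measure M {x \<in> cell k b. (u ^^ N) (f x) = f x}"
  shows "c + c' - measure M (cell k b) \<le>
    measure M {x \<in> cell k b. f (axis_shift k i (int (j * P)) x) = f x}"
proof -
  note u = axis_cocycleD(1)[OF cocycle]
  let ?H = "{x \<in> cell k b. (u ^^ (j * P)) (f x) = f (axis_shift k i (int (j * P)) x)}"
  let ?F = "{x \<in> cell k b. (u ^^ N) (f x) = f x}"
  have sets: "?H \<in> sets M" "?F \<in> sets M"
    by (intro cell_hom_sets cell_fixed_sets funpow u axis_shift_G)+
  have "c + c' \<le> measure M (cell k b) + measure M (?H \<inter> ?F)"
    using measure_add_le_measure_Int[OF sets cell_sets, of k b]
      axis_cocycleD(2)[OF cocycle, of "j * P"] fixed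
    by auto
  moreover have "measure M (?H \<inter> ?F) \<le>
      measure M {x \<in> cell k b. f (axis_shift k i (int (j * P)) x) = f x}"
  proof (rule finite_measure_mono)
    show "?H \<inter> ?F \<subseteq> {x \<in> cell k b. f (axis_shift k i (int (j * P)) x) = f x}"
      using funpow_fixed_dvd[of N u _ "j * P"] \<open>N dvd P\<close> by auto
    show "{x \<in> cell k b. f (axis_shift k i (int (j * P)) x) = f x} \<in> sets M"
      using cell_hom_sets[OF id axis_shift_G] by (simp add: eq_commute)
  qed
  ultimately show ?thesis by linarith
qed

lemma ex_return_period:
  assumes i: "i \<in> I" and cocycle: "axis_cocycle c k b i u"
    and "c' < c"
  shows "\<exists>N>0. \<forall>P j. N dvd P \<longrightarrow>
    c + c' - measure M (cell k b) \<le> measure M {x \<in> cell k b. f (axis_shift k i (int (j * P)) x) = f x}"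
  using ex_fixed_power[OF assms] measure_axis_return_ge[OF cocycle] by blast

lemma return_sets: "g \<in> G \<Longrightarrow> {x \<in> cell k b. f (g x) = f x} \<in> sets M"
  using cell_hom_sets[OF id] by (simp add: eq_commute)

lemma measure_return_comp_ge:
  assumes g: "g \<in> G" "\<And>x. x \<in> space M \<Longrightarrow> code k (g x) = code k x" and h: "h \<in> G"
  shows "measure M {x \<in> cell k b. f (g x) = f x} + measure M {x \<in> cell k b. f (h x) = f x} \<le>
    measure M (cell k b) + measure M {x \<in> cell k b. f (h (g x)) = f x}"
proof -
  let ?A = "{x \<in> cell k b. f (g x) = f x}" and ?B = "{x \<in> cell k b. f (h x) = f x}"
  let ?V = "g -` ?B \<inter> space M"
  have "?V \<subseteq> cell k b" using g(2) by (auto simp: cell_def)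
  then have "measure M ?A + measure M ?V \<le> measure M (cell k b) + measure M (?A \<inter> ?V)"
    by (intro measure_add_le_measure_Int return_sets G_vimage_sets g(1) h cell_sets) auto
  also have "measure M (?A \<inter> ?V) \<le> measure M {x \<in> cell k b. f (h (g x)) = f x}"
    using return_sets[OF G_comp[OF h g(1)]] by (intro finite_measure_mono) auto
  finally show ?thesis by (simp only: measure_G_vimage[OF g(1) return_sets[OF h]])
qed

lemma measure_box_return_ge:
  fixes \<delta> :: real
  assumes axis: "\<And>i j. i \<in> I \<Longrightarrow>
      (1 - \<delta>) * measure M (cell k b) \<le> measure M {x \<in> cell k b. f (axis_shift k i (int (j * P)) x) = f x}"
    and J: "J \<subseteq> I"
  shows "(1 - card J * \<delta>) * measure M (cell k b) \<le>
    measure M {x \<in> cell k b. f (T (\<lambda>i. if i \<in> J then int (t i * P) * int p ^ k else 0) x) = f x}"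
  using finite_subset[OF J finite_I] J
proof (induction J rule: finite_induct)
  case empty
  have "{x \<in> cell k b. f (T (\<lambda>_. 0) x) = f x} = cell k b" by (auto simp: cell_def T_zero)
  then show ?case by simp
next
  case (insert i J)
  let ?s = "\<lambda>J i. if i \<in> J then int (t i * P) * int p ^ k else 0"
  let ?\<rho> = "axis_shift k i (int (t i * P))"
  have T_insert: "?\<rho> (T (?s J) x) = T (?s (insert i J)) x" if "x \<in> cell k b" for x
    unfolding axis_shift_def T_add[OF subsetD[OF cell_subset_space that]]
    using insert.hyps by (intro arg_cong[of _ _ "\<lambda>s. T s x"]) auto
  have "(1 - card (insert i J) * \<delta>) * measure M (cell k b) + measure M (cell k b) =
      (1 - card J * \<delta>) * measure M (cell k b) + (1 - \<delta>) * measure M (cell k b)"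
    using insert.hyps by (simp add: algebra_simps)
  also have "\<dots> \<le> measure M {x \<in> cell k b. f (T (?s J) x) = f x} +
      measure M {x \<in> cell k b. f (?\<rho> x) = f x}"
    using insert axis by (intro add_mono) auto
  also have "\<dots> \<le> measure M (cell k b) + measure M {x \<in> cell k b. f (?\<rho> (T (?s J) x)) = f x}"
  proof (rule measure_return_comp_ge[OF T_G _ axis_shift_G])
    show "code k (T (?s J) x) = code k x" if "x \<in> space M" for x
      unfolding code_T_fixed_iff[OF that] by simp
  qed
  also have "{x \<in> cell k b. f (?\<rho> (T (?s J) x)) = f x} =
      {x \<in> cell k b. f (T (?s (insert i J)) x) = f x}"
    by (simp only: T_insert cong: conj_cong)
  finally show ?case by simp
qed

lemma stabiliser_fibre_sets: "{x \<in> space M. stabiliser (f x) = S} \<in> sets M"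
proof (cases "S \<subseteq> L")
  case True
  have "{x \<in> space M. l (f x) = f x \<longleftrightarrow> l \<in> S} \<in> sets M" if "l \<in> L" for l
  proof (cases "l \<in> S")
    case not_in: False
    have "{x \<in> space M. l (f x) = f x \<longleftrightarrow> l \<in> S} = space M - {x \<in> space M. l (f x) = f x}"
      using not_in by auto
    then show ?thesis using fixed_sets[OF that] by auto
  qed (use fixed_sets[OF that] in simp)
  then have "{x \<in> space M. \<forall>l\<in>L. l (f x) = f x \<longleftrightarrow> l \<in> S} \<in> sets M"
    using countable by (intro sets.sets_Collect_countable_All')
  moreover have "stabiliser (f x) = S \<longleftrightarrow> (\<forall>l\<in>L. l (f x) = f x \<longleftrightarrow> l \<in> S)" for x
    using True by (auto simp: stabiliser_def)
  ultimately show ?thesis by simp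
next
  case False
  then have "{x \<in> space M. stabiliser (f x) = S} = {}" by (auto simp: stabiliser_def)
  then show ?thesis by (simp only: sets.empty_sets)
qed

lemma ex_common_return_period:
  assumes m: "measure M (cell k b) > 0" and e: "0 < e"
    and cocycle: "\<forall>i\<in>I. \<exists>u. axis_cocycle ((1 - 4 * e) * measure M (cell k b)) k b i u"
  obtains P where "P > 0" "\<And>i j. i \<in> I \<Longrightarrow> (1 - 9 * e) * measure M (cell k b) \<le>
    measure M {x \<in> cell k b. f (axis_shift k i (int (j * P)) x) = f x}"
proof -
  let ?m = "measure M (cell k b)"
  define period where "period i N \<longleftrightarrow> (\<forall>P j. N dvd P \<longrightarrow>
    (1 - 9 * e) * ?m \<le> measure M {x \<in> cell k b. f (axis_shift k i (int (j * P)) x) = f x})" for i N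
  have "\<exists>N>0. period i N" if i: "i \<in> I" for i
  proof -
    obtain u where u: "axis_cocycle ((1 - 4 * e) * ?m) k b i u"
      using bspec[OF cocycle i] by (elim exE)
    have "(1 - 5 * e) * ?m < (1 - 4 * e) * ?m" using e m by simp
    note ex_return_period[OF i u this]
    moreover have "(1 - 4 * e) * ?m + (1 - 5 * e) * ?m - ?m = (1 - 9 * e) * ?m"
      by (simp add: algebra_simps)
    ultimately show ?thesis by (simp only: period_def)
  qed
  then obtain N where N: "\<And>i. i \<in> I \<Longrightarrow> N i > 0" "\<And>i. i \<in> I \<Longrightarrow> period i (N i)" by metis
  show ?thesis
  proof (rule that)
    show "(\<Prod>i\<in>I. N i) > 0" using N by (intro prod_pos) auto
    fix i j assume i: "i \<in> I"
    have "N i dvd (\<Prod>i\<in>I. N i)" using i finite_I by (simp add: dvd_prodI)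
    then show "(1 - 9 * e) * ?m \<le>
        measure M {x \<in> cell k b. f (axis_shift k i (int (j * (\<Prod>i\<in>I. N i))) x) = f x}"
      using N(2)[OF i] unfolding period_def by blast
  qed
qed

theorem ex_positive_fibre: "\<exists>x0\<in>space M. measure M {x \<in> space M. f x = f x0} > 0"
proof -
  obtain x1 where x1: "measure M {x \<in> space M. stabiliser (f x) = stabiliser (f x1)} > 0"
    using ex_positive_fibre_of_countable_range[OF countable_stabilisers stabiliser_fibre_sets]
    by blast
  define e :: real where "e = 1 / (20 * card I)"
  have e: "0 < e" "e \<le> 1 / 12" using two_le_card_I by (simp_all add: e_def field_simps)
  obtain k b where b: "b \<in> code k ` space M"
    and cocycle: "\<forall>i\<in>I. \<exists>u. axis_cocycle ((1 - 4 * e) * measure M (cell k b)) k b i u"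
    using ex_cell_with_axis_cocycles[OF e stabiliser_fibre_sets x1] by force
  define m where "m = measure M (cell k b)"
  have m: "m > 0" using measure_cell[OF b] num_cells_pos by (simp add: m_def)
  obtain P where "P > 0" and axis_return: "\<And>i j. i \<in> I \<Longrightarrow> (1 - 9 * e) * measure M (cell k b) \<le>
      measure M {x \<in> cell k b. f (axis_shift k i (int (j * P)) x) = f x}"
    using ex_common_return_period[OF m[unfolded m_def] e(1) cocycle] by blast
  have box: "(1 - card I * (9 * e)) * m \<le> measure M {x \<in> cell k b. f (shift k P t x) = f x}" for t
    unfolding m_def shift_def
    by (rule measure_box_return_ge[OF axis_return order_refl])
  have "card I * (9 * e) = 9 / 20" using two_le_card_I by (simp add: e_def)
  then have half: "m / 2 \<le> (1 - card I * (9 * e)) * m" using m by (simp only:) simp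
  have return: "m / 2 \<le> measure M {x \<in> space M. y (f (shift k P t x)) = y (f x)}" for t
  proof -
    note [measurable] = y_f_measurable measurable_compose[OF shift_measurable y_f_measurable]
    have "measure M {x \<in> cell k b. f (shift k P t x) = f x} \<le>
        measure M {x \<in> space M. y (f (shift k P t x)) = y (f x)}"
      by (intro finite_measure_mono) (auto simp: cell_def)
    then show ?thesis using half box[of t] by linarith
  qed
  obtain x0 where "x0 \<in> space M" "measure M {x \<in> space M. y (f x) = y (f x0)} > 0"
    using ex_positive_fibre_of_return[OF y_f_measurable \<open>P > 0\<close> half_gt_zero[OF m] return] by blast
  moreover have "{x \<in> space M. y (f x) = y (f x0)} = {x \<in> space M. f x = f x0}" if "x0 \<in> space M"
    for x0
    using that inj_on_eq_iff[OF y_inj] by auto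
  ultimately show ?thesis by (metis (no_types))
qed

end

section \<open>Recurrent lines over the p-adic numbers\<close>

lemma padic_norm_0 [simp]: "padic_norm 0 = 0" by (simp add: padic_norm_eq_0_iff)

lemma padic_norm_1 [simp]: "padic_norm (1 :: 'a :: prime_card padic) = 1"
  using padic_norm_of_rat[of 1, where 'a = 'a] by (simp add: padic_abs_1[OF prime_card])

lemma padic_norm_of_int:
  "padic_norm (of_int a :: 'a :: prime_card padic) =
    (if a = 0 then 0 else inverse (real CARD('a)) ^ multiplicity (int CARD('a)) a)"
proof -
  have "padic_norm (of_int a :: 'a padic) = padic_abs CARD('a) (of_int a / of_int 1)"
    using padic_norm_of_rat[of "of_int a", where 'a = 'a] by simp
  then show ?thesis
    by (cases "a = 0")
      (simp_all add: padic_abs_frac[OF prime_card] power_int_minus power_inverse del: of_int_1)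
qed

lemma one_less_prime_card: "1 < CARD('a :: prime_card)"
  using prime_card[where 'a = 'a] prime_gt_1_nat by blast

lemma inverse_prime_card_power_le_1: "inverse (real CARD('a :: prime_card)) ^ l \<le> 1"
  using one_less_prime_card[where 'a = 'a] by (intro power_le_one) (auto simp: inverse_le_1_iff)

lemma padic_norm_of_int_le_1: "padic_norm (of_int a :: 'a :: prime_card padic) \<le> 1"
  by (simp add: padic_norm_of_int inverse_prime_card_power_le_1)

lemma padic_norm_of_int_le_iff:
  "padic_norm (of_int a :: 'a :: prime_card padic) \<le> inverse (real CARD('a)) ^ k \<longleftrightarrow>
    int CARD('a) ^ k dvd a"
proof (cases "a = 0")
  case False
  have "padic_norm (of_int a :: 'a padic) \<le> inverse (real CARD('a)) ^ k \<longleftrightarrow>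
      k \<le> multiplicity (int CARD('a)) a"
    unfolding padic_norm_of_int using False one_less_prime_card[where 'a = 'a]
    by (auto simp: power_decreasing_iff inverse_less_1_iff)
  also have "\<dots> \<longleftrightarrow> int CARD('a) ^ k dvd a"
    using False one_less_prime_card[where 'a = 'a] by (subst power_dvd_iff_le_multiplicity) auto
  finally show ?thesis .
qed simp

lemma padic_norm_diff_le: "padic_norm (x - y) \<le> max (padic_norm x) (padic_norm y)"
  using padic_norm_ultrametric[of x "- y"] by (simp add: padic_norm_minus)

lemma padic_norm_diff_commute: "padic_norm (x - y) = padic_norm (y - x)"
  using padic_norm_minus[of "x - y"] by simp

lemma padic_norm_add_le: "padic_norm x \<le> c \<Longrightarrow> padic_norm y \<le> c \<Longrightarrow> padic_norm (x + y) \<le> c"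
  using padic_norm_ultrametric[of x y] by simp

lemma padic_norm_sum_le:
  "0 \<le> c \<Longrightarrow> (\<And>i. i \<in> A \<Longrightarrow> padic_norm (h i) \<le> c) \<Longrightarrow> padic_norm (\<Sum>i\<in>A. h i) \<le> c"
  by (induction A rule: infinite_finite_induct) (auto intro: padic_norm_add_le)

lemma dist_padic: "dist x y = padic_norm (x - y)" for x y :: "'a :: prime_card padic"
  by (simp add: dist_padic_def)

lemma padic_norm_inverse: "padic_norm (inverse x) = inverse (padic_norm x)"
proof (cases "x = 0")
  case False
  then have "padic_norm x * padic_norm (inverse x) = 1" by (simp flip: padic_norm_mult)
  then show ?thesis by (simp add: inverse_unique)
qed simp

lemma padic_norm_divide: "padic_norm (x / y) = padic_norm x / padic_norm y"
  by (simp add: divide_inverse padic_norm_mult padic_norm_inverse)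

lemma continuous_on_padic_norm: "continuous_on A (padic_norm :: 'a :: prime_card padic \<Rightarrow> real)"
proof -
  have "padic_norm x = dist x 0" for x :: "'a padic" by (simp add: dist_padic)
  then show ?thesis by (simp add: continuous_on_dist continuous_on_id continuous_on_const)
qed

lemma padic_norm_card_power:
  "padic_norm (of_nat CARD('a) ^ j :: 'a :: prime_card padic) = inverse (real CARD('a)) ^ j"
proof -
  have "multiplicity (int CARD('a)) (int CARD('a)) = 1"
    using one_less_prime_card[where 'a = 'a] by (intro multiplicity_self) auto
  then have "padic_norm (of_nat CARD('a) :: 'a padic) = inverse (real CARD('a))"
    using padic_norm_of_int[of "int CARD('a)", where 'a = 'a] by simp
  then show ?thesis by (induction j) (simp_all add: padic_norm_mult)
qed

lemma padic_tendsto_iff: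
  fixes X :: "'i \<Rightarrow> 'a :: prime_card padic"
  shows "(X \<longlongrightarrow> L) F \<longleftrightarrow> (\<forall>l. \<forall>\<^sub>F j in F. padic_norm (X j - L) \<le> inverse (real CARD('a)) ^ l)"
proof
  assume X: "(X \<longlongrightarrow> L) F"
  show "\<forall>l. \<forall>\<^sub>F j in F. padic_norm (X j - L) \<le> inverse (real CARD('a)) ^ l"
  proof
    fix l
    have "\<forall>\<^sub>F j in F. dist (X j) L < inverse (real CARD('a)) ^ l"
      using X one_less_prime_card[where 'a = 'a] by (intro tendstoD) auto
    then show "\<forall>\<^sub>F j in F. padic_norm (X j - L) \<le> inverse (real CARD('a)) ^ l"
      by (rule eventually_mono) (simp add: dist_padic)
  qed
next
  assume close: "\<forall>l. \<forall>\<^sub>F j in F. padic_norm (X j - L) \<le> inverse (real CARD('a)) ^ l"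
  show "(X \<longlongrightarrow> L) F"
  proof (rule tendstoI)
    fix e :: real assume "e > 0"
    moreover have "inverse (real CARD('a)) < 1"
      using one_less_prime_card[where 'a = 'a] by (simp add: inverse_less_1_iff)
    ultimately obtain l where "inverse (real CARD('a)) ^ l < e" using real_arch_pow_inv by blast
    then show "\<forall>\<^sub>F j in F. dist (X j) L < e"
      using close by (auto elim!: eventually_mono[OF spec[of _ l]] simp: dist_padic)
  qed
qed

lemma padic_norm_of_rat_le_1_imp:
  assumes "padic_norm (of_rat r :: 'a :: prime_card padic) \<le> 1"
  obtains c d where "r = of_int c / of_int d" "d > 0" "\<not> int CARD('a) dvd d"
proof -
  let ?p = "int CARD('a)"
  have "prime ?p" using prime_card[where 'a = 'a] by simp
  obtain c d where cd: "quotient_of r = (c, d)" by (cases "quotient_of r") auto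
  have d: "d > 0" "coprime c d" "r = of_int c / of_int d"
    using quotient_of_denom_pos[OF cd] quotient_of_coprime[OF cd] quotient_of_div[OF cd] by auto
  have "\<not> ?p dvd d"
  proof
    assume "?p dvd d"
    then have "\<not> ?p dvd c" using d(2) \<open>prime ?p\<close> by (meson coprime_common_divisor not_prime_unit)
    then have norm_c: "padic_norm (of_int c :: 'a padic) = 1"
      by (auto simp: padic_norm_of_int not_dvd_imp_multiplicity_0)
    have "?p ^ 1 dvd d" using \<open>?p dvd d\<close> by simp
    then have "padic_norm (of_int d :: 'a padic) \<le> inverse (real CARD('a)) ^ 1"
      by (simp only: padic_norm_of_int_le_iff)
    also have "\<dots> < 1" using one_less_prime_card[where 'a = 'a] by (simp add: inverse_less_1_iff)
    finally have "padic_norm (of_int d :: 'a padic) < 1" .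
    moreover have "padic_norm (of_rat r * of_int d :: 'a padic) = 1"
      using d norm_c by (simp add: of_rat_divide)
    moreover have "padic_norm (of_rat r * of_int d :: 'a padic) \<le> padic_norm (of_int d :: 'a padic)"
      using assms by (simp add: padic_norm_mult mult_left_le_one_le padic_norm_nonneg)
    ultimately show False by linarith
  qed
  then show ?thesis using that d by blast
qed

lemma padic_int_dense:
  fixes x :: "'a :: prime_card padic"
  assumes "padic_norm x \<le> 1"
  obtains a :: nat where "a < CARD('a) ^ k"
    "padic_norm (x - of_nat a) \<le> inverse (real CARD('a)) ^ k"
proof -
  let ?p = "int CARD('a)"
  have "prime ?p" using prime_card[where 'a = 'a] by simp
  obtain r where r: "dist (of_rat r) x < inverse (real CARD('a)) ^ k"
    using padic_rat_dense[of "inverse (real CARD('a)) ^ k" x] one_less_prime_card[where 'a = 'a]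
    by auto
  have "padic_norm (of_rat r :: 'a padic) \<le> 1"
    using padic_norm_ultrametric[of "of_rat r - x" x] r assms
      inverse_prime_card_power_le_1[of k, where 'a = 'a] by (simp add: dist_padic)
  then obtain c d where r_eq: "r = of_int c / of_int d" and d: "d > 0" "\<not> ?p dvd d"
    by (rule padic_norm_of_rat_le_1_imp)
  have "coprime d (?p ^ k)"
    using prime_imp_coprime[OF \<open>prime ?p\<close> d(2)] by (simp add: coprime_commute)
  then obtain e where e: "[d * e = 1] (mod ?p ^ k)" using cong_solve_coprime_int by blast
  have p_pos: "?p ^ k > 0" by simp
  define a where "a = nat ((c * e) mod ?p ^ k)"
  have a: "int a = (c * e) mod ?p ^ k" using p_pos by (simp add: a_def)
  have "[d * int a = d * (c * e)] (mod ?p ^ k)" by (simp add: a cong_def mod_mult_right_eq)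
  also have "[d * (c * e) = c] (mod ?p ^ k)"
    using cong_scalar_left[OF e, of c] by (simp add: mult.left_commute)
  finally have "?p ^ k dvd c - d * int a" by (simp add: cong_iff_dvd_diff dvd_diff_commute)
  moreover have "padic_norm (of_int d :: 'a padic) = 1"
    using d by (simp add: padic_norm_of_int not_dvd_imp_multiplicity_0)
  moreover have "(of_rat r :: 'a padic) - of_nat a = of_int (c - d * int a) / of_int d"
    using d by (simp add: r_eq of_rat_divide field_simps)
  ultimately have "padic_norm (of_rat r - of_nat a :: 'a padic) \<le> inverse (real CARD('a)) ^ k"
    by (simp only: padic_norm_divide padic_norm_of_int_le_iff div_by_1)
  then have "padic_norm ((x - of_rat r) + (of_rat r - of_nat a)) \<le> inverse (real CARD('a)) ^ k"
    using r by (intro padic_norm_add_le) (simp_all add: dist_padic padic_norm_diff_commute[of x])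
  then have "padic_norm (x - of_nat a) \<le> inverse (real CARD('a)) ^ k" by simp
  moreover have "int a < ?p ^ k" unfolding a using p_pos by simp
  then have "a < CARD('a) ^ k" by (metis of_nat_less_iff of_nat_power)
  ultimately show ?thesis using that by blast
qed

lemma tendsto_padic_vec_add:
  fixes X Y :: "'i \<Rightarrow> 'a :: prime_card padic ^ 'N"
  assumes "(X \<longlongrightarrow> L) F" "(Y \<longlongrightarrow> K) F"
  shows "((\<lambda>j. X j + Y j) \<longlongrightarrow> L + K) F"
  by (rule vec_tendstoI) (unfold vector_add_component, intro tendsto_add tendsto_vec_nth assms)

lemma tendsto_padic_vec_scale:
  fixes X :: "'i \<Rightarrow> 'a :: prime_card padic ^ 'N"
  assumes "(X \<longlongrightarrow> L) F"
  shows "((\<lambda>j. c *s X j) \<longlongrightarrow> c *s L) F"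
  by (rule vec_tendstoI)
    (unfold vector_smult_component, intro tendsto_mult tendsto_const tendsto_vec_nth assms)

lemma tendsto_padic_linear:
  fixes g :: "'a :: prime_card padic ^ 'N \<Rightarrow> 'a padic ^ 'K"
  assumes g: "Vector_Spaces.linear (*s) (*s) g" and X: "(X \<longlongrightarrow> L) F"
  shows "((\<lambda>j. g (X j)) \<longlongrightarrow> g L) F"
proof -
  have "((\<lambda>j. matrix g *v X j) \<longlongrightarrow> matrix g *v L) F"
  proof (rule vec_tendstoI)
    fix a
    show "((\<lambda>j. (matrix g *v X j) $ a) \<longlongrightarrow> (matrix g *v L) $ a) F"
      unfolding matrix_vector_mult_def vec_lambda_beta
      by (intro tendsto_sum tendsto_mult tendsto_const tendsto_vec_nth X)
  qed
  then show ?thesis by (simp add: matrix_works[OF g])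
qed

lemma linear_funpow:
  fixes U :: "'a :: field ^ 'N \<Rightarrow> 'a ^ 'N"
  assumes U: "Vector_Spaces.linear (*s) (*s) U"
  shows "Vector_Spaces.linear (*s) (*s) (U ^^ n)"
proof (induction n)
  case 0
  show ?case using vec.linear_ident by (simp add: id_def)
next
  case (Suc n)
  show ?case using Vector_Spaces.linear_compose[OF Suc U] by (simp only: funpow.simps(2))
qed

definition integral_vectors :: "('a :: prime_card padic ^ 'N) set" where
  "integral_vectors = {v. \<forall>a. padic_norm (v $ a) \<le> 1}"

definition congruent_id :: "nat \<Rightarrow> ('a :: prime_card padic ^ 'N \<Rightarrow> 'a padic ^ 'N) \<Rightarrow> bool" where
  "congruent_id l W \<longleftrightarrow> Vector_Spaces.linear (*s) (*s) W \<and>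
     (\<forall>v\<in>integral_vectors. \<forall>a. padic_norm ((W v - v) $ a) \<le> inverse (real CARD('a)) ^ l)"

lemma congruent_id_linear: "congruent_id l W \<Longrightarrow> Vector_Spaces.linear (*s) (*s) W"
  by (simp add: congruent_id_def)

lemma congruent_id_bound:
  fixes W :: "'a :: prime_card padic ^ 'N \<Rightarrow> 'a padic ^ 'N"
  shows "congruent_id l W \<Longrightarrow> v \<in> integral_vectors \<Longrightarrow>
    padic_norm ((W v - v) $ a) \<le> inverse (real CARD('a)) ^ l"
  by (simp add: congruent_id_def)

lemma congruent_id_integral:
  assumes W: "congruent_id l W" and v: "v \<in> integral_vectors"
  shows "W v \<in> integral_vectors"
  unfolding integral_vectors_def
proof (intro CollectI allI)
  fix a
  have "padic_norm ((W v - v) $ a + v $ a) \<le> 1"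
    using congruent_id_bound[OF W v, of a] v inverse_prime_card_power_le_1[of l, where 'a = 'a]
    by (intro padic_norm_add_le) (auto simp: integral_vectors_def)
  then show "padic_norm (W v $ a) \<le> 1" by simp
qed

lemma congruent_id_ident: "congruent_id l (\<lambda>v. v)"
  by (simp add: congruent_id_def vec.linear_ident)

lemma congruent_id_comp:
  assumes W: "congruent_id l W" and W': "congruent_id l W'"
  shows "congruent_id l (W \<circ> W')"
  unfolding congruent_id_def
proof (intro conjI ballI allI)
  show "Vector_Spaces.linear (*s) (*s) (W \<circ> W')"
    using assms by (intro Vector_Spaces.linear_compose[of _ "(*s)"] congruent_id_linear)
  fix v :: "'a padic ^ 'b" and a assume v: "v \<in> integral_vectors"
  have "padic_norm ((W (W' v) - W' v) $ a + (W' v - v) $ a) \<le> inverse (real CARD('a)) ^ l"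
    using congruent_id_bound[OF W congruent_id_integral[OF W' v]] congruent_id_bound[OF W' v]
    by (intro padic_norm_add_le) auto
  then show "padic_norm (((W \<circ> W') v - v) $ a) \<le> inverse (real CARD('a)) ^ l" by simp
qed

lemma congruent_id_funpow: "congruent_id l W \<Longrightarrow> congruent_id l (W ^^ n)"
proof (induction n)
  case 0
  show ?case using congruent_id_ident[of l] by (simp add: id_def)
next
  case (Suc n)
  then show ?case unfolding funpow.simps(2) by (intro congruent_id_comp)
qed

lemma congruent_id_mono:
  fixes W :: "'a :: prime_card padic ^ 'N \<Rightarrow> 'a padic ^ 'N"
  assumes "l' \<le> l" "congruent_id l W"
  shows "congruent_id l' W"
proof -
  have "inverse (real CARD('a)) ^ l \<le> inverse (real CARD('a)) ^ l'"
    using one_less_prime_card[where 'a = 'a] assms(1)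
    by (intro power_decreasing) (auto simp: inverse_le_1_iff)
  then show ?thesis using assms(2) unfolding congruent_id_def by (meson order_trans)
qed

lemma congruent_id_scaled_difference:
  fixes W :: "'a :: prime_card padic ^ 'N \<Rightarrow> 'a padic ^ 'N"
  assumes W: "congruent_id l W" and v: "v \<in> integral_vectors"
  obtains d where "d \<in> integral_vectors" "W v - v = of_nat CARD('a) ^ l *s d"
proof -
  let ?\<pi> = "of_nat CARD('a) ^ l :: 'a padic"
  have \<pi>: "padic_norm ?\<pi> = inverse (real CARD('a)) ^ l" "?\<pi> \<noteq> 0" "padic_norm ?\<pi> > 0"
    using one_less_prime_card[where 'a = 'a] by (simp_all add: padic_norm_card_power)
  define d where "d = inverse ?\<pi> *s (W v - v)"
  have "padic_norm (d $ a) \<le> 1" for a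
  proof -
    have "padic_norm (d $ a) = padic_norm ((W v - v) $ a) / padic_norm ?\<pi>"
      by (simp only: d_def vector_smult_component padic_norm_mult padic_norm_inverse
          divide_inverse mult.commute)
    also have "\<dots> \<le> 1"
      using congruent_id_bound[OF W v, of a] \<pi>(3) unfolding \<pi>(1) by (simp only: divide_le_eq_1_pos)
    finally show ?thesis .
  qed
  then have "d \<in> integral_vectors" by (simp add: integral_vectors_def)
  moreover have "W v - v = ?\<pi> *s d" using \<pi>(2) by (simp add: d_def vector_smult_assoc)
  ultimately show ?thesis by (rule that)
qed

lemma linear_funpow_diff_eq_sum:
  assumes W: "Vector_Spaces.linear (*s) (*s) W"
  shows "(W ^^ n) v - v = (\<Sum>i<n. (W ^^ i) (W v - v))"
proof (induction n)
  case (Suc n)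
  have "(W ^^ Suc n) v - v = (W ^^ n) (W v) - (W ^^ n) v + ((W ^^ n) v - v)"
    by (simp add: funpow_swap1)
  then show ?case using Suc by (simp add: vec.linear_diff[OF linear_funpow[OF W]])
qed simp

text \<open>
  \<open>W ^ q - 1 = (1 + W + \<dots> + W ^ (q - 1)) (W - 1)\<close>, and modulo \<open>q\<close> the first factor is \<open>q = 0\<close>.
\<close>

lemma congruent_id_card_power:
  fixes W :: "'a :: prime_card padic ^ 'N \<Rightarrow> 'a padic ^ 'N"
  assumes W: "congruent_id l W" and l: "l \<ge> 1"
  shows "congruent_id (Suc l) (W ^^ CARD('a))"
  unfolding congruent_id_def
proof (intro conjI ballI allI)
  let ?q = "CARD('a)"
  note W_pow = congruent_id_funpow[OF W]
  note linear = congruent_id_linear[OF W_pow]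
  show "Vector_Spaces.linear (*s) (*s) (W ^^ ?q)" by (rule linear)
  fix v :: "'a padic ^ 'N" and a assume v: "v \<in> integral_vectors"
  obtain d where d: "d \<in> integral_vectors" "W v - v = of_nat ?q ^ l *s d"
    using congruent_id_scaled_difference[OF W v] .
  have "(W ^^ ?q) v - v = of_nat ?q ^ l *s (\<Sum>i<?q. (W ^^ i) d)"
    unfolding linear_funpow_diff_eq_sum[OF congruent_id_linear[OF W]] d(2)
      vec.linear_scale[OF linear]
    by (simp add: vec.scale_sum_right)
  also have "(\<Sum>i<?q. (W ^^ i) d) = of_nat ?q *s d + (\<Sum>i<?q. (W ^^ i) d - d)"
    by (simp add: sum_subtractf vec_eq_iff of_nat_index)
  finally have diff_eq: "((W ^^ ?q) v - v) $ a =
      of_nat ?q ^ l * (of_nat ?q * d $ a + (\<Sum>i<?q. ((W ^^ i) d - d) $ a))"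
    by (simp only: vector_smult_component vector_add_component sum_component)
  have "padic_norm (of_nat ?q * d $ a + (\<Sum>i<?q. ((W ^^ i) d - d) $ a)) \<le> inverse (real ?q)"
  proof (rule padic_norm_add_le)
    show "padic_norm (of_nat ?q * d $ a) \<le> inverse (real ?q)"
      using d(1) padic_norm_card_power[of 1, where 'a = 'a]
      by (simp add: integral_vectors_def padic_norm_mult mult_left_le)
    show "padic_norm (\<Sum>i<?q. ((W ^^ i) d - d) $ a) \<le> inverse (real ?q)"
      using congruent_id_bound[OF congruent_id_mono[OF l W_pow] d(1)]
      by (intro padic_norm_sum_le) auto
  qed
  then show "padic_norm (((W ^^ ?q) v - v) $ a) \<le> inverse (real ?q) ^ Suc l"
    unfolding diff_eq padic_norm_mult padic_norm_card_power
    using one_less_prime_card[where 'a = 'a] by (simp add: mult_left_mono mult.commute)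
qed

lemma congruent_id_funpow_dvd:
  fixes W :: "'a :: prime_card padic ^ 'N \<Rightarrow> 'a padic ^ 'N"
  assumes W: "congruent_id 1 W" and n: "CARD('a) ^ l dvd n"
  shows "congruent_id (Suc l) (W ^^ n)"
proof -
  have "congruent_id (Suc l) (W ^^ (CARD('a) ^ l))"
  proof (induction l)
    case (Suc l)
    have "(W ^^ (CARD('a) ^ l)) ^^ CARD('a) = W ^^ (CARD('a) ^ Suc l)"
      by (simp add: funpow_mult mult.commute)
    then show ?case using congruent_id_card_power[OF Suc] by simp
  qed (use W in simp)
  moreover obtain c where "n = CARD('a) ^ l * c" using n by blast
  ultimately show ?thesis
    using congruent_id_funpow[of "Suc l" "W ^^ (CARD('a) ^ l)" c] by (simp add: funpow_mult)
qed

lemma congruent_idI_axis: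
  fixes W :: "'a :: prime_card padic ^ 'N \<Rightarrow> 'a padic ^ 'N"
  assumes W: "Vector_Spaces.linear (*s) (*s) W"
    and axis: "\<And>b a. padic_norm ((W (axis b 1) - axis b 1) $ a) \<le> inverse (real CARD('a)) ^ l"
  shows "congruent_id l W"
  unfolding congruent_id_def
proof (intro conjI ballI allI W)
  fix v :: "'a padic ^ 'N" and a assume v: "v \<in> integral_vectors"
  have "W v = W (\<Sum>b\<in>UNIV. v $ b *s axis b 1)" by (simp add: basis_expansion)
  also have "\<dots> = (\<Sum>b\<in>UNIV. v $ b *s W (axis b 1))"
    by (simp add: vec.linear_sum[OF W] vec.linear_scale[OF W])
  finally have "W v - v = (\<Sum>b\<in>UNIV. v $ b *s W (axis b 1)) - (\<Sum>b\<in>UNIV. v $ b *s axis b 1)"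
    by (simp add: basis_expansion)
  also have "\<dots> = (\<Sum>b\<in>UNIV. v $ b *s (W (axis b 1) - axis b 1))"
    by (simp add: sum_subtractf vec.scale_right_diff_distrib)
  finally have "(W v - v) $ a = (\<Sum>b\<in>UNIV. v $ b * (W (axis b 1) - axis b 1) $ a)"
    by (simp only: sum_component vector_smult_component)
  also have "padic_norm \<dots> \<le> inverse (real CARD('a)) ^ l"
  proof (rule padic_norm_sum_le)
    fix b
    have "padic_norm (v $ b) * padic_norm ((W (axis b 1) - axis b 1) $ a) \<le>
        1 * inverse (real CARD('a)) ^ l"
      using v axis by (intro mult_mono) (auto simp: integral_vectors_def padic_norm_nonneg)
    then show "padic_norm (v $ b * (W (axis b 1) - axis b 1) $ a) \<le> inverse (real CARD('a)) ^ l"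
      by (simp only: padic_norm_mult mult_1)
  qed simp
  finally show "padic_norm ((W v - v) $ a) \<le> inverse (real CARD('a)) ^ l" .
qed

lemma eventually_congruent_id:
  fixes W :: "'i \<Rightarrow> 'a :: prime_card padic ^ 'N \<Rightarrow> 'a padic ^ 'N"
  assumes linear: "\<And>j. Vector_Spaces.linear (*s) (*s) (W j)" and lim: "\<And>v. ((\<lambda>j. W j v) \<longlongrightarrow> v) F"
  shows "\<forall>\<^sub>F j in F. congruent_id l (W j)"
proof -
  have "\<forall>\<^sub>F j in F. \<forall>b a. padic_norm ((W j (axis b 1) - axis b 1) $ a) \<le>
      inverse (real CARD('a)) ^ l"
    unfolding vector_minus_component
    using lim
    by (intro eventually_all_finite padic_tendsto_iff[THEN iffD1, rule_format] tendsto_vec_nth)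
  then show ?thesis by (rule eventually_mono) (auto intro!: congruent_idI_axis linear)
qed

lemma tendsto_of_congruent_id:
  fixes W :: "'i \<Rightarrow> 'a :: prime_card padic ^ 'N \<Rightarrow> 'a padic ^ 'N"
  assumes "\<And>l. \<forall>\<^sub>F j in F. congruent_id l (W j)" "v \<in> integral_vectors"
  shows "((\<lambda>j. W j v) \<longlongrightarrow> v) F"
proof (intro vec_tendstoI padic_tendsto_iff[THEN iffD2] allI)
  fix a l
  show "\<forall>\<^sub>F j in F. padic_norm (W j v $ a - v $ a) \<le> inverse (real CARD('a)) ^ l"
    using assms(1)[of l] by (rule eventually_mono) (use congruent_id_bound[OF _ assms(2)] in simp)
qed

definition cyclic_span :: "('a :: field ^ 'N \<Rightarrow> 'a ^ 'N) \<Rightarrow> 'a ^ 'N \<Rightarrow> ('a ^ 'N) set" where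
  "cyclic_span U y = vec.span (range (\<lambda>n. (U ^^ n) y))"

lemma funpow_cyclic_span:
  assumes U: "Vector_Spaces.linear (*s) (*s) U" and "v \<in> cyclic_span U y"
  shows "(U ^^ n) v \<in> cyclic_span U y"
  using assms(2) unfolding cyclic_span_def
proof (induction rule: vec.span_induct_alt)
  case base
  show ?case by (simp add: vec.linear_0[OF linear_funpow[OF U]] vec.span_zero)
next
  case (step c x z)
  then obtain m where "x = (U ^^ m) y" by auto
  then have "(U ^^ n) x = (U ^^ (n + m)) y" by (simp add: funpow_add)
  then have "(U ^^ n) x \<in> vec.span (range (\<lambda>n. (U ^^ n) y))" by (auto intro: vec.span_base)
  then show ?case using step(2)
    by (simp add: vec.linear_add[OF linear_funpow[OF U]] vec.linear_scale[OF linear_funpow[OF U]]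
        vec.span_add vec.span_scale)
qed

lemma tendsto_cyclic_span:
  fixes U :: "'a :: prime_card padic ^ 'N \<Rightarrow> 'a padic ^ 'N"
  assumes U: "Vector_Spaces.linear (*s) (*s) U"
    and lim: "((\<lambda>j. s j *s (U ^^ \<sigma> j) y) \<longlongrightarrow> y) F" and v: "v \<in> cyclic_span U y"
  shows "((\<lambda>j. s j *s (U ^^ \<sigma> j) v) \<longlongrightarrow> v) F"
  using v unfolding cyclic_span_def
proof (induction rule: vec.span_induct_alt)
  note linear = linear_funpow[OF U]
  case base
  show ?case by (simp add: vec.linear_0[OF linear])
next
  note linear = linear_funpow[OF U]
  case (step c x z)
  then obtain m where m: "x = (U ^^ m) y" by auto
  have "(U ^^ \<sigma> j) x = (U ^^ m) ((U ^^ \<sigma> j) y)" for j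
    by (simp add: m add.commute flip: funpow_add o_apply[of "_ ^^ _"])
  then have "((\<lambda>j. s j *s (U ^^ \<sigma> j) x) \<longlongrightarrow> x) F"
    using tendsto_padic_linear[OF linear[of m] lim] by (simp add: m vec.linear_scale[OF linear])
  then have "((\<lambda>j. c *s (s j *s (U ^^ \<sigma> j) x) + s j *s (U ^^ \<sigma> j) z) \<longlongrightarrow> c *s x + z) F"
    using step(2) by (intro tendsto_padic_vec_add tendsto_padic_vec_scale)
  then show ?case
    by (simp add: vec.linear_add[OF linear] vec.linear_scale[OF linear] vec.scale_right_distrib
        vector_smult_assoc mult.commute)
qed

lemma ex_linear_projection:
  fixes E :: "('a :: field ^ 'N) set"
  assumes "vec.subspace E"
  obtains \<pi> where "Vector_Spaces.linear (*s) (*s) \<pi>" "\<And>v. v \<in> E \<Longrightarrow> \<pi> v = v" "\<And>v. \<pi> v \<in> E"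
proof -
  obtain B where B: "B \<subseteq> E" "vec.independent B" "E \<subseteq> vec.span B"
    using vec.maximal_independent_subset by blast
  obtain g where g: "Vector_Spaces.linear (*s) (*s) g" "\<And>x. x \<in> B \<Longrightarrow> g x = x" "range g = vec.span B"
    using vec.linear_independent_extend_subspace[OF B(2), of "\<lambda>x. x"] by auto
  have "g v \<in> E" for v using g(3) vec.span_minimal[OF B(1) assms] by auto
  moreover have "g v = v" if "v \<in> E" for v
    using vec.linear_eq_on[OF g(1) vec.linear_ident, of v B] that B(3) g(2) by blast
  ultimately show ?thesis using that g(1) by blast
qed

text \<open>
  The recurrent maps converge to the identity only on the cyclic subspace of \<open>y\<close>; completing them
  by the identity on a complement makes the convergence uniform on integral vectors.
\<close>

lemma ex_completed_recurrence:
  fixes U :: "'a :: prime_card padic ^ 'N \<Rightarrow> 'a padic ^ 'N"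
  assumes U: "Vector_Spaces.linear (*s) (*s) U"
    and lim: "((\<lambda>j. s j *s (U ^^ \<sigma> j) y) \<longlongrightarrow> y) F"
  obtains W where "\<And>l. \<forall>\<^sub>F j in F. congruent_id l (W j)"
    "\<And>j n. (W j ^^ n) y = s j ^ n *s (U ^^ (\<sigma> j * n)) y"
proof -
  note linear = linear_funpow[OF U]
  obtain \<pi> where \<pi>: "Vector_Spaces.linear (*s) (*s) \<pi>" "\<And>v. v \<in> cyclic_span U y \<Longrightarrow> \<pi> v = v"
    "\<And>v. \<pi> v \<in> cyclic_span U y"
    using ex_linear_projection[of "cyclic_span U y"]
    by (auto simp: cyclic_span_def vec.subspace_span)
  define W where "W j v = s j *s (U ^^ \<sigma> j) (\<pi> v) + (v - \<pi> v)" for j v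
  have "Vector_Spaces.linear (*s) (*s) (W j)" for j
  proof -
    have "Vector_Spaces.linear (*s) (*s) (\<lambda>v. (U ^^ \<sigma> j) (\<pi> v))"
      using Vector_Spaces.linear_compose[OF \<pi>(1) linear] by (simp add: o_def)
    then show ?thesis unfolding W_def
      by (intro vec.linear_compose_add vec.linear_compose_sub vec.linear_compose_scale_right
          vec.linear_ident \<pi>(1))
  qed
  moreover have "((\<lambda>j. W j v) \<longlongrightarrow> v) F" for v
  proof -
    have "((\<lambda>j. W j v) \<longlongrightarrow> \<pi> v + (v - \<pi> v)) F"
      unfolding W_def
      by (intro tendsto_padic_vec_add tendsto_const tendsto_cyclic_span[OF U lim] \<pi>(3))
    then show ?thesis by simp
  qed
  ultimately have "\<forall>\<^sub>F j in F. congruent_id l (W j)" for l by (rule eventually_congruent_id)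
  moreover have "(W j ^^ n) y = s j ^ n *s (U ^^ (\<sigma> j * n)) y" for j n
  proof (induction n)
    case (Suc n)
    have "y \<in> cyclic_span U y"
      unfolding cyclic_span_def by (rule vec.span_base) (rule image_eqI[of _ _ 0], simp_all)
    then have "s j ^ n *s (U ^^ (\<sigma> j * n)) y \<in> cyclic_span U y"
      using funpow_cyclic_span[OF U] by (simp add: cyclic_span_def vec.span_scale)
    then have "W j (s j ^ n *s (U ^^ (\<sigma> j * n)) y) =
        s j *s (U ^^ \<sigma> j) (s j ^ n *s (U ^^ (\<sigma> j * n)) y)"
      by (simp add: W_def \<pi>(2))
    also have "\<dots> = s j ^ Suc n *s (U ^^ (\<sigma> j * Suc n)) y"
      by (simp add: vec.linear_scale[OF linear] vector_smult_assoc funpow_add mult.commute)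
    finally show ?case using Suc by simp
  qed simp
  ultimately show ?thesis by (rule that)
qed

lemma tendsto_congruent_id_funpow:
  fixes W :: "'a :: prime_card padic ^ 'N \<Rightarrow> 'a padic ^ 'N"
  assumes W: "congruent_id 1 W" and y: "y \<in> integral_vectors"
    and \<sigma>: "\<And>j. \<sigma> j \<ge> 1" "\<And>l. \<forall>\<^sub>F j in F. CARD('a) ^ l dvd \<sigma> j - 1"
  shows "((\<lambda>j. (W ^^ \<sigma> j) y) \<longlongrightarrow> W y) F"
proof -
  have "\<forall>\<^sub>F j in F. congruent_id l (W ^^ (\<sigma> j - 1))" for l
    using \<sigma>(2)[of l]
    by (rule eventually_mono)
      (rule congruent_id_mono[OF le_SucI[OF order_refl] congruent_id_funpow_dvd[OF W]])
  then have "((\<lambda>j. (W ^^ (\<sigma> j - 1)) (W y)) \<longlongrightarrow> W y) F"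
    using congruent_id_integral[OF W y] by (rule tendsto_of_congruent_id)
  moreover have "(W ^^ (\<sigma> j - 1)) (W y) = (W ^^ \<sigma> j) y" for j
    using \<sigma>(1)[of j] by (cases "\<sigma> j") (auto simp: funpow_Suc_right simp del: funpow.simps)
  ultimately show ?thesis by simp
qed

lemma vec_proportional_of_cross_eq:
  fixes v w :: "'a :: field ^ 'N"
  assumes "\<And>a b. v $ a * w $ b = v $ b * w $ a" "w $ a0 \<noteq> 0"
  shows "\<exists>\<kappa>. v = \<kappa> *s w"
proof (intro exI vec_eq_iff[THEN iffD2] allI)
  fix a
  show "v $ a = ((v $ a0 / w $ a0) *s w) $ a"
    using assms(1)[of a a0] assms(2) by (simp add: field_simps)
qed

theorem line_recurrence:
  fixes U :: "'a :: prime_card padic ^ 'N \<Rightarrow> 'a padic ^ 'N"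
  assumes U: "Vector_Spaces.linear (*s) (*s) U" and y: "y \<in> integral_vectors" "y \<noteq> 0"
    and s: "\<And>j. s j \<noteq> 0" and F: "F \<noteq> bot" and lim: "((\<lambda>j. s j *s (U ^^ \<sigma> j) y) \<longlongrightarrow> y) F"
    and \<sigma>: "\<And>j. \<sigma> j \<ge> 1" "\<And>l. \<forall>\<^sub>F j in F. CARD('a) ^ l dvd \<sigma> j - 1"
  shows "\<exists>i \<kappa>. (U ^^ \<sigma> i) y = \<kappa> *s y"
proof -
  obtain W where W: "\<And>l. \<forall>\<^sub>F j in F. congruent_id l (W j)"
    and W_pow: "\<And>j n. (W j ^^ n) y = s j ^ n *s (U ^^ (\<sigma> j * n)) y"
    using ex_completed_recurrence[OF U lim] by metis
  obtain i where i: "congruent_id 1 (W i)" using eventually_happens'[OF F W] by blast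
  have lim_power: "((\<lambda>j. (W i ^^ \<sigma> j) y) \<longlongrightarrow> W i y) F"
    by (rule tendsto_congruent_id_funpow[OF i y(1) \<sigma>])
  have "\<forall>\<^sub>F j in F. congruent_id l (W j ^^ \<sigma> i)" for l
    using W[of l] by (rule eventually_mono) (rule congruent_id_funpow)
  then have lim_ident: "((\<lambda>j. (W j ^^ \<sigma> i) y) \<longlongrightarrow> y) F"
    using y(1) by (rule tendsto_of_congruent_id)
  have "W i y $ a * y $ b = W i y $ b * y $ a" for a b
  proof (rule tendsto_unique[OF F])
    show "((\<lambda>j. (W i ^^ \<sigma> j) y $ a * (W j ^^ \<sigma> i) y $ b) \<longlongrightarrow> W i y $ a * y $ b) F"
      by (intro tendsto_mult tendsto_vec_nth lim_power lim_ident)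
    have "(W i ^^ \<sigma> j) y $ a * (W j ^^ \<sigma> i) y $ b = (W i ^^ \<sigma> j) y $ b * (W j ^^ \<sigma> i) y $ a" for j
      by (simp add: W_pow mult_ac)
    then show "((\<lambda>j. (W i ^^ \<sigma> j) y $ a * (W j ^^ \<sigma> i) y $ b) \<longlongrightarrow> W i y $ b * y $ a) F"
      by (simp only:) (intro tendsto_mult tendsto_vec_nth lim_power lim_ident)
  qed
  moreover obtain a0 where "y $ a0 \<noteq> 0" using y(2) by (auto simp: vec_eq_iff)
  ultimately obtain \<kappa> where "W i y = \<kappa> *s y" using vec_proportional_of_cross_eq by blast
  then have "s i *s (U ^^ \<sigma> i) y = \<kappa> *s y" using W_pow[where j = i and n = 1] by simp
  then have "inverse (s i) *s (s i *s (U ^^ \<sigma> i) y) = inverse (s i) *s (\<kappa> *s y)" by simp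
  then show ?thesis using s[of i] by (auto simp: vector_smult_assoc)
qed

section \<open>Topology of p-adic vectors\<close>

instance padic :: (prime_card) second_countable_topology
proof
  let ?B = "(\<lambda>(r, n). ball (of_rat r :: 'a padic) (1 / real (Suc n))) ` UNIV"
  have "topological_basis ?B"
  proof (rule topological_basisI)
    show "open U" if "U \<in> ?B" for U using that by auto
    fix U and x :: "'a padic" assume "open U" "x \<in> U"
    then obtain e where e: "e > 0" "ball x e \<subseteq> U" by (auto simp: open_contains_ball)
    obtain n where n: "1 / real (Suc n) < e / 2" using nat_approx_posE[of "e / 2"] e(1) by auto
    obtain r where r: "dist (of_rat r) x < 1 / real (Suc n)"
      using padic_rat_dense[of "1 / real (Suc n)" x] by auto
    have "dist x y < e" if "dist (of_rat r) y < 1 / real (Suc n)" for y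
      using dist_triangle3[of x y "of_rat r"] r n that by linarith
    then have "ball (of_rat r) (1 / real (Suc n)) \<subseteq> U" using e(2) by auto
    then show "\<exists>B'\<in>?B. x \<in> B' \<and> B' \<subseteq> U" using r by auto
  qed
  then show "\<exists>B :: 'a padic set set. countable B \<and> open = generate_topology B"
    by (intro exI[of _ ?B] conjI topological_basis_imp_subbasis) auto
qed

instance vec :: ("{metric_space, second_countable_topology}", finite) second_countable_topology
proof
  obtain B :: "'a set set" where B: "countable B" "topological_basis B"
    using ex_countable_basis by blast
  let ?box = "\<lambda>b. {x :: 'a ^ 'b. \<forall>i. x $ i \<in> b i}"
  have "topological_basis (?box ` (UNIV \<rightarrow>\<^sub>E B))"
  proof (rule topological_basisI)
    fix U assume "U \<in> ?box ` (UNIV \<rightarrow>\<^sub>E B)"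
    then obtain b where b: "b \<in> UNIV \<rightarrow>\<^sub>E B" "U = ?box b" by (rule imageE)
    have "open (b i)" for i using topological_basis_open[OF B(2) PiE_mem[OF b(1)]] by simp
    then show "open U" unfolding b(2) open_vec_def by (intro ballI exI[of _ b]) auto
  next
    fix U and x :: "'a ^ 'b" assume "open U" "x \<in> U"
    then have "\<exists>A. (\<forall>i. open (A i) \<and> x $ i \<in> A i) \<and> (\<forall>y. (\<forall>i. y $ i \<in> A i) \<longrightarrow> y \<in> U)"
      unfolding open_vec_def by (rule bspec)
    then obtain A where A: "\<forall>i. open (A i) \<and> x $ i \<in> A i" "\<forall>y. (\<forall>i. y $ i \<in> A i) \<longrightarrow> y \<in> U"
      by (elim exE conjE)
    have "\<forall>i. \<exists>b. b \<in> B \<and> x $ i \<in> b \<and> b \<subseteq> A i"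
    proof
      fix i
      have "open (A i)" "x $ i \<in> A i" using A(1) by simp_all
      then obtain b where "b \<in> B" "x $ i \<in> b" "b \<subseteq> A i" by (rule topological_basisE[OF B(2)])
      then show "\<exists>b. b \<in> B \<and> x $ i \<in> b \<and> b \<subseteq> A i" by blast
    qed
    then obtain b where b: "\<forall>i. b i \<in> B \<and> x $ i \<in> b i \<and> b i \<subseteq> A i" by (rule choice[THEN exE])
    have "?box b \<subseteq> U"
    proof
      fix y assume "y \<in> ?box b"
      then have "\<forall>i. y $ i \<in> A i" using b by auto
      then show "y \<in> U" using A(2) by simp
    qed
    moreover have "?box b \<in> ?box ` (UNIV \<rightarrow>\<^sub>E B)"
      by (rule imageI) (use b in \<open>simp add: PiE_UNIV_domain\<close>)
    moreover have "x \<in> ?box b" using b by simp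
    ultimately show "\<exists>B'\<in>?box ` (UNIV \<rightarrow>\<^sub>E B). x \<in> B' \<and> B' \<subseteq> U" by (intro bexI conjI)
  qed
  moreover have "countable (?box ` (UNIV \<rightarrow>\<^sub>E B))"
    using B(1) by (intro countable_image countable_PiE) auto
  ultimately show "\<exists>B :: ('a ^ 'b) set set. countable B \<and> open = generate_topology B"
    by (intro exI[of _ "?box ` (UNIV \<rightarrow>\<^sub>E B)"] conjI topological_basis_imp_subbasis)
qed

lemma padic_norm_eq_of_close: "padic_norm (x - y) < padic_norm y \<Longrightarrow> padic_norm x = padic_norm y"
  using padic_norm_ultrametric[of "x - y" y] padic_norm_diff_le[of x "x - y"] by auto

lemma padic_norm_pos: "x \<noteq> 0 \<Longrightarrow> 0 < padic_norm x"
  using padic_norm_nonneg[of x] padic_norm_eq_0_iff[of x] by linarith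

lemma eventually_padic_close:
  fixes X :: "'i \<Rightarrow> 'a :: prime_card padic"
  shows "(X \<longlongrightarrow> x) F \<Longrightarrow> 0 < e \<Longrightarrow> \<forall>\<^sub>F j in F. padic_norm (X j - x) < e"
  using tendstoD[of X x F e] by (simp add: dist_padic)

lemma tendsto_padic_inverse:
  fixes X :: "'i \<Rightarrow> 'a :: prime_card padic"
  assumes X: "(X \<longlongrightarrow> x) F" and x: "x \<noteq> 0"
  shows "((\<lambda>j. inverse (X j)) \<longlongrightarrow> inverse x) F"
proof (rule tendstoI)
  fix e :: real assume "e > 0"
  then have "\<forall>\<^sub>F j in F. padic_norm (X j - x) < padic_norm x"
    "\<forall>\<^sub>F j in F. padic_norm (X j - x) < e * (padic_norm x)\<^sup>2"
    using padic_norm_pos[OF x] by (auto intro!: eventually_padic_close[OF X])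
  then show "\<forall>\<^sub>F j in F. dist (inverse (X j)) (inverse x) < e"
  proof eventually_elim
    case (elim j)
    have norm_X: "padic_norm (X j) = padic_norm x" using elim(1) by (rule padic_norm_eq_of_close)
    then have "X j \<noteq> 0" using padic_norm_pos[OF x] by auto
    then have "inverse (X j) - inverse x = - ((X j - x) / (X j * x))"
      using x by (simp add: field_simps)
    then have "dist (inverse (X j)) (inverse x) = padic_norm (X j - x) / (padic_norm x)\<^sup>2"
      by (simp only: dist_padic padic_norm_minus padic_norm_divide padic_norm_mult norm_X
          power2_eq_square)
    then show ?case using elim(2) padic_norm_pos[OF x] by (simp add: divide_less_eq)
  qed
qed

definition max_index :: "'a :: prime_card padic ^ 'N \<Rightarrow> 'N" where
  "max_index D = (SOME J. J \<in> {J. \<forall>J'. padic_norm (D $ J') \<le> padic_norm (D $ J)})"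

lemma padic_norm_le_max_index: "padic_norm (D $ J) \<le> padic_norm (D $ max_index D)"
proof -
  let ?n = "\<lambda>J. padic_norm (D $ J)"
  have "Max (range ?n) \<in> range ?n" by (rule Max_in) auto
  then obtain J0 where "Max (range ?n) = ?n J0" by blast
  then have "\<forall>J'. ?n J' \<le> ?n J0" by (metis Max_ge finite finite_imageI rangeI)
  then have "max_index D \<in> {J. \<forall>J'. ?n J' \<le> ?n J}"
    unfolding max_index_def by (intro someI[of "\<lambda>J. J \<in> {J. \<forall>J'. ?n J' \<le> ?n J}" J0]) simp
  then show ?thesis by blast
qed

lemma max_index_scale:
  assumes "c \<noteq> 0"
  shows "max_index (c *s D) = max_index D"
  unfolding max_index_def by (simp add: padic_norm_mult padic_norm_pos[OF assms])

lemma max_index_nonzero: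
  assumes "D \<noteq> 0"
  shows "D $ max_index D \<noteq> 0"
proof
  assume "D $ max_index D = 0"
  then have "D $ J = 0" for J
    using padic_norm_le_max_index[of D J] padic_norm_nonneg[of "D $ J"]
    by (simp add: padic_norm_eq_0_iff)
  then show False using assms by (simp add: vec_eq_iff)
qed

lemma max_index_eq_of_close:
  fixes D E :: "'a :: prime_card padic ^ 'N"
  assumes close: "\<And>J. padic_norm (E $ J - D $ J) < padic_norm (D $ max_index D)"
  shows "max_index E = max_index D"
proof -
  define m where "m = padic_norm (D $ max_index D)"
  have D: "padic_norm (D $ J) \<le> m" for J unfolding m_def by (rule padic_norm_le_max_index)
  have E: "padic_norm (E $ J) \<le> m" for J
    using padic_norm_add_le[of "E $ J - D $ J" m "D $ J"] close[of J] D[of J] by (simp add: m_def)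
  have E_iff_D: "padic_norm (E $ J) = m \<longleftrightarrow> padic_norm (D $ J) = m" for J
  proof
    show "padic_norm (E $ J) = m" if "padic_norm (D $ J) = m"
      using padic_norm_eq_of_close[of "E $ J" "D $ J"] close[of J] that by (simp add: m_def)
    show "padic_norm (D $ J) = m" if "padic_norm (E $ J) = m"
      using padic_norm_eq_of_close[of "D $ J" "E $ J"] close[of J] that
      by (simp add: m_def padic_norm_diff_commute)
  qed
  have argmax_iff: "(\<forall>J'. n J' \<le> n J) \<longleftrightarrow> n J = m" if n: "\<And>J. n J \<le> m" "n J0 = m" for n :: "'N \<Rightarrow> real"
    and J J0
  proof
    assume "\<forall>J'. n J' \<le> n J"
    then show "n J = m" using n(1)[of J] n(2) by (metis antisym)
  qed (use n in simp)
  have "(\<forall>J'. padic_norm (E $ J') \<le> padic_norm (E $ J)) \<longleftrightarrow>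
      (\<forall>J'. padic_norm (D $ J') \<le> padic_norm (D $ J))" for J
    using argmax_iff[where n = "\<lambda>J. padic_norm (E $ J)" and J = J, OF E, of "max_index D"]
      argmax_iff[where n = "\<lambda>J. padic_norm (D $ J)" and J = J, OF D, of "max_index D"] E_iff_D
        by (simp add: m_def)
  then show ?thesis by (simp add: max_index_def)
qed

definition normalise :: "'a :: prime_card padic ^ 'N \<Rightarrow> 'a padic ^ 'N" where
  "normalise D = inverse (D $ max_index D) *s D"

lemma normalise_scale: "c \<noteq> 0 \<Longrightarrow> normalise (c *s D) = normalise D"
  by (simp add: normalise_def max_index_scale vec_eq_iff)

lemma normalise_integral:
  assumes "D \<noteq> 0"
  shows "normalise D \<in> integral_vectors"
proof -
  have "padic_norm (normalise D $ J) = padic_norm (D $ J) / padic_norm (D $ max_index D)" for J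
    by (simp add: normalise_def padic_norm_mult padic_norm_inverse divide_inverse mult.commute)
  then show ?thesis
    using padic_norm_le_max_index[of D] padic_norm_pos[OF max_index_nonzero[OF assms]]
    by (simp add: integral_vectors_def)
qed

lemma normalise_max_index: "D \<noteq> 0 \<Longrightarrow> normalise D $ max_index D = 1"
  using max_index_nonzero[of D] by (simp add: normalise_def)

lemma normalise_nonzero: "D \<noteq> 0 \<Longrightarrow> normalise D \<noteq> 0"
  using normalise_max_index[of D] by auto

lemma scale_normalise: "D \<noteq> 0 \<Longrightarrow> (D $ max_index D) *s normalise D = D"
  using max_index_nonzero[of D] by (simp add: normalise_def vec_eq_iff)

text \<open>Away from 0 the index of a largest coordinate is locally constant.\<close>

lemma tendsto_normalise:
  fixes X :: "'i \<Rightarrow> 'a :: prime_card padic ^ 'N"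
  assumes X: "(X \<longlongrightarrow> D) F" and D: "D \<noteq> 0"
  shows "((\<lambda>j. normalise (X j)) \<longlongrightarrow> normalise D) F"
proof (rule Lim_transform_eventually)
  have "((\<lambda>j. inverse (X j $ max_index D) * X j $ J) \<longlongrightarrow> inverse (D $ max_index D) * D $ J) F" for J
    by (intro tendsto_mult tendsto_padic_inverse tendsto_vec_nth X max_index_nonzero D)
  then show "((\<lambda>j. inverse (X j $ max_index D) *s X j) \<longlongrightarrow> normalise D) F"
    by (intro vec_tendstoI) (simp add: normalise_def)
  have "\<forall>\<^sub>F j in F. \<forall>J. padic_norm (X j $ J - D $ J) < padic_norm (D $ max_index D)"
    by (intro eventually_all_finite eventually_padic_close tendsto_vec_nth X padic_norm_pos
        max_index_nonzero D)
  then show "\<forall>\<^sub>F j in F. inverse (X j $ max_index D) *s X j = normalise (X j)"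
  proof (rule eventually_mono)
    fix j assume "\<forall>J. padic_norm (X j $ J - D $ J) < padic_norm (D $ max_index D)"
    then have "max_index (X j) = max_index D" by (intro max_index_eq_of_close) blast
    then show "inverse (X j $ max_index D) *s X j = normalise (X j)" by (simp only: normalise_def)
  qed
qed

lemma recurrent_subfilter:
  fixes X :: "'i \<Rightarrow> 'z :: metric_space"
  assumes "\<And>\<epsilon>. \<epsilon> > 0 \<Longrightarrow> \<exists>\<^sub>F j in G. dist (X j) L < \<epsilon>"
  obtains F where "F \<noteq> bot" "F \<le> G" "(X \<longlongrightarrow> L) F"
proof (rule that[of "inf G (filtercomap X (nhds L))"])
  show "inf G (filtercomap X (nhds L)) \<noteq> bot"
  proof
    assume "inf G (filtercomap X (nhds L)) = bot"
    then obtain P Q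
      where PQ: "eventually P G" "eventually Q (filtercomap X (nhds L))" "\<And>j. P j \<Longrightarrow> Q j \<Longrightarrow> False"
      by (auto simp: trivial_limit_def eventually_inf)
    then obtain \<epsilon> where \<epsilon>: "\<epsilon> > 0" "\<And>j. dist (X j) L < \<epsilon> \<Longrightarrow> Q j"
      by (auto simp: eventually_filtercomap eventually_nhds_metric)
    have "\<forall>\<^sub>F j in G. \<not> dist (X j) L < \<epsilon>"
      using PQ(1) by (rule eventually_mono) (use PQ(3) \<epsilon>(2) in blast)
    then show False using assms[OF \<epsilon>(1)] by (simp add: frequently_def)
  qed
  show "(X \<longlongrightarrow> L) (inf G (filtercomap X (nhds L)))"
    by (rule filterlim_mono[OF filterlim_filtercomap]) auto
qed simp

section \<open>Pluecker coordinates\<close>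

abbreviation coord_index :: "'n :: finite \<Rightarrow> nat" where
  "coord_index \<equiv> to_nat_on UNIV"

lemma bij_betw_coord_index: "bij_betw coord_index (UNIV :: 'n :: finite set) {..<CARD('n)}"
  by (rule to_nat_on_finite) simp

lemma ex_coord_index: "m < CARD('n :: finite) \<Longrightarrow> \<exists>i :: 'n. coord_index i = m"
  using bij_betw_coord_index[where 'n = 'n] by (metis bij_betw_imp_surj_on imageE lessThan_iff)

text \<open>
  Pluecker coordinates without exterior powers: the coordinate \<open>J\<close> of a \<open>k\<close>-frame is the
  determinant of the matrix whose first \<open>k\<close> rows (in the enumeration \<open>coord_index\<close>) are the frame
  and whose remaining rows are the unit vectors \<open>J i\<close>.
\<close>

definition frame_rows :: "nat \<Rightarrow> (nat \<Rightarrow> 'a :: field ^ 'n) \<Rightarrow> ('n \<Rightarrow> 'a ^ 'n) \<Rightarrow> 'a ^ 'n ^ 'n" where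
  "frame_rows k v W = (\<chi> i. if coord_index i < k then v (coord_index i) else W i)"

definition plucker :: "nat \<Rightarrow> (nat \<Rightarrow> 'a :: field ^ 'n) \<Rightarrow> 'a ^ ('n \<Rightarrow> 'n)" where
  "plucker k v = (\<chi> J. det (frame_rows k v (\<lambda>i. axis (J i) 1)))"

definition minor_coeff :: "nat \<Rightarrow> ('n \<Rightarrow> 'a :: field ^ 'n) \<Rightarrow> ('n \<Rightarrow> 'n) \<Rightarrow> 'a" where
  "minor_coeff k W J = (if \<forall>i. coord_index i < k \<longrightarrow> J i = i
     then \<Prod>i\<in>UNIV. (if coord_index i < k then 1 else W i $ J i) else 0)"

lemma row_frame_rows:
  "row i (frame_rows k v W) = (if coord_index i < k then v (coord_index i) else W i)"
  by (simp add: row_def frame_rows_def vec_eq_iff)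

lemma det_frame_rows_expand:
  fixes v :: "nat \<Rightarrow> 'a :: field ^ 'n"
  shows "det (frame_rows k v W) = (\<Sum>J\<in>UNIV. minor_coeff k W J * plucker k v $ J)"
proof -
  define a where "a i j = (if coord_index i < k then (if j = i then v (coord_index i) else 0)
    else W i $ j *s axis j 1)" for i j :: 'n
  have "frame_rows k v W = (\<chi> i. sum (a i) UNIV)"
    unfolding frame_rows_def
    by (rule arg_cong[of _ _ vec_lambda]) (auto simp: a_def fun_eq_iff basis_expansion)
  then have "det (frame_rows k v W) = (\<Sum>J | \<forall>i. J i \<in> UNIV. det (\<chi> i. a i (J i)))"
    by (simp only: det_linear_rows_sum[OF finite])
  also have "\<dots> = (\<Sum>J\<in>UNIV. minor_coeff k W J * plucker k v $ J)"
  proof (intro sum.cong)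
    fix J :: "'n \<Rightarrow> 'n"
    show "det (\<chi> i. a i (J i)) = minor_coeff k W J * plucker k v $ J"
    proof (cases "\<forall>i. coord_index i < k \<longrightarrow> J i = i")
      case True
      let ?c = "\<lambda>i. if coord_index i < k then 1 else W i $ J i"
      let ?r = "\<lambda>i. if coord_index i < k then v (coord_index i) else axis (J i) 1"
      have "(\<chi> i. a i (J i)) = (\<chi> i. ?c i *s ?r i)"
        using True by (intro arg_cong[of _ _ vec_lambda]) (auto simp: a_def fun_eq_iff)
      then have "det (\<chi> i. a i (J i)) = prod ?c UNIV * det (\<chi> i. ?r i)" by (simp only: det_rows_mul)
      then show ?thesis using True by (simp add: minor_coeff_def plucker_def frame_rows_def)
    next
      case False
      then obtain i where i: "coord_index i < k" "J i \<noteq> i" by blast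
      have "row i (\<chi> i. a i (J i)) = 0" using i by (simp add: row_def a_def vec_eq_iff)
      then have "det (\<chi> i. a i (J i)) = 0" by (rule det_zero_row(2))
      then show ?thesis using False by (auto simp: minor_coeff_def)
    qed
  qed simp
  finally show ?thesis .
qed

lemma det_nonzero_if_independent_rows:
  fixes A :: "'a :: field ^ 'n ^ 'n"
  assumes inj: "inj (\<lambda>i. A $ i)" and indep: "vec.independent (range (\<lambda>i. A $ i))"
  shows "det A \<noteq> 0"
proof -
  let ?g = "the_inv (\<lambda>i. A $ i)"
  have "\<exists>C. A ** C = mat 1"
    unfolding matrix_right_invertible_independent_rows
  proof (intro allI impI)
    fix c :: "'n \<Rightarrow> 'a" and i assume c: "(\<Sum>i\<in>UNIV. c i *s row i A) = 0"
    have "(\<Sum>b\<in>range (\<lambda>i. A $ i). c (?g b) *s b) = (\<Sum>i\<in>UNIV. c i *s A $ i)"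
      by (subst sum.reindex[OF inj]) (simp add: the_inv_f_f[OF inj])
    also have "\<dots> = 0" using c by (simp add: row_def vec_nth_inverse)
    finally have "c (?g (A $ i)) = 0"
      using vec.independentD[OF indep _ order_refl, of "\<lambda>b. c (?g b)"] by simp
    then show "c i = 0" by (simp only: the_inv_f_f[OF inj])
  qed
  then show ?thesis using invertible_right_inverse invertible_det_nz by blast
qed

lemma vec_dim_UNIV: "vec.dim (UNIV :: ('a :: field ^ 'n) set) = CARD('n)"
  by (simp add: vec.dim_UNIV card_cart_basis)

lemma frames_le_CARD:
  fixes v :: "nat \<Rightarrow> 'a :: field ^ 'n"
  assumes "inj_on v {..<k}" "vec.independent (v ` {..<k})"
  shows "k \<le> CARD('n)"
  using vec.independent_card_le_dim[OF subset_UNIV assms(2)] card_image[OF assms(1)]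
  by (simp add: card_cart_basis)

lemma frame_extends_to_basis:
  fixes v :: "nat \<Rightarrow> 'a :: field ^ 'n"
  assumes v: "inj_on v {..<k}" "vec.independent (v ` {..<k})"
  obtains W where "inj (\<lambda>i. frame_rows k v W $ i)"
    "vec.independent (range (\<lambda>i. frame_rows k v W $ i))"
    "vec.span (range (\<lambda>i. frame_rows k v W $ i)) = UNIV"
proof -
  let ?B = "v ` {..<k}"
  let ?B' = "vec.extend_basis ?B"
  have B': "?B \<subseteq> ?B'" "vec.independent ?B'" "vec.span ?B' = UNIV"
    using vec.extend_basis_superset[OF v(2)] vec.independent_extend_basis[OF v(2)]
      vec.span_extend_basis[OF v(2)] by auto
  have fin: "finite ?B'" using B'(2) by (rule vec.finiteI_independent)
  have card_B': "card ?B' = CARD('n)"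
    using vec.dim_eq_card_independent[OF B'(2)] vec.dim_span[of ?B']
      vec_dim_UNIV[where 'a = 'a and 'n = 'n] B'(3)
    by metis
  have card_B: "card ?B = k" using card_image[OF v(1)] by simp
  have "card (?B' - ?B) = card {k..<CARD('n)}"
    using card_Diff_subset[OF finite_subset[OF B'(1) fin] B'(1)] card_B card_B' by simp
  then obtain h where h: "bij_betw h {k..<CARD('n)} (?B' - ?B)"
    using finite_same_card_bij[of "{k..<CARD('n)}" "?B' - ?B"] fin by auto
  define F where "F m = (if m < k then v m else h m)" for m
  have "bij_betw F ({..<k} \<union> {k..<CARD('n)}) (?B \<union> (?B' - ?B))"
  proof (rule bij_betw_combine)
    show "bij_betw F {..<k} ?B" using v(1) by (auto simp: F_def bij_betw_def inj_on_def)
    show "bij_betw F {k..<CARD('n)} (?B' - ?B)"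
      using h by (rule bij_betw_cong[THEN iffD1, rotated]) (auto simp: F_def)
  qed auto
  moreover have "{..<k} \<union> {k..<CARD('n)} = {..<CARD('n)}" using frames_le_CARD[OF v] by auto
  moreover have "?B \<union> (?B' - ?B) = ?B'" using B'(1) by auto
  ultimately have "bij_betw F {..<CARD('n)} ?B'" by simp
  then have "bij_betw (F \<circ> coord_index) (UNIV :: 'n set) ?B'"
    using bij_betw_trans[OF bij_betw_coord_index] by blast
  moreover have "(\<lambda>i. frame_rows k v (h \<circ> coord_index) $ i) = F \<circ> coord_index"
    by (auto simp: frame_rows_def F_def)
  ultimately have "bij_betw (\<lambda>i. frame_rows k v (h \<circ> coord_index) $ i) UNIV ?B'" by (simp only:)
  then show ?thesis using B'(2,3) by (intro that[of "h \<circ> coord_index"]) (simp_all add: bij_betw_def)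
qed

lemma plucker_nonzero:
  assumes "v \<in> frames k"
  shows "plucker k v \<noteq> 0"
proof
  assume zero: "plucker k v = 0"
  have "inj_on v {..<k}" "vec.independent (v ` {..<k})" using assms by (auto simp: frames_def)
  then obtain W where "inj (\<lambda>i. frame_rows k v W $ i)"
    "vec.independent (range (\<lambda>i. frame_rows k v W $ i))"
    by (rule frame_extends_to_basis)
  then have "det (frame_rows k v W) \<noteq> 0" by (rule det_nonzero_if_independent_rows)
  then show False using zero by (simp add: det_frame_rows_expand)
qed

lemma frame_rows_matrix_mult:
  fixes A :: "'a :: field ^ 'n ^ 'n"
  shows "frame_rows k (\<lambda>m. A *v v m) (\<lambda>i. A *v W i) = frame_rows k v W ** transpose A"
proof -
  have "(N ** transpose A) $ i = A *v (N $ i)" for N :: "'a ^ 'n ^ 'n" and i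
    by (simp add: vec_eq_iff matrix_matrix_mult_def matrix_vector_mult_def transpose_def
        mult.commute)
  then show ?thesis by (simp add: vec_eq_iff frame_rows_def)
qed

lemma frame_rows_cong: "(\<And>m. m < k \<Longrightarrow> v m = v' m) \<Longrightarrow> frame_rows k v W = frame_rows k v' W"
  by (simp add: frame_rows_def vec_eq_iff)

definition plucker_map :: "nat \<Rightarrow> 'a :: field ^ 'n ^ 'n \<Rightarrow> 'a ^ ('n \<Rightarrow> 'n) \<Rightarrow> 'a ^ ('n \<Rightarrow> 'n)" where
  "plucker_map k A = (*v) (\<chi> J J'. det A * minor_coeff k (\<lambda>i. matrix_inv A *v axis (J i) 1) J')"

lemma linear_plucker_map: "Vector_Spaces.linear (*s) (*s) (plucker_map k A)"
  unfolding plucker_map_def by (rule matrix_vector_mul_linear_gen)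

lemma plucker_matrix_image:
  fixes A :: "'a :: field ^ 'n ^ 'n"
  assumes A: "invertible A" and v': "\<And>m. m < k \<Longrightarrow> v' m = A *v v m"
  shows "plucker k v' = plucker_map k A (plucker k v)"
  unfolding vec_eq_iff
proof
  fix J
  have inverse: "A *v (matrix_inv A *v x) = x" for x
    using someI_ex[OF A[unfolded invertible_def]] unfolding matrix_inv_def
    by (simp add: matrix_vector_mul_assoc)
  have "plucker k v' $ J =
      det (frame_rows k (\<lambda>m. A *v v m) (\<lambda>i. A *v (matrix_inv A *v axis (J i) 1)))"
    unfolding inverse plucker_def vec_lambda_beta by (intro arg_cong[of _ _ det] frame_rows_cong v')
  also have "\<dots> = det (frame_rows k v (\<lambda>i. matrix_inv A *v axis (J i) 1)) * det A"
    by (simp only: frame_rows_matrix_mult det_mul det_transpose)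
  finally show "plucker k v' $ J = plucker_map k A (plucker k v) $ J"
    by (simp add: det_frame_rows_expand plucker_map_def matrix_vector_mult_def
        sum_distrib_left sum_distrib_right mult_ac)
qed

lemma ex_det_frame_rows_nonzero_containing:
  fixes v :: "nat \<Rightarrow> 'a :: field ^ 'n"
  assumes v: "v \<in> frames k" and x: "x \<notin> vec.span (v ` {..<k})"
  obtains W i where "coord_index i \<ge> k" "W i = x" "det (frame_rows k v W) \<noteq> 0"
proof -
  define w where "w = v(k := x)"
  have w_image: "w ` {..<Suc k} = insert x (v ` {..<k})" by (auto simp: w_def lessThan_Suc)
  have "x \<notin> v ` {..<k}" using x by (auto intro: vec.span_base)
  moreover have "inj_on v {..<k}" "vec.independent (v ` {..<k})" using v by (auto simp: frames_def)
  ultimately have w: "inj_on w {..<Suc k}" "vec.independent (w ` {..<Suc k})"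
    unfolding w_image using vec.independent_insertI[OF x]
    by (auto simp: w_def lessThan_Suc inj_on_def)
  obtain W where "inj (\<lambda>i. frame_rows (Suc k) w W $ i)"
    "vec.independent (range (\<lambda>i. frame_rows (Suc k) w W $ i))"
    using w by (rule frame_extends_to_basis)
  then have W: "det (frame_rows (Suc k) w W) \<noteq> 0" by (rule det_nonzero_if_independent_rows)
  obtain i :: 'n where i: "coord_index i = k"
    using ex_coord_index[where 'n = 'n, of k] frames_le_CARD[OF w] by auto
  have "coord_index j = k \<Longrightarrow> j = i" for j
    using i bij_betw_coord_index[where 'n = 'n] by (auto simp: bij_betw_def inj_on_def)
  then have "frame_rows (Suc k) w W = frame_rows k v (W(i := x))"
    unfolding frame_rows_def
    by (intro arg_cong[of _ _ vec_lambda] ext) (auto simp: w_def less_Suc_eq i)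
  then show ?thesis using W i by (intro that[of i "W(i := x)"]) auto
qed

lemma plucker_span_subset:
  fixes v :: "nat \<Rightarrow> 'a :: field ^ 'n"
  assumes v: "v \<in> frames k" and proportional: "plucker k v' = c *s plucker k v" "c \<noteq> 0"
  shows "v' ` {..<k} \<subseteq> vec.span (v ` {..<k})"
proof (rule image_subsetI, rule ccontr)
  fix j assume j: "j \<in> {..<k}" and outside: "v' j \<notin> vec.span (v ` {..<k})"
  obtain W i0 where W: "coord_index i0 \<ge> k" "W i0 = v' j" "det (frame_rows k v W) \<noteq> 0"
    using ex_det_frame_rows_nonzero_containing[OF v outside] .
  have "k \<le> CARD('n)" using v frames_le_CARD by (auto simp: frames_def)
  then obtain j0 :: 'n where j0: "coord_index j0 = j"
    using ex_coord_index[where 'n = 'n, of j] j by auto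
  have "det (frame_rows k v' W) = 0"
  proof (rule det_identical_rows)
    show "i0 \<noteq> j0" using W(1) j0 j by auto
    show "row i0 (frame_rows k v' W) = row j0 (frame_rows k v' W)"
      using W(1,2) j0 j by (simp add: row_frame_rows)
  qed
  moreover have "det (frame_rows k v' W) = c * det (frame_rows k v W)"
    unfolding det_frame_rows_expand proportional(1) by (simp add: sum_distrib_left mult_ac)
  ultimately show False using W(3) proportional(2) by simp
qed

lemma det_frame_rows_mod_span:
  fixes v :: "nat \<Rightarrow> 'a :: field ^ 'n"
  assumes k: "k \<le> CARD('n)" and W: "\<And>i. W i - W' i \<in> vec.span (v ` {..<k})"
  shows "det (frame_rows k v W) = det (frame_rows k v W')"
proof -
  let ?N = "\<lambda>S. frame_rows k v (\<lambda>i. if i \<in> S then W i else W' i)"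
  have "det (?N S) = det (frame_rows k v W')" if "finite S" for S
    using that
  proof (induction S rule: finite_induct)
    case (insert i S)
    show ?case
    proof (cases "coord_index i < k")
      case True
      then have "?N (insert i S) = ?N S" by (auto simp: frame_rows_def vec_eq_iff)
      then show ?thesis using insert by simp
    next
      case False
      have "v ` {..<k} \<subseteq> {row j (?N S) |j. j \<noteq> i}"
      proof (rule image_subsetI)
        fix m assume m: "m \<in> {..<k}"
        obtain j :: 'n where j: "coord_index j = m"
          using ex_coord_index[where 'n = 'n, of m] m k by auto
        then show "v m \<in> {row j (?N S) |j. j \<noteq> i}"
          using m False by (auto simp: row_frame_rows intro!: exI[of _ j])
      qed
      then have "W i - W' i \<in> vec.span {row j (?N S) |j. j \<noteq> i}" using W vec.span_mono by blast
      then have "det (\<chi> j. if j = i then row i (?N S) + (W i - W' i) else row j (?N S)) =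
          det (?N S)"
        by (rule det_row_span)
      moreover have "(\<chi> j. if j = i then row i (?N S) + (W i - W' i) else row j (?N S)) =
          ?N (insert i S)"
        using insert False by (simp add: vec_eq_iff row_frame_rows) (simp add: frame_rows_def)
      ultimately show ?thesis using insert by simp
    qed
  qed simp
  from this[of UNIV] show ?thesis by simp
qed

lemma ex_linear_frame_change:
  fixes v v' :: "nat \<Rightarrow> 'a :: field ^ 'n"
  assumes v: "v \<in> frames k" and same_span: "vec.span (v' ` {..<k}) = vec.span (v ` {..<k})"
  obtains g where "Vector_Spaces.linear (*s) (*s) g" "\<And>m. m < k \<Longrightarrow> g (v m) = v' m"
    "\<And>x. g x - x \<in> vec.span (v ` {..<k})"
proof -
  have v_indep: "inj_on v {..<k}" "vec.independent (v ` {..<k})" using v by (auto simp: frames_def)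
  obtain W where W: "inj (\<lambda>i. frame_rows k v W $ i)"
    "vec.independent (range (\<lambda>i. frame_rows k v W $ i))"
    "vec.span (range (\<lambda>i. frame_rows k v W $ i)) = UNIV"
    using v_indep by (rule frame_extends_to_basis)
  let ?b = "\<lambda>i. frame_rows k v W $ i"
  obtain g where g: "Vector_Spaces.linear (*s) (*s) g"
    and "\<And>x. x \<in> range ?b \<Longrightarrow> g x = frame_rows k v' W $ the_inv ?b x"
    using vec.linear_independent_extend[OF W(2), of "\<lambda>x. frame_rows k v' W $ the_inv ?b x"] by blast
  then have g_basis: "g (?b i) = frame_rows k v' W $ i" for i by (simp add: the_inv_f_f[OF W(1)])
  have "g (v m) = v' m" if m: "m < k" for m
  proof -
    obtain i :: 'n where "coord_index i = m"
      using ex_coord_index[where 'n = 'n, of m] m frames_le_CARD[OF v_indep] by auto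
    then show ?thesis using g_basis[of i] m by (simp add: frame_rows_def)
  qed
  moreover have "g x - x \<in> vec.span (v ` {..<k})" for x
  proof -
    have "v' m - v m \<in> vec.span (v ` {..<k})" if "m < k" for m
      using that vec.span_base[of "v' m" "v' ` {..<k}"] vec.span_base[of "v m" "v ` {..<k}"]
        same_span
      by (intro vec.span_diff) auto
    then have "g (?b i) - ?b i \<in> vec.span (v ` {..<k})" for i
      unfolding g_basis by (simp add: frame_rows_def vec.span_zero)
    then have "(\<lambda>x. g x - x) ` range ?b \<subseteq> vec.span (v ` {..<k})" by blast
    then have "vec.span ((\<lambda>x. g x - x) ` range ?b) \<subseteq> vec.span (v ` {..<k})"
      by (rule vec.span_minimal) (rule vec.subspace_span)
    moreover have "vec.span ((\<lambda>x. g x - x) ` range ?b) = range (\<lambda>x. g x - x)"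
      using vec.linear_span_image[OF vec.linear_compose_sub[OF g vec.linear_ident], of "range ?b"]
        W(3)
      by simp
    ultimately show ?thesis by auto
  qed
  ultimately show ?thesis using that g by blast
qed

lemma plucker_proportional:
  fixes v :: "nat \<Rightarrow> 'a :: field ^ 'n"
  assumes v: "v \<in> frames k" and v': "v' \<in> frames k"
    and same_span: "vec.span (v' ` {..<k}) = vec.span (v ` {..<k})"
  shows "\<exists>c. c \<noteq> 0 \<and> plucker k v' = c *s plucker k v"
proof -
  obtain g where g: "Vector_Spaces.linear (*s) (*s) g" "\<And>m. m < k \<Longrightarrow> g (v m) = v' m"
    "\<And>x. g x - x \<in> vec.span (v ` {..<k})"
    by (rule ex_linear_frame_change[OF v same_span]) blast
  have k: "k \<le> CARD('n)" using v frames_le_CARD by (auto simp: frames_def)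
  have "plucker k v' = det (matrix g) *s plucker k v"
    unfolding vec_eq_iff
  proof
    fix J :: "'n \<Rightarrow> 'n"
    let ?W = "\<lambda>i. axis (J i) 1 :: 'a ^ 'n"
    have "plucker k v' $ J = det (frame_rows k v' (\<lambda>i. g (?W i)))"
      unfolding plucker_def vec_lambda_beta
    proof (rule det_frame_rows_mod_span[OF k])
      show "?W i - g (?W i) \<in> vec.span (v' ` {..<k})" for i
        using vec.span_neg[OF g(3)[of "?W i"]] same_span by simp
    qed
    also have "frame_rows k v' (\<lambda>i. g (?W i)) = frame_rows k (\<lambda>m. g (v m)) (\<lambda>i. g (?W i))"
      by (rule frame_rows_cong) (simp add: g(2))
    also have "\<dots> = frame_rows k v ?W ** transpose (matrix g)"
      using frame_rows_matrix_mult[of k "matrix g" v ?W] by (simp only: matrix_works[OF g(1)])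
    finally show "plucker k v' $ J = (det (matrix g) *s plucker k v) $ J"
      by (simp add: det_mul det_transpose plucker_def)
  qed
  moreover have "det (matrix g) \<noteq> 0" using plucker_nonzero[OF v'] calculation by auto
  ultimately show ?thesis by blast
qed

definition some_frame :: "nat \<Rightarrow> ('a :: prime_card padic ^ 'n) set \<Rightarrow> nat \<Rightarrow> 'a padic ^ 'n" where
  "some_frame k V = (SOME v. v \<in> frames k \<and> vec.span (v ` {..<k}) = V)"

definition plucker_pt :: "nat \<Rightarrow> ('a :: prime_card padic ^ 'n) set \<Rightarrow> 'a padic ^ ('n \<Rightarrow> 'n)" where
  "plucker_pt k V = normalise (plucker k (some_frame k V))"

lemma some_frame:
  assumes "V \<in> grassmannian k"
  shows "some_frame k V \<in> frames k" "vec.span (some_frame k V ` {..<k}) = V"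
  using someI_ex[of "\<lambda>v. v \<in> frames k \<and> vec.span (v ` {..<k}) = V"] grassmannian_frame[OF assms]
  unfolding some_frame_def by (metis (mono_tags, lifting))+

lemma plucker_pt_span:
  assumes v: "v \<in> frames k"
  shows "plucker_pt k (vec.span (v ` {..<k})) = normalise (plucker k v)"
proof -
  obtain c where "c \<noteq> 0" "plucker k (some_frame k (vec.span (v ` {..<k}))) = c *s plucker k v"
    using plucker_proportional[OF v some_frame[OF frame_span_grassmannian[OF v]]] by blast
  then show ?thesis by (simp add: plucker_pt_def normalise_scale)
qed

lemma plucker_pt_integral: "V \<in> grassmannian k \<Longrightarrow> plucker_pt k V \<in> integral_vectors"
  and plucker_pt_nonzero: "V \<in> grassmannian k \<Longrightarrow> plucker_pt k V \<noteq> 0"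
  unfolding plucker_pt_def
  by (rule normalise_integral normalise_nonzero, rule plucker_nonzero, rule some_frame(1),
      assumption)+

lemma plucker_pt_inj_scale:
  assumes V: "V \<in> grassmannian k" and V': "V' \<in> grassmannian k"
    and proportional: "plucker_pt k V' = c *s plucker_pt k V"
  shows "V' = V"
proof -
  obtain v where v: "v \<in> frames k" "V = vec.span (v ` {..<k})"
    using grassmannian_frame[OF V] by blast
  obtain v' where v': "v' \<in> frames k" "V' = vec.span (v' ` {..<k})"
    using grassmannian_frame[OF V'] by blast
  let ?d = "plucker k v $ max_index (plucker k v)" and ?d' = "plucker k v' $ max_index (plucker k v')"
  have "plucker k v' = ?d' *s plucker_pt k V'"
    by (simp only: v'(2) plucker_pt_span[OF v'(1)] scale_normalise[OF plucker_nonzero[OF v'(1)]])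
  also have "\<dots> = (?d' * c * inverse ?d) *s plucker k v"
    unfolding proportional v(2) plucker_pt_span[OF v(1)] normalise_def
    by (simp only: vector_smult_assoc mult.assoc)
  finally have eq: "plucker k v' = (?d' * c * inverse ?d) *s plucker k v" .
  moreover have "?d' * c * inverse ?d \<noteq> 0" using eq plucker_nonzero[OF v'(1)] by auto
  ultimately have "v' ` {..<k} \<subseteq> V" unfolding v(2) by (rule plucker_span_subset[OF v(1)])
  moreover have "vec.subspace V" "vec.dim V = k" "vec.subspace V'" "vec.dim V' = k"
    using V V' by (auto simp: grassmannian_def)
  ultimately show ?thesis
    using vec.span_minimal[of "v' ` {..<k}" V]
    by (intro vec.subspace_dim_equal) (simp_all add: v'(2))
qed

lemma inj_on_plucker_pt: "inj_on (plucker_pt k) (grassmannian k)"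
  by (rule inj_onI) (rule plucker_pt_inj_scale[where c = 1], auto)

lemma matrix_image_frame_span:
  "matrix_image A (vec.span (v ` {..<k})) = vec.span ((\<lambda>i\<in>{..<k}. A *v v i) ` {..<k})"
  for A :: "'a :: field ^ 'n ^ 'n"
  by (simp add: matrix_image_span image_image)

lemma matrix_image_grassmannian:
  fixes A :: "'a :: field ^ 'n ^ 'n"
  assumes V: "V \<in> grassmannian k" and A: "invertible A"
  shows "matrix_image A V \<in> grassmannian k"
proof -
  obtain v where v: "v \<in> frames k" "V = vec.span (v ` {..<k})"
    using grassmannian_frame[OF V] by blast
  show ?thesis
    unfolding v(2) matrix_image_frame_span
    by (rule frame_span_grassmannian[OF matrix_image_frame[OF v(1) A]])
qed

lemma plucker_pt_matrix_image:
  fixes A :: "'a :: prime_card padic ^ 'n ^ 'n"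
  assumes V: "V \<in> grassmannian k" and A: "invertible A"
  shows "\<exists>s. s \<noteq> 0 \<and> plucker_pt k (matrix_image A V) = s *s plucker_map k A (plucker_pt k V)"
proof -
  obtain v where v: "v \<in> frames k" "V = vec.span (v ` {..<k})"
    using grassmannian_frame[OF V] by blast
  define v' where "v' = (\<lambda>i\<in>{..<k}. A *v v i)"
  have v': "v' \<in> frames k" unfolding v'_def by (rule matrix_image_frame[OF v(1) A])
  let ?D = "plucker k v" and ?D' = "plucker k v'"
  have "?D' = plucker_map k A ((?D $ max_index ?D) *s normalise ?D)"
    unfolding scale_normalise[OF plucker_nonzero[OF v(1)]]
    by (rule plucker_matrix_image[OF A]) (simp add: v'_def)
  also have "\<dots> = (?D $ max_index ?D) *s plucker_map k A (plucker_pt k V)"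
    unfolding v(2) plucker_pt_span[OF v(1)] by (rule vec.linear_scale[OF linear_plucker_map])
  finally have "normalise ?D' = normalise ((?D $ max_index ?D) *s plucker_map k A (plucker_pt k V))"
    by simp
  also have "\<dots> = normalise (plucker_map k A (plucker_pt k V))"
    by (rule normalise_scale[OF max_index_nonzero[OF plucker_nonzero[OF v(1)]]])
  finally have pt: "plucker_pt k (matrix_image A V) = normalise (plucker_map k A (plucker_pt k V))"
    unfolding v(2) matrix_image_frame_span v'_def[symmetric] by (simp only: plucker_pt_span v')
  then show ?thesis
    using plucker_pt_nonzero[OF matrix_image_grassmannian[OF V A]] unfolding normalise_def
    by (intro exI conjI) auto
qed

lemma plucker_pt_funpow:
  fixes A :: "'a :: prime_card padic ^ 'n ^ 'n"
  assumes V: "V \<in> grassmannian k" and A: "invertible A"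
  shows "(matrix_image A ^^ n) V \<in> grassmannian k \<and>
    (\<exists>s. s \<noteq> 0 \<and> plucker_pt k ((matrix_image A ^^ n) V) = s *s (plucker_map k A ^^ n) (plucker_pt k V))"
proof (induction n)
  case 0
  show ?case using V by (auto intro: exI[of _ 1])
next
  case (Suc n)
  let ?Vn = "(matrix_image A ^^ n) V" and ?Un = "(plucker_map k A ^^ n) (plucker_pt k V)"
  from Suc obtain s where Vn: "?Vn \<in> grassmannian k" and s: "s \<noteq> 0" "plucker_pt k ?Vn = s *s ?Un"
    by blast
  obtain t where t: "t \<noteq> 0"
    "plucker_pt k (matrix_image A ?Vn) = t *s plucker_map k A (plucker_pt k ?Vn)"
    using plucker_pt_matrix_image[OF Vn A] by blast
  have "plucker_pt k (matrix_image A ?Vn) = (t * s) *s plucker_map k A ?Un"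
    unfolding t(2) s(2) by (simp only: vec.linear_scale[OF linear_plucker_map] vector_smult_assoc)
  then show ?case
    using s(1) t(1) matrix_image_grassmannian[OF Vn A] by (auto intro!: exI[of _ "t * s"])
qed

lemma grassmannian_recurrence:
  fixes A :: "'a :: prime_card padic ^ 'n ^ 'n"
  assumes V: "V \<in> grassmannian k" and A: "invertible A"
    and \<sigma>: "\<And>j. \<sigma> j \<ge> 1" "\<And>l. \<forall>\<^sub>F j in sequentially. CARD('a) ^ l dvd \<sigma> j - 1"
    and recurrent: "\<And>\<epsilon>. \<epsilon> > 0 \<Longrightarrow>
      \<exists>\<^sub>F j in sequentially. dist (plucker_pt k ((matrix_image A ^^ \<sigma> j) V)) (plucker_pt k V) < \<epsilon>"
  shows "\<exists>j. (matrix_image A ^^ \<sigma> j) V = V"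
proof -
  have "\<forall>j. \<exists>s. s \<noteq> 0 \<and>
      plucker_pt k ((matrix_image A ^^ \<sigma> j) V) = s *s (plucker_map k A ^^ \<sigma> j) (plucker_pt k V)"
    using plucker_pt_funpow[OF V A] by blast
  then obtain s where s: "\<And>j. s j \<noteq> 0"
    "\<And>j. plucker_pt k ((matrix_image A ^^ \<sigma> j) V) =
      s j *s (plucker_map k A ^^ \<sigma> j) (plucker_pt k V)"
    by metis
  obtain F where F: "F \<noteq> bot" "F \<le> sequentially"
    and lim: "((\<lambda>j. plucker_pt k ((matrix_image A ^^ \<sigma> j) V)) \<longlongrightarrow> plucker_pt k V) F"
    using recurrent by (rule recurrent_subfilter)
  have "\<forall>\<^sub>F j in F. CARD('a) ^ l dvd \<sigma> j - 1" for l using F(2) \<sigma>(2) by (rule filter_leD)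
  then obtain i \<kappa> where "(plucker_map k A ^^ \<sigma> i) (plucker_pt k V) = \<kappa> *s plucker_pt k V"
    using line_recurrence[OF linear_plucker_map plucker_pt_integral[OF V] plucker_pt_nonzero[OF V]
        s(1) F(1) lim[unfolded s(2)] \<sigma>(1)] by blast
  then have "plucker_pt k ((matrix_image A ^^ \<sigma> i) V) = (s i * \<kappa>) *s plucker_pt k V"
    by (simp only: s(2) vector_smult_assoc)
  then show ?thesis using plucker_pt_inj_scale[OF V] plucker_pt_funpow[OF V A] by blast
qed

section \<open>The Borel structure of Grassmannians\<close>

lemma borel_of_open: "openin T U \<Longrightarrow> U \<in> sets (borel_of T)"
  and space_borel_of [simp]: "space (borel_of T) = topspace T"
proof -
  have "{U. openin T U} \<subseteq> Pow (topspace T)" by (auto dest: openin_subset)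
  then show "openin T U \<Longrightarrow> U \<in> sets (borel_of T)" "space (borel_of T) = topspace T"
    by (auto simp: borel_of_def sets_measure_of space_measure_of)
qed

lemma borel_of_euclidean: "borel_of euclidean = borel"
  by (simp add: borel_of_def borel_def)

lemma continuous_map_measurable:
  assumes g: "continuous_map S T g"
  shows "g \<in> measurable (borel_of S) (borel_of T)"
  unfolding borel_of_def[of T]
proof (rule measurable_measure_of)
  show "{U. openin T U} \<subseteq> Pow (topspace T)" by (auto dest: openin_subset)
  show "g \<in> space (borel_of S) \<rightarrow> topspace T" using continuous_map_funspace[OF g] by simp
  fix U assume "U \<in> {U. openin T U}"
  then have "openin S {x \<in> topspace S. g x \<in> U}" using openin_continuous_map_preimage[OF g] by simp
  moreover have "g -` U \<inter> space (borel_of S) = {x \<in> topspace S. g x \<in> U}" by auto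
  ultimately show "g -` U \<inter> space (borel_of S) \<in> sets (borel_of S)" using borel_of_open by metis
qed

lemma continuous_map_euclidean_iff_tendsto:
  "continuous_map X euclidean g \<longleftrightarrow> (\<forall>x\<in>topspace X. (g \<longlongrightarrow> g x) (atin X x))"
  by (simp add: continuous_map_atin limitin_canonical_iff)

lemma tendsto_prod_padic:
  fixes g :: "'i \<Rightarrow> 'x \<Rightarrow> 'a :: prime_card padic"
  assumes "\<And>i. i \<in> S \<Longrightarrow> (g i \<longlongrightarrow> l i) F"
  shows "((\<lambda>x. \<Prod>i\<in>S. g i x) \<longlongrightarrow> (\<Prod>i\<in>S. l i)) F"
  using assms by (induction S rule: infinite_finite_induct) (auto intro!: tendsto_mult)

lemma continuous_map_frame_component:
  "m < k \<Longrightarrow> continuous_map (frame_topology k) euclidean (\<lambda>v. v m)"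
  unfolding frame_topology_def
  by (intro continuous_map_from_subtopology continuous_map_product_projection) simp

lemma tendsto_plucker:
  fixes v :: "nat \<Rightarrow> 'a :: prime_card padic ^ 'n"
  assumes v: "v \<in> frames k"
  shows "(plucker k \<longlongrightarrow> plucker k v) (atin (frame_topology k) v)"
proof -
  have component: "((\<lambda>v. v m) \<longlongrightarrow> v m) (atin (frame_topology k) v)" if "m < k" for m
    using continuous_map_frame_component[OF that] v unfolding continuous_map_euclidean_iff_tendsto
    by auto
  have entry: "((\<lambda>v. frame_rows k v W $ i $ j) \<longlongrightarrow> frame_rows k v W $ i $ j) (atin (frame_topology k) v)"
    for i j :: 'n and W
    using component
    by (cases "coord_index i < k") (auto simp: frame_rows_def intro!: tendsto_vec_nth)
  show ?thesis
    unfolding plucker_def det_def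
    by (intro vec_tendstoI, unfold vec_lambda_beta)
      (intro tendsto_sum tendsto_mult tendsto_const tendsto_prod_padic entry)
qed

lemma continuous_map_plucker_pt:
  "continuous_map (grassmannian_topology k) euclidean
     (plucker_pt k :: ('a :: prime_card padic ^ 'n) set \<Rightarrow> _)"
proof (rule continuous_compose_quotient_map[OF quotient_map_frame_span])
  have "continuous_map (frame_topology k) euclidean
      (\<lambda>v :: nat \<Rightarrow> 'a padic ^ 'n. normalise (plucker k v))"
    unfolding continuous_map_euclidean_iff_tendsto
    by (auto intro!: tendsto_normalise tendsto_plucker plucker_nonzero)
  then show "continuous_map (frame_topology k) euclidean
      (plucker_pt k \<circ> (\<lambda>v :: nat \<Rightarrow> 'a padic ^ 'n. vec.span (v ` {..<k})))"
    by (rule continuous_map_eq) (simp add: plucker_pt_span)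
qed

abbreviation (input) borel_grassmannian :: "nat \<Rightarrow> ('a :: prime_card padic ^ 'n) set measure" where
  "borel_grassmannian k \<equiv> borel_of (grassmannian_topology k)"

lemma plucker_pt_measurable: "plucker_pt k \<in> borel_measurable (borel_grassmannian k)"
  using continuous_map_measurable[OF continuous_map_plucker_pt] by (simp add: borel_of_euclidean)

lemma grassmannian_equality_sets:
  fixes g h :: "'x \<Rightarrow> ('a :: prime_card padic ^ 'n) set"
  assumes g: "g \<in> measurable M (borel_grassmannian k)"
    and h: "h \<in> measurable M (borel_grassmannian k)"
  shows "{x \<in> space M. g x = h x} \<in> sets M"
proof -
  have "g x = h x \<longleftrightarrow> plucker_pt k (g x) = plucker_pt k (h x)" if "x \<in> space M" for x
    using measurable_space[OF g that] measurable_space[OF h that]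
      inj_on_eq_iff[OF inj_on_plucker_pt]
    by (metis space_borel_of topspace_grassmannian_topology)
  then have "{x \<in> space M. g x = h x} = {x \<in> space M. plucker_pt k (g x) = plucker_pt k (h x)}"
    by blast
  also have "\<dots> \<in> sets M"
    using measurable_compose[OF g plucker_pt_measurable]
      measurable_compose[OF h plucker_pt_measurable]
    by (rule measurable_equality_set)
  finally show ?thesis .
qed

lemma continuous_map_matrix_image:
  fixes A :: "'a :: prime_card padic ^ 'n ^ 'n"
  assumes A: "invertible A"
  shows "continuous_map (grassmannian_topology k) (grassmannian_topology k) (matrix_image A)"
proof (rule continuous_compose_quotient_map[OF quotient_map_frame_span])
  let ?f = "\<lambda>v. \<lambda>i\<in>{..<k}. A *v v i"
  have "continuous_map euclidean euclidean ((*v) A)"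
    unfolding continuous_map_iff_continuous2 matrix_vector_mult_def
    by (intro continuous_on_vec_lambda continuous_intros)
  then have "continuous_map (frame_topology k) euclidean (\<lambda>v. A *v v m)" if "m < k" for m
    using continuous_map_compose[OF continuous_map_frame_component[OF that], of euclidean "(*v) A"]
    by (simp add: o_def)
  then have "continuous_map (frame_topology k) (product_topology (\<lambda>_. euclidean) {..<k}) ?f"
    by (auto simp: continuous_map_componentwise)
  then have "continuous_map (frame_topology k) (frame_topology k) ?f"
    unfolding frame_topology_def[of k]
    using matrix_image_frame[OF _ A] by (auto simp: continuous_map_in_subtopology)
  from continuous_map_compose[OF this quotient_imp_continuous_map[OF quotient_map_frame_span]]
  show "continuous_map (frame_topology k) (grassmannian_topology k)
      (matrix_image A \<circ> (\<lambda>v. vec.span (v ` {..<k})))"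
    by (simp add: o_def matrix_image_frame_span)
qed

section \<open>The rational transformation group\<close>

definition rat_maps :: "(('a :: prime_card padic ^ 'n) set \<Rightarrow> ('a padic ^ 'n) set) set" where
  "rat_maps = (\<lambda>A. matrix_image (map_matrix of_rat A)) ` GL_rat"

lemma matrix_image_comp: "matrix_image A (matrix_image B V) = matrix_image (A ** B) V"
  by (simp add: matrix_image_def image_image matrix_vector_mul_assoc)

lemma matrix_image_one [simp]: "matrix_image (mat 1) V = V"
  by (simp add: matrix_image_def)

lemma map_matrix_of_rat_mult:
  "map_matrix (of_rat :: rat \<Rightarrow> 'a :: field_char_0) (A ** B) =
    map_matrix of_rat A ** map_matrix of_rat B"
  by (simp add: map_matrix_def matrix_matrix_mult_def vec_eq_iff of_rat_sum of_rat_mult)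

lemma map_matrix_of_rat_one [simp]:
  "map_matrix (of_rat :: rat \<Rightarrow> 'a :: field_char_0) (mat 1) = mat 1"
  by (simp add: map_matrix_def mat_def vec_eq_iff)

lemma invertible_map_matrix_of_rat:
  assumes "A \<in> GL_rat"
  shows "invertible (map_matrix (of_rat :: rat \<Rightarrow> 'a :: field_char_0) A)"
proof -
  obtain B where "A ** B = mat 1" "B ** A = mat 1"
    using assms by (auto simp: GL_rat_def invertible_def)
  then show ?thesis
    unfolding invertible_def
    by (intro exI[of _ "map_matrix of_rat B"]) (simp flip: map_matrix_of_rat_mult)
qed

lemma rat_maps_inverse:
  assumes "l \<in> rat_maps"
  obtains m where "m \<in> rat_maps" "m \<circ> l = id" "l \<circ> m = id"
proof -
  obtain A where A: "invertible A" "l = matrix_image (map_matrix of_rat A)"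
    using assms by (auto simp: rat_maps_def GL_rat_def)
  then obtain B where B: "A ** B = mat 1" "B ** A = mat 1" by (auto simp: invertible_def)
  show ?thesis
  proof (rule that)
    show "matrix_image (map_matrix of_rat B) \<in> rat_maps"
      using B by (auto simp: rat_maps_def GL_rat_def invertible_def)
    show "matrix_image (map_matrix of_rat B) \<circ> l = id" "l \<circ> matrix_image (map_matrix of_rat B) = id"
      by (simp_all add: A fun_eq_iff matrix_image_comp B flip: map_matrix_of_rat_mult)
  qed
qed

lemma countable_transformation_group_rat_maps:
  "countable_transformation_group
     (rat_maps :: (('a :: prime_card padic ^ 'n) set \<Rightarrow> ('a padic ^ 'n) set) set)"
proof
  show "countable (rat_maps :: (('a padic ^ 'n) set \<Rightarrow> ('a padic ^ 'n) set) set)"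
    unfolding rat_maps_def by (intro countable_image) simp
  have "mat 1 \<in> GL_rat" by (auto simp: GL_rat_def invertible_def intro: exI[of _ "mat 1"])
  moreover have "(id :: ('a padic ^ 'n) set \<Rightarrow> _) = matrix_image (map_matrix of_rat (mat 1))"
    by (simp add: fun_eq_iff)
  ultimately show "(id :: ('a padic ^ 'n) set \<Rightarrow> _) \<in> rat_maps"
    unfolding rat_maps_def by (rule rev_image_eqI)
next
  fix l m :: "('a padic ^ 'n) set \<Rightarrow> ('a padic ^ 'n) set"
  assume l: "l \<in> rat_maps"
  obtain m' where m': "m' \<in> rat_maps" "m' \<circ> l = id" "l \<circ> m' = id" using l by (rule rat_maps_inverse)
  show bij: "bij l" using m'(2,3) by (rule o_bij)
  have "the_inv l y = m' y" for y
    using the_inv_f_f[OF bij_is_inj[OF bij], of "m' y"] fun_cong[OF m'(3), of y] by simp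
  then have "the_inv l = m'" by (rule ext)
  then show "the_inv l \<in> rat_maps" using m'(1) by simp
  assume "m \<in> rat_maps"
  with l obtain A B where AB: "A \<in> GL_rat" "B \<in> GL_rat" "l = matrix_image (map_matrix of_rat A)"
    "m = matrix_image (map_matrix of_rat B)"
    by (auto simp: rat_maps_def)
  have "A ** B \<in> GL_rat" using AB(1,2) by (simp add: GL_rat_def invertible_mult)
  moreover have "l \<circ> m = matrix_image (map_matrix of_rat (A ** B))"
    by (simp add: AB(3,4) fun_eq_iff matrix_image_comp map_matrix_of_rat_mult)
  ultimately show "l \<circ> m \<in> rat_maps" unfolding rat_maps_def by blast
qed

lemma countable_rat_subspaces: "countable {S :: (rat ^ 'N) set. vec.subspace S}"
proof -
  have "{S :: (rat ^ 'N) set. vec.subspace S} \<subseteq> vec.span ` {B. finite B}"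
  proof
    fix S :: "(rat ^ 'N) set" assume "S \<in> {S. vec.subspace S}"
    then have S: "vec.subspace S" by simp
    obtain B where B: "B \<subseteq> S" "vec.independent B" "S \<subseteq> vec.span B"
      using vec.maximal_independent_subset by blast
    have "S = vec.span B" using B S vec.span_minimal[of B S] by blast
    then show "S \<in> vec.span ` {B. finite B}" using vec.finiteI_independent[OF B(2)] by blast
  qed
  moreover have "countable (vec.span ` {B :: (rat ^ 'N) set. finite B})"
    by (intro countable_image countable_Collect_finite)
  ultimately show ?thesis by (rule countable_subset)
qed

text \<open>Matrices are flattened to vectors to have the library's vector space structure on them.\<close>

definition unflatten :: "rat ^ ('n \<times> 'n) \<Rightarrow> 'a :: prime_card padic ^ 'n ^ 'n" where
  "unflatten a = map_matrix of_rat (\<chi> i j. a $ (i, j))"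

definition rat_endomorphisms :: "('a :: prime_card padic ^ 'n) set \<Rightarrow> (rat ^ ('n \<times> 'n)) set" where
  "rat_endomorphisms V = {a. \<forall>v\<in>V. unflatten a *v v \<in> V}"

lemma subspace_rat_endomorphisms:
  fixes V :: "('a :: prime_card padic ^ 'n) set"
  assumes V: "vec.subspace V"
  shows "vec.subspace (rat_endomorphisms V)"
proof -
  have "unflatten (a + b) *v v = unflatten a *v v + unflatten b *v v" for a b
    and v :: "'a padic ^ 'n"
    by (simp add: vec_eq_iff map_matrix_def unflatten_def matrix_vector_mult_def of_rat_add
        algebra_simps sum.distrib)
  moreover have "unflatten (c *s a) *v v = of_rat c *s (unflatten a *v v)" for a c
    and v :: "'a padic ^ 'n"
    by (simp add: vec_eq_iff map_matrix_def unflatten_def matrix_vector_mult_def of_rat_mult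
        sum_distrib_left mult_ac)
  moreover have "unflatten 0 *v v = 0" for v :: "'a padic ^ 'n"
    by (simp add: vec_eq_iff map_matrix_def unflatten_def matrix_vector_mult_def)
  ultimately show ?thesis
    unfolding vec.subspace_def rat_endomorphisms_def
    using vec.subspace_0[OF V] vec.subspace_add[OF V] vec.subspace_scale[OF V] by simp
qed

lemma stabiliser_rat_maps:
  fixes V :: "('a :: prime_card padic ^ 'n) set"
  assumes V: "V \<in> grassmannian k"
  shows "countable_transformation_group.stabiliser rat_maps V =
    (\<lambda>a. matrix_image (unflatten a)) ` {a \<in> rat_endomorphisms V. (\<chi> i j. a $ (i, j)) \<in> GL_rat}"
  (is "_ = ?R")
proof -
  have "{l \<in> rat_maps. l V = V} = ?R"
  proof (intro equalityI subsetI)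
    fix l assume "l \<in> {l \<in> rat_maps. l V = V}"
    then obtain A where A: "A \<in> GL_rat" "l = matrix_image (map_matrix of_rat A)" "l V = V"
      by (auto simp: rat_maps_def)
    define a where "a = (\<chi> z. A $ fst z $ snd z)"
    have a: "(\<chi> i j. a $ (i, j)) = A" by (simp add: a_def vec_eq_iff)
    have "map_matrix of_rat A *v v \<in> V" if "v \<in> V" for v
      using A(3) that unfolding A(2) matrix_image_def by blast
    then have "a \<in> rat_endomorphisms V" by (simp add: rat_endomorphisms_def unflatten_def a)
    then show "l \<in> ?R" using A(1,2) a by (intro image_eqI[of _ _ a]) (auto simp: unflatten_def)
  next
    fix l assume "l \<in> ?R"
    then obtain a
      where a: "(\<chi> i j. a $ (i, j)) \<in> GL_rat" "a \<in> rat_endomorphisms V"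
        "l = matrix_image (unflatten a)"
      by auto
    have "l V \<subseteq> V" using a(2) unfolding a(3) rat_endomorphisms_def matrix_image_def by auto
    moreover have "l V \<in> grassmannian k"
      unfolding a(3) unflatten_def
      by (rule matrix_image_grassmannian[OF V invertible_map_matrix_of_rat[OF a(1)]])
    ultimately have "l V = V"
      using V vec.subspace_dim_equal[of "l V" V] by (simp add: grassmannian_def)
    then show "l \<in> {l \<in> rat_maps. l V = V}" using a by (auto simp: rat_maps_def unflatten_def)
  qed
  then show ?thesis
    by (simp add: countable_transformation_group.stabiliser_def[OF countable_transformation_group_rat_maps])
qed

lemma countable_stabilisers_rat_maps:
  "countable (countable_transformation_group.stabiliser rat_maps `
     (grassmannian k :: ('a :: prime_card padic ^ 'n) set set))"
proof (rule countable_subset)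
  let ?S = "\<lambda>E. (\<lambda>a. matrix_image (unflatten a :: 'a padic ^ 'n ^ 'n)) `
    {a \<in> E. (\<chi> i j. a $ (i, j)) \<in> GL_rat}"
  show "countable (?S ` {E. vec.subspace E})" by (intro countable_image countable_rat_subspaces)
  show "countable_transformation_group.stabiliser rat_maps ` grassmannian k \<subseteq>
      ?S ` {E. vec.subspace E}"
  proof (rule image_subsetI)
    fix V :: "('a padic ^ 'n) set" assume V: "V \<in> grassmannian k"
    then have "vec.subspace (rat_endomorphisms V)"
      by (intro subspace_rat_endomorphisms) (simp add: grassmannian_def)
    then show "countable_transformation_group.stabiliser rat_maps V \<in> ?S ` {E. vec.subspace E}"
      unfolding stabiliser_rat_maps[OF V] by simp
  qed
qed

section \<open>Charts of projective space\<close>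

abbreviation (input) int_mat :: "int ^ 'm ^ 'm \<Rightarrow> 'a :: comm_ring_1 ^ 'm ^ 'm" where
  "int_mat \<equiv> map_matrix of_int"

lemma int_mat_mult: "int_mat (A ** B) = int_mat A ** int_mat B"
  by (simp add: map_matrix_def matrix_matrix_mult_def vec_eq_iff)

lemma int_mat_one [simp]: "int_mat (mat 1) = mat 1"
  by (simp add: map_matrix_def mat_def vec_eq_iff)

lemma det_int_mat: "det (int_mat A) = of_int (det A)"
  by (simp add: det_def map_matrix_def of_int_sum of_int_prod)

lemma int_mat_SL_padic_integers:
  "h \<in> SL_int \<Longrightarrow> (int_mat h :: 'a :: prime_card padic ^ 'm ^ 'm) \<in> SL_padic_integers"
  by (simp add: det_int_mat SL_int_def SL_padic_integers_def padic_integers_def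
      padic_norm_of_int_le_1)

text \<open>
  Equal to \<open>SL_int\<close> by Cramer's rule, which the library provides only over fields; the subset
  already contains the elementary matrices, and these suffice below.
\<close>

definition SL_int_units :: "(int ^ 'm ^ 'm) set" where
  "SL_int_units = {h \<in> SL_int. invertible h}"

lemma SL_int_units_SL_int: "h \<in> SL_int_units \<Longrightarrow> h \<in> SL_int"
  by (simp add: SL_int_units_def)

lemma SL_int_units_one: "mat 1 \<in> SL_int_units"
  by (auto simp: SL_int_units_def SL_int_def invertible_def intro!: exI[of _ "mat 1"])

lemma SL_int_units_mult: "g \<in> SL_int_units \<Longrightarrow> h \<in> SL_int_units \<Longrightarrow> g ** h \<in> SL_int_units"
  by (simp add: SL_int_units_def SL_int_def det_mul invertible_mult)

lemma SL_int_units_inverse: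
  assumes "h \<in> SL_int_units"
  obtains h' where "h' \<in> SL_int_units" "h ** h' = mat 1" "h' ** h = mat 1"
proof -
  obtain h' where h': "h ** h' = mat 1" "h' ** h = mat 1"
    using assms by (auto simp: SL_int_units_def invertible_def)
  have "det (h ** h') = 1" by (simp add: h'(1))
  then have "det h' = 1" using assms by (simp add: SL_int_units_def SL_int_def det_mul)
  then have "h' \<in> SL_int_units" using h' by (auto simp: SL_int_units_def SL_int_def invertible_def)
  then show ?thesis using h' by (rule that)
qed

definition elem_matrix :: "'m \<Rightarrow> 'm \<Rightarrow> int \<Rightarrow> int ^ 'm ^ 'm" where
  "elem_matrix i j c = (\<chi> k. if k = i then row i (mat 1) + c *s row j (mat 1) else row k (mat 1))"

lemma elem_matrix_mult_vec:
  fixes a :: "'a :: comm_ring_1 ^ 'm"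
  shows "(int_mat (elem_matrix i j c) *v a) $ k =
    (if k = i then a $ i + of_int c * a $ j else a $ k)"
proof -
  have "(int_mat (elem_matrix i j c) *v a) $ k =
      (\<Sum>l\<in>UNIV. (if k = l then a $ l else 0) +
        (if l = j then (if k = i then of_int c * a $ l else 0) else 0))"
    unfolding matrix_vector_mult_def vec_lambda_beta
    by (rule sum.cong) (auto simp: map_matrix_def elem_matrix_def row_def mat_def algebra_simps)
  also have "\<dots> = a $ k + (if k = i then of_int c * a $ j else 0)"
    by (simp add: sum.distrib sum.delta sum.delta' del: if_split)
  finally show ?thesis by auto
qed

lemma elem_matrix_mult_inverse:
  fixes i j :: "'m :: finite"
  assumes "i \<noteq> j"
  shows "elem_matrix i j c ** elem_matrix i j (- c) = mat 1"
proof -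
  have int_mat_id: "int_mat A = A" for A :: "int ^ 'm ^ 'm" by (simp add: map_matrix_def vec_eq_iff)
  have "(elem_matrix i j c ** elem_matrix i j (- c)) *v a = a" for a :: "int ^ 'm"
    using assms elem_matrix_mult_vec[where 'a = int and 'm = 'm, unfolded int_mat_id]
    by (simp add: vec_eq_iff del: of_int_eq_id flip: matrix_vector_mul_assoc)
  then show ?thesis by (simp add: matrix_eq)
qed

lemma elem_matrix_SL_int_units: "i \<noteq> j \<Longrightarrow> elem_matrix i j c \<in> SL_int_units"
  using elem_matrix_mult_inverse[of i j c] elem_matrix_mult_inverse[of i j "- c"]
  by (auto simp: SL_int_units_def SL_int_def invertible_def elem_matrix_def det_row_operation)

lemma ex_SL_int_units_moving_coordinate:
  fixes i j :: "'m :: finite"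
  shows "\<exists>h\<in>SL_int_units. \<forall>a :: 'a :: comm_ring_1 ^ 'm. (int_mat h *v a) $ i = a $ j"
proof (cases "i = j")
  case True
  show ?thesis by (rule bexI[OF _ SL_int_units_one]) (simp add: True)
next
  case False
  let ?h = "elem_matrix i j 1 ** (elem_matrix j i (- 1) ** elem_matrix i j 1)"
  have "?h \<in> SL_int_units" using False by (intro SL_int_units_mult elem_matrix_SL_int_units) auto
  moreover have "(int_mat ?h *v a) $ i = a $ j" for a :: "'a ^ 'm"
    using False by (simp add: int_mat_mult elem_matrix_mult_vec flip: matrix_vector_mul_assoc)
  ultimately show ?thesis by blast
qed

lemma padic_norm_prod: "padic_norm (\<Prod>i\<in>S. h i) = (\<Prod>i\<in>S. padic_norm (h i))"
  for h :: "'i \<Rightarrow> 'a :: prime_card padic"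
  by (induction S rule: infinite_finite_induct) (auto simp: padic_norm_mult)

lemma padic_norm_mult_vec_le:
  fixes A :: "'a :: prime_card padic ^ 'm ^ 'n"
  assumes A: "\<And>i j. padic_norm (A $ i $ j) \<le> 1" and x: "\<And>j. padic_norm (x $ j) \<le> C"
  shows "padic_norm ((A *v x) $ i) \<le> C"
  unfolding matrix_vector_mult_def vec_lambda_beta
proof (rule padic_norm_sum_le)
  show "0 \<le> C" using x padic_norm_nonneg by (rule order_trans[rotated])
  fix j
  have "padic_norm (A $ i $ j) * padic_norm (x $ j) \<le> 1 * C"
    using A x by (intro mult_mono) (auto simp: padic_norm_nonneg)
  then show "padic_norm (A $ i $ j * x $ j) \<le> C" by (simp add: padic_norm_mult)
qed

lemma padic_norm_det_le_column:
  fixes B :: "'a :: prime_card padic ^ 'm ^ 'm"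
  assumes B: "\<And>i j. j \<noteq> k \<Longrightarrow> padic_norm (B $ i $ j) \<le> 1" and column: "\<And>i. padic_norm (B $ i $ k) \<le> C"
  shows "padic_norm (det B) \<le> C"
  unfolding det_def
proof (rule padic_norm_sum_le)
  show C: "0 \<le> C" using column padic_norm_nonneg by (rule order_trans[rotated])
  fix \<pi> assume "\<pi> \<in> {\<pi>. \<pi> permutes (UNIV :: 'm set)}"
  then have \<pi>: "bij \<pi>" by (simp add: permutes_bij)
  then obtain i0 where i0: "\<pi> i0 = k" by (metis bij_pointE)
  have other: "\<pi> i \<noteq> k" if "i \<noteq> i0" for i using i0 \<pi> that by (metis bij_pointE)
  have "padic_norm (\<Prod>i\<in>UNIV. B $ i $ \<pi> i) =
      padic_norm (B $ i0 $ \<pi> i0) * (\<Prod>i\<in>UNIV - {i0}. padic_norm (B $ i $ \<pi> i))"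
    unfolding padic_norm_prod by (rule prod.remove) auto
  also have "\<dots> \<le> C * 1"
    using B column other C i0
    by (intro mult_mono prod_le_1) (auto intro!: prod_nonneg padic_norm_nonneg)
  finally have "padic_norm (\<Prod>i\<in>UNIV. B $ i $ \<pi> i) \<le> C" by simp
  moreover have "padic_norm (of_int (sign \<pi>) :: 'a padic) = 1"
    by (simp add: sign_def padic_norm_minus)
  ultimately show "padic_norm (of_int (sign \<pi>) * (\<Prod>i\<in>UNIV. B $ i $ \<pi> i)) \<le> C"
    by (simp add: padic_norm_mult)
qed

lemma SL_padic_norm_le:
  fixes A :: "'a :: prime_card padic ^ 'm ^ 'm"
  assumes A: "A \<in> SL_padic_integers" and x: "\<And>i. padic_norm ((A *v x) $ i) \<le> C"
  shows "padic_norm (x $ k) \<le> C"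
proof -
  let ?B = "(\<chi> i j. if j = k then (A *v x) $ i else A $ i $ j) :: 'a padic ^ 'm ^ 'm"
  have "x $ k = det ?B" using cramer_lemma[of k A x] A by (simp add: SL_padic_integers_def)
  also have "padic_norm (det ?B) \<le> C"
    using A x
    by (intro padic_norm_det_le_column[where k = k])
      (auto simp: SL_padic_integers_def padic_integers_def)
  finally show ?thesis .
qed

lemma SL_padic_mult:
  fixes A B :: "'a :: prime_card padic ^ 'm ^ 'm"
  assumes A: "A \<in> SL_padic_integers" and B: "B \<in> SL_padic_integers"
  shows "A ** B \<in> SL_padic_integers"
proof -
  have "padic_norm ((A ** B) $ i $ j) \<le> 1" for i j
  proof -
    have "(A ** B) $ i $ j = (A *v (\<chi> l. B $ l $ j)) $ i"
      by (simp add: matrix_matrix_mult_def matrix_vector_mult_def)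
    then show ?thesis
      using padic_norm_mult_vec_le[of A "\<chi> l. B $ l $ j" 1 i] A B
      by (simp add: SL_padic_integers_def padic_integers_def)
  qed
  then show ?thesis using A B by (simp add: SL_padic_integers_def padic_integers_def det_mul)
qed

definition chart :: "'m \<Rightarrow> ('a :: prime_card padic ^ 'm) set" where
  "chart c = {a \<in> integral_vectors. a $ c = 1}"

definition padic_cell :: "nat \<Rightarrow> 'a :: prime_card padic ^ 'm \<Rightarrow> ('a padic ^ 'm) set" where
  "padic_cell k a = {b. \<forall>i. padic_norm (a $ i - b $ i) \<le> inverse (real CARD('a)) ^ k}"

abbreviation chart_space :: "'m \<Rightarrow> ('a :: prime_card padic ^ 'm) measure" where
  "chart_space c \<equiv> restrict_space borel (chart c)"

lemma padic_cell_eq_iff: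
  fixes a b :: "'a :: prime_card padic ^ 'm"
  shows "padic_cell k a = padic_cell k b \<longleftrightarrow>
    (\<forall>i. padic_norm (a $ i - b $ i) \<le> inverse (real CARD('a)) ^ k)"
proof
  assume "padic_cell k a = padic_cell k b"
  moreover have "b \<in> padic_cell k b" by (simp add: padic_cell_def)
  ultimately have "b \<in> padic_cell k a" by simp
  then show "\<forall>i. padic_norm (a $ i - b $ i) \<le> inverse (real CARD('a)) ^ k"
    by (simp add: padic_cell_def)
next
  let ?r = "inverse (real CARD('a)) ^ k"
  assume close: "\<forall>i. padic_norm (a $ i - b $ i) \<le> ?r"
  have "padic_norm (a $ i - x $ i) \<le> ?r \<longleftrightarrow> padic_norm (b $ i - x $ i) \<le> ?r" for x i
    using close[rule_format, of i] padic_norm_add_le[of "a $ i - b $ i" ?r "b $ i - x $ i"]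
      padic_norm_diff_commute[of "a $ i" "b $ i"]
      padic_norm_add_le[of "b $ i - a $ i" ?r "a $ i - x $ i"]
        by auto
  then show "padic_cell k a = padic_cell k b" by (simp add: padic_cell_def)
qed

lemma padic_cell_Suc:
  fixes x y :: "'a :: prime_card padic ^ 'm"
  assumes "padic_cell (Suc k) x = padic_cell (Suc k) y"
  shows "padic_cell k x = padic_cell k y"
proof -
  have "inverse (real CARD('a)) ^ Suc k \<le> inverse (real CARD('a)) ^ k"
    using one_less_prime_card[where 'a = 'a]
    by (intro power_decreasing) (auto simp: inverse_le_1_iff)
  then show ?thesis using assms unfolding padic_cell_eq_iff by (meson order_trans)
qed

lemma padic_cell_image_chart:
  fixes c :: "'m :: finite"
  shows "padic_cell k ` (chart c :: ('a :: prime_card padic ^ 'm) set) \<subseteq>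
    (\<lambda>t. padic_cell k (\<chi> i. if i = c then 1 else of_nat (t i))) ` ((UNIV - {c}) \<rightarrow>\<^sub>E {..<CARD('a) ^ k})"
proof (rule image_subsetI)
  fix x :: "'a padic ^ 'm" assume x: "x \<in> chart c"
  have "\<exists>n. n < CARD('a) ^ k \<and> padic_norm (x $ i - of_nat n) \<le> inverse (real CARD('a)) ^ k" for i
    using padic_int_dense[of "x $ i" k] x by (auto simp: chart_def integral_vectors_def)
  then obtain t where t: "\<And>i. t i < CARD('a) ^ k"
    "\<And>i. padic_norm (x $ i - of_nat (t i)) \<le> inverse (real CARD('a)) ^ k" by metis
  let ?t = "restrict t (UNIV - {c})"
  have "padic_cell k x = padic_cell k (\<chi> i. if i = c then 1 else of_nat (?t i))"
    unfolding padic_cell_eq_iff using t(2) x by (auto simp: chart_def)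
  moreover have "?t \<in> (UNIV - {c}) \<rightarrow>\<^sub>E {..<CARD('a) ^ k}" using t(1) by auto
  ultimately show "padic_cell k x \<in> (\<lambda>t. padic_cell k (\<chi> i. if i = c then 1 else of_nat (t i))) `
      ((UNIV - {c}) \<rightarrow>\<^sub>E {..<CARD('a) ^ k})"
    by (rule image_eqI)
qed

lemma finite_padic_cell_chart:
  "finite (padic_cell k ` (chart c :: ('a :: prime_card padic ^ 'm) set))"
  by (rule finite_subset[OF padic_cell_image_chart]) (auto intro!: finite_PiE)

lemma card_padic_cell_chart:
  "card (padic_cell k ` (chart c :: ('a :: prime_card padic ^ 'm) set)) \<le>
    CARD('a) ^ (k * card (UNIV - {c}))"
proof -
  have fin: "finite ((UNIV - {c}) \<rightarrow>\<^sub>E {..<CARD('a) ^ k})" by (auto intro!: finite_PiE)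
  have "card (padic_cell k ` (chart c :: ('a padic ^ 'm) set)) \<le>
      card ((UNIV - {c}) \<rightarrow>\<^sub>E {..<CARD('a) ^ k})"
    using card_mono[OF finite_imageI[OF fin] padic_cell_image_chart] card_image_le[OF fin]
    by (rule order_trans)
  also have "\<dots> = CARD('a) ^ (k * card (UNIV - {c}))" by (simp add: card_PiE power_mult)
  finally show ?thesis .
qed

lemma chart_cell_sets: "{x \<in> chart c. padic_cell k x = b} \<in> sets (chart_space c)"
proof (cases "{x \<in> chart c. padic_cell k x = b} = {}")
  case False
  then obtain x0 where "padic_cell k x0 = b" by blast
  then have "{x \<in> chart c. padic_cell k x = b} =
      chart c \<inter> (\<Inter>i. {x. padic_norm (x $ i - x0 $ i) \<le> inverse (real CARD('a)) ^ k})"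
    by (auto simp flip: padic_cell_eq_iff) (auto simp: padic_cell_eq_iff)
  moreover have "closed (\<Inter>i. {x :: 'a padic ^ 'b.
      padic_norm (x $ i - x0 $ i) \<le> inverse (real CARD('a)) ^ k})"
    unfolding dist_padic[symmetric]
    by (intro closed_INT ballI closed_Collect_le continuous_on_dist continuous_on_component
        continuous_on_id continuous_on_const)
  ultimately show ?thesis by (auto simp: sets_restrict_space)
qed (simp only: sets.empty_sets)

lemma ex_padic_cell_subset_ball:
  fixes x :: "'a :: prime_card padic ^ 'm"
  assumes "e > 0"
  obtains k where "\<And>y. padic_cell k y = padic_cell k x \<Longrightarrow> dist y x < e"
proof -
  obtain k where k: "inverse (real CARD('a)) ^ k < e / real CARD('m)"
    using real_arch_pow_inv[of "e / real CARD('m)" "inverse (real CARD('a))"] assms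
      one_less_prime_card[where 'a = 'a] by (auto simp: inverse_less_1_iff)
  have "dist y x < e" if "padic_cell k y = padic_cell k x" for y
  proof -
    have "dist y x \<le> (\<Sum>i\<in>UNIV. dist (y $ i) (x $ i))"
      unfolding dist_vec_def by (intro L2_set_le_sum) simp
    also have "\<dots> \<le> (\<Sum>i\<in>(UNIV :: 'm set). inverse (real CARD('a)) ^ k)"
      using that unfolding padic_cell_eq_iff by (intro sum_mono) (simp add: dist_padic)
    also have "\<dots> < e" using k by (simp add: field_simps)
    finally show ?thesis .
  qed
  then show ?thesis by (rule that)
qed

lemma open_Int_chart_eq_UN_cells:
  fixes U :: "('a :: prime_card padic ^ 'm) set"
  assumes U: "open U"
  obtains K where "countable K" "U \<inter> chart c = (\<Union>(k, b)\<in>K. {x \<in> chart c. padic_cell k x = b})"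
proof
  let ?K = "{(k, b) \<in> Sigma UNIV (\<lambda>k. padic_cell k ` (chart c :: ('a padic ^ 'm) set)).
    {x \<in> chart c. padic_cell k x = b} \<subseteq> U}"
  have "countable (Sigma (UNIV :: nat set) (\<lambda>k. padic_cell k ` (chart c :: ('a padic ^ 'm) set)))"
    by (rule countable_SIGMA) (simp_all add: countable_finite finite_padic_cell_chart)
  then show "countable ?K" by (rule countable_subset[rotated]) auto
  show "U \<inter> chart c = (\<Union>(k, b)\<in>?K. {x \<in> chart c. padic_cell k x = b})"
  proof (intro equalityI subsetI)
    fix x assume x: "x \<in> U \<inter> chart c"
    then obtain e where e: "e > 0" "\<And>y. dist y x < e \<Longrightarrow> y \<in> U" using U by (auto simp: open_dist)
    obtain k where "\<And>y. padic_cell k y = padic_cell k x \<Longrightarrow> dist y x < e"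
      using ex_padic_cell_subset_ball[OF e(1)] by blast
    then have "(k, padic_cell k x) \<in> ?K" using e(2) x by auto
    then show "x \<in> (\<Union>(k, b)\<in>?K. {x \<in> chart c. padic_cell k x = b})" using x by blast
  qed auto
qed

lemma sets_borel_of_top_of_set: "sets (borel_of (top_of_set S)) = sets (restrict_space borel S)"
proof -
  have "{(\<lambda>x. x) -` A \<inter> S |A. A \<in> {U. open U}} = {U. openin (top_of_set S) U}"
    by (auto simp: openin_open Int_commute)
  then have "vimage_algebra S (\<lambda>x. x) borel = borel_of (top_of_set S)"
    unfolding borel_def by (subst vimage_algebra_sigma) (simp_all add: borel_of_def)
  then show ?thesis by (simp add: restrict_space_eq_vimage_algebra')
qed

lemma sets_chart_space:
  "sets (chart_space c :: ('a :: prime_card padic ^ 'm) measure) =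
     sigma_sets (chart c) {{x \<in> chart c. padic_cell k x = b} |k b. True}"
  (is "_ = sigma_sets _ ?C")
proof
  show "sigma_sets (chart c) ?C \<subseteq> sets (chart_space c)"
    using sets.sigma_sets_subset[of ?C "chart_space c"] chart_cell_sets
    by (auto simp: space_restrict_space)
  interpret sigma_algebra "chart c" "sigma_sets (chart c) ?C"
    by (rule sigma_algebra_sigma_sets) auto
  have "U \<in> sigma_sets (chart c) ?C" if "openin (top_of_set (chart c)) U" for U
  proof -
    obtain W where W: "open W" "U = W \<inter> chart c" using \<open>openin _ U\<close> by (auto simp: openin_open)
    obtain K where K: "countable K" "W \<inter> chart c = (\<Union>(k, b)\<in>K. {x \<in> chart c. padic_cell k x = b})"
      by (rule open_Int_chart_eq_UN_cells[OF W(1)])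
    show ?thesis
      unfolding W(2) K(2) by (rule countable_UN''[OF K(1)]) (auto intro!: sigma_sets.Basic)
  qed
  then have "sigma_sets (chart c) {U. openin (top_of_set (chart c)) U} \<subseteq> sigma_sets (chart c) ?C"
    by (intro sigma_sets_mono) auto
  moreover have "{U. openin (top_of_set (chart c)) U} \<subseteq> Pow (chart c :: ('a padic ^ 'm) set)"
    by (auto dest: openin_imp_subset)
  ultimately show "sets (chart_space c) \<subseteq> sigma_sets (chart c) ?C"
    by (simp add: borel_of_def sets_measure_of flip: sets_borel_of_top_of_set)
qed

lemma span_singleton_grassmannian: "a \<noteq> 0 \<Longrightarrow> vec.span {a} \<in> grassmannian 1"
  for a :: "'a :: field ^ 'm"
  by (simp add: grassmannian_def vec.dim_span vec.dim_eq_card_independent)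

lemma chart_nonzero: "a \<in> chart c \<Longrightarrow> a \<noteq> 0"
  by (auto simp: chart_def)

lemma continuous_map_span:
  "continuous_map (top_of_set (- {0})) (grassmannian_topology 1)
     (\<lambda>a :: 'a :: prime_card padic ^ 'm. vec.span {a})"
proof -
  let ?f = "\<lambda>a :: 'a padic ^ 'm. \<lambda>i\<in>{..<1::nat}. a"
  have "continuous_map (top_of_set (- {0})) (product_topology (\<lambda>_. euclidean) {..<1}) ?f"
    by (auto simp: continuous_map_componentwise)
  moreover have "?f ` topspace (top_of_set (- {0})) \<subseteq> frames 1"
    by (auto simp: frames_def inj_on_def PiE_def extensional_def lessThan_Suc)
  ultimately have "continuous_map (top_of_set (- {0})) (frame_topology 1) ?f"
    unfolding frame_topology_def by (auto simp: continuous_map_in_subtopology)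
  from continuous_map_compose[OF this quotient_imp_continuous_map[OF quotient_map_frame_span]]
  show ?thesis by (simp add: o_def lessThan_Suc)
qed

lemma span_measurable_chart:
  "(\<lambda>a :: 'a :: prime_card padic ^ 'm. vec.span {a}) \<in>
     measurable (chart_space c) (borel_grassmannian 1)"
proof (rule measurable_restrict_mono)
  show "(\<lambda>a :: 'a padic ^ 'm. vec.span {a}) \<in>
      measurable (restrict_space borel (- {0})) (borel_grassmannian 1)"
    using continuous_map_measurable[OF continuous_map_span]
    by (simp only: measurable_cong_sets[OF sets_borel_of_top_of_set refl])
qed (use chart_nonzero in auto)

definition chart_group :: "'m \<Rightarrow> ('a :: prime_card padic ^ 'm \<Rightarrow> 'a padic ^ 'm) set" where
  "chart_group c = {g. \<exists>h\<in>SL_int_units. g = (*v) (int_mat h) \<and> (\<forall>a. g a $ c = a $ c)}"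

lemma chart_group_chart: "g \<in> chart_group c \<Longrightarrow> x \<in> chart c \<Longrightarrow> g x \<in> chart c"
  unfolding chart_group_def chart_def integral_vectors_def
  by (auto intro!: padic_norm_mult_vec_le simp: map_matrix_def padic_norm_of_int_le_1)

lemma chart_group_comp:
  assumes "f \<in> chart_group c" "g \<in> chart_group c"
  shows "f \<circ> g \<in> chart_group c"
proof -
  obtain h where h: "h \<in> SL_int_units" "f = (*v) (int_mat h)" "\<And>a. f a $ c = a $ c"
    using assms(1) by (auto simp: chart_group_def)
  obtain h' where h': "h' \<in> SL_int_units" "g = (*v) (int_mat h')" "\<And>a. g a $ c = a $ c"
    using assms(2) by (auto simp: chart_group_def)
  have "f \<circ> g = (*v) (int_mat (h ** h'))"
    by (simp add: h(2) h'(2) int_mat_mult matrix_vector_mul_assoc fun_eq_iff)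
  moreover have "(f \<circ> g) a $ c = a $ c" for a by (simp add: h(3) h'(3))
  ultimately show ?thesis
    unfolding chart_group_def using SL_int_units_mult[OF h(1) h'(1)] by blast
qed

lemma chart_group_inverse:
  assumes "g \<in> chart_group c"
  obtains g' where "g' \<in> chart_group c" "\<And>x. g' (g x) = x"
proof -
  obtain h where h: "h \<in> SL_int_units" "g = (*v) (int_mat h)" "\<And>a. g a $ c = a $ c"
    using assms by (auto simp: chart_group_def)
  obtain h' where h': "h' \<in> SL_int_units" "h ** h' = mat 1" "h' ** h = mat 1"
    using h(1) by (rule SL_int_units_inverse)
  define g' :: "'a padic ^ 'b \<Rightarrow> 'a padic ^ 'b" where "g' = (*v) (int_mat h')"
  have cancel: "g' (g x) = x" "g (g' x) = x" for x
    using h'(2,3) by (simp_all add: g'_def h(2) matrix_vector_mul_assoc flip: int_mat_mult)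
  have "g' a $ c = a $ c" for a using h(3)[of "g' a"] by (simp add: cancel)
  then have "g' \<in> chart_group c" using h'(1) g'_def by (auto simp: chart_group_def)
  then show ?thesis using cancel(1) by (rule that)
qed

lemma chart_group_padic_cell_cong:
  fixes x y :: "'a :: prime_card padic ^ 'm"
  assumes g: "g \<in> chart_group c" and same: "padic_cell k x = padic_cell k y"
  shows "padic_cell k (g x) = padic_cell k (g y)"
proof -
  obtain h where h: "g = (*v) (int_mat h)" using g by (auto simp: chart_group_def)
  have "g x $ i - g y $ i = (int_mat h *v (x - y)) $ i" for i
    by (simp add: h matrix_vector_mult_diff_distrib)
  moreover have "padic_norm ((int_mat h *v (x - y)) $ i) \<le> inverse (real CARD('a)) ^ k" for i
    using same unfolding padic_cell_eq_iff
    by (intro padic_norm_mult_vec_le) (simp_all add: map_matrix_def padic_norm_of_int_le_1)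
  ultimately show ?thesis by (simp add: padic_cell_eq_iff)
qed

lemma chart_group_padic_cell_eq_iff:
  "g \<in> chart_group c \<Longrightarrow> padic_cell k (g x) = padic_cell k (g y) \<longleftrightarrow> padic_cell k x = padic_cell k y"
  by (metis chart_group_inverse chart_group_padic_cell_cong)

lemma continuous_on_matrix_vector_mult: "continuous_on A ((*v) B)"
  for B :: "'a :: prime_card padic ^ 'n ^ 'm"
  unfolding matrix_vector_mult_def by (intro continuous_intros)

lemma chart_group_measurable: "g \<in> chart_group c \<Longrightarrow> g \<in> measurable (chart_space c) (chart_space c)"
proof (rule measurable_restrict_space3)
  assume g: "g \<in> chart_group c"
  then show "g \<in> borel_measurable borel"
    unfolding chart_group_def
    by (auto intro!: borel_measurable_continuous_onI continuous_on_matrix_vector_mult)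
  show "g \<in> chart c \<rightarrow> chart c" using chart_group_chart[OF g] by blast
qed

definition shear :: "'m \<Rightarrow> 'm \<Rightarrow> int \<Rightarrow> 'a :: prime_card padic ^ 'm \<Rightarrow> 'a padic ^ 'm" where
  "shear i j d = (*v) (int_mat (elem_matrix i j d))"

definition translate :: "'m \<Rightarrow> ('m \<Rightarrow> int) \<Rightarrow> 'a :: prime_card padic ^ 'm \<Rightarrow> 'a padic ^ 'm" where
  "translate c t a = (\<chi> k. if k = c then a $ k else a $ k + of_int (t k) * a $ c)"

lemma shear_nth: "shear i j d a $ k = (if k = i then a $ i + of_int d * a $ j else a $ k)"
  by (simp add: shear_def elem_matrix_mult_vec)

lemma shear_chart_group: "i \<noteq> j \<Longrightarrow> i \<noteq> c \<Longrightarrow> shear i j d \<in> chart_group c"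
  unfolding chart_group_def
  by (auto intro!: bexI[OF _ elem_matrix_SL_int_units] simp: shear_def elem_matrix_mult_vec)

lemma translate_chart_group: "translate c t \<in> chart_group c"
proof -
  let ?p = "\<lambda>K. \<lambda>a :: 'a padic ^ 'b. \<chi> k. if k \<in> K then a $ k + of_int (t k) * a $ c else a $ k"
  have "?p K \<in> chart_group c" if "c \<notin> K" for K
    using finite[of K] that
  proof (induction K rule: finite_induct)
    case empty
    show ?case
      unfolding chart_group_def
      by (intro CollectI bexI[OF _ SL_int_units_one]) (simp add: fun_eq_iff)
  next
    case (insert i K)
    have "shear i c (t i) \<circ> ?p K \<in> chart_group c"
      using insert by (intro chart_group_comp shear_chart_group) auto
    moreover have "shear i c (t i) \<circ> ?p K = ?p (insert i K)"
      using insert by (auto simp: fun_eq_iff vec_eq_iff shear_nth)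
    ultimately show ?case by simp
  qed
  then have "?p (UNIV - {c}) \<in> chart_group c" by blast
  moreover have "translate c t = ?p (UNIV - {c})"
    by (auto simp: translate_def fun_eq_iff vec_eq_iff)
  ultimately show ?thesis by (simp only:)
qed

lemma shear_translate:
  assumes "i \<noteq> c" "j \<noteq> c" "i \<noteq> j"
  shows "shear i j d (translate c t x) = translate c (t(i := t i + d * t j)) (shear i j d x)"
  using assms by (simp add: vec_eq_iff shear_nth translate_def algebra_simps)

lemma translate_translate: "translate c s (translate c t x) = translate c (\<lambda>i. s i + t i) x"
  by (simp add: translate_def vec_eq_iff algebra_simps)

lemma translate_zero: "translate c (\<lambda>i. 0) x = x"
  by (simp add: translate_def vec_eq_iff)

lemma padic_cell_translate_fixed_iff:
  fixes x :: "'a :: prime_card padic ^ 'm"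
  assumes "x \<in> chart c"
  shows "padic_cell k (translate c t x) = padic_cell k x \<longleftrightarrow>
    (\<forall>i\<in>UNIV - {c}. int CARD('a) ^ k dvd t i)"
proof -
  have "translate c t x $ i - x $ i = (if i = c then 0 else of_int (t i))" for i
    using assms by (simp add: translate_def chart_def)
  then show ?thesis
    unfolding padic_cell_eq_iff using padic_norm_of_int_le_iff[where 'a = 'a and k = k] by auto
qed

lemma ex_translate_padic_cell_eq:
  fixes x y :: "'a :: prime_card padic ^ 'm"
  assumes x: "x \<in> chart c" and y: "y \<in> chart c"
  shows "\<exists>t. padic_cell k (translate c t x) = padic_cell k y"
proof -
  have "\<exists>n. padic_norm ((y $ i - x $ i) - of_nat n) \<le> inverse (real CARD('a)) ^ k" for i
  proof -
    have "padic_norm (y $ i - x $ i) \<le> 1"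
      using x y padic_norm_add_le[of "y $ i" 1 "- x $ i"]
      by (simp add: chart_def integral_vectors_def padic_norm_minus)
    then show ?thesis using padic_int_dense[of "y $ i - x $ i" k] by metis
  qed
  then obtain t
    where t: "\<And>i. padic_norm ((y $ i - x $ i) - of_nat (t i)) \<le> inverse (real CARD('a)) ^ k"
    by metis
  have "padic_norm (translate c (\<lambda>i. int (t i)) x $ i - y $ i) \<le> inverse (real CARD('a)) ^ k" for i
  proof (cases "i = c")
    case True
    then show ?thesis using x y by (simp add: translate_def chart_def)
  next
    case False
    then have "translate c (\<lambda>i. int (t i)) x $ i - y $ i = - ((y $ i - x $ i) - of_nat (t i))"
      using x by (simp add: translate_def chart_def)
    then show ?thesis using t[of i] by (simp only: padic_norm_minus)
  qed
  then show ?thesis unfolding padic_cell_eq_iff by blast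
qed

section \<open>Haar measure on lines\<close>

locale haar_line = prob_space \<nu>
  for \<nu> :: "('p :: prime_card padic ^ 'm ^ 'm) measure" +
  fixes w :: "'p padic ^ 'm"
  assumes haar: "is_haar_prob SL_padic_integers \<nu>" and w_integral: "w \<in> integral_vectors"
    and w_unit: "\<exists>i. padic_norm (w $ i) = 1"
begin

lemma sets_haar: "sets \<nu> = sets (restrict_space borel SL_padic_integers)"
  using haar by (simp add: is_haar_prob_def)

lemma space_haar: "space \<nu> = SL_padic_integers"
  using sets_eq_imp_space_eq[OF sets_haar] by (simp add: space_restrict_space)

lemma closed_sets_haar: "closed C \<Longrightarrow> {g \<in> SL_padic_integers. g \<in> C} \<in> sets \<nu>"
  unfolding sets_haar sets_restrict_space by (intro image_eqI[of _ _ C]) auto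

lemma left_mult_measurable:
  assumes A: "A \<in> SL_padic_integers"
  shows "(**) A \<in> measurable \<nu> \<nu>"
  unfolding measurable_cong_sets[OF sets_haar sets_haar]
proof (rule measurable_restrict_space3)
  have "continuous_on UNIV ((**) A)"
    unfolding matrix_matrix_mult_def by (intro continuous_on_vec_lambda continuous_intros)
  then show "(**) A \<in> borel_measurable borel" by (rule borel_measurable_continuous_onI)
  show "(**) A \<in> SL_padic_integers \<rightarrow> SL_padic_integers" using SL_padic_mult[OF A] by blast
qed

lemma haar_distr:
  assumes h: "h \<in> SL_int_units"
  shows "distr \<nu> \<nu> ((**) (int_mat h)) = \<nu>"
proof (rule measure_eqI)
  fix B assume "B \<in> sets (distr \<nu> \<nu> ((**) (int_mat h)))"
  then have B: "B \<in> sets \<nu>" by simp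
  let ?H = "int_mat h :: 'p padic ^ 'm ^ 'm"
  let ?A = "(**) ?H -` B \<inter> space \<nu>"
  obtain h' where h': "h' \<in> SL_int_units" "h ** h' = mat 1" using h by (rule SL_int_units_inverse)
  have H: "?H \<in> SL_padic_integers" "int_mat h' \<in> SL_padic_integers"
    using h h'(1) by (auto intro: int_mat_SL_padic_integers SL_int_units_SL_int)
  have "(**) ?H ` ?A = B"
  proof (intro equalityI subsetI)
    fix b assume b: "b \<in> B"
    have cancel: "?H ** (int_mat h' ** b) = b"
      using h'(2) by (simp add: matrix_mul_assoc flip: int_mat_mult)
    moreover have "int_mat h' ** b \<in> SL_padic_integers"
      using sets.sets_into_space[OF B] b SL_padic_mult[OF H(2)] by (auto simp: space_haar)
    ultimately have "int_mat h' ** b \<in> ?A" using b by (simp add: space_haar)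
    then show "b \<in> (**) ?H ` ?A" by (rule rev_image_eqI) (simp only: cancel)
  qed auto
  moreover have "emeasure \<nu> ((**) ?H ` ?A) = emeasure \<nu> ?A"
    using haar H(1) measurable_sets[OF left_mult_measurable[OF H(1)] B]
    by (simp add: is_haar_prob_def)
  ultimately show "emeasure (distr \<nu> \<nu> ((**) ?H)) B = emeasure \<nu> B"
    by (simp add: emeasure_distr[OF left_mult_measurable[OF H(1)] B])
qed simp

lemma AE_left_mult_iff:
  assumes "h \<in> SL_int_units" "{g \<in> space \<nu>. P g} \<in> sets \<nu>"
  shows "(AE g in \<nu>. P (int_mat h ** g)) \<longleftrightarrow> (AE g in \<nu>. P g)"
proof -
  have "(AE g in distr \<nu> \<nu> ((**) (int_mat h)). P g) \<longleftrightarrow> (AE g in \<nu>. P (int_mat h ** g))"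
    using assms
    by (intro AE_distr_iff left_mult_measurable int_mat_SL_padic_integers SL_int_units_SL_int)
  then show ?thesis unfolding haar_distr[OF assms(1)] by (rule sym)
qed

lemma mult_w_integral:
  assumes "g \<in> SL_padic_integers"
  shows "g *v w \<in> integral_vectors"
  using assms w_integral padic_norm_mult_vec_le[of g w 1]
  by (simp add: integral_vectors_def SL_padic_integers_def padic_integers_def)

definition unit_coord :: "'m \<Rightarrow> ('p padic ^ 'm ^ 'm) set" where
  "unit_coord i = {g \<in> SL_padic_integers. padic_norm ((g *v w) $ i) = 1}"

lemma unit_coord_cover: "(\<Union>i. unit_coord i) = SL_padic_integers"
proof (intro equalityI subsetI)
  fix g :: "'p padic ^ 'm ^ 'm" assume g: "g \<in> SL_padic_integers"
  obtain k where k: "padic_norm (w $ k) = 1" using w_unit by blast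
  have "1 \<le> padic_norm ((g *v w) $ max_index (g *v w))"
    using SL_padic_norm_le[OF g padic_norm_le_max_index, of w k] k by simp
  then have "padic_norm ((g *v w) $ max_index (g *v w)) = 1"
    using mult_w_integral[OF g] by (intro antisym) (simp_all add: integral_vectors_def)
  then show "g \<in> (\<Union>i. unit_coord i)" using g by (auto simp: unit_coord_def)
qed (auto simp: unit_coord_def)

lemma continuous_on_mult_w: "continuous_on A (\<lambda>g :: 'p padic ^ 'm ^ 'm. g *v w)"
  unfolding matrix_vector_mult_def by (intro continuous_intros)

lemma unit_coord_sets [measurable]: "unit_coord i \<in> sets \<nu>"
proof -
  have "closed {g :: 'p padic ^ 'm ^ 'm. padic_norm ((g *v w) $ i) = 1}"
    by (intro closed_Collect_eq continuous_on_compose2[OF continuous_on_padic_norm[of UNIV]]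
        continuous_on_component continuous_on_mult_w continuous_on_const) simp
  from closed_sets_haar[OF this] show ?thesis by (simp add: unit_coord_def)
qed

lemma ex_unit_coord_transport:
  obtains h where "h \<in> SL_int_units"
    "\<And>g. g \<in> SL_padic_integers \<Longrightarrow> int_mat h ** g \<in> unit_coord c \<longleftrightarrow> g \<in> unit_coord i"
proof -
  obtain h :: "int ^ 'm ^ 'm" where h: "h \<in> SL_int_units"
    "\<And>a :: 'p padic ^ 'm. (int_mat h *v a) $ c = a $ i"
    using ex_SL_int_units_moving_coordinate[of c i, where 'a = "'p padic"] by auto
  have "int_mat h ** g \<in> unit_coord c \<longleftrightarrow> g \<in> unit_coord i" if "g \<in> SL_padic_integers" for g
    using SL_padic_mult[OF int_mat_SL_padic_integers[OF SL_int_units_SL_int[OF h(1)]] that] that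
    by (simp add: unit_coord_def h(2) flip: matrix_vector_mul_assoc)
  with h(1) show ?thesis by (rule that)
qed

text \<open>The group acts transitively on the coordinates, so one piece of the cover decides the matter.\<close>

lemma AE_of_AE_unit_coord:
  assumes P: "{g \<in> space \<nu>. P g} \<in> sets \<nu>"
    and invariant: "\<And>h g. h \<in> SL_int_units \<Longrightarrow> g \<in> SL_padic_integers \<Longrightarrow> P (int_mat h ** g) \<longleftrightarrow> P g"
    and AE_c: "AE g in \<nu>. g \<in> unit_coord c \<longrightarrow> P g"
  shows "AE g in \<nu>. P g"
proof -
  have "AE g in \<nu>. g \<in> unit_coord i \<longrightarrow> P g" for i
  proof -
    obtain h where h: "h \<in> SL_int_units"
      "\<And>g. g \<in> SL_padic_integers \<Longrightarrow> int_mat h ** g \<in> unit_coord c \<longleftrightarrow> g \<in> unit_coord i"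
      by (rule ex_unit_coord_transport[of c i]) blast
    have "{g \<in> space \<nu>. g \<in> unit_coord c \<longrightarrow> P g} \<in> sets \<nu>" using P by measurable
    then have "AE g in \<nu>. int_mat h ** g \<in> unit_coord c \<longrightarrow> P (int_mat h ** g)"
      using AE_c by (simp only: AE_left_mult_iff[OF h(1), of "\<lambda>g. g \<in> unit_coord c \<longrightarrow> P g"])
    then show ?thesis using AE_space by eventually_elim (simp add: space_haar h invariant)
  qed
  then have "AE g in \<nu>. \<forall>i\<in>UNIV. g \<in> unit_coord i \<longrightarrow> P g" by (intro AE_finite_allI) auto
  then show ?thesis
    using AE_space by eventually_elim (use unit_coord_cover in \<open>auto simp: space_haar\<close>)
qed

lemma unit_coord_pos: "emeasure \<nu> (unit_coord c) \<noteq> 0"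
proof
  assume "emeasure \<nu> (unit_coord c) = 0"
  then have "AE g in \<nu>. g \<in> unit_coord c \<longrightarrow> False"
    by (auto simp: AE_iff_null_sets[symmetric] null_sets_def)
  then have "AE g in \<nu>. False" by (intro AE_of_AE_unit_coord[of "\<lambda>_. False" c]) auto
  then show False by (simp only: AE_False)
qed

text \<open>The value \<open>axis c 1\<close> is a dummy that keeps the map inside the chart.\<close>

definition chart_pt :: "'m \<Rightarrow> 'p padic ^ 'm ^ 'm \<Rightarrow> 'p padic ^ 'm" where
  "chart_pt c g = (if g \<in> unit_coord c then inverse ((g *v w) $ c) *s (g *v w) else axis c 1)"

lemma chart_pt_chart: "chart_pt c g \<in> chart c"
proof (cases "g \<in> unit_coord c")
  case True
  then have g: "g \<in> SL_padic_integers" "padic_norm ((g *v w) $ c) = 1"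
    by (auto simp: unit_coord_def)
  then have "(g *v w) $ c \<noteq> 0" by auto
  then show ?thesis
    using g True mult_w_integral[OF g(1)]
    by (simp add: chart_pt_def chart_def integral_vectors_def padic_norm_mult padic_norm_inverse)
qed (auto simp: chart_pt_def chart_def integral_vectors_def axis_def)

lemma span_chart_pt:
  assumes g: "g \<in> unit_coord c"
  shows "vec.span {chart_pt c g} = matrix_image g (vec.span {w})"
proof -
  have "(g *v w) $ c \<noteq> 0" using g by (auto simp: unit_coord_def)
  then have "vec.span {inverse ((g *v w) $ c) *s (g *v w)} = vec.span {g *v w}"
    using vec.span_image_scale[of "{g *v w}" "\<lambda>_. inverse ((g *v w) $ c)"] by simp
  then show ?thesis using g by (simp add: chart_pt_def matrix_image_span)
qed

lemma chart_pt_measurable: "chart_pt c \<in> measurable \<nu> (chart_space c)"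
proof (rule measurable_restrict_space2)
  show "chart_pt c \<in> space \<nu> \<rightarrow> chart c" by (simp add: chart_pt_chart)
  have "continuous_on (unit_coord c) (\<lambda>g. inverse ((g *v w) $ c) *s (g *v w))"
    unfolding continuous_on_def
  proof (intro ballI vec_tendstoI)
    fix g j assume "g \<in> unit_coord c"
    then have "(g *v w) $ c \<noteq> 0" by (auto simp: unit_coord_def)
    moreover have "((\<lambda>g. g *v w) \<longlongrightarrow> g *v w) (at g within unit_coord c)"
      using continuous_on_mult_w \<open>g \<in> unit_coord c\<close> unfolding continuous_on_def by blast
    ultimately show "((\<lambda>g. (inverse ((g *v w) $ c) *s (g *v w)) $ j) \<longlongrightarrow>
        (inverse ((g *v w) $ c) *s (g *v w)) $ j) (at g within unit_coord c)"
      unfolding vector_smult_component by (intro tendsto_mult tendsto_padic_inverse tendsto_vec_nth)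
  qed
  then have "(\<lambda>g. inverse ((g *v w) $ c) *s (g *v w)) \<in>
      borel_measurable (restrict_space \<nu> {g. g \<in> unit_coord c})"
    by (subst measurable_cong_sets[of _ "restrict_space borel (unit_coord c)", OF _ refl])
      (auto simp: sets_restrict_space_cong[OF sets_haar] sets_restrict_restrict_space unit_coord_def
        Int_def intro!: borel_measurable_continuous_on_restrict)
  then show "chart_pt c \<in> borel_measurable \<nu>"
    unfolding chart_pt_def by (subst measurable_If_restrict_space_iff) auto
qed

definition chart_measure :: "'m \<Rightarrow> ('p padic ^ 'm) measure" where
  "chart_measure c = distr (uniform_measure \<nu> (unit_coord c)) (chart_space c) (chart_pt c)"

lemma sets_chart_measure [measurable_cong]: "sets (chart_measure c) = sets (chart_space c)"
  and space_chart_measure [simp]: "space (chart_measure c) = chart c"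
  by (simp_all add: chart_measure_def space_restrict_space)

lemma chart_pt_measurable_uniform:
  "chart_pt c \<in> measurable (uniform_measure \<nu> (unit_coord c)) (chart_space c)"
  using chart_pt_measurable by (simp add: measurable_cong_sets[OF sets_uniform_measure refl])

lemma prob_space_chart_measure: "prob_space (chart_measure c)"
  unfolding chart_measure_def
  by (intro prob_space.prob_space_distr prob_space_uniform_measure unit_coord_pos
      chart_pt_measurable_uniform) simp

lemma AE_chart_measure_iff:
  assumes "{a \<in> chart c. P a} \<in> sets (chart_space c)"
  shows "(AE a in chart_measure c. P a) \<longleftrightarrow> (AE g in \<nu>. g \<in> unit_coord c \<longrightarrow> P (chart_pt c g))"
  unfolding chart_measure_def using assms
  by (subst AE_distr_iff[OF chart_pt_measurable_uniform])
    (simp_all add: space_restrict_space AE_uniform_measure[OF unit_coord_pos] flip: less_top)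

lemma uniform_measure_unit_coord_distr:
  assumes h: "h \<in> SL_int_units"
    and invariant: "\<And>g. g \<in> SL_padic_integers \<Longrightarrow> int_mat h ** g \<in> unit_coord c \<longleftrightarrow> g \<in> unit_coord c"
  shows "distr (uniform_measure \<nu> (unit_coord c)) \<nu> ((**) (int_mat h)) =
    uniform_measure \<nu> (unit_coord c)"
    (is "distr ?U \<nu> ?H = ?U")
proof (rule measure_eqI)
  fix B assume "B \<in> sets (distr ?U \<nu> ?H)"
  then have B: "B \<in> sets \<nu>" by simp
  have H: "?H \<in> measurable \<nu> \<nu>"
    by (rule left_mult_measurable[OF int_mat_SL_padic_integers[OF SL_int_units_SL_int[OF h]]])
  then have "emeasure (distr ?U \<nu> ?H) B = emeasure ?U (?H -` B \<inter> space \<nu>)"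
    using emeasure_distr[of ?H ?U \<nu> B] B
    by (simp add: measurable_cong_sets[OF sets_uniform_measure refl])
  also have "\<dots> = emeasure \<nu> (unit_coord c \<inter> (?H -` B \<inter> space \<nu>)) / emeasure \<nu> (unit_coord c)"
    using measurable_sets[OF H B] by simp
  also have "unit_coord c \<inter> (?H -` B \<inter> space \<nu>) = ?H -` (unit_coord c \<inter> B) \<inter> space \<nu>"
    using invariant by (auto simp: space_haar)
  also have "emeasure \<nu> \<dots> = emeasure (distr \<nu> \<nu> ?H) (unit_coord c \<inter> B)"
    using B by (intro emeasure_distr[OF H, symmetric]) simp
  finally show "emeasure (distr ?U \<nu> ?H) B = emeasure ?U B"
    using B by (simp add: haar_distr[OF h])
qed simp

lemma chart_group_distr:
  assumes g: "g \<in> chart_group c"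
  shows "distr (chart_measure c) (chart_measure c) g = chart_measure c"
proof -
  let ?U = "uniform_measure \<nu> (unit_coord c)" and ?S = "chart_space c"
  obtain h where h: "h \<in> SL_int_units" "g = (*v) (int_mat h)" "\<And>a. g a $ c = a $ c"
    using g by (auto simp: chart_group_def)
  let ?H = "int_mat h :: 'p padic ^ 'm ^ 'm"
  have H: "?H \<in> SL_padic_integers"
    by (rule int_mat_SL_padic_integers[OF SL_int_units_SL_int[OF h(1)]])
  have fixed: "((?H ** x) *v w) $ c = (x *v w) $ c" for x
    using h(3)[of "x *v w"] by (simp add: h(2) matrix_vector_mul_assoc)
  have invariant: "?H ** x \<in> unit_coord c \<longleftrightarrow> x \<in> unit_coord c" if "x \<in> SL_padic_integers" for x
    using SL_padic_mult[OF H that] that by (simp add: unit_coord_def fixed)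
  have equivariant: "g (chart_pt c x) = chart_pt c (?H ** x)" if "x \<in> unit_coord c" for x
    using that invariant[of x]
    by (simp add: chart_pt_def fixed h(2) vec.linear_scale[OF matrix_vector_mul_linear_gen]
        matrix_vector_mul_assoc unit_coord_def)
  have H_measurable: "(**) ?H \<in> measurable ?U \<nu>"
    using left_mult_measurable[OF H]
    by (simp add: measurable_cong_sets[OF sets_uniform_measure refl])
  have "distr (chart_measure c) (chart_measure c) g = distr (distr ?U ?S (chart_pt c)) ?S g"
    by (intro distr_cong) (simp_all add: chart_measure_def)
  also have "\<dots> = distr ?U ?S (g \<circ> chart_pt c)"
    by (rule distr_distr[OF chart_group_measurable[OF g] chart_pt_measurable_uniform])
  also have "\<dots> = distr ?U ?S (chart_pt c \<circ> (**) ?H)"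
  proof (rule distr_cong_AE)
    show "AE x in ?U. (g \<circ> chart_pt c) x = (chart_pt c \<circ> (**) ?H) x"
      by (intro AE_uniform_measureI) (auto simp: equivariant)
  qed (auto intro: measurable_comp chart_pt_measurable_uniform chart_group_measurable[OF g]
      H_measurable chart_pt_measurable)
  also have "\<dots> = distr (distr ?U \<nu> ((**) ?H)) ?S (chart_pt c)"
    by (rule distr_distr[OF chart_pt_measurable H_measurable, symmetric])
  finally show ?thesis
    by (simp add: uniform_measure_unit_coord_distr[OF h(1) invariant] flip: chart_measure_def)
qed

lemma chart_group_measurable_chart_measure:
  "g \<in> chart_group c \<Longrightarrow> g \<in> measurable (chart_measure c) (chart_measure c)"
  using chart_group_measurable
  by (simp add: measurable_cong_sets[OF sets_chart_measure sets_chart_measure])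

lemma odometer_chart_measure:
  "odometer (chart_measure c) padic_cell CARD('p) (UNIV - {c}) (translate c)"
proof -
  interpret chart: prob_space "chart_measure c" by (rule prob_space_chart_measure)
  show ?thesis
  proof
    show "1 < CARD('p)" by (rule one_less_prime_card)
    show "card (padic_cell k ` space (chart_measure c)) \<le> CARD('p) ^ (k * card (UNIV - {c}))" for k
      using card_padic_cell_chart[of k c] by simp
    show "{x \<in> space (chart_measure c). padic_cell k x = b} \<in> sets (chart_measure c)" for k b
      by (simp add: sets_chart_measure chart_cell_sets)
    show "padic_cell k x = padic_cell k y" if "padic_cell (Suc k) x = padic_cell (Suc k) y" for k
      and x y :: "'p padic ^ 'm"
      using that by (rule padic_cell_Suc)
    show "sets (chart_measure c) = sigma_sets (space (chart_measure c))
        {{x \<in> space (chart_measure c). padic_cell k x = b} |k b. True}"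
      by (simp add: sets_chart_measure sets_chart_space)
    show "padic_cell k (translate c t x) = padic_cell k x \<longleftrightarrow>
        (\<forall>i\<in>UNIV - {c}. int CARD('p) ^ k dvd t i)"
      if "x \<in> space (chart_measure c)" for k t x
      using that padic_cell_translate_fixed_iff[of x c] by simp
    show "\<exists>t. padic_cell k (translate c t x) = padic_cell k y"
      if "x \<in> space (chart_measure c)" "y \<in> space (chart_measure c)" for k x y
      using that ex_translate_padic_cell_eq[of x c y] by simp
  qed (simp_all add: finite_padic_cell_chart chart_group_measurable_chart_measure chart_group_distr
      translate_chart_group translate_translate translate_zero
      chart_group_padic_cell_eq_iff[OF translate_chart_group])
qed

lemma matrix_image_line_measurable:
  "(\<lambda>g. matrix_image g (vec.span {w})) \<in> measurable \<nu> (borel_grassmannian 1)"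
proof -
  have "w \<noteq> 0" using w_unit by auto
  then have "continuous_map (top_of_set SL_padic_integers) (grassmannian_topology 1)
      (\<lambda>g. matrix_image g (vec.span {w}))"
    by (intro continuous_map_orbit span_singleton_grassmannian SL_padic_integers_invertible)
  from continuous_map_measurable[OF this] show ?thesis
    by (simp only: measurable_cong_sets[OF sets_borel_of_top_of_set refl]
        measurable_cong_sets[OF sets_haar refl])
qed

theorem AE_matrix_image_in_invariant_set:
  assumes D: "D \<in> sets (borel_grassmannian 1)"
    and invariant: "\<And>h x. h \<in> SL_int_units \<Longrightarrow> matrix_image (int_mat h) x \<in> D \<longleftrightarrow> x \<in> D"
    and pos: "measure (chart_measure c) {a \<in> chart c. vec.span {a} \<in> D} > 0"
  shows "AE g in \<nu>. matrix_image g (vec.span {w}) \<in> D"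
proof (rule AE_of_AE_unit_coord)
  interpret chart: odometer "chart_measure c" padic_cell "CARD('p)" "UNIV - {c}" "translate c"
    by (rule odometer_chart_measure)
  let ?D = "{a \<in> chart c. vec.span {a} \<in> D}"
  have D_sets: "?D \<in> sets (chart_space c)"
    using measurable_sets[OF span_measurable_chart D, of c]
    by (simp add: space_restrict_space vimage_def Int_def conj_commute)
  have "translate c t a \<in> ?D \<longleftrightarrow> a \<in> ?D" if "a \<in> space (chart_measure c)" for t a
  proof -
    obtain h where h: "h \<in> SL_int_units" "(translate c t :: 'p padic ^ 'm \<Rightarrow> _) = (*v) (int_mat h)"
      using translate_chart_group[of c t, where 'a = 'p] by (auto simp: chart_group_def)
    show ?thesis
      using that chart_group_chart[OF translate_chart_group, of a c t]
        invariant[OF h(1), of "vec.span {a}"]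
      by (simp add: h(2) matrix_image_span)
  qed
  then have "measure (chart_measure c) ?D = 1"
    using D_sets pos by (intro chart.ergodic) (simp_all add: sets_chart_measure)
  then have "AE a in chart_measure c. a \<in> ?D" by (rule chart.AE_prob_1)
  then have "AE g in \<nu>. g \<in> unit_coord c \<longrightarrow> chart_pt c g \<in> ?D"
    using D_sets by (subst (asm) AE_chart_measure_iff) simp_all
  then show "AE g in \<nu>. g \<in> unit_coord c \<longrightarrow> matrix_image g (vec.span {w}) \<in> D"
    by eventually_elim (auto simp: span_chart_pt)
  show "{g \<in> space \<nu>. matrix_image g (vec.span {w}) \<in> D} \<in> sets \<nu>"
    using measurable_sets[OF matrix_image_line_measurable D]
    by (simp add: vimage_def Int_def conj_commute)
qed (simp add: invariant flip: matrix_image_comp)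

end

section \<open>Homomorphisms from projective space to Grassmannians\<close>

lemma ex_crt_exponents:
  fixes p q :: nat
  assumes p: "prime p" and q: "prime q" and ne: "p \<noteq> q"
  obtains \<sigma> :: "nat \<Rightarrow> nat" where "\<And>l. \<sigma> l > 0" "\<And>l. p ^ l dvd \<sigma> l" "\<And>l. q ^ l dvd \<sigma> l - 1"
proof -
  have "\<exists>s. p ^ l dvd s \<and> s > 0 \<and> q ^ l dvd s - 1" for l
  proof -
    have "coprime (p ^ l) (q ^ l)" using primes_coprime[OF p q ne] by simp
    then obtain x where x: "[x = 0] (mod p ^ l)" "[x = 1] (mod q ^ l)"
      using binary_chinese_remainder_nat by blast
    let ?s = "x + p ^ l * q ^ l"
    have pos: "?s > 0" using p q by (simp add: prime_gt_0_nat)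
    have "[?s = 0] (mod p ^ l)" "[?s = 1] (mod q ^ l)" using x by (simp_all add: cong_def)
    then have "p ^ l dvd ?s" "q ^ l dvd ?s - 1" using pos cong_to_1_nat by (auto simp: cong_0_iff)
    then show ?thesis using pos by blast
  qed
  then obtain \<sigma> where "\<And>l. p ^ l dvd \<sigma> l \<and> \<sigma> l > 0 \<and> q ^ l dvd \<sigma> l - 1" by metis
  then show ?thesis using that by blast
qed

lemma ex_primitive_generator:
  assumes "L \<in> (grassmannian 1 :: ('a :: prime_card padic ^ 'm) set set)"
  obtains w where "L = vec.span {w}" "w \<in> integral_vectors" "\<exists>i. padic_norm (w $ i) = 1"
proof -
  obtain v where v: "v \<in> frames 1" "L = vec.span (v ` {..<1})"
    using grassmannian_frame[OF assms] by blast
  let ?a = "v 0"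
  have a: "?a \<noteq> 0" using v(1) by (simp add: frames_def lessThan_Suc)
  have "vec.span {normalise ?a} = vec.span {?a}"
    using vec.span_image_scale[of "{?a}" "\<lambda>_. inverse (?a $ max_index ?a)"] max_index_nonzero[OF a]
    by (simp add: normalise_def)
  then show ?thesis
    using that[of "normalise ?a"] normalise_integral[OF a] normalise_max_index[OF a] v(2)
    by (metis image_insert image_empty lessThan_0 lessThan_Suc One_nat_def padic_norm_1)
qed

locale projective_hom = haar_line \<nu> w
  for \<nu> :: "('p :: prime_card padic ^ 'm ^ 'm) measure" and w :: "'p padic ^ 'm" +
  fixes k :: nat and f :: "('p padic ^ 'm) set \<Rightarrow> ('q :: prime_card padic ^ 'n) set"
  assumes three_le_dimension: "3 \<le> CARD('m)" and distinct_primes: "CARD('p) \<noteq> CARD('q)"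
    and f_measurable: "f \<in> measurable (borel_grassmannian 1) (borel_grassmannian k)"
    and f_equivariant: "h \<in> SL_int \<Longrightarrow> x \<in> grassmannian 1 \<Longrightarrow>
      \<exists>l\<in>rat_maps. l (f x) = f (matrix_image (int_mat h) x)"
begin

definition f_chart :: "'p padic ^ 'm \<Rightarrow> ('q padic ^ 'n) set" where
  "f_chart a = f (vec.span {a})"

lemma f_chart_measurable: "f_chart \<in> measurable (chart_measure c) (borel_grassmannian k)"
  using measurable_compose[OF span_measurable_chart f_measurable]
  by (simp add: f_chart_def[abs_def] measurable_cong_sets[OF sets_chart_measure refl])

lemma f_grassmannian: "x \<in> grassmannian 1 \<Longrightarrow> f x \<in> grassmannian k"
  using measurable_space[OF f_measurable, of x] by simp

lemma rat_maps_grassmannian: "l \<in> rat_maps \<Longrightarrow> V \<in> grassmannian k \<Longrightarrow> l V \<in> grassmannian k"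
  by (auto simp: rat_maps_def intro!: matrix_image_grassmannian invertible_map_matrix_of_rat)

lemma rat_maps_measurable:
  "l \<in> rat_maps \<Longrightarrow> l \<in> measurable (borel_grassmannian k) (borel_grassmannian k)"
  by (auto simp: rat_maps_def
      intro!: continuous_map_measurable continuous_map_matrix_image invertible_map_matrix_of_rat)

lemma odometer_hom_chart:
  "odometer_hom (chart_measure c) padic_cell CARD('p) (UNIV - {c}) (translate c)
     rat_maps (chart_group c) shear f_chart"
proof -
  interpret chart: odometer "chart_measure c" padic_cell "CARD('p)" "UNIV - {c}" "translate c"
    by (rule odometer_chart_measure)
  interpret maps: countable_transformation_group "rat_maps :: (('q padic ^ 'n) set \<Rightarrow> _) set"
    by (rule countable_transformation_group_rat_maps)
  show ?thesis
  proof unfold_locales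
    show "2 \<le> card (UNIV - {c})" using three_le_dimension by (simp add: card_Diff_singleton)
    show "shear i j d (translate c t x) = translate c (t(i := t i + d * t j)) (shear i j d x)"
      if "i \<in> UNIV - {c}" "j \<in> UNIV - {c}" "i \<noteq> j" for i j d t x
      using that by (intro shear_translate) auto
    fix g :: "'p padic ^ 'm \<Rightarrow> 'p padic ^ 'm" assume g: "g \<in> chart_group c"
    show "\<exists>l\<in>rat_maps. l (f_chart x) = f_chart (g x)" if x: "x \<in> space (chart_measure c)" for x
    proof -
      obtain h where h: "h \<in> SL_int_units" "g = (*v) (int_mat h)"
        using g by (auto simp: chart_group_def)
      have "vec.span {x} \<in> grassmannian 1"
        using x by (intro span_singleton_grassmannian chart_nonzero[of x c]) simp
      from f_equivariant[OF SL_int_units_SL_int[OF h(1)] this] show ?thesis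
        by (simp add: f_chart_def h(2) matrix_image_span)
    qed
    show "{x \<in> space (chart_measure c). l (f_chart x) = f_chart (g x)} \<in> sets (chart_measure c)"
      if "l \<in> rat_maps" for l
      using measurable_compose[OF f_chart_measurable rat_maps_measurable[OF that]]
        measurable_compose[OF chart_group_measurable_chart_measure[OF g] f_chart_measurable]
      by (rule grassmannian_equality_sets)
  qed (simp_all add: chart_group_measurable_chart_measure chart_group_distr chart_group_padic_cell_eq_iff
      chart_group_comp translate_chart_group shear_chart_group)
qed

lemma ex_positive_fibre_f_chart:
  "\<exists>x0\<in>chart c. measure (chart_measure c) {x \<in> chart c. f_chart x = f_chart x0} > 0"
proof -
  obtain \<sigma> :: "nat \<Rightarrow> nat"
    where \<sigma>: "\<And>l. \<sigma> l > 0" "\<And>l. CARD('p) ^ l dvd \<sigma> l" "\<And>l. CARD('q) ^ l dvd \<sigma> l - 1"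
    using ex_crt_exponents[OF prime_card[where 'a = 'p] prime_card[where 'a = 'q] distinct_primes]
    by blast
  interpret hom: odometer_hom "chart_measure c" padic_cell "CARD('p)" "UNIV - {c}" "translate c"
    rat_maps "chart_group c" shear f_chart
    by (rule odometer_hom_chart)
  have f_chart: "f_chart x \<in> grassmannian k" if "x \<in> space (chart_measure c)" for x
    using measurable_space[OF f_chart_measurable that] by simp
  have q_dvd: "\<forall>\<^sub>F j in sequentially. CARD('q) ^ l dvd \<sigma> j - 1" for l
    using eventually_ge_at_top[of l] by eventually_elim (rule dvd_trans[OF le_imp_power_dvd \<sigma>(3)])
  interpret recurrent: recurrent_odometer_hom "chart_measure c" padic_cell "CARD('p)" "UNIV - {c}"
    "translate c"
    rat_maps "chart_group c" shear f_chart "plucker_pt k" \<sigma>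
  proof unfold_locales
    show "(\<lambda>x. plucker_pt k (f_chart x)) \<in> borel_measurable (chart_measure c)"
      by (rule measurable_compose[OF f_chart_measurable plucker_pt_measurable])
    show "inj_on (plucker_pt k) (f_chart ` space (chart_measure c))"
      using inj_on_plucker_pt by (rule inj_on_subset) (use f_chart in blast)
    show "countable ((\<lambda>x. hom.stabiliser (f_chart x)) ` space (chart_measure c))"
      by (rule countable_subset[OF _ countable_stabilisers_rat_maps[of k]]) (use f_chart in blast)
    show "\<sigma> l > 0" "CARD('p) ^ l dvd \<sigma> l" for l by (rule \<sigma>)+
    fix u :: "('q padic ^ 'n) set \<Rightarrow> ('q padic ^ 'n) set" and x
    assume u: "u \<in> rat_maps" and x: "x \<in> space (chart_measure c)"
      and close: "\<And>\<epsilon>. \<epsilon> > 0 \<Longrightarrow>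
        \<exists>\<^sub>F j in sequentially. dist (plucker_pt k ((u ^^ \<sigma> j) (f_chart x)))
          (plucker_pt k (f_chart x)) < \<epsilon>"
    obtain A where A: "A \<in> GL_rat" "u = matrix_image (map_matrix of_rat A)"
      using u by (auto simp: rat_maps_def)
    show "\<exists>j. (u ^^ \<sigma> j) (f_chart x) = f_chart x"
      unfolding A(2)
      by (rule grassmannian_recurrence[OF f_chart[OF x] invertible_map_matrix_of_rat[OF A(1)] _ q_dvd
            close[unfolded A(2)]]) (use \<sigma>(1) in \<open>simp_all add: Suc_le_eq\<close>)
  qed
  show ?thesis using recurrent.ex_positive_fibre by simp
qed

definition saturated_fibre :: "('q padic ^ 'n) set \<Rightarrow> ('p padic ^ 'm) set set" where
  "saturated_fibre V = {x \<in> grassmannian 1. \<exists>l\<in>rat_maps. f x = l V}"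

lemma saturated_fibre_sets:
  assumes V: "V \<in> grassmannian k"
  shows "saturated_fibre V \<in> sets (borel_grassmannian 1)"
proof -
  have "saturated_fibre V = (\<Union>l\<in>rat_maps. {x \<in> space (borel_grassmannian 1). f x = l V})"
    by (auto simp: saturated_fibre_def)
  also have "\<dots> \<in> sets (borel_grassmannian 1)"
    using countable_transformation_group.countable[OF countable_transformation_group_rat_maps]
    by (intro sets.countable_UN' image_subsetI grassmannian_equality_sets[OF f_measurable]
        measurable_const)
      (auto intro: rat_maps_grassmannian V)
  finally show ?thesis .
qed

lemma matrix_image_saturated_fibre:
  assumes h: "h \<in> SL_int" and x: "x \<in> saturated_fibre V"
  shows "matrix_image (int_mat h) x \<in> saturated_fibre V"
proof -
  interpret maps: countable_transformation_group "rat_maps :: (('q padic ^ 'n) set \<Rightarrow> _) set"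
    by (rule countable_transformation_group_rat_maps)
  obtain l where l: "l \<in> rat_maps" "f x = l V" and x_line: "x \<in> grassmannian 1"
    using x by (auto simp: saturated_fibre_def)
  obtain m where m: "m \<in> rat_maps" "m (f x) = f (matrix_image (int_mat h) x)"
    using f_equivariant[OF h x_line] by blast
  have "m \<circ> l \<in> rat_maps" "f (matrix_image (int_mat h) x) = (m \<circ> l) V"
    using maps.comp[OF m(1) l(1)] l(2) m(2) by simp_all
  moreover have "matrix_image (int_mat h) x \<in> grassmannian 1"
    by (rule matrix_image_grassmannian[OF x_line
          SL_padic_integers_invertible[OF int_mat_SL_padic_integers[OF h]]])
  ultimately show ?thesis unfolding saturated_fibre_def by blast
qed

lemma matrix_image_saturated_fibre_iff:
  assumes h: "h \<in> SL_int_units"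
  shows "matrix_image (int_mat h) x \<in> saturated_fibre V \<longleftrightarrow> x \<in> saturated_fibre V"
proof -
  obtain h' where h': "h' \<in> SL_int_units" "h' ** h = mat 1" using h by (rule SL_int_units_inverse)
  have "matrix_image (int_mat h') (matrix_image (int_mat h) x) = x"
    using h'(2) by (simp add: matrix_image_comp flip: int_mat_mult)
  then show ?thesis
    using matrix_image_saturated_fibre[OF SL_int_units_SL_int[OF h], of x V]
      matrix_image_saturated_fibre[OF SL_int_units_SL_int[OF h'(1)], of "matrix_image (int_mat h) x" V]
    by auto
qed

lemma ex_AE_saturated_fibre:
  "\<exists>V\<in>grassmannian k. AE g in \<nu>. matrix_image g (vec.span {w}) \<in> saturated_fibre V"
proof -
  obtain c :: 'm where "c = c" by blast
  obtain x0 where x0: "x0 \<in> chart c"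
    and pos: "measure (chart_measure c) {x \<in> chart c. f_chart x = f_chart x0} > 0"
    using ex_positive_fibre_f_chart by blast
  let ?V = "f_chart x0"
  have line: "vec.span {x} \<in> grassmannian 1" if "x \<in> chart c" for x
    using that by (intro span_singleton_grassmannian chart_nonzero[of x c])
  have V: "?V \<in> grassmannian k" unfolding f_chart_def by (rule f_grassmannian[OF line[OF x0]])
  interpret chart: prob_space "chart_measure c" by (rule prob_space_chart_measure)
  let ?A = "{x \<in> chart c. vec.span {x} \<in> saturated_fibre ?V}"
  have A_sets: "?A \<in> sets (chart_measure c)"
    using measurable_sets[OF span_measurable_chart saturated_fibre_sets[OF V], of c]
    by (simp add: sets_chart_measure space_restrict_space vimage_def Int_def conj_commute)
  have "{x \<in> chart c. f_chart x = ?V} \<subseteq> ?A"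
  proof
    fix x assume "x \<in> {x \<in> chart c. f_chart x = ?V}"
    then have x: "x \<in> chart c" "f (vec.span {x}) = id ?V" by (simp_all add: f_chart_def)
    have "id \<in> rat_maps"
      by (rule countable_transformation_group.id[OF countable_transformation_group_rat_maps])
    then have "vec.span {x} \<in> saturated_fibre ?V"
      unfolding saturated_fibre_def using line[OF x(1)] x(2) by (intro CollectI conjI bexI)
    then show "x \<in> ?A" using x(1) by simp
  qed
  then have "measure (chart_measure c) {x \<in> chart c. f_chart x = ?V} \<le> measure (chart_measure c) ?A"
    using A_sets by (rule chart.finite_measure_mono)
  with pos have "measure (chart_measure c) ?A > 0" by (rule less_le_trans)
  then show ?thesis
    by (intro bexI[OF _ V]
        AE_matrix_image_in_invariant_set[OF saturated_fibre_sets[OF V] matrix_image_saturated_fibre_iff])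
qed

theorem ex_conull_saturated_fibre:
  "\<exists>V\<in>grassmannian k. grassmannian 1 - saturated_fibre V \<in>
    null_sets (distr \<nu> (borel_grassmannian 1) (\<lambda>g. matrix_image g (vec.span {w})))"
  (is "\<exists>V\<in>_. _ \<in> null_sets ?\<mu>")
proof -
  obtain V where V: "V \<in> grassmannian k"
    and AE_V: "AE g in \<nu>. matrix_image g (vec.span {w}) \<in> saturated_fibre V"
    using ex_AE_saturated_fibre by blast
  have V_sets: "saturated_fibre V \<in> sets ?\<mu>" using saturated_fibre_sets[OF V] by simp
  moreover have "{x \<in> space ?\<mu>. x \<in> saturated_fibre V} = saturated_fibre V"
    by (auto simp: saturated_fibre_def)
  ultimately have "AE x in ?\<mu>. x \<in> saturated_fibre V"
    using AE_V by (subst AE_distr_iff[OF matrix_image_line_measurable]) simp_all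
  then have "space ?\<mu> - saturated_fibre V \<in> null_sets ?\<mu>"
    using sets.compl_sets[OF V_sets] by (subst AE_iff_null_sets) auto
  then show ?thesis using V by (intro bexI[of _ V]) simp_all
qed

lemma image_saturated_fibre_subset:
  assumes V: "V \<in> grassmannian k"
  shows "f ` saturated_fibre V \<subseteq>
    orbit_rel GL_rat (\<lambda>A. matrix_image (map_matrix of_rat A)) (grassmannian k) `` {V}"
proof (rule image_subsetI)
  fix x assume "x \<in> saturated_fibre V"
  then obtain l where l: "l \<in> rat_maps" "f x = l V" by (auto simp: saturated_fibre_def)
  have "l V \<in> grassmannian k" using l(1) V by (rule rat_maps_grassmannian)
  then show "f x \<in> orbit_rel GL_rat (\<lambda>A. matrix_image (map_matrix of_rat A)) (grassmannian k) `` {V}"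
    using l V by (auto simp: orbit_rel_def rat_maps_def)
qed

end

lemma borel_homomorphism_equivariant:
  fixes f :: "('p :: prime_card padic ^ 'm) set \<Rightarrow> ('q :: prime_card padic ^ 'n) set"
  assumes f: "borel_homomorphism \<mu> (orbit_rel SL_int (\<lambda>A. matrix_image (int_mat A)) (space \<mu>)) N
      (orbit_rel GL_rat (\<lambda>A. matrix_image (map_matrix of_rat A)) (grassmannian k)) f"
    and space: "space \<mu> = grassmannian 1" and h: "h \<in> SL_int" and x: "x \<in> grassmannian 1"
  shows "\<exists>l\<in>rat_maps. l (f x) = f (matrix_image (int_mat h) x)"
proof -
  have "matrix_image (int_mat h) x \<in> grassmannian 1"
    by (intro matrix_image_grassmannian x SL_padic_integers_invertible int_mat_SL_padic_integers h)
  then have "(x, matrix_image (int_mat h) x) \<in>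
      orbit_rel SL_int (\<lambda>A. matrix_image (int_mat A)) (space \<mu>)"
    using h x by (auto simp: orbit_rel_def space)
  then have "(f x, f (matrix_image (int_mat h) x)) \<in>
      orbit_rel GL_rat (\<lambda>A. matrix_image (map_matrix of_rat A)) (grassmannian k)"
    using f by (auto simp: borel_homomorphism_def)
  then show ?thesis by (auto simp: orbit_rel_def rat_maps_def)
qed

theorem theorem3p6:
  fixes k :: nat
    and \<mu> :: "('p :: prime_card padic ^ 'm) set measure"
    and F :: "(('q :: prime_card padic ^ 'n) set \<times> ('q padic ^ 'n) set) set"
  assumes "3 \<le> CARD('m)" and "3 \<le> CARD('n)" and "k \<le> CARD('n)"
    and "CARD('p) \<noteq> CARD('q)"
    and "is_haar_projective \<mu>"
    and "F = orbit_rel GL_rat (\<lambda>A. matrix_image (map_matrix of_rat A)) (grassmannian k)"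
  shows "F_ergodic SL_int (\<lambda>A. matrix_image (map_matrix of_int A)) \<mu>
           (borel_of (grassmannian_topology k)) F"
  unfolding F_ergodic_def
proof (intro allI impI)
  fix f assume f: "borel_homomorphism \<mu> (orbit_rel SL_int (\<lambda>A. matrix_image (int_mat A)) (space \<mu>))
    (borel_grassmannian k) F f"
  obtain \<nu> L where \<nu>: "is_haar_prob SL_padic_integers \<nu>" and L: "L \<in> grassmannian 1"
    and \<mu>: "\<mu> = distr \<nu> (borel_grassmannian 1) (\<lambda>g. matrix_image g L)"
    using assms(5) by (auto simp: is_haar_projective_def)
  obtain w where w: "L = vec.span {w}" "w \<in> integral_vectors" "\<exists>i. padic_norm (w $ i) = 1"
    using L by (rule ex_primitive_generator)
  interpret prob_space \<nu> using \<nu> by (simp add: is_haar_prob_def)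
  have "f \<in> measurable (borel_grassmannian 1) (borel_grassmannian k)"
    using f by (simp add: borel_homomorphism_def \<mu>)
  then interpret projective_hom \<nu> w k f
    using \<nu> w assms(1,4) borel_homomorphism_equivariant[OF f[unfolded assms(6)]]
    by unfold_locales (simp_all add: \<mu>)
  obtain V where V: "V \<in> grassmannian k" and "grassmannian 1 - saturated_fibre V \<in> null_sets \<mu>"
    using ex_conull_saturated_fibre unfolding \<mu> w(1) by blast
  then show "\<exists>A\<in>sets \<mu>. space \<mu> - A \<in> null_sets \<mu> \<and>
      (\<exists>y\<in>space (borel_grassmannian k). f ` A \<subseteq> F `` {y})"
    using V saturated_fibre_sets[OF V] image_saturated_fibre_subset[OF V]
    by (intro bexI[of _ "saturated_fibre V"] conjI bexI[of _ V]) (simp_all add: \<mu> assms(6))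
qed

end
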